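(* Let $F:(\Delta,m)\to(\Delta,m)$ be a tower satisfying the assumptions listed in the context (measure structure, bounded distortion, aperiodicity, finiteness). Then $F$ admits a unique invariant probability measure $\nu$ absolutely continuous with respect to $m$, and $\nu$ is mixing. Furthermore, for all $\varphi,\psi\in\mathcal L^\infty(\Delta,m)$, $$\left|\int(\varphi\circ F^n)\psi\,d\nu-\int\varphi\,d\nu\int\psi\,d\nu\right|\le\|\varphi\|_\infty\,C(\psi)\,u_n,$$ where $C(\psi)>0$ is some constant (depending on $F$ and $\psi$) and $(u_n)$ is a sequence converging to zero at some rate determined by $F$ and $(v_n(\psi))$. In particular: Case 1: Suppose $m_0\{R>n\}=\mathcal O(\theta_0^n)$ for some $\theta_0\in(0,1)$. Then (i) if $\psi\in(V1,\gamma)$ for some $\gamma\in(0,1)$, then $u_n=\mathcal O(\theta^n)$ for some $\theta\in(0,1)$; (ii) if $\psi\in(V2,\gamma)$ for some $\gamma\in(0,1)$, then $u_n=\mathcal O(e^{-n^{\gamma'}})$ for every $\gamma'<\gamma$; (iii) if $\psi\in(V3,\gamma)$ for some $\gamma>1$, then $u_n=\mathcal O(e^{-(\log n)^{\gamma'}})$ for every $\gamma'<\gamma$; (iv) for any constant $C_\infty>0$ there exists $\zeta\in(0,1)$ such that if $\psi\in(V4,\gamma)$ for some $\gamma>\frac1\zeta$ and $v_0(\psi)<C_\infty$, then $u_n=\mathcal O(n^{1-\zeta\gamma})$. Case 2: Suppose $m_0\{R>n\}=\mathcal O(n^{-\alpha})$ for some $\alpha>1$. Then for every $C_\infty>0$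 there exists $\zeta\in(0,1)$ such that if $\psi\in(V4,\gamma)$ for some $\gamma>\frac2\zeta$, with $v_0(\psi)<C_\infty$, then (i) if $\gamma=\frac{\alpha+1}\zeta$, $u_n=\mathcal O(n^{1-\alpha}\log n)$; (ii) otherwise, $u_n=\mathcal O(\max(n^{1-\alpha},n^{2-\zeta\gamma}))$.
   Context: Tower. Let $(\Delta_0,\mathcal B,m_0)$ be a finite measure space, $F^R:\Delta_0\to\Delta_0$ a map and $\mathcal P=\{\Delta_{0,i}:i\in\mathbb N\}$ a partition (mod $0$) of $\Delta_0$ such that $F^R|\Delta_{0,i}$ is an injection onto $\Delta_0$ for each $i$ and $\bigvee_{j=0}^\infty(F^R)^{-j}\mathcal P$ is the partition into points. Let $R:\Delta_0\to\mathbb N$ be constant on each $\Delta_{0,i}$. Put $\Delta=\{(z,l):z\in\Delta_0,\,0\le l<R(z)\}$, $\Delta_l=\{(z,l')\in\Delta:l'=l\}$ (the zeroth level is identified with $\Delta_0$), $\Delta_{l,i}=\{(z,l):z\in\Delta_{0,i}\}$ for $l<R(\Delta_{0,i})$, and let $\eta$ be the partition of $\Delta$ into the sets $\Delta_{l,i}$. Define $F(z,l)=(z,l+1)$ if $l+1<R(z)$, and $F(z,l)=(F^R(z),0)$ otherwise. Separation time: for $x,y\in\Delta_0$, $s(x,y)$ is the least $n\ge0$ such that $(F^R)^nx,(F^R)^ny$ lie in different elements of $\mathcal P$; for $x=(x_0,l),y=(y_0,l)$ in the same $\Delta_{l,i}$, $s(x,y)=s(x_0,y_0)$; for $x,y$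 in different elements of $\eta$, $s(x,y)=0$. The Jacobian $JF^R$ is the function with $m_0(F^R(E))=\int_EJF^R\,dm_0$ for every measurable $E$ on which $F^R$ is injective; it is assumed uniquely defined, positive and finite $m_0$-a.e. Assumptions. Measure structure: elements of $\mathcal P$ and of each $\bigvee_{i=0}^{n-1}(F^R)^{-i}\mathcal P$ are in $\mathcal B$, $F^R$ and $(F^R|\Delta_{0,i})^{-1}$ are measurable, and $m$ is the measure on $\Delta$ with $m(E)=m_0(F^{-l}E)$ for $E\subset\Delta_l$ (when $F^{-l}E\in\mathcal B$, where $F^{-l}E$ is the corresponding subset of $\Delta_0$). Bounded distortion: there are $C>0$, $\beta<1$ such that for $x,y$ in any $\Delta_{0,i}$, $\left|\frac{JF^R(x)}{JF^R(y)}-1\right|\le C\beta^{s(F^Rx,F^Ry)}$. Aperiodicity: $\gcd\{R(x):x\in\Delta_0\}=1$. Finiteness: $\int R\,dm_0<\infty$. Points are always taken to be good: each point of the orbit lies in a single element of $\eta$ and the Jacobian is well defined and positive there. Variation: for bounded $\psi:\Delta\to\mathbb R$, $v_n(\psi)=\sup\{|\psi(x)-\psi(y)|:s(x,y)\ge n\}$, $n\ge0$. $\psi\in(V1,\gamma)$, $\gamma\in(0,1)$, if $v_n(\psi)=\mathcal O(\gamma^n)$; $\psi\in(V2,\gamma)$, $\gamma\in(0,1)$, if $v_n(\psi)=\mathcal O(\exp\{-n^\gamma\})$; $\psi\in(V3,\gamma)$, $\gamma>1$, if $v_n(\psi)=\mathcal O(\exp\{-(\log n)^\gamma\})$; $\psi\in(V4,\gamma)$,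 $\gamma>1$, if $v_n(\psi)=\mathcal O(n^{-\gamma})$.
   Formalization: Added: sets of the join of the (F^R)^{-j}P generate B mod 0 (automatic in Lebesgue spaces; without it uniqueness can fail). The rate u_n is determined by F and (v_n(ψ)) only for bounded ψ with v_n(ψ)→0; otherwise u_n→0 may depend on ψ. *)

theory Defs
  imports
    "HOL-Probability.Essential_Supremum"
    "HOL-Probability.Probability"
    "HOL-Library.Landau_Symbols"
    "HOL-Library.Extended_Nat"
begin

record 'a tower_data =
  base :: "'a measure"            \<comment> \<open>\<open>(\<Delta>\<^sub>0, B, m\<^sub>0)\<close>\<close>
  ret :: "'a \<Rightarrow> 'a"               \<comment> \<open>the return map \<open>F\<^sup>R\<close>\<close>
  part :: "nat \<Rightarrow> 'a set"         \<comment> \<open>\<open>\<Delta>\<^sub>0\<^sub>,\<^sub>i\<close>\<close>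
  rtime :: "'a \<Rightarrow> nat"            \<comment> \<open>\<open>R\<close>\<close>
  jac :: "'a \<Rightarrow> real"             \<comment> \<open>a version of the Jacobian of \<open>F\<^sup>R\<close>\<close>

definition tower_space :: "'a tower_data \<Rightarrow> ('a \<times> nat) set" where
  "tower_space T = {(z, l). z \<in> space (base T) \<and> l < rtime T z}"

definition tower_measure :: "'a tower_data \<Rightarrow> ('a \<times> nat) measure" where
  "tower_measure T = restrict_space (base T \<Otimes>\<^sub>M count_space UNIV) (tower_space T)"

fun tower_map :: "'a tower_data \<Rightarrow> 'a \<times> nat \<Rightarrow> 'a \<times> nat" where
  "tower_map T (z, l) = (if l + 1 < rtime T z then (z, l + 1) else (ret T z, 0))"

definition level_part :: "'a tower_data \<Rightarrow> nat \<Rightarrow> nat \<Rightarrow> ('a \<times> nat) set" where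
  "level_part T l i = {(z, l') \<in> tower_space T. l' = l \<and> z \<in> part T i}"

text \<open>
  Pointwise conditions are only ever imposed at good points. The forward orbit of \<open>(z, l)\<close> consists
  of points in the columns over the iterates of \<open>z\<close> under the return map, and the only Jacobians
  met along it that are not identically 1 are those of the return map at these iterates. Hence
  \<open>(z, l)\<close> is good iff \<open>z\<close> is.
\<close>

definition good_base :: "'a tower_data \<Rightarrow> 'a set" where
  "good_base T = {x \<in> space (base T).
     \<forall>n. (\<exists>!i. (ret T ^^ n) x \<in> part T i) \<and> 0 < jac T ((ret T ^^ n) x)}"

definition good :: "'a tower_data \<Rightarrow> ('a \<times> nat) set" where
  "good T = {(z, l) \<in> tower_space T. z \<in> good_base T}"

text \<open>Points that are never separated have separation time \<open>\<infinity>\<close>, with the convention \<open>\<beta>\<^sup>\<infinity> = 0\<close>.\<close>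

definition sep_base :: "'a tower_data \<Rightarrow> 'a \<Rightarrow> 'a \<Rightarrow> enat" where
  "sep_base T x y =
     (INF n \<in> {n. \<not> (\<exists>i. (ret T ^^ n) x \<in> part T i \<and> (ret T ^^ n) y \<in> part T i)}. enat n)"

definition sep :: "'a tower_data \<Rightarrow> 'a \<times> nat \<Rightarrow> 'a \<times> nat \<Rightarrow> enat" where
  "sep T x y =
     (if \<exists>l i. x \<in> level_part T l i \<and> y \<in> level_part T l i
      then sep_base T (fst x) (fst y) else 0)"

definition power_enat :: "real \<Rightarrow> enat \<Rightarrow> real" where
  "power_enat b s = (case s of enat n \<Rightarrow> b ^ n | \<infinity> \<Rightarrow> 0)"

text \<open>
  The set \<open>E\<close> in \<open>jacobian\<close> is any measurable set on which the return map is injective; measurability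
  of its image holds automatically if \<open>E\<close> lies in one element of the partition, and otherwise is
  needed for the formula to make sense.

  That the refined partitions separate points is expressed by \<open>separates\<close>, and \<open>generates\<close> is the
  corresponding statement for measurable sets modulo null sets. In a Lebesgue space
  (in the sense of Rokhlin) \<open>generates\<close> follows from \<open>separates\<close>. In an arbitrary finite measure
  space it does not, and without it ergodicity may fail: let \<open>A\<close> be a completely invariant set such
  that \<open>A\<close> and its complement both have full outer Lebesgue measure in \<open>[0,1]\<close>, for a piecewise affine
  map with full branches, and adjoin \<open>A\<close> to the Borel sets as a set of measure \<open>1/2\<close>, independent of
  them.
\<close>

locale tower = finite_measure "base T" for T :: "'a tower_data" +
  assumes base_nonnull: "0 < emeasure (base T) (space (base T))"
    and part_sets: "part T i \<in> sets (base T)"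
    and part_disjoint: "i \<noteq> j \<Longrightarrow> part T i \<inter> part T j \<in> null_sets (base T)"
    and part_covers: "space (base T) - (\<Union>i. part T i) \<in> null_sets (base T)"
    and cylinder_sets: "(\<Inter>j<n. (ret T ^^ j) -` part T (w j)) \<inter> space (base T) \<in> sets (base T)"
    and ret_measurable: "ret T \<in> base T \<rightarrow>\<^sub>M base T"
    and ret_bij: "bij_betw (ret T) (part T i) (space (base T))"
    and ret_inv_measurable: "the_inv_into (part T i) (ret T) \<in> base T \<rightarrow>\<^sub>M base T"
    and separates: "x \<in> good_base T \<Longrightarrow> y \<in> good_base T \<Longrightarrow>
      (\<And>n. \<exists>i. (ret T ^^ n) x \<in> part T i \<and> (ret T ^^ n) y \<in> part T i) \<Longrightarrow> x = y"
    and generates: "E \<in> sets (base T) \<Longrightarrow>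
      \<exists>E' \<in> sigma_sets (space (base T)) {(ret T ^^ n) -` part T i \<inter> space (base T) | n i. True}.
        (E - E') \<union> (E' - E) \<in> null_sets (base T)"
    and rtime_measurable: "rtime T \<in> base T \<rightarrow>\<^sub>M count_space UNIV"
    and rtime_pos: "x \<in> space (base T) \<Longrightarrow> 0 < rtime T x"
    and rtime_const: "x \<in> part T i \<Longrightarrow> y \<in> part T i \<Longrightarrow> rtime T x = rtime T y"
    and jac_measurable: "jac T \<in> borel_measurable (base T)"
    and jac_pos: "AE x in base T. 0 < jac T x"
    and jacobian: "E \<in> sets (base T) \<Longrightarrow> inj_on (ret T) E \<Longrightarrow> ret T ` E \<in> sets (base T) \<Longrightarrow>
      emeasure (base T) (ret T ` E) = (\<integral>\<^sup>+x\<in>E. ennreal (jac T x) \<partial>base T)"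
    and bounded_distortion: "\<exists>C>0. \<exists>\<beta>. 0 < \<beta> \<and> \<beta> < 1 \<and>
      (\<forall>i. \<forall>x \<in> part T i \<inter> good_base T. \<forall>y \<in> part T i \<inter> good_base T.
        \<bar>jac T x / jac T y - 1\<bar> \<le> C * power_enat \<beta> (sep_base T (ret T x) (ret T y)))"
    \<comment> \<open>the value of \<open>R\<close> on the null set of bad points must not influence the gcd\<close>
    and aperiodic: "Gcd (rtime T ` good_base T) = 1"
    and rtime_integrable: "integrable (base T) (\<lambda>x. real (rtime T x))"
begin

lemma tower_space_sets: "tower_space T \<in> sets (base T \<Otimes>\<^sub>M count_space UNIV)"
proof -
  have eq: "tower_space T = (\<Union>l. (rtime T -` {l<..} \<inter> space (base T)) \<times> {l})"
    by (auto simp: tower_space_def)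
  have "rtime T -` {l<..} \<inter> space (base T) \<in> sets (base T)" for l
    by (rule measurable_sets[OF rtime_measurable]) simp
  then show ?thesis
    unfolding eq by (intro sets.countable_UN image_subsetI pair_measureI) auto
qed

lemma emeasure_tower_level:
  assumes "A \<in> sets (base T)" "\<And>z. z \<in> A \<Longrightarrow> l < rtime T z"
  shows "A \<times> {l} \<in> sets (tower_measure T)"
    and "emeasure (tower_measure T) (A \<times> {l}) = emeasure (base T) A"
proof -
  interpret C: sigma_finite_measure "count_space UNIV :: nat measure"
    by (rule sigma_finite_measure_count_space)
  have sub: "A \<times> {l} \<subseteq> tower_space T"
    using assms sets.sets_into_space[OF assms(1)] by (auto simp: tower_space_def)
  have sp: "tower_space T \<inter> space (base T \<Otimes>\<^sub>M count_space (UNIV :: nat set))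
      \<in> sets (base T \<Otimes>\<^sub>M count_space UNIV)"
    using tower_space_sets by (intro sets.Int) auto
  have prod: "A \<times> {l} \<in> sets (base T \<Otimes>\<^sub>M count_space UNIV)"
    using assms(1) by (intro pair_measureI) auto
  show "A \<times> {l} \<in> sets (tower_measure T)"
    unfolding tower_measure_def using sets_restrict_space_iff[OF sp] sub prod by simp
  show "emeasure (tower_measure T) (A \<times> {l}) = emeasure (base T) A"
    unfolding tower_measure_def emeasure_restrict_space[OF sp sub]
    using C.emeasure_pair_measure_Times[OF assms(1), of "{l}"] by simp
qed

end

text \<open>Bounded functions have real variations; for others the supremum is meaningless.\<close>

definition bounded_obs :: "'a tower_data \<Rightarrow> ('a \<times> nat \<Rightarrow> real) set" where
  "bounded_obs T = {\<psi>. bounded (\<psi> ` good T)}"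

definition variation :: "'a tower_data \<Rightarrow> ('a \<times> nat \<Rightarrow> real) \<Rightarrow> nat \<Rightarrow> real" where
  "variation T \<psi> n =
     Sup {\<bar>\<psi> x - \<psi> y\<bar> | x y. x \<in> good T \<and> y \<in> good T \<and> enat n \<le> sep T x y}"

definition V1 :: "'a tower_data \<Rightarrow> real \<Rightarrow> ('a \<times> nat \<Rightarrow> real) set" where
  "V1 T \<gamma> = {\<psi> \<in> bounded_obs T. 0 < \<gamma> \<and> \<gamma> < 1 \<and> variation T \<psi> \<in> O(\<lambda>n. \<gamma> ^ n)}"

definition V2 :: "'a tower_data \<Rightarrow> real \<Rightarrow> ('a \<times> nat \<Rightarrow> real) set" where
  "V2 T \<gamma> = {\<psi> \<in> bounded_obs T. 0 < \<gamma> \<and> \<gamma> < 1 \<and>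
     variation T \<psi> \<in> O(\<lambda>n. exp (- (real n powr \<gamma>)))}"

definition V3 :: "'a tower_data \<Rightarrow> real \<Rightarrow> ('a \<times> nat \<Rightarrow> real) set" where
  "V3 T \<gamma> = {\<psi> \<in> bounded_obs T. 1 < \<gamma> \<and>
     variation T \<psi> \<in> O(\<lambda>n. exp (- (ln (real n) powr \<gamma>)))}"

definition V4 :: "'a tower_data \<Rightarrow> real \<Rightarrow> ('a \<times> nat \<Rightarrow> real) set" where
  "V4 T \<gamma> = {\<psi> \<in> bounded_obs T. 1 < \<gamma> \<and> variation T \<psi> \<in> O(\<lambda>n. real n powr (- \<gamma>))}"

definition Linf :: "'b measure \<Rightarrow> ('b \<Rightarrow> real) set" where
  "Linf M = {f \<in> borel_measurable M. esssup M (\<lambda>x. ereal \<bar>f x\<bar>) < \<infinity>}"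

definition Linf_norm :: "'b measure \<Rightarrow> ('b \<Rightarrow> real) \<Rightarrow> real" where
  "Linf_norm M f = real_of_ereal (esssup M (\<lambda>x. ereal \<bar>f x\<bar>))"

definition invariant_measure :: "('b \<Rightarrow> 'b) \<Rightarrow> 'b measure \<Rightarrow> bool" where
  "invariant_measure f \<nu> \<longleftrightarrow> f \<in> \<nu> \<rightarrow>\<^sub>M \<nu> \<and> distr \<nu> \<nu> f = \<nu>"

definition acip :: "'a tower_data \<Rightarrow> ('a \<times> nat) measure \<Rightarrow> bool" where
  "acip T \<nu> \<longleftrightarrow> sets \<nu> = sets (tower_measure T) \<and> prob_space \<nu> \<and>
     invariant_measure (tower_map T) \<nu> \<and> absolutely_continuous (tower_measure T) \<nu>"

definition mixing :: "('b \<Rightarrow> 'b) \<Rightarrow> 'b measure \<Rightarrow> bool" where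
  "mixing f \<nu> \<longleftrightarrow> (\<forall>A \<in> sets \<nu>. \<forall>B \<in> sets \<nu>.
     (\<lambda>n. measure \<nu> ((f ^^ n) -` A \<inter> B)) \<longlonglongrightarrow> measure \<nu> A * measure \<nu> B)"

definition correlation ::
  "('b \<Rightarrow> 'b) \<Rightarrow> 'b measure \<Rightarrow> ('b \<Rightarrow> real) \<Rightarrow> ('b \<Rightarrow> real) \<Rightarrow> nat \<Rightarrow> real" where
  "correlation f \<nu> \<phi> \<psi> n =
     (\<integral>x. \<phi> ((f ^^ n) x) * \<psi> x \<partial>\<nu>) - (\<integral>x. \<phi> x \<partial>\<nu>) * (\<integral>x. \<psi> x \<partial>\<nu>)"

definition tail :: "'a tower_data \<Rightarrow> nat \<Rightarrow> real" where
  "tail T n = measure (base T) {x \<in> space (base T). n < rtime T x}"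

end

theory Submission
  imports Defs "HOL-Complex_Analysis.Complex_Analysis" "HOL-Real_Asymp.Real_Asymp"
begin

text \<open>
  Everything is reduced to a scalar renewal equation. Let \<open>m\<close> be the measure on the base. The
  density with respect to \<open>m\<close> of the mass that arrives at the base at time \<open>n\<close> is obtained by
  summing over all inverse branches, and by bounded distortion the logarithm of such a sum is
  Lipschitz for the metric \<open>\<beta> ^ s(x, y)\<close>: one application of a transfer operator \<^emph>\<open>improves\<close> the
  Lipschitz constant from \<open>K1\<close> to \<open>K < K1\<close> (\<open>reg_transfer_op_K\<close>). Such a density is bounded below by a
  multiple of its mean, so a fixed fraction \<open>eps\<close> of its mass can be split off in the form of a
  constant, and what is left is still regular with constant \<open>K1\<close>. The mass split off has forgotten
  its past: it starts again from \<open>m\<close>. Repeating this at every arrival at the base gives, for every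
  regular initial density, the identity \<open>regeneration\<close>, in which each summand is a mass that
  regenerates at time \<open>m\<close> for the first time, followed by the evolution of the uniform density.

  For the uniform density itself the identity is a renewal equation \<open>x = h + p * x\<close>, where \<open>p\<close> is
  the distribution of the time until the first regeneration. Two facts are needed.
  \<^item> The tail of \<open>p\<close> decays as fast as \<open>m {R > n}\<close>, both for polynomial and for exponential decay
    (\<open>t_poly\<close>, \<open>t_exp\<close>). At every arrival at the base the fraction \<open>eps\<close> of the arriving mass
    regenerates, which gives a recursive inequality for the tail.
  \<^item> The solution of the renewal equation converges, and the error at time \<open>n\<close> decays like the sum of
    the tail of \<open>p\<close> beyond \<open>n\<close>, for polynomial and for exponential tails (\<open>renewal_rate\<close>). If \<open>B(z)\<close>
    is the power series of the tail of \<open>p\<close>, then \<open>1 - p(z) = (1 - z) B(z)\<close>, and the increments of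
    \<open>x\<close> are the coefficients of \<open>h(z) / B(z)\<close>. By aperiodicity \<open>B\<close> has no zero in the closed unit
    disc, so by Wiener's lemma (\<open>wiener_inverse\<close>) the coefficients of \<open>1 / B\<close> are summable, and they
    inherit polynomial and exponential decay from those of \<open>B\<close>.

  Hence all regular densities converge to a common limit, uniformly over observables bounded by 1
  (\<open>regular_rate\<close>). The limit is the integral against a measure \<open>\<nu>\<close> with a regular density, and \<open>\<nu>\<close>
  is invariant because a limit along \<open>n\<close> does not change under \<open>n \<mapsto> n + 1\<close>.

  A function \<open>g\<close> of the level and of the first \<open>k\<close> symbols loses its influence after \<open>k\<close> returns to the
  base: on every cylinder the density pushed forward is regular. So \<open>\<phi> \<circ> F ^ n\<close> and \<open>g\<close> are
  decorrelated up to the error of \<open>regular_rate\<close> at time \<open>n / 2\<close> and the probability that the \<open>k\<close>-th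
  return takes longer than \<open>n / 2\<close> (\<open>cylinder_corr\<close>). An observable \<open>\<psi>\<close> differs from such a function
  by at most its \<open>k\<close>-th variation (\<open>corr_variation\<close>), and the rate assigned to a sequence of
  variations is the infimum of the resulting bound over \<open>k\<close>. With exponential tails one takes \<open>k\<close>
  proportional to \<open>n\<close> and bounds the return times by exponential moments (\<open>slow_chernoff\<close>); with
  tails \<open>n powr -\<alpha>\<close> one takes \<open>k\<close> about \<open>n powr (1 / (1 + \<alpha>))\<close> and a union bound (\<open>slow_poly\<close>),
  which makes the error \<open>n powr (1 - \<alpha>)\<close>.

  Sets that are determined by finitely many symbols generate the \<open>\<sigma>\<close>-algebra up to null sets.
  Therefore functions of finitely many symbols are dense in \<open>L\<^sup>1(\<nu>)\<close>, and correlations with every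
  integrable \<open>\<psi>\<close> tend to zero uniformly over observables bounded by 1 (\<open>decorrelating_integrable\<close>). This
  contains mixing, the statement for general \<open>\<psi>\<close>, and, with the density of another absolutely
  continuous invariant measure as \<open>\<psi>\<close>, the uniqueness of \<open>\<nu>\<close>.
\<close>

section \<open>Wiener's lemma for power series with summable coefficients\<close>

definition l1_bounded :: "complex fps \<Rightarrow> real \<Rightarrow> bool" where
  "l1_bounded f B \<longleftrightarrow> (\<forall>N. (\<Sum>n\<le>N. norm (fps_nth f n)) \<le> B)"

lemma l1_bounded_nonneg: "l1_bounded f B \<Longrightarrow> 0 \<le> B"
  unfolding l1_bounded_def by (metis norm_ge_zero order_trans sum_nonneg)

lemma l1_bounded_summable:
  assumes "l1_bounded f B"
  shows "summable (\<lambda>n. norm (fps_nth f n))" "(\<Sum>n. norm (fps_nth f n)) \<le> B"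
proof -
  show s: "summable (\<lambda>n. norm (fps_nth f n))"
    using assms unfolding l1_bounded_def
    by (intro bounded_imp_summable[where B = B]) auto
  show "(\<Sum>n. norm (fps_nth f n)) \<le> B"
    using assms unfolding l1_bounded_def
    by (intro suminf_le_const s) (metis lessThan_Suc_atMost norm_ge_zero not0_implies_Suc order_trans sum.lessThan_Suc sum_nonneg lessThan_0 sum.empty)
qed

lemma summable_l1_bounded:
  assumes "summable (\<lambda>n. norm (fps_nth f n))" "(\<Sum>n. norm (fps_nth f n)) \<le> B"
  shows "l1_bounded f B"
  unfolding l1_bounded_def using sum_le_suminf[OF assms(1)] assms(2)
  by (meson finite_atMost norm_ge_zero order_trans)

lemma triangle_sum_le:
  fixes a b :: "nat \<Rightarrow> real"
  assumes "\<And>n. 0 \<le> a n" "\<And>n. 0 \<le> b n"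
  shows "(\<Sum>n\<le>N. \<Sum>i\<le>n. a i * b (n - i)) \<le> (\<Sum>n\<le>N. a n) * (\<Sum>n\<le>N. b n)"
proof -
  have "(\<Sum>n\<le>N. \<Sum>i\<le>n. a i * b (n - i)) = (\<Sum>(i,j)\<in>{(i,j). i + j \<le> N}. a i * b j)"
    by (rule sum.triangle_reindex_eq[symmetric])
  also have "\<dots> \<le> (\<Sum>(i,j)\<in>{..N} \<times> {..N}. a i * b j)"
    using assms by (intro sum_mono2) auto
  also have "\<dots> = (\<Sum>n\<le>N. a n) * (\<Sum>n\<le>N. b n)"
    by (simp add: sum_product sum.cartesian_product)
  finally show ?thesis .
qed

lemma norm_fps_mult_nth_le:
  "norm (fps_nth (f * g) n) \<le> (\<Sum>i\<le>n. norm (fps_nth f i) * norm (fps_nth (g :: complex fps) (n - i)))"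
  unfolding fps_mult_nth atLeast0AtMost
  by (rule order_trans[OF norm_sum]) (simp add: norm_mult)

lemma l1_bounded_mult:
  assumes f: "l1_bounded f A" and g: "l1_bounded g B"
  shows "l1_bounded (f * g) (A * B)"
  unfolding l1_bounded_def
proof
  fix N
  have "(\<Sum>n\<le>N. norm (fps_nth (f * g) n))
      \<le> (\<Sum>n\<le>N. \<Sum>i\<le>n. norm (fps_nth f i) * norm (fps_nth g (n - i)))"
    by (intro sum_mono norm_fps_mult_nth_le)
  also have "\<dots> \<le> (\<Sum>n\<le>N. norm (fps_nth f n)) * (\<Sum>n\<le>N. norm (fps_nth g n))"
    by (rule triangle_sum_le) auto
  also have "\<dots> \<le> A * B"
    using f g l1_bounded_nonneg[OF f] unfolding l1_bounded_def
    by (intro mult_mono) (auto intro: sum_nonneg)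
  finally show "(\<Sum>n\<le>N. norm (fps_nth (f * g) n)) \<le> A * B" .
qed

lemma l1_bounded_one: "l1_bounded 1 1"
  unfolding l1_bounded_def by (auto simp: if_distrib[of norm] sum.delta cong: if_cong)

lemma l1_bounded_power: "l1_bounded f A \<Longrightarrow> l1_bounded (f ^ k) (A ^ k)"
  by (induction k) (auto intro: l1_bounded_mult l1_bounded_one)

text \<open>
  Used to recognise the reciprocal of a series from an approximate inverse and a Neumann series.
\<close>

lemma inverse_of_right:
  fixes A B :: "complex fps" assumes "A * B = 1" shows "inverse A = B"
proof -
  have "fps_nth A 0 * fps_nth B 0 = 1"
    using assms by (metis fps_mult_nth_0 fps_one_nth)
  hence "fps_nth A 0 \<noteq> 0" by auto
  hence "inverse A * A = 1" by (rule inverse_mult_eq_1)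
  thus ?thesis using assms by (metis mult.assoc mult.left_neutral mult.right_neutral)
qed

text \<open>
  Cauchy's estimate on the circle of radius \<open>\<rho>\<close>. The bound is geometric in \<open>n\<close> and has the right
  dependence on \<open>k\<close>, without which the powers in the proof of Wiener's lemma could not be
  controlled.
\<close>

lemma poly_inverse_power_decay:
  fixes P :: "complex poly"
  assumes rho: "\<rho> > 1" and eta: "\<eta> > 0" and lb: "\<And>z. norm z \<le> \<rho> \<Longrightarrow> \<eta> \<le> norm (poly P z)"
  shows "norm (fps_nth (inverse (fps_of_poly P) ^ k) n) \<le> (1 / \<eta>) ^ k * (1 / \<rho>) ^ n"
proof -
  let ?f = "\<lambda>z. inverse (poly P z) ^ k"
  have nz: "poly P z \<noteq> 0" if "norm z \<le> \<rho>" for z using lb[OF that] eta by auto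
  have "(\<lambda>z. poly P z) has_fps_expansion fps_of_poly P"
    unfolding has_fps_expansion_def by auto
  moreover have "fps_nth (fps_of_poly P) 0 \<noteq> 0"
    using nz[of 0] rho by (simp add: poly_0_coeff_0)
  ultimately have ex: "?f has_fps_expansion inverse (fps_of_poly P) ^ k"
    by (intro has_fps_expansion_power has_fps_expansion_inverse)
  have "fps_nth (inverse (fps_of_poly P) ^ k) n = (deriv ^^ n) ?f 0 / fact n"
    using fps_nth_fps_expansion[OF ex] by simp
  moreover have "norm ((deriv ^^ n) ?f 0) \<le> fact n * (1 / \<eta>) ^ k / \<rho> ^ n"
  proof (rule Cauchy_inequality)
    show "?f holomorphic_on ball 0 \<rho>"
      using nz by (intro holomorphic_intros) auto
    show "continuous_on (cball 0 \<rho>) ?f"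
      using nz by (intro continuous_intros) auto
    show "norm (?f x) \<le> (1 / \<eta>) ^ k" if "norm (0 - x) = \<rho>" for x
    proof -
      have "inverse (norm (poly P x)) \<le> 1 / \<eta>"
        using le_imp_inverse_le[OF lb eta, of x] that by (simp add: inverse_eq_divide)
      then show ?thesis by (simp add: norm_power norm_inverse power_mono)
    qed
  qed (use rho in auto)
  ultimately have "norm (fps_nth (inverse (fps_of_poly P) ^ k) n)
      \<le> (fact n * (1 / \<eta>) ^ k / \<rho> ^ n) / fact n"
    by (simp only: norm_divide norm_fact) (intro divide_right_mono, auto)
  then show ?thesis by (simp add: power_one_over)
qed

text \<open>
  Wiener's lemma, by Newman's elementary argument, for any class \<open>D\<close> of series that is stable under
  the operations used. The series \<open>A\<close> is close in the norm of \<open>\<ell>\<^sup>1\<close> to a polynomial \<open>P\<close> without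
  zeros in a disc of radius \<open>\<rho> > 1\<close>. With \<open>Q = 1 / P\<close> and \<open>S = (P - A) Q\<close> one has \<open>A Q = 1 - S\<close>, and
  although \<open>S\<close> need not be small, a power \<open>S ^ K\<close> is. Hence
  \<open>1 / A = Q (1 + S + \<dots> + S ^ (K - 1)) / (1 - S ^ K)\<close>, in which the last factor is given by the
  assumption on Neumann series.
\<close>

theorem wiener_inverse:
  fixes A :: "complex fps" and D :: "complex fps \<Rightarrow> bool"
  assumes l1: "summable (\<lambda>n. norm (fps_nth A n))"
    and nz: "\<And>z. norm z \<le> 1 \<Longrightarrow> (\<Sum>n. fps_nth A n * z ^ n) \<noteq> 0"
    and D_A: "D A"
    and D_add: "\<And>f g. D f \<Longrightarrow> D g \<Longrightarrow> D (f + g)"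
    and D_mult: "\<And>f g. D f \<Longrightarrow> D g \<Longrightarrow> D (f * g)"
    and D_geometric: "\<And>f C \<theta>. 0 < \<theta> \<Longrightarrow> \<theta> < 1 \<Longrightarrow> (\<And>n. norm (fps_nth f n) \<le> C * \<theta> ^ n) \<Longrightarrow> D f"
    and D_Neumann: "\<And>\<sigma>. D \<sigma> \<Longrightarrow> l1_bounded \<sigma> (1 / 2) \<Longrightarrow> D (inverse (1 - \<sigma>))"
  shows "D (inverse A)"
proof -
  define a where "a z = (\<Sum>n. fps_nth A n * z ^ n)" for z
  have pw: "norm (fps_nth A n * z ^ n) \<le> norm (fps_nth A n)" if "norm z \<le> 1" for n and z :: complex
    using that by (simp add: norm_mult norm_power mult_left_le power_le_one)
  have ulim: "uniform_limit (cball 0 1) (\<lambda>n z. \<Sum>i<n. fps_nth A i * z ^ i) a sequentially"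
    unfolding a_def using pw l1 by (intro Weierstrass_m_test) auto
  have "continuous_on (cball 0 1) a"
    by (rule uniform_limit_theorem[OF _ ulim]) (auto intro!: continuous_intros always_eventually)
  then have "\<exists>x\<in>cball 0 1. \<forall>y\<in>cball 0 1. norm (a x) \<le> norm (a y)"
    by (intro continuous_attains_inf continuous_intros) auto
  then obtain x0 where x0: "norm x0 \<le> 1" "\<And>z. norm z \<le> 1 \<Longrightarrow> norm (a x0) \<le> norm (a z)"
    by auto
  define \<delta> where "\<delta> = norm (a x0)"
  have d: "\<delta> > 0" using nz[OF x0(1)] by (auto simp: \<delta>_def a_def)
  obtain N where N: "norm (\<Sum>i. norm (fps_nth A (i + N))) < \<delta> / 4"
    using suminf_exist_split[OF _ l1, of "\<delta> / 4"] d by auto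
  \<comment> \<open>the truncation of \<open>A\<close> at an index where the remainder is small compared with the minimum of \<open>\<bar>A\<bar>\<close> on the disc\<close>
  define P where "P = Poly (map (fps_nth A) [0..<N])"
  have cP: "coeff P n = (if n < N then fps_nth A n else 0)" for n
    by (simp add: P_def nth_default_def)
  have PA: "l1_bounded (fps_of_poly P - A) (\<delta> / 4)"
  proof (rule summable_l1_bounded)
    have eq: "norm (fps_nth (fps_of_poly P - A) (n + N)) = norm (fps_nth A (n + N))" for n
      by (simp add: cP)
    show "summable (\<lambda>n. norm (fps_nth (fps_of_poly P - A) n))"
    proof -
      have "summable (\<lambda>n. norm (fps_nth (fps_of_poly P - A) (n + N)))"
        unfolding eq by (rule summable_ignore_initial_segment[OF l1])
      then show ?thesis by (rule summable_iff_shift[THEN iffD1])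
    qed
    then have "(\<Sum>n. norm (fps_nth (fps_of_poly P - A) n)) =
        (\<Sum>n. norm (fps_nth A (n + N))) + (\<Sum>n<N. norm (fps_nth (fps_of_poly P - A) n))"
      unfolding eq[symmetric] by (rule suminf_split_initial_segment)
    also have "(\<Sum>n<N. norm (fps_nth (fps_of_poly P - A) n)) = 0"
      by (simp add: cP)
    finally show "(\<Sum>n. norm (fps_nth (fps_of_poly P - A) n)) \<le> \<delta> / 4"
      using N by auto
  qed
  have pP: "norm (poly P z - a z) \<le> \<delta> / 4" if "norm z \<le> 1" for z
  proof -
    have s: "summable (\<lambda>n. fps_nth A n * z ^ n)"
      using pw[OF that] l1 by (intro summable_comparison_test'[OF l1]) auto
    have "(\<lambda>n. coeff P n * z ^ n) sums poly P z"
      unfolding poly_altdef by (rule sums_finite) (auto simp: coeff_eq_0)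
    then have "(\<lambda>n. coeff P n * z ^ n - fps_nth A n * z ^ n) sums (poly P z - a z)"
      unfolding a_def by (intro sums_diff summable_sums s)
    then have eq: "poly P z - a z = (\<Sum>n. fps_nth (fps_of_poly P - A) n * z ^ n)"
      by (simp add: sums_iff algebra_simps)
    have "norm (fps_nth (fps_of_poly P - A) n * z ^ n) \<le> norm (fps_nth (fps_of_poly P - A) n)" for n
      using that by (simp add: norm_mult norm_power mult_left_le power_le_one)
    then have "norm (poly P z - a z) \<le> (\<Sum>n. norm (fps_nth (fps_of_poly P - A) n))"
      unfolding eq using l1_bounded_summable(1)[OF PA]
      by (intro norm_suminf_le) auto
    also have "\<dots> \<le> \<delta> / 4" by (rule l1_bounded_summable(2)[OF PA])
    finally show ?thesis .
  qed
  have "norm (poly P z) > \<delta> / 2" if "norm z \<le> 1" for z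
  proof -
    have "\<delta> \<le> norm (a z)" using x0(2)[OF that] by (simp add: \<delta>_def)
    also have "\<dots> \<le> norm (poly P z) + norm (poly P z - a z)"
      by (metis add.commute norm_minus_commute norm_triangle_sub)
    finally show ?thesis using pP[OF that] d by simp
  qed
  then have sub: "cball 0 1 \<subseteq> {z. \<delta> / 2 < norm (poly P z)}" by auto
  have op: "open {z. \<delta> / 2 < norm (poly P z)}"
    by (intro open_Collect_less continuous_intros)
  obtain e where e: "e > 0" "(\<Union>x\<in>cball 0 1. ball x e) \<subseteq> {z. \<delta> / 2 < norm (poly P z)}"
    using compact_subset_open_imp_ball_epsilon_subset[OF compact_cball op sub] by blast
  \<comment> \<open>by compactness the lower bound for \<open>P\<close> extends to a slightly larger disc\<close>
  define \<rho> where "\<rho> = 1 + e / 2"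
  have rho: "\<rho> > 1" using e by (simp add: \<rho>_def)
  have lb: "\<delta> / 2 \<le> norm (poly P z)" if "norm z \<le> \<rho>" for z
  proof -
    define x where "x = z / of_real \<rho>"
    have "norm x \<le> 1" using that rho by (simp add: x_def norm_divide field_simps)
    moreover have "dist x z < e"
    proof -
      have "x - z = - x * of_real (\<rho> - 1)"
        using rho by (simp add: x_def field_simps)
      then have "norm (x - z) = norm x * (\<rho> - 1)"
        using rho by (simp only: norm_mult norm_minus_cancel norm_of_real)
      also have "\<dots> \<le> 1 * (\<rho> - 1)" using \<open>norm x \<le> 1\<close> rho by (intro mult_right_mono) auto
      finally show ?thesis using e by (simp add: dist_norm \<rho>_def)
    qed
    ultimately have "z \<in> (\<Union>x\<in>cball 0 1. ball x e)" by auto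
    with e(2) have "z \<in> {z. \<delta> / 2 < norm (poly P z)}" by blast
    then show ?thesis by simp
  qed
  define Q where "Q = inverse (fps_of_poly P)"
  have Qk: "norm (fps_nth (Q ^ k) n) \<le> (2 / \<delta>) ^ k * (1 / \<rho>) ^ n" for k n
    using poly_inverse_power_decay[OF rho _ lb, of k n] d by (simp add: Q_def)
  define c where "c = 1 / (1 - 1 / \<rho>)"
  have Ql1: "l1_bounded (Q ^ k) ((2 / \<delta>) ^ k * c)" for k
  proof -
    have "(\<Sum>n\<le>M. norm (fps_nth (Q ^ k) n)) \<le> (2 / \<delta>) ^ k * c" for M
    proof -
      have "(\<Sum>n\<le>M. norm (fps_nth (Q ^ k) n)) \<le> (\<Sum>n\<le>M. (2 / \<delta>) ^ k * (1 / \<rho>) ^ n)"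
        by (intro sum_mono Qk)
      also have "\<dots> = (2 / \<delta>) ^ k * (\<Sum>n\<le>M. (1 / \<rho>) ^ n)"
        by (simp add: sum_distrib_left)
      also have "\<dots> \<le> (2 / \<delta>) ^ k * (\<Sum>n. (1 / \<rho>) ^ n)"
        using rho d by (intro mult_left_mono sum_le_suminf summable_geometric) auto
      also have "(\<Sum>n. (1 / \<rho>) ^ n) = c"
        using rho by (subst suminf_geometric) (auto simp: c_def)
      finally show ?thesis .
    qed
    then show ?thesis by (simp add: l1_bounded_def)
  qed
  have "poly P 0 \<noteq> 0" using lb[of 0] d rho by auto
  then have PQ: "fps_of_poly P * Q = 1"
    unfolding Q_def by (intro inverse_mult_eq_1') (simp add: poly_0_coeff_0)
  define S where "S = (fps_of_poly P - A) * Q"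
  have A_eq: "A * Q = 1 - S" unfolding S_def using PQ by (simp add: algebra_simps)
  \<comment> \<open>the norm of \<open>S ^ K\<close> is at most \<open>c / 2 ^ K\<close>\<close>
  obtain K where K: "c * 2 \<le> (2::real) ^ K"
    using real_arch_pow[of 2 "c * 2"] by (auto intro: less_imp_le)
  have SK: "l1_bounded (S ^ K) (1 / 2)"
  proof -
    have "l1_bounded ((fps_of_poly P - A) ^ K * Q ^ K) ((\<delta> / 4) ^ K * ((2 / \<delta>) ^ K * c))"
      by (intro l1_bounded_mult l1_bounded_power PA Ql1)
    also have "(\<delta> / 4) ^ K * ((2 / \<delta>) ^ K * c) = (1 / 2) ^ K * c"
      using d by (simp add: power_mult_distrib[symmetric] mult.assoc[symmetric])
    finally have "l1_bounded (S ^ K) ((1 / 2) ^ K * c)"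
      by (simp add: S_def power_mult_distrib)
    moreover have "(1 / 2) ^ K * c \<le> 1 / 2"
      using K by (simp add: field_simps power_one_over)
    ultimately show ?thesis unfolding l1_bounded_def by (meson order_trans)
  qed
  define r where "r = Q * (\<Sum>k<K. S ^ k)"
  have Ar: "A * r = 1 - S ^ K"
    unfolding r_def mult.assoc[symmetric] A_eq by (rule one_diff_power_eq[symmetric])
  have DQ: "D Q"
    using Qk[of 1] rho by (intro D_geometric[of "1 / \<rho>" Q "2 / \<delta>"]) auto
  have Dfin: "D f" if "\<And>n. n \<ge> M \<Longrightarrow> fps_nth f n = 0" for f M
  proof (rule D_geometric[of "1/2"])
    fix n
    show "norm (fps_nth f n) \<le> ((\<Sum>i<M. norm (fps_nth f i)) * 2 ^ M) * (1 / 2) ^ n"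
    proof (cases "n < M")
      case True
      have "norm (fps_nth f n) \<le> (\<Sum>i<M. norm (fps_nth f i))"
        using True by (intro member_le_sum) auto
      moreover have "(1::real) \<le> 2 ^ M * (1 / 2) ^ n"
        using True by (simp add: power_one_over field_simps power_increasing)
      ultimately show ?thesis
        by (smt (verit, best) mult.assoc mult_left_le mult_le_cancel_left1 norm_ge_zero)
    next
      case False
      then show ?thesis using that by (simp add: sum_nonneg)
    qed
  qed auto
  have Dsub: "D (fps_of_poly P - A)"
  proof -
    have "D (fps_const (-1) * A)" by (intro D_mult D_A Dfin[of 1]) auto
    moreover have "D (fps_of_poly P)" by (intro Dfin[of N]) (simp add: cP)
    ultimately have "D (fps_of_poly P + fps_const (-1) * A)" by (rule D_add[rotated])
    then show ?thesis by (simp add: fps_eq_iff minus_mult_left[symmetric] fps_const_neg[symmetric] del: fps_const_neg)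
  qed
  have DS: "D (S ^ k)" for k
  proof (induction k)
    case 0
    show ?case using Dfin[of 1 1] by simp
  next
    case (Suc k)
    then show ?case unfolding S_def power_Suc by (intro D_mult Dsub DQ)
  qed
  have "D (\<Sum>k<K. S ^ k)" for K
    by (induction K) (auto intro: D_add DS Dfin[of 0])
  then have "D r" unfolding r_def by (intro D_mult DQ)
  have "fps_nth A 0 \<noteq> 0"
    using nz[of 0] powser_zero[of "fps_nth A"] by simp
  have n0: "fps_nth (1 - S ^ K) 0 \<noteq> 0"
  proof -
    have "norm (fps_nth (S ^ K) 0) \<le> 1 / 2" using SK[unfolded l1_bounded_def, rule_format, of 0] by simp
    then show ?thesis by (auto simp: fps_one_nth)
  qed
  have "A * (r * inverse (1 - S ^ K)) = 1"
    unfolding mult.assoc[symmetric] Ar by (rule inverse_mult_eq_1'[OF n0])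
  then have "inverse A = r * inverse (1 - S ^ K)" by (rule inverse_of_right)
  then show ?thesis using \<open>D r\<close> D_Neumann[OF DS SK] by (simp add: D_mult)
qed

section \<open>Rates of decay\<close>

text \<open>
  Bounds for all \<open>n\<close>, with \<open>n + 1\<close> in the place of \<open>n\<close>, are easier to convolve and to iterate than
  the equivalent statements in Landau notation.
\<close>

definition poly_decay :: "real \<Rightarrow> (nat \<Rightarrow> real) \<Rightarrow> bool" where
  "poly_decay \<alpha> f \<longleftrightarrow> (\<exists>C. \<forall>n. \<bar>f n\<bar> \<le> C * real (n + 1) powr (- \<alpha>))"

definition exp_decay :: "(nat \<Rightarrow> real) \<Rightarrow> bool" where
  "exp_decay f \<longleftrightarrow> (\<exists>C \<theta>. 0 < \<theta> \<and> \<theta> < 1 \<and> (\<forall>n. \<bar>f n\<bar> \<le> C * \<theta> ^ n))"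

lemma poly_decayE:
  assumes "poly_decay \<alpha> f"
  obtains C where "C > 0" "\<And>n. \<bar>f n\<bar> \<le> C * real (n + 1) powr (- \<alpha>)"
proof -
  obtain C where C: "\<And>n. \<bar>f n\<bar> \<le> C * real (n + 1) powr (- \<alpha>)"
    using assms unfolding poly_decay_def by blast
  have "\<bar>f n\<bar> \<le> (\<bar>C\<bar> + 1) * real (n + 1) powr (- \<alpha>)" for n
    by (rule order_trans[OF C]) (intro mult_right_mono, auto)
  then show ?thesis using that[of "\<bar>C\<bar> + 1"] by auto
qed

lemma exp_decayE:
  assumes "exp_decay f"
  obtains C \<theta> where "C > 0" "0 < \<theta>" "\<theta> < 1" "\<And>n. \<bar>f n\<bar> \<le> C * \<theta> ^ n"
proof -
  obtain C \<theta> where C: "\<And>n. \<bar>f n\<bar> \<le> C * \<theta> ^ n" "0 < \<theta>" "\<theta> < 1"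
    using assms unfolding exp_decay_def by blast
  have "\<bar>f n\<bar> \<le> (\<bar>C\<bar> + 1) * \<theta> ^ n" for n
    using C(2) by (intro order_trans[OF C(1)] mult_right_mono) auto
  then show ?thesis using that[of "\<bar>C\<bar> + 1" \<theta>] C by auto
qed

lemma poly_decay_mono: "poly_decay \<alpha> g \<Longrightarrow> (\<And>n. \<bar>f n\<bar> \<le> \<bar>g n\<bar>) \<Longrightarrow> poly_decay \<alpha> f"
  unfolding poly_decay_def by (meson order_trans)

lemma exp_decay_mono: "exp_decay g \<Longrightarrow> (\<And>n. \<bar>f n\<bar> \<le> \<bar>g n\<bar>) \<Longrightarrow> exp_decay f"
  unfolding exp_decay_def by (meson order_trans)

lemma poly_decay_add: assumes "poly_decay \<alpha> f" "poly_decay \<alpha> g" shows "poly_decay \<alpha> (\<lambda>n. f n + g n)"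
proof -
  obtain C1 where C1: "\<And>n. \<bar>f n\<bar> \<le> C1 * real (n + 1) powr (- \<alpha>)" using assms(1) by (auto simp: poly_decay_def)
  obtain C2 where C2: "\<And>n. \<bar>g n\<bar> \<le> C2 * real (n + 1) powr (- \<alpha>)" using assms(2) by (auto simp: poly_decay_def)
  have "\<bar>f n + g n\<bar> \<le> (C1 + C2) * real (n + 1) powr (- \<alpha>)" for n
    using abs_triangle_ineq[of "f n" "g n"] C1[of n] C2[of n] by (simp add: ring_distribs del: of_nat_add)
  then show ?thesis by (auto simp: poly_decay_def)
qed

lemma poly_decay_cmult: assumes "poly_decay \<alpha> f" shows "poly_decay \<alpha> (\<lambda>n. c * f n)"
proof -
  obtain C1 where C1: "\<And>n. \<bar>f n\<bar> \<le> C1 * real (n + 1) powr (- \<alpha>)" using assms(1) by (auto simp: poly_decay_def)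
  have "\<bar>c * f n\<bar> \<le> (\<bar>c\<bar> * C1) * real (n + 1) powr (- \<alpha>)" for n
    using mult_left_mono[OF C1, of "\<bar>c\<bar>"] by (simp add: abs_mult mult.assoc del: of_nat_add)
  then show ?thesis unfolding poly_decay_def by blast
qed

lemma exp_decay_add: assumes "exp_decay f" "exp_decay g" shows "exp_decay (\<lambda>n. f n + g n)"
proof -
  obtain C1 \<theta>1 where C1: "C1 > 0" "0 < \<theta>1" "\<theta>1 < 1" "\<And>n. \<bar>f n\<bar> \<le> C1 * \<theta>1 ^ n" using exp_decayE[OF assms(1)] by blast
  obtain C2 \<theta>2 where C2: "C2 > 0" "0 < \<theta>2" "\<theta>2 < 1" "\<And>n. \<bar>g n\<bar> \<le> C2 * \<theta>2 ^ n" using exp_decayE[OF assms(2)] by blast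
  have "\<bar>f n + g n\<bar> \<le> (C1 + C2) * (max \<theta>1 \<theta>2) ^ n" for n
  proof -
    have "C1 * \<theta>1 ^ n \<le> C1 * (max \<theta>1 \<theta>2) ^ n" "C2 * \<theta>2 ^ n \<le> C2 * (max \<theta>1 \<theta>2) ^ n"
      using C1 C2 by (auto intro!: mult_left_mono power_mono)
    then show ?thesis using abs_triangle_ineq[of "f n" "g n"] C1(4)[of n] C2(4)[of n] by (simp add: ring_distribs)
  qed
  moreover have "0 < max \<theta>1 \<theta>2" "max \<theta>1 \<theta>2 < 1" using C1 C2 by auto
  ultimately show ?thesis unfolding exp_decay_def by blast
qed

lemma exp_decay_cmult: assumes "exp_decay f" shows "exp_decay (\<lambda>n. c * f n)"
proof -
  obtain C1 \<theta>1 where C1: "C1 > 0" "0 < \<theta>1" "\<theta>1 < 1" "\<And>n. \<bar>f n\<bar> \<le> C1 * \<theta>1 ^ n" using exp_decayE[OF assms(1)] by blast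
  have "\<bar>c * f n\<bar> \<le> (\<bar>c\<bar> * C1) * \<theta>1 ^ n" for n
    using mult_left_mono[OF C1(4), of "\<bar>c\<bar>"] by (simp add: abs_mult mult.assoc)
  then show ?thesis unfolding exp_decay_def using C1 by blast
qed

lemma summable_Suc_powr: "\<alpha> > 1 \<Longrightarrow> summable (\<lambda>n. real (n + 1) powr (- \<alpha>))"
  using summable_iff_shift[of "\<lambda>n. real n powr (- \<alpha>)" 1] summable_real_powr_iff[of "- \<alpha>"] by simp

lemma poly_decay_summable:
  assumes "\<alpha> > 1" "poly_decay \<alpha> f" shows "summable (\<lambda>n. \<bar>f n\<bar>)"
proof -
  obtain C where C: "\<And>n. \<bar>f n\<bar> \<le> C * real (n + 1) powr (- \<alpha>)" using assms(2) by (auto simp: poly_decay_def)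
  show ?thesis
    by (rule summable_comparison_test'[OF summable_mult[OF summable_Suc_powr[OF assms(1)]], where N = 0])
       (use C in auto)
qed

text \<open>
  One of \<open>i\<close> and \<open>n - i\<close> is at least \<open>n / 2\<close>, and the other factor is summable.
\<close>

lemma poly_decay_convolution:
  assumes \<alpha>: "\<alpha> > 1" and f: "poly_decay \<alpha> f" and g: "poly_decay \<alpha> g"
  shows "poly_decay \<alpha> (\<lambda>n. \<Sum>i\<le>n. \<bar>f i\<bar> * \<bar>g (n - i)\<bar>)"
proof -
  obtain C where C: "C > 0" "\<And>n. \<bar>f n\<bar> \<le> C * real (n + 1) powr (- \<alpha>)" using poly_decayE[OF f] by blast
  obtain K where K: "K > 0" "\<And>n. \<bar>g n\<bar> \<le> K * real (n + 1) powr (- \<alpha>)" using poly_decayE[OF g] by blast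
  have sf: "summable (\<lambda>n. \<bar>f n\<bar>)" and sg: "summable (\<lambda>n. \<bar>g n\<bar>)"
    using poly_decay_summable \<alpha> f g by auto
  define B where "B = C * 2 powr \<alpha> * (\<Sum>n. \<bar>g n\<bar>) + K * 2 powr \<alpha> * (\<Sum>n. \<bar>f n\<bar>)"
  have "(\<Sum>i\<le>n. \<bar>f i\<bar> * \<bar>g (n - i)\<bar>) \<le> B * real (n + 1) powr (- \<alpha>)" for n
  proof -
    let ?p = "real (n + 1) powr (- \<alpha>)"
    have half: "real (m + 1) powr (- \<alpha>) \<le> 2 powr \<alpha> * ?p" if "n + 1 \<le> 2 * (m + 1)" for m
    proof -
      have "real (m + 1) powr (- \<alpha>) \<le> (real (n + 1) / 2) powr (- \<alpha>)"
        using that \<alpha> by (intro powr_mono2') auto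
      also have "\<dots> = 2 powr \<alpha> * ?p"
        by (simp add: powr_divide powr_minus field_simps del: of_nat_add)
      finally show ?thesis .
    qed
    have "(\<Sum>i\<le>n. \<bar>f i\<bar> * \<bar>g (n - i)\<bar>)
       \<le> (\<Sum>i\<le>n. C * (2 powr \<alpha> * ?p) * \<bar>g (n - i)\<bar> + K * (2 powr \<alpha> * ?p) * \<bar>f i\<bar>)"
    proof (intro sum_mono)
      fix i assume i: "i \<in> {..n}"
      show "\<bar>f i\<bar> * \<bar>g (n - i)\<bar> \<le> C * (2 powr \<alpha> * ?p) * \<bar>g (n - i)\<bar> + K * (2 powr \<alpha> * ?p) * \<bar>f i\<bar>"
      proof (cases "n + 1 \<le> 2 * (i + 1)")
        case True
        have "\<bar>f i\<bar> * \<bar>g (n - i)\<bar> \<le> C * (2 powr \<alpha> * ?p) * \<bar>g (n - i)\<bar>"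
          by (intro mult_right_mono order_trans[OF C(2)] mult_left_mono half[OF True]) (use C in auto)
        moreover have "0 \<le> K * (2 powr \<alpha> * ?p) * \<bar>f i\<bar>" using K by simp
        ultimately show ?thesis by simp
      next
        case False
        then have *: "n + 1 \<le> 2 * (n - i + 1)" using i by auto
        have "\<bar>g (n - i)\<bar> * \<bar>f i\<bar> \<le> K * (2 powr \<alpha> * ?p) * \<bar>f i\<bar>"
          by (intro mult_right_mono order_trans[OF K(2)] mult_left_mono half[OF *]) (use K in auto)
        moreover have "0 \<le> C * (2 powr \<alpha> * ?p) * \<bar>g (n - i)\<bar>" using C by simp
        ultimately show ?thesis by (simp add: mult.commute)
      qed
    qed
    also have "\<dots> = C * (2 powr \<alpha> * ?p) * (\<Sum>i\<le>n. \<bar>g (n - i)\<bar>) + K * (2 powr \<alpha> * ?p) * (\<Sum>i\<le>n. \<bar>f i\<bar>)"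
      by (simp only: sum.distrib sum_distrib_left)
    also have "(\<Sum>i\<le>n. \<bar>g (n - i)\<bar>) = (\<Sum>i\<le>n. \<bar>g i\<bar>)"
      by (rule sum.nat_diff_reindex[of "\<lambda>i. \<bar>g i\<bar>" "Suc n", unfolded lessThan_Suc_atMost, simplified])
    also have "C * (2 powr \<alpha> * ?p) * (\<Sum>i\<le>n. \<bar>g i\<bar>) + K * (2 powr \<alpha> * ?p) * (\<Sum>i\<le>n. \<bar>f i\<bar>)
      \<le> C * (2 powr \<alpha> * ?p) * (\<Sum>i. \<bar>g i\<bar>) + K * (2 powr \<alpha> * ?p) * (\<Sum>i. \<bar>f i\<bar>)"
      using C K by (intro add_mono mult_left_mono sum_le_suminf sf sg) auto
    also have "\<dots> = B * ?p" by (simp add: B_def algebra_simps)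
    finally show ?thesis .
  qed
  then show ?thesis unfolding poly_decay_def by (intro exI[of _ B]) (simp add: sum_nonneg)
qed

lemma exp_decay_convolution:
  assumes f: "exp_decay f" and g: "exp_decay g"
  shows "exp_decay (\<lambda>n. \<Sum>i\<le>n. \<bar>f i\<bar> * \<bar>g (n - i)\<bar>)"
proof -
  obtain C x where C: "C > 0" "0 < x" "x < 1" "\<And>n. \<bar>f n\<bar> \<le> C * x ^ n" using exp_decayE[OF f] by blast
  obtain K y where K: "K > 0" "0 < y" "y < 1" "\<And>n. \<bar>g n\<bar> \<le> K * y ^ n" using exp_decayE[OF g] by blast
  define z where "z = (1 + max x y) / 2"
  have z: "x < z" "y < z" "0 < z" "z < 1" using C K by (auto simp: z_def)
  have "(\<Sum>i\<le>n. \<bar>f i\<bar> * \<bar>g (n - i)\<bar>) \<le> (C * K * (1 / (1 - x / z))) * z ^ n" for n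
  proof -
    have "(\<Sum>i\<le>n. \<bar>f i\<bar> * \<bar>g (n - i)\<bar>) \<le> (\<Sum>i\<le>n. (C * x ^ i) * (K * z ^ (n - i)))"
    proof (intro sum_mono mult_mono)
      fix i
      have "y ^ (n - i) \<le> z ^ (n - i)" using z K by (intro power_mono) auto
      then show "\<bar>g (n - i)\<bar> \<le> K * z ^ (n - i)"
        using K by (intro order_trans[OF K(4)] mult_left_mono) auto
    qed (use C in auto)
    also have "\<dots> = (\<Sum>i\<le>n. C * K * z ^ n * (x / z) ^ i)"
      using z by (intro sum.cong refl) (simp add: power_diff power_divide field_simps)
    also have "\<dots> = C * K * z ^ n * (\<Sum>i\<le>n. (x / z) ^ i)" by (simp add: sum_distrib_left)
    also have "\<dots> \<le> C * K * z ^ n * (\<Sum>i. (x / z) ^ i)"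
      using z C K by (intro mult_left_mono sum_le_suminf summable_geometric) auto
    also have "(\<Sum>i. (x / z) ^ i) = 1 / (1 - x / z)"
      using z C by (intro suminf_geometric) auto
    finally show ?thesis by (simp add: mult_ac)
  qed
  then show ?thesis unfolding exp_decay_def
    by (intro exI[of _ "C * K * (1 / (1 - x / z))"] exI[of _ z]) (use z in \<open>simp add: sum_nonneg\<close>)
qed

text \<open>
  A polynomially decaying sequence changes by a factor close to 1 between \<open>(1 - \<eta>) n\<close> and \<open>n\<close>. So
  the contraction factor \<open>q\<close> beats this loss as soon as \<open>\<eta>\<close> is small, and the exponent of the
  forcing term is kept without any loss.
\<close>

lemma window_bootstrap:
  fixes a :: "nat \<Rightarrow> real"
  assumes q: "0 < q" "q < 1" and \<alpha>: "\<alpha> > 0" and nn: "\<And>n. 0 \<le> a n"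
    and H: "\<And>\<eta>. 0 < \<eta> \<Longrightarrow> \<eta> < 1 \<Longrightarrow> \<exists>C. \<forall>n. \<exists>m\<le>n. (1 - \<eta>) * real (n + 1) \<le> real (m + 1) \<and>
        a n \<le> q * a m + C * real (n + 1) powr (- \<alpha>)"
  shows "poly_decay \<alpha> a"
proof -
  define q' where "q' = (1 + q) / 2"
  have q': "q < q'" "q' < 1" "0 < q'" using q by (auto simp: q'_def)
  define x where "x = (q / q') powr (1 / \<alpha>)"
  have x: "0 < x" "x < 1"
  proof -
    show "0 < x" using q q' by (simp add: x_def)
    have "(q / q') powr (1 / \<alpha>) < 1 powr (1 / \<alpha>)"
      using q q' \<alpha> by (intro powr_less_mono2) auto
    then show "x < 1" by (simp add: x_def)
  qed
  have xa: "q * x powr (- \<alpha>) = q'"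
    using q q' \<alpha> by (simp add: x_def powr_powr powr_minus divide_simps)
  obtain C where C: "\<And>n. \<exists>m\<le>n. x * real (n + 1) \<le> real (m + 1) \<and>
        a n \<le> q * a m + C * real (n + 1) powr (- \<alpha>)"
    using H[of "1 - x"] x by auto
  define K where "K = \<bar>C\<bar> / (1 - q')"
  have K: "K \<ge> 0" "\<bar>C\<bar> = K * (1 - q')" using q' by (auto simp: K_def)
  have "a n \<le> K * real (n + 1) powr (- \<alpha>)" for n
  proof (induction n rule: less_induct)
    case (less n)
    let ?p = "real (n + 1) powr (- \<alpha>)"
    obtain m where m: "m \<le> n" "x * real (n + 1) \<le> real (m + 1)" "a n \<le> q * a m + C * ?p"
      using C by blast
    have Cp: "C * ?p \<le> K * (1 - q') * ?p"
      using K(2) by (intro mult_right_mono) auto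
    show ?case
    proof (cases "m = n")
      case True
      then have "(1 - q) * a n \<le> K * (1 - q') * ?p" using m(3) Cp by (simp add: algebra_simps)
      also have "\<dots> \<le> K * (1 - q) * ?p" using K q' by (intro mult_right_mono mult_left_mono) auto
      finally have "(1 - q) * a n \<le> (1 - q) * (K * ?p)" by (simp add: mult_ac)
      then show ?thesis using q by simp
    next
      case False
      then have "a m \<le> K * real (m + 1) powr (- \<alpha>)" using m less.IH by simp
      also have "\<dots> \<le> K * (x * real (n + 1)) powr (- \<alpha>)"
        using m x \<alpha> K by (intro mult_left_mono powr_mono2') auto
      also have "\<dots> = K * x powr (- \<alpha>) * ?p" by (subst powr_mult) (use x in auto)
      finally have "q * a m \<le> q * (K * x powr (- \<alpha>) * ?p)" using q by (intro mult_left_mono) auto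
      also have "\<dots> = K * q' * ?p" by (simp only: xa[symmetric]) simp
      finally show ?thesis using m(3) Cp by (simp add: algebra_simps)
    qed
  qed
  then show ?thesis unfolding poly_decay_def using nn by (intro exI[of _ K]) simp
qed

text \<open>
  This is the identity \<open>1 / (1 - \<sigma>) = 1 + \<sigma> / (1 - \<sigma>)\<close>.
\<close>

lemma Neumann_recursion:
  fixes \<sigma> :: "complex fps"
  assumes "l1_bounded \<sigma> (1 / 2)"
  shows "norm (fps_nth (inverse (1 - \<sigma>)) n)
     \<le> (if n = 0 then 1 else 0) + (\<Sum>i\<le>n. norm (fps_nth \<sigma> i) * norm (fps_nth (inverse (1 - \<sigma>)) (n - i)))"
proof -
  have "norm (fps_nth \<sigma> 0) \<le> 1 / 2" using assms[unfolded l1_bounded_def, rule_format, of 0] by simp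
  then have "fps_nth (1 - \<sigma>) 0 \<noteq> 0" by (auto simp: fps_one_nth)
  then have "(1 - \<sigma>) * inverse (1 - \<sigma>) = 1" by (rule inverse_mult_eq_1')
  then have "inverse (1 - \<sigma>) = 1 + \<sigma> * inverse (1 - \<sigma>)" by (simp add: algebra_simps)
  then have "norm (fps_nth (inverse (1 - \<sigma>)) n) = norm (fps_nth 1 n + fps_nth (\<sigma> * inverse (1 - \<sigma>)) n)"
    by (metis fps_add_nth)
  also have "\<dots> \<le> norm (fps_nth (1::complex fps) n) + norm (fps_nth (\<sigma> * inverse (1 - \<sigma>)) n)"
    by (rule norm_triangle_ineq)
  also have "\<dots> \<le> (if n = 0 then 1 else 0) + (\<Sum>i\<le>n. norm (fps_nth \<sigma> i) * norm (fps_nth (inverse (1 - \<sigma>)) (n - i)))"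
    by (intro add_mono norm_fps_mult_nth_le) auto
  finally show ?thesis .
qed

lemma Neumann_weighted:
  fixes \<sigma> :: "complex fps"
  assumes l1: "l1_bounded \<sigma> (1 / 2)" and x: "x \<ge> 1" and q: "q < 1"
    and w: "\<And>N. (\<Sum>n\<le>N. norm (fps_nth \<sigma> n) * x ^ n) \<le> q"
  shows "(\<Sum>n\<le>N. norm (fps_nth (inverse (1 - \<sigma>)) n) * x ^ n) \<le> 1 / (1 - q)"
proof -
  define y where "y n = norm (fps_nth (inverse (1 - \<sigma>)) n) * x ^ n" for n
  define s where "s n = norm (fps_nth \<sigma> n) * x ^ n" for n
  have x0: "x > 0" using x by simp
  have "y n \<le> (if n = 0 then 1 else 0) + (\<Sum>i\<le>n. s i * y (n - i))" for n
  proof -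
    have "y n \<le> ((if n = 0 then 1 else 0) + (\<Sum>i\<le>n. norm (fps_nth \<sigma> i) * norm (fps_nth (inverse (1 - \<sigma>)) (n - i)))) * x ^ n"
      unfolding y_def using x by (intro mult_right_mono Neumann_recursion l1) auto
    also have "\<dots> = (if n = 0 then 1 else 0) + (\<Sum>i\<le>n. s i * y (n - i))"
      unfolding ring_distribs sum_distrib_right s_def y_def
      by (intro arg_cong2[where f = "(+)"] sum.cong refl) (use x0 in \<open>auto simp: power_diff\<close>)
    finally show ?thesis .
  qed
  then have "(\<Sum>n\<le>N. y n) \<le> (\<Sum>n\<le>N. (if n = 0 then 1 else 0) + (\<Sum>i\<le>n. s i * y (n - i)))"
    by (rule sum_mono)
  also have "\<dots> = 1 + (\<Sum>n\<le>N. \<Sum>i\<le>n. s i * y (n - i))"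
    by (simp add: sum.distrib sum.delta)
  also have "\<dots> \<le> 1 + (\<Sum>n\<le>N. s n) * (\<Sum>n\<le>N. y n)"
    using x by (intro add_left_mono triangle_sum_le) (auto simp: s_def y_def)
  also have "\<dots> \<le> 1 + q * (\<Sum>n\<le>N. y n)"
    using w x by (intro add_left_mono mult_right_mono) (auto simp: s_def y_def intro!: sum_nonneg)
  finally show ?thesis using q unfolding y_def by (simp add: field_simps)
qed

lemma Neumann_l1:
  fixes \<sigma> :: "complex fps"
  assumes "l1_bounded \<sigma> (1 / 2)"
  shows "l1_bounded (inverse (1 - \<sigma>)) 2"
  using Neumann_weighted[OF assms, of 1 "1/2"] assms by (simp add: l1_bounded_def)

text \<open>
  In the recursion the terms in which \<open>\<sigma>\<close> has a small index contract, because the norm of \<open>\<sigma>\<close> is at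
  most \<open>1 / 2\<close>, and those with a large index decay like \<open>\<sigma>\<close> itself. This is the situation of
  \<open>window_bootstrap\<close>.
\<close>

lemma Neumann_poly_decay:
  fixes \<sigma> :: "complex fps"
  assumes \<alpha>: "\<alpha> > 1" and s: "poly_decay \<alpha> (\<lambda>n. norm (fps_nth \<sigma> n))" and l1: "l1_bounded \<sigma> (1 / 2)"
  shows "poly_decay \<alpha> (\<lambda>n. norm (fps_nth (inverse (1 - \<sigma>)) n))"
proof (rule window_bootstrap[of "1/2"])
  define y where "y n = norm (fps_nth (inverse (1 - \<sigma>)) n)" for n
  obtain C where C: "C > 0" "\<And>n. norm (fps_nth \<sigma> n) \<le> C * real (n + 1) powr (- \<alpha>)"
    using poly_decayE[OF s] by auto
  fix \<eta> :: real assume eta: "0 < \<eta>" "\<eta> < 1"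
  define K where "K = C * \<eta> powr (- \<alpha>) * 2 + 1"
  have "\<exists>m\<le>n. (1 - \<eta>) * real (n + 1) \<le> real (m + 1) \<and> y n \<le> 1/2 * y m + K * real (n + 1) powr (- \<alpha>)" for n
  proof (cases "n = 0")
    case True
    have "y 0 \<le> 1 + norm (fps_nth \<sigma> 0) * y 0"
      using Neumann_recursion[OF l1, of 0] by (simp add: y_def)
    also have "\<dots> \<le> 1 + 1 / 2 * y 0"
      using l1[unfolded l1_bounded_def, rule_format, of 0] by (intro add_left_mono mult_right_mono) (auto simp: y_def)
    finally have "y 0 \<le> 1 + 1 / 2 * y 0" .
    moreover have "1 \<le> K" using C by (simp add: K_def)
    ultimately show ?thesis using True eta by (intro exI[of _ 0]) simp
  next
    case False
    let ?p = "real (n + 1) powr (- \<alpha>)"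
    define W where "W = {m. m \<le> n \<and> (1 - \<eta>) * real (n + 1) \<le> real (m + 1)}"
    have fW: "finite W" by (simp add: W_def)
    have nW: "n \<in> W" using eta by (simp add: W_def mult_left_le_one_le)
    obtain m where m: "m \<in> W" "\<And>k. k \<in> W \<Longrightarrow> y k \<le> y m"
      using fW nW obtains_MAX[of W y] by (metis Max_ge empty_iff finite_imageI imageI)
    have "y n \<le> (\<Sum>i\<le>n. norm (fps_nth \<sigma> i) * y (n - i))"
      using Neumann_recursion[OF l1, of n] False by (simp add: y_def)
    also have "\<dots> \<le> (\<Sum>i\<le>n. norm (fps_nth \<sigma> i) * y m + C * \<eta> powr (- \<alpha>) * ?p * y (n - i))"
    proof (intro sum_mono)
      fix i assume i: "i \<in> {..n}"
      show "norm (fps_nth \<sigma> i) * y (n - i) \<le> norm (fps_nth \<sigma> i) * y m + C * \<eta> powr (- \<alpha>) * ?p * y (n - i)"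
      proof (cases "n - i \<in> W")
        case True
        have "norm (fps_nth \<sigma> i) * y (n - i) \<le> norm (fps_nth \<sigma> i) * y m"
          by (intro mult_left_mono m True) auto
        moreover have "0 \<le> C * \<eta> powr (- \<alpha>) * ?p * y (n - i)" using C by (simp add: y_def)
        ultimately show ?thesis by simp
      next
        case False
        then have "real (n - i + 1) < (1 - \<eta>) * real (n + 1)" by (simp add: W_def)
        then have "\<eta> * real (n + 1) \<le> real (i + 1)" using i by (simp add: of_nat_diff algebra_simps)
        then have "real (i + 1) powr (- \<alpha>) \<le> (\<eta> * real (n + 1)) powr (- \<alpha>)"
          using eta \<alpha> by (intro powr_mono2') auto
        also have "\<dots> = \<eta> powr (- \<alpha>) * ?p" using eta by (simp add: powr_mult)
        finally have "norm (fps_nth \<sigma> i) \<le> C * (\<eta> powr (- \<alpha>) * ?p)"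
          using C by (intro order_trans[OF C(2)] mult_left_mono) auto
        then have "norm (fps_nth \<sigma> i) * y (n - i) \<le> C * \<eta> powr (- \<alpha>) * ?p * y (n - i)"
          by (intro mult_right_mono) (auto simp: y_def mult.assoc)
        moreover have "0 \<le> norm (fps_nth \<sigma> i) * y m" by (simp add: y_def)
        ultimately show ?thesis by simp
      qed
    qed
    also have "\<dots> = (\<Sum>i\<le>n. norm (fps_nth \<sigma> i)) * y m + C * \<eta> powr (- \<alpha>) * ?p * (\<Sum>i\<le>n. y (n - i))"
      by (simp only: sum.distrib sum_distrib_left sum_distrib_right)
    also have "(\<Sum>i\<le>n. y (n - i)) = (\<Sum>i\<le>n. y i)"
      by (rule sum.nat_diff_reindex[of y "Suc n", unfolded lessThan_Suc_atMost, simplified])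
    also have "(\<Sum>i\<le>n. norm (fps_nth \<sigma> i)) * y m + C * \<eta> powr (- \<alpha>) * ?p * (\<Sum>i\<le>n. y i)
        \<le> 1/2 * y m + C * \<eta> powr (- \<alpha>) * ?p * 2"
      using l1 Neumann_l1[OF l1] C unfolding l1_bounded_def y_def
      by (intro add_mono mult_right_mono mult_left_mono) auto
    also have "\<dots> \<le> 1/2 * y m + K * ?p" by (simp add: K_def algebra_simps)
    finally show ?thesis using m(1) by (intro exI[of _ m]) (auto simp: W_def)
  qed
  then show "\<exists>C. \<forall>n. \<exists>m\<le>n. (1 - \<eta>) * real (n + 1) \<le> real (m + 1) \<and>
       norm (fps_nth (inverse (1 - \<sigma>)) n) \<le> 1/2 * norm (fps_nth (inverse (1 - \<sigma>)) m) + C * real (n + 1) powr (- \<alpha>)"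
    unfolding y_def by blast
qed (use \<alpha> in auto)

text \<open>
  For some \<open>x > 1\<close> the norm of \<open>\<sigma>\<close> with the weights \<open>x ^ n\<close> is still less than 1.
\<close>

lemma Neumann_exp_decay:
  fixes \<sigma> :: "complex fps"
  assumes s: "exp_decay (\<lambda>n. norm (fps_nth \<sigma> n))" and l1: "l1_bounded \<sigma> (1 / 2)"
  shows "exp_decay (\<lambda>n. norm (fps_nth (inverse (1 - \<sigma>)) n))"
proof -
  obtain C \<theta> where C: "C > 0" "0 < \<theta>" "\<theta> < 1" "\<And>n. norm (fps_nth \<sigma> n) \<le> C * \<theta> ^ n"
    using exp_decayE[OF s] by auto
  define K where "K = (1 + 1 / \<theta>) / 2"
  have K: "1 < K" "K * \<theta> < 1" using C by (auto simp: K_def field_simps)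
  have sm: "summable (\<lambda>n. norm (fps_nth \<sigma> n) * K ^ n)"
  proof (rule summable_comparison_test'[where N = 0])
    show "summable (\<lambda>n. C * (K * \<theta>) ^ n)" using K C by (intro summable_mult summable_geometric) auto
    show "norm (norm (fps_nth \<sigma> n) * K ^ n) \<le> C * (K * \<theta>) ^ n" for n
      using mult_right_mono[OF C(4)[of n], of "K ^ n"] K by (simp add: power_mult_distrib mult_ac abs_mult)
  qed
  define F where "F x = (\<Sum>n. norm (fps_nth \<sigma> n) * x ^ n)" for x :: real
  have "isCont F 1" unfolding F_def using K by (intro isCont_powser[OF sm]) auto
  moreover have "F 1 \<le> 1 / 2" unfolding F_def using l1_bounded_summable(2)[OF l1] by simp
  ultimately have "eventually (\<lambda>x. F x < 3/4) (at 1)"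
    unfolding isCont_def by (intro order_tendstoD(2)) auto
  then obtain e where e: "e > 0" "\<And>x. x \<noteq> 1 \<Longrightarrow> dist x 1 < e \<Longrightarrow> F x < 3/4"
    unfolding eventually_at by auto
  define x where "x = min (1 + e / 2) K"
  have x: "1 < x" "x \<le> K" "dist x 1 < e" using e K by (auto simp: x_def dist_real_def)
  have Fx: "F x < 3/4" using e(2)[of x] x by auto
  have smx: "summable (\<lambda>n. norm (fps_nth \<sigma> n) * x ^ n)"
    by (rule summable_comparison_test'[OF sm, where N = 0]) (use x in \<open>auto intro!: mult_left_mono power_mono\<close>)
  have "(\<Sum>n\<le>N. norm (fps_nth \<sigma> n) * x ^ n) \<le> 3/4" for N
  proof -
    have "(\<Sum>n\<le>N. norm (fps_nth \<sigma> n) * x ^ n) \<le> F x"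
      unfolding F_def using x by (intro sum_le_suminf smx) auto
    with Fx show ?thesis by simp
  qed
  then have b: "(\<Sum>n\<le>N. norm (fps_nth (inverse (1 - \<sigma>)) n) * x ^ n) \<le> 4" for N
    using Neumann_weighted[OF l1, of x "3/4" N] x by simp
  have "norm (fps_nth (inverse (1 - \<sigma>)) n) \<le> 4 * (1 / x) ^ n" for n
  proof -
    have "norm (fps_nth (inverse (1 - \<sigma>)) n) * x ^ n \<le> (\<Sum>n\<le>n. norm (fps_nth (inverse (1 - \<sigma>)) n) * x ^ n)"
      using x by (intro member_le_sum) auto
    with b[of n] have "norm (fps_nth (inverse (1 - \<sigma>)) n) * x ^ n \<le> 4" by linarith
    then show ?thesis using x by (simp add: field_simps power_one_over)
  qed
  then show ?thesis unfolding exp_decay_def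
    by (intro exI[of _ 4] exI[of _ "1 / x"]) (use x in auto)
qed

text \<open>
  Comparison with a telescoping sum, where the mean value theorem replaces an integral.
\<close>

lemma poly_decay_tail_sum:
  assumes \<alpha>: "\<alpha> > 1" and f: "poly_decay \<alpha> f" and nn: "\<And>n. 0 \<le> f n"
  shows "poly_decay (\<alpha> - 1) (\<lambda>n. \<Sum>j. f (j + n))"
proof -
  have sm: "summable f" using poly_decay_summable[OF \<alpha> f] nn by simp
  obtain C where C: "C > 0" "\<And>n. \<bar>f n\<bar> \<le> C * real (n + 1) powr (- \<alpha>)"
    using poly_decayE[OF f] by blast
  have step: "f n \<le> C * real (n + 1) powr (-\<alpha>)" for n using C(2)[of n] by simp
  have diff: "C * real (Suc n + 1) powr (-\<alpha>) \<le> C / (\<alpha> - 1) * (real (n + 1) powr (1 - \<alpha>) - real (Suc n + 1) powr (1 - \<alpha>))" for n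
  proof -
    have "\<exists>z. real n + 1 < z \<and> z < real n + 2 \<and>
       (real n + 2) powr (1 - \<alpha>) - (real n + 1) powr (1 - \<alpha>) = (real n + 2 - (real n + 1)) * ((1 - \<alpha>) * z powr (1 - \<alpha> - 1))"
      by (intro MVT2) (auto intro!: derivative_eq_intros)
    then obtain z where z: "real n + 1 < z" "z < real n + 2"
       "(real n + 2) powr (1 - \<alpha>) - (real n + 1) powr (1 - \<alpha>) = (1 - \<alpha>) * z powr (- \<alpha>)" by auto
    have "(real n + 2) powr (- \<alpha>) \<le> z powr (- \<alpha>)" using z \<alpha> by (intro powr_mono2') auto
    then have "(\<alpha> - 1) * (real n + 2) powr (- \<alpha>) \<le> (\<alpha> - 1) * z powr (- \<alpha>)" using \<alpha> by (intro mult_left_mono) auto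
    also have "\<dots> = (real n + 1) powr (1 - \<alpha>) - (real n + 2) powr (1 - \<alpha>)" using z(3) by (simp add: algebra_simps)
    finally have "C * ((\<alpha> - 1) * (real n + 2) powr (- \<alpha>)) \<le> C * ((real n + 1) powr (1 - \<alpha>) - (real n + 2) powr (1 - \<alpha>))"
      using C by (intro mult_left_mono) auto
    then show ?thesis using \<alpha> by (simp add: field_simps add.commute add.left_commute)
  qed
  have "(\<Sum>j. f (j + n)) \<le> (C + C / (\<alpha> - 1)) * real (n + 1) powr (1 - \<alpha>)" for n
  proof -
    let ?f = "\<lambda>j. C / (\<alpha> - 1) * real (j + n + 1) powr (1 - \<alpha>)"
    have lim: "?f \<longlonglongrightarrow> 0" using \<alpha> C by real_asymp
    have tel: "(\<lambda>j. ?f j - ?f (Suc j)) sums (?f 0 - 0)" by (rule telescope_sums'[OF lim])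
    have "(\<Sum>j. f (j + n)) = f n + (\<Sum>j. f (Suc j + n))"
      using suminf_split_head[of "\<lambda>j. f (j + n)"] summable_ignore_initial_segment[OF sm, of n] by simp
    also have "(\<Sum>j. f (Suc j + n)) \<le> (\<Sum>j. ?f j - ?f (Suc j))"
    proof (rule suminf_le)
      show "f (Suc j + n) \<le> ?f j - ?f (Suc j)" for j
      proof -
        have "f (Suc j + n) \<le> C * real (Suc (j + n) + 1) powr (-\<alpha>)" using step[of "Suc j + n"] by simp
        also have "\<dots> \<le> C / (\<alpha> - 1) * (real (j + n + 1) powr (1 - \<alpha>) - real (Suc (j + n) + 1) powr (1 - \<alpha>))"
          by (rule diff)
        finally show ?thesis by (simp add: right_diff_distrib)
      qed
      show "summable (\<lambda>j. f (Suc j + n))"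
        using summable_ignore_initial_segment[OF sm, of "Suc n"] by simp
      show "summable (\<lambda>j. ?f j - ?f (Suc j))" using tel by (rule sums_summable)
    qed
    also have "(\<Sum>j. ?f j - ?f (Suc j)) = ?f 0" using tel by (simp add: sums_iff)
    also have "f n \<le> C * real (n + 1) powr (1 - \<alpha>)"
    proof -
      have "real (n + 1) powr (- \<alpha>) \<le> real (n + 1) powr (1 - \<alpha>)" by (intro powr_mono) auto
      then show ?thesis using C by (intro order_trans[OF step] mult_left_mono) auto
    qed
    finally show ?thesis by (simp add: algebra_simps)
  qed
  moreover have "0 \<le> (\<Sum>j. f (j + n))" for n
    by (intro suminf_nonneg nn summable_ignore_initial_segment sm)
  ultimately have "\<bar>\<Sum>j. f (j + n)\<bar> \<le> (C + C / (\<alpha> - 1)) * real (n + 1) powr (- (\<alpha> - 1))" for n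
    by (simp only: abs_of_nonneg minus_diff_eq)
  then show ?thesis unfolding poly_decay_def by blast
qed

lemma filterlim_half: "filterlim (\<lambda>n::nat. n div 2) sequentially sequentially"
  unfolding filterlim_at_top
proof
  fix k :: nat
  show "\<forall>\<^sub>F n in sequentially. k \<le> n div 2"
    using eventually_ge_at_top[of "2 * k"] by eventually_elim simp
qed

section \<open>The renewal equation\<close>

text \<open>
  The exponents \<open>n\<close> with \<open>z ^ n = 1\<close> are the multiples of the order of \<open>z\<close>.
\<close>

lemma root_of_unity_gcd:
  fixes z :: complex
  assumes g: "Gcd S = (1::nat)" and z: "\<And>n. n \<in> S \<Longrightarrow> z ^ n = 1"
  shows "z = 1"
proof -
  have "\<exists>n\<in>S. n > 0"
  proof (rule ccontr)
    assume "\<not> (\<exists>n\<in>S. n > 0)"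
    then have "S \<subseteq> {0}" by auto
    then have "Gcd S = 0" by (metis Gcd_0_iff)
    with g show False by simp
  qed
  then obtain n0 where n0: "n0 \<in> S" "n0 > 0" by auto
  define d where "d = (LEAST n. n > 0 \<and> z ^ n = 1)"
  have d: "d > 0 \<and> z ^ d = 1"
    unfolding d_def by (rule LeastI[of _ n0]) (use n0 z in auto)
  have "d dvd n" if "n \<in> S" for n
  proof -
    have "z ^ (d * (n div d) + n mod d) = z ^ n" by (simp only: mult_div_mod_eq)
    then have "z ^ (n mod d) = 1"
      using z[OF that] d by (simp only: power_add power_mult) simp
    moreover have "n mod d < d" using d by simp
    ultimately have "n mod d = 0"
      unfolding d_def by (metis (mono_tags, lifting) bot_nat_0.not_eq_extremum not_less_Least)
    then show ?thesis by auto
  qed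
  then have "d dvd Gcd S" by (rule Gcd_greatest)
  then show ?thesis using g d by simp
qed

text \<open>
  Summation by parts. If \<open>zb\<close> is the tail of a probability distribution \<open>p\<close>, this reads
  \<open>p(z) = 1 - (1 - z) zb(z)\<close>.
\<close>

lemma one_minus_mult_tail_series:
  fixes zb :: "nat \<Rightarrow> real" and z :: complex
  assumes s: "summable zb" and nn: "\<And>n. 0 \<le> zb n" and z: "norm z \<le> 1"
  shows "(\<lambda>n. of_real (zb n - zb (Suc n)) * z ^ Suc n) sums
      (of_real (zb 0) - (1 - z) * (\<Sum>n. of_real (zb n) * z ^ n))"
proof -
  have sm: "summable (\<lambda>n. of_real (zb n) * z ^ n)"
    by (rule summable_comparison_test'[OF s, where N = 0])
       (use nn z in \<open>auto simp: norm_mult norm_power mult_left_le power_le_one\<close>)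
  define a where "a = (\<Sum>n. of_real (zb n) * z ^ n)"
  have 1: "(\<lambda>n. of_real (zb n) * z ^ n) sums a" unfolding a_def by (rule summable_sums[OF sm])
  have 2: "(\<lambda>n. of_real (zb (Suc n)) * z ^ Suc n) sums (a - of_real (zb 0))"
    using 1 sums_Suc_iff[of "\<lambda>n. of_real (zb n) * z ^ n" "a - of_real (zb 0)"] by simp
  have 3: "(\<lambda>n. z * (of_real (zb n) * z ^ n)) sums (z * a)" by (rule sums_mult[OF 1])
  from sums_diff[OF 3 2] show ?thesis
    unfolding a_def[symmetric] by (simp add: algebra_simps)
qed

text \<open>
  The point where aperiodicity enters. At a zero \<open>z\<close> the distribution with tail \<open>zb\<close> satisfies
  \<open>p(z) = 1\<close>, so equality holds in the triangle inequality and \<open>z ^ n = 1\<close> for all \<open>n\<close> of positive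
  probability. As their gcd is 1, \<open>z = 1\<close>; but at 1 the series is positive.
\<close>

lemma tail_series_nonzero:
  fixes zb :: "nat \<Rightarrow> real" and z :: complex
  assumes s: "summable zb" and nn: "\<And>n. 0 \<le> zb n" and dec: "\<And>n. zb (Suc n) \<le> zb n"
    and z0: "zb 0 = 1" and g: "Gcd {n. zb n < zb (n - 1)} = 1" and z: "norm z \<le> 1"
  shows "(\<Sum>n. of_real (zb n) * z ^ n) \<noteq> 0"
proof
  assume a0: "(\<Sum>n. of_real (zb n) * z ^ n) = 0"
  let ?p = "\<lambda>n. zb n - zb (Suc n)"
  have 1: "(\<lambda>n. of_real (?p n) * z ^ Suc n) sums 1"
    using one_minus_mult_tail_series[OF s nn z] a0 z0 by simp
  have 2: "?p sums 1"
    using telescope_sums'[OF summable_LIMSEQ_zero[OF s]] z0 by simp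
  have "(\<lambda>n. Re (of_real (?p n) * z ^ Suc n)) sums Re 1"
    by (rule sums_Re[OF 1])
  also have "(\<lambda>n. Re (of_real (?p n) * z ^ Suc n)) = (\<lambda>n. ?p n * Re (z ^ Suc n))"
    by (rule ext) (simp only: times_complex.sel Re_complex_of_real Im_complex_of_real mult_zero_left diff_zero)
  finally have 4: "(\<lambda>n. ?p n * Re (z ^ Suc n)) sums 1" by simp
  have 3: "(\<lambda>n. ?p n * (1 - Re (z ^ Suc n))) sums 0"
    using sums_diff[OF 2 4] unfolding right_diff_distrib mult_1_right diff_self .
  have Re_le: "Re (z ^ Suc n) \<le> 1" for n
    using complex_Re_le_cmod[of "z ^ Suc n"] power_le_one[OF norm_ge_zero z, of "Suc n"]
    by (simp only: norm_power)
  have "\<forall>n. ?p n * (1 - Re (z ^ Suc n)) = 0"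
  proof (rule iffD1[OF suminf_eq_zero_iff])
    show "summable (\<lambda>n. ?p n * (1 - Re (z ^ Suc n)))" using 3 by (rule sums_summable)
    show "(\<Sum>n. ?p n * (1 - Re (z ^ Suc n))) = 0" using 3 by (rule sums_unique[symmetric])
    show "0 \<le> ?p n * (1 - Re (z ^ Suc n))" for n using dec[of n] Re_le[of n] by (intro mult_nonneg_nonneg) (simp_all only: diff_ge_0_iff_ge)
  qed
  then have R: "?p n \<noteq> 0 \<Longrightarrow> Re (z ^ Suc n) = 1" for n by (metis eq_iff_diff_eq_0 mult_eq_0_iff)
  have "z = 1"
  proof (rule root_of_unity_gcd[OF g])
    fix n assume "n \<in> {n. zb n < zb (n - 1)}"
    then obtain m where m: "n = Suc m" "?p m \<noteq> 0" by (cases n) auto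
    then have re: "Re (z ^ n) = 1" using R by blast
    have "norm (z ^ n) \<le> 1" unfolding norm_power by (rule power_le_one[OF norm_ge_zero z])
    then have "(Re (z ^ n))\<^sup>2 + (Im (z ^ n))\<^sup>2 \<le> 1"
      unfolding cmod_def by simp
    then have "Im (z ^ n) = 0" unfolding re by simp
    with re show "z ^ n = 1" by (simp add: complex_eq_iff)
  qed
  with a0 have "(\<Sum>n. complex_of_real (zb n)) = 0" by simp
  then have "suminf zb = 0"
    using suminf_of_real[OF s, where 'a = complex] by (metis of_real_eq_0_iff)
  then have "zb 0 = 0" using suminf_eq_zero_iff[OF s nn] by simp
  with z0 show False by simp
qed

text \<open>
  The coefficients of the reciprocal of the power series with coefficients \<open>zb\<close>. If \<open>zb\<close> is the tail
  of a distribution, they are the increments of its renewal sequence.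
\<close>

definition renewal_inv :: "(nat \<Rightarrow> real) \<Rightarrow> nat \<Rightarrow> real" where
  "renewal_inv zb n = fps_nth (inverse (Abs_fps zb)) n"

lemma inverse_fps_of_real:
  assumes "zb 0 \<noteq> (0::real)"
  shows "fps_nth (inverse (Abs_fps (\<lambda>n. complex_of_real (zb n)))) n = of_real (renewal_inv zb n)"
proof -
  have "Abs_fps zb * inverse (Abs_fps zb) = 1" by (rule inverse_mult_eq_1') (use assms in simp)
  then have "(\<Sum>i=0..n. zb i * renewal_inv zb (n - i)) = (if n = 0 then 1 else 0)" for n
    unfolding renewal_inv_def by (simp add: fps_eq_iff fps_mult_nth fps_one_nth)
  then have "(\<Sum>i=0..n. complex_of_real (zb i) * of_real (renewal_inv zb (n - i))) = (if n = 0 then 1 else 0)" for n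
    by (simp only: of_real_mult[symmetric] of_real_sum[symmetric]) simp
  then have "Abs_fps (\<lambda>n. complex_of_real (zb n)) * Abs_fps (\<lambda>n. of_real (renewal_inv zb n)) = 1"
    by (simp add: fps_eq_iff fps_mult_nth fps_one_nth)
  from inverse_of_right[OF this] show ?thesis by simp
qed

text \<open>
  The sequence \<open>zb\<close> is the tail of an aperiodic distribution on the positive integers with finite
  mean. The distribution is \<open>p n = zb (n - 1) - zb n\<close>.
\<close>

locale renewal_tail =
  fixes zb :: "nat \<Rightarrow> real"
  assumes summable_zb: "summable zb" and zb_nonneg: "\<And>n. 0 \<le> zb n"
    and zb_dec: "\<And>n. zb (Suc n) \<le> zb n"
    and zb_0: "zb 0 = 1" and zb_gcd: "Gcd {n. zb n < zb (n - 1)} = 1"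
begin

abbreviation "dd \<equiv> renewal_inv zb"

lemma wiener_renewal:
  assumes "D (Abs_fps (\<lambda>n. complex_of_real (zb n)))"
    and "\<And>f g. D f \<Longrightarrow> D g \<Longrightarrow> D (f + g)"
    and "\<And>f g. D f \<Longrightarrow> D g \<Longrightarrow> D (f * g)"
    and "\<And>f C \<theta>. 0 < \<theta> \<Longrightarrow> \<theta> < 1 \<Longrightarrow> (\<And>n. norm (fps_nth f n) \<le> C * \<theta> ^ n) \<Longrightarrow> D f"
    and "\<And>\<sigma>. D \<sigma> \<Longrightarrow> l1_bounded \<sigma> (1 / 2) \<Longrightarrow> D (inverse (1 - \<sigma>))"
  shows "D (Abs_fps (\<lambda>n. complex_of_real (dd n)))"
proof -
  have "D (inverse (Abs_fps (\<lambda>n. complex_of_real (zb n))))"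
  proof (rule wiener_inverse[where D = D])
    show "summable (\<lambda>n. norm (fps_nth (Abs_fps (\<lambda>n. complex_of_real (zb n))) n))"
      using zb_nonneg summable_zb by simp
    show "(\<Sum>n. fps_nth (Abs_fps (\<lambda>n. complex_of_real (zb n))) n * z ^ n) \<noteq> 0" if "norm z \<le> 1" for z
      using tail_series_nonzero[OF summable_zb zb_nonneg zb_dec zb_0 zb_gcd that] by simp
  qed (fact assms)+
  also have "inverse (Abs_fps (\<lambda>n. complex_of_real (zb n))) = Abs_fps (\<lambda>n. complex_of_real (dd n))"
    using inverse_fps_of_real[of zb] zb_0 by (simp add: fps_eq_iff)
  finally show ?thesis .
qed

lemma dd_summable: "summable (\<lambda>n. \<bar>dd n\<bar>)"
proof -
  have "\<exists>B. l1_bounded (Abs_fps (\<lambda>n. complex_of_real (dd n))) B"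
  proof (rule wiener_renewal)
    show "\<exists>B. l1_bounded (Abs_fps (\<lambda>n. complex_of_real (zb n))) B"
      by (rule exI, rule summable_l1_bounded[OF _ order_refl]) (use summable_zb zb_nonneg in simp)
    show "\<exists>B. l1_bounded (f + g) B" if fg: "\<exists>B. l1_bounded f B" "\<exists>B. l1_bounded g B" for f g
    proof -
      obtain A B where AB: "l1_bounded f A" "l1_bounded g B" using fg by blast
      have "(\<Sum>n\<le>N. norm (fps_nth (f + g) n)) \<le> A + B" for N
      proof -
        have "(\<Sum>n\<le>N. norm (fps_nth (f + g) n)) \<le> (\<Sum>n\<le>N. norm (fps_nth f n) + norm (fps_nth g n))"
          by (intro sum_mono) (simp add: norm_triangle_ineq)
        also have "\<dots> \<le> A + B" using AB by (auto simp: sum.distrib l1_bounded_def intro!: add_mono)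
        finally show ?thesis .
      qed
      then show ?thesis unfolding l1_bounded_def by blast
    qed
    show "\<exists>B. l1_bounded f B" if "0 < \<theta>" "\<theta> < 1" "\<And>n. norm (fps_nth f n) \<le> C * \<theta> ^ n" for f C \<theta>
    proof -
      have "summable (\<lambda>n. norm (fps_nth f n))"
        by (rule summable_comparison_test'[where N = 0 and g = "\<lambda>n. C * \<theta> ^ n"])
           (use that in \<open>auto intro!: summable_mult summable_geometric\<close>)
      then show ?thesis using summable_l1_bounded by blast
    qed
  qed (use l1_bounded_mult Neumann_l1 in blast)+
  then show ?thesis using l1_bounded_summable(1) by fastforce
qed

lemma dd_poly_decay:
  assumes \<alpha>: "\<alpha> > 1" and zb: "poly_decay \<alpha> zb" shows "poly_decay \<alpha> dd"
proof -
  have "poly_decay \<alpha> (\<lambda>n. norm (fps_nth (Abs_fps (\<lambda>n. complex_of_real (dd n))) n))"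
  proof (rule wiener_renewal[where D = "\<lambda>f. poly_decay \<alpha> (\<lambda>n. norm (fps_nth f n))"])
    show "poly_decay \<alpha> (\<lambda>n. norm (fps_nth (Abs_fps (\<lambda>n. complex_of_real (zb n))) n))"
      by (rule poly_decay_mono[OF zb]) simp
    show "poly_decay \<alpha> (\<lambda>n. norm (fps_nth (f + g) n))"
      if "poly_decay \<alpha> (\<lambda>n. norm (fps_nth f n))" "poly_decay \<alpha> (\<lambda>n. norm (fps_nth g n))" for f g :: "complex fps"
      by (rule poly_decay_mono[OF poly_decay_add[OF that]]) (use norm_triangle_ineq in auto)
    show "poly_decay \<alpha> (\<lambda>n. norm (fps_nth (f * g) n))"
      if "poly_decay \<alpha> (\<lambda>n. norm (fps_nth f n))" "poly_decay \<alpha> (\<lambda>n. norm (fps_nth g n))" for f g :: "complex fps"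
      by (rule poly_decay_mono[OF poly_decay_convolution[OF \<alpha> that]])
         (use norm_fps_mult_nth_le in \<open>auto simp: sum_nonneg\<close>)
    show "poly_decay \<alpha> (\<lambda>n. norm (fps_nth f n))"
      if t: "0 < \<theta>" "\<theta> < 1" "\<And>n. norm (fps_nth f n) \<le> C * \<theta> ^ n" for f :: "complex fps" and C \<theta>
    proof -
      have "(\<lambda>n. \<theta> ^ n * real (n + 1) powr \<alpha>) \<longlonglongrightarrow> 0" using t \<alpha> by real_asymp
      then have "Bseq (\<lambda>n. \<theta> ^ n * real (n + 1) powr \<alpha>)" by (rule convergentI[THEN convergent_imp_Bseq])
      then obtain K where K: "K > 0" "\<And>n. norm (\<theta> ^ n * real (n + 1) powr \<alpha>) \<le> K" by (rule BseqE) blast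
      have "\<bar>norm (fps_nth f n)\<bar> \<le> (\<bar>C\<bar> * K) * real (n + 1) powr (- \<alpha>)" for n
      proof -
        have "\<theta> ^ n \<le> K * real (n + 1) powr (- \<alpha>)"
          using K(2)[of n] t by (simp add: powr_minus field_simps abs_mult)
        then have "\<bar>C\<bar> * \<theta> ^ n \<le> \<bar>C\<bar> * (K * real (n + 1) powr (- \<alpha>))" by (intro mult_left_mono) auto
        moreover have "C * \<theta> ^ n \<le> \<bar>C\<bar> * \<theta> ^ n" using t by (intro mult_right_mono) auto
        ultimately show ?thesis using t(3)[of n] by (simp add: mult.assoc)
      qed
      then show ?thesis unfolding poly_decay_def by blast
    qed
  qed (use Neumann_poly_decay[OF \<alpha>] in blast)
  then show ?thesis by (rule poly_decay_mono) simp
qed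

lemma dd_exp_decay:
  assumes zb: "exp_decay zb" shows "exp_decay dd"
proof -
  have "exp_decay (\<lambda>n. norm (fps_nth (Abs_fps (\<lambda>n. complex_of_real (dd n))) n))"
  proof (rule wiener_renewal[where D = "\<lambda>f. exp_decay (\<lambda>n. norm (fps_nth f n))"])
    show "exp_decay (\<lambda>n. norm (fps_nth (Abs_fps (\<lambda>n. complex_of_real (zb n))) n))"
      by (rule exp_decay_mono[OF zb]) simp
    show "exp_decay (\<lambda>n. norm (fps_nth (f + g) n))"
      if "exp_decay (\<lambda>n. norm (fps_nth f n))" "exp_decay (\<lambda>n. norm (fps_nth g n))" for f g :: "complex fps"
      by (rule exp_decay_mono[OF exp_decay_add[OF that]]) (use norm_triangle_ineq in auto)
    show "exp_decay (\<lambda>n. norm (fps_nth (f * g) n))"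
      if "exp_decay (\<lambda>n. norm (fps_nth f n))" "exp_decay (\<lambda>n. norm (fps_nth g n))" for f g :: "complex fps"
      by (rule exp_decay_mono[OF exp_decay_convolution[OF that]])
         (use norm_fps_mult_nth_le in \<open>auto simp: sum_nonneg\<close>)
    show "exp_decay (\<lambda>n. norm (fps_nth f n))"
      if t: "0 < \<theta>" "\<theta> < 1" "\<And>n. norm (fps_nth f n) \<le> C * \<theta> ^ n" for f :: "complex fps" and C \<theta>
      using t unfolding exp_decay_def by auto
  qed (use Neumann_exp_decay in blast)
  then show ?thesis by (rule exp_decay_mono) simp
qed

text \<open>
  In terms of power series, \<open>x = h / (1 - p) = h / ((1 - z) zb)\<close>; division by \<open>1 - z\<close> is the
  summation over \<open>j\<close>.
\<close>

lemma renewal_solution: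
  assumes x: "\<And>n. x n = h n + (\<Sum>m=1..n. (zb (m - 1) - zb m) * x (n - m))"
  shows "x n = (\<Sum>j\<le>n. \<Sum>i\<le>j. h i * dd (j - i))"
proof -
  let ?Z = "Abs_fps zb" and ?X = "Abs_fps x" and ?H = "Abs_fps h"
  define P where "P = Abs_fps (\<lambda>m. if m = 0 then 0 else zb (m - 1) - zb m)"
  have "?X = ?H + P * ?X"
  proof (rule fps_ext)
    fix n
    have "fps_nth (P * ?X) n = (\<Sum>m=0..n. fps_nth P m * x (n - m))" by (simp add: fps_mult_nth)
    also have "\<dots> = (\<Sum>m=1..n. fps_nth P m * x (n - m))"
      by (rule sum.mono_neutral_right) (auto simp: P_def)
    also have "\<dots> = (\<Sum>m=1..n. (zb (m - 1) - zb m) * x (n - m))"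
      by (intro sum.cong) (auto simp: P_def)
    finally show "fps_nth ?X n = fps_nth (?H + P * ?X) n" using x[of n] by simp
  qed
  then have 1: "(1 - P) * ?X = ?H" by (simp add: algebra_simps)
  have "(1 - P) = (1 - fps_X) * ?Z"
    by (rule fps_ext) (auto simp: P_def zb_0 ring_distribs fps_one_nth)
  with 1 have 2: "?Z * ((1 - fps_X) * ?X) = ?H" by (simp only: mult_ac)
  have "inverse ?Z * ?Z = 1" by (rule inverse_mult_eq_1) (simp add: zb_0)
  with 2 have 3: "(1 - fps_X) * ?X = ?H * inverse ?Z"
    by (metis mult.assoc mult.commute mult.left_neutral)
  have nth: "fps_nth ((1 - fps_X) * ?X) n = (\<Sum>i\<le>n. h i * dd (n - i))" for n
    unfolding 3 by (simp add: fps_mult_nth renewal_inv_def atLeast0AtMost)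
  show ?thesis
  proof (induction n)
    case 0
    show ?case using nth[of 0] by (simp add: ring_distribs)
  next
    case (Suc n)
    have "x (Suc n) - x n = (\<Sum>i\<le>Suc n. h i * dd (Suc n - i))"
      using nth[of "Suc n"] by (simp add: ring_distribs)
    then show ?case using Suc by simp
  qed
qed

text \<open>
  A majorant of the increments of every solution of the renewal equation with \<open>\<bar>h\<bar> \<le> zb\<close>. The sum of
  those still to come bounds the distance to the limit.
\<close>

definition conv :: "nat \<Rightarrow> real" where "conv n = (\<Sum>i\<le>n. \<bar>zb i\<bar> * \<bar>dd (n - i)\<bar>)"
definition renewal_err :: "nat \<Rightarrow> real" where "renewal_err n = (\<Sum>j. conv (j + n))"

lemma conv_nonneg: "0 \<le> conv n" by (simp add: conv_def sum_nonneg)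

lemma conv_summable: "summable conv"
  unfolding conv_def
  using summable_Cauchy_product[of "\<lambda>n. \<bar>zb n\<bar>" "\<lambda>n. \<bar>dd n\<bar>"] summable_zb zb_nonneg dd_summable by simp

lemma sum_dd: "suminf zb * suminf dd = 1"
proof -
  have "Abs_fps zb * inverse (Abs_fps zb) = 1" by (rule inverse_mult_eq_1') (simp add: zb_0)
  then have "(\<Sum>i\<le>n. zb i * dd (n - i)) = (if n = 0 then 1 else 0)" for n
    by (simp add: fps_eq_iff fps_mult_nth fps_one_nth renewal_inv_def atLeast0AtMost)
  moreover have "(\<lambda>n. \<Sum>i\<le>n. zb i * dd (n - i)) sums (suminf zb * suminf dd)"
    using summable_zb zb_nonneg dd_summable by (intro Cauchy_product_sums) simp_all
  ultimately have "(\<lambda>n::nat. if n = 0 then 1 else 0) sums (suminf zb * suminf dd)" by simp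
  then show ?thesis using sums_single[of 0 "\<lambda>_. 1::real"] sums_unique2 by fastforce
qed

text \<open>
  The renewal theorem with a rate. The increments of \<open>x\<close> are the convolution of \<open>h\<close> with the
  summable sequence \<open>dd\<close>, so \<open>x\<close> converges and the distance to the limit is a tail of this
  convolution. The bound does not involve \<open>h\<close>; this is the source of all uniformity with respect to
  the observable.
\<close>

theorem renewal_rate:
  assumes x: "\<And>n. x n = h n + (\<Sum>m=1..n. (zb (m - 1) - zb m) * x (n - m))"
    and h: "\<And>n. \<bar>h n\<bar> \<le> zb n"
  shows "\<bar>x n - suminf h / suminf zb\<bar> \<le> renewal_err (Suc n)"
proof -
  have sh: "summable (\<lambda>n. \<bar>h n\<bar>)"
    by (rule summable_comparison_test'[OF summable_zb, where N = 0]) (use h in auto)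
  define c where "c n = (\<Sum>i\<le>n. h i * dd (n - i))" for n
  have c: "\<bar>c n\<bar> \<le> conv n" for n
    unfolding c_def conv_def
    by (rule order_trans[OF sum_abs]) (use h zb_nonneg in \<open>auto simp: abs_mult intro!: sum_mono mult_right_mono\<close>)
  have sc: "summable c"
    by (rule summable_comparison_test'[OF conv_summable, where N = 0]) (use c in auto)
  have "c sums (suminf h * suminf dd)"
    unfolding c_def using sh dd_summable by (intro Cauchy_product_sums) simp_all
  also have "suminf h * suminf dd = suminf h / suminf zb"
    using sum_dd by (metis div_by_0 mult.commute mult_zero_left nonzero_eq_divide_eq times_divide_eq_left times_divide_eq_right mult_1 zero_neq_one)
  finally have L: "suminf h / suminf zb = (\<Sum>n. c n)" by (rule sums_unique)
  also have "\<dots> = (\<Sum>j. c (j + Suc n)) + (\<Sum>j<Suc n. c j)" by (rule suminf_split_initial_segment[OF sc])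
  also have "(\<Sum>j<Suc n. c j) = x n"
    unfolding c_def renewal_solution[OF x, of n] lessThan_Suc_atMost ..
  finally have "\<bar>x n - suminf h / suminf zb\<bar> = \<bar>\<Sum>j. c (j + Suc n)\<bar>" by simp
  also have "\<dots> \<le> (\<Sum>j. conv (j + Suc n))"
    using norm_suminf_le[of "\<lambda>j. c (j + Suc n)" "\<lambda>j. conv (j + Suc n)"] c
      summable_ignore_initial_segment[OF conv_summable, of "Suc n"] by simp
  finally show ?thesis by (simp add: renewal_err_def)
qed

lemma renewal_err_nonneg: "0 \<le> renewal_err n"
  unfolding renewal_err_def
  by (intro suminf_nonneg conv_nonneg summable_ignore_initial_segment conv_summable)

lemma renewal_err_eq: "renewal_err n = suminf conv - (\<Sum>j<n. conv j)"
  unfolding renewal_err_def using suminf_split_initial_segment[OF conv_summable, of n] by simp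

lemma renewal_err_antimono: "m \<le> n \<Longrightarrow> renewal_err n \<le> renewal_err m"
  unfolding renewal_err_eq by (intro diff_left_mono sum_mono2) (auto simp: conv_nonneg)

lemma renewal_err_tendsto: "renewal_err \<longlonglongrightarrow> 0"
proof -
  have "(\<lambda>n. suminf conv - (\<Sum>j<n. conv j)) \<longlonglongrightarrow> suminf conv - suminf conv"
    by (intro tendsto_intros summable_LIMSEQ conv_summable)
  then show ?thesis by (simp add: renewal_err_eq[abs_def])
qed

lemma renewal_err_poly:
  assumes \<alpha>: "\<alpha> > 1" and zb: "poly_decay \<alpha> zb" shows "poly_decay (\<alpha> - 1) renewal_err"
proof -
  have "poly_decay \<alpha> conv" unfolding conv_def by (rule poly_decay_convolution[OF \<alpha> zb dd_poly_decay[OF \<alpha> zb]])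
  from poly_decay_tail_sum[OF \<alpha> this conv_nonneg] show ?thesis unfolding renewal_err_def[abs_def] .
qed

lemma renewal_err_exp:
  assumes zb: "exp_decay zb" shows "exp_decay renewal_err"
proof -
  have "exp_decay conv" unfolding conv_def by (rule exp_decay_convolution[OF zb dd_exp_decay[OF zb]])
  then obtain C \<theta> where C: "C > 0" "0 < \<theta>" "\<theta> < 1" "\<And>n. \<bar>conv n\<bar> \<le> C * \<theta> ^ n" using exp_decayE by blast
  have "renewal_err n \<le> (C / (1 - \<theta>)) * \<theta> ^ n" for n
  proof -
    have s: "(\<lambda>j. C * \<theta> ^ n * \<theta> ^ j) sums (C * \<theta> ^ n * (1 / (1 - \<theta>)))"
      using C by (intro sums_mult geometric_sums) auto
    have "renewal_err n \<le> (\<Sum>j. C * \<theta> ^ n * \<theta> ^ j)"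
      unfolding renewal_err_def
    proof (rule suminf_le)
      show "conv (j + n) \<le> C * \<theta> ^ n * \<theta> ^ j" for j
        using C(4)[of "j + n"] by (simp add: power_add mult_ac)
      show "summable (\<lambda>j. conv (j + n))" by (rule summable_ignore_initial_segment[OF conv_summable])
      show "summable (\<lambda>j. C * \<theta> ^ n * \<theta> ^ j)" using s by (rule sums_summable)
    qed
    also have "\<dots> = (C / (1 - \<theta>)) * \<theta> ^ n" using s by (simp add: sums_iff)
    finally show ?thesis .
  qed
  then show ?thesis unfolding exp_decay_def
    by (intro exI[of _ "C / (1 - \<theta>)"] exI[of _ \<theta>]) (use renewal_err_nonneg C in auto)
qed

end

section \<open>Recursive inequalities for tails\<close>

text \<open>
  Let \<open>Z n\<close> be the mass that has not regenerated by time \<open>n\<close>, and suppose that a mass staying in the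
  tower does so for a time with tail at most \<open>th\<close>. Whenever the mass \<open>Z (j - 1) - Z j\<close> regenerates
  at time \<open>j\<close>, \<open>E\<close> times as much arrives at the base without regenerating and starts a new stay:
  this is the recursion. Summation by parts of the weighted sum on the right brings in a factor
  \<open>x - 1\<close>, so for \<open>x\<close> close to 1 it can be absorbed. The case \<open>x = 1\<close> gives summability and the case
  \<open>x > 1\<close> exponential decay.
\<close>

lemma regen_sum:
  fixes th Z :: "nat \<Rightarrow> real"
  assumes th: "\<And>n. 0 \<le> th n" and E: "E \<ge> 0" and Z: "\<And>n. 0 \<le> Z n" and dec: "\<And>n. Z (Suc n) \<le> Z n"
    and rec: "\<And>n. Z n \<le> Z 0 * th n + E * (\<Sum>j=1..n. (Z (j - 1) - Z j) * th (n - j))"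
    and x: "x \<ge> 1" and T: "\<And>N. (\<Sum>n\<le>N. th n * x ^ n) \<le> T" and small: "E * T * (x - 1) \<le> 1 / 2"
  shows "(\<Sum>n\<le>N. Z n * x ^ n) \<le> 2 * T * (1 + E) * Z 0"
proof -
  define A where "A j = (if j = 0 then 0 else (Z (j - 1) - Z j) * x ^ j)" for j
  define t where "t n = th n * x ^ n" for n
  define S where "S = (\<Sum>n\<le>N. Z n * x ^ n)"
  have x0: "x > 0" using x by simp
  have A0: "0 \<le> A j" for j using dec[of "j - 1"] x0 by (cases j) (auto simp: A_def)
  have T0: "0 \<le> T" using T[of 0] th[of 0] by simp
  have S0: "0 \<le> S" unfolding S_def using Z x0 by (intro sum_nonneg) auto
  have summand: "Z n * x ^ n \<le> Z 0 * t n + E * (\<Sum>j\<le>n. A j * t (n - j))" for n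
  proof -
    have "Z n * x ^ n \<le> (Z 0 * th n + E * (\<Sum>j=1..n. (Z (j - 1) - Z j) * th (n - j))) * x ^ n"
      using x0 by (intro mult_right_mono rec) auto
    also have "\<dots> = Z 0 * t n + E * (\<Sum>j=1..n. (Z (j - 1) - Z j) * th (n - j) * x ^ n)"
      by (simp add: t_def ring_distribs sum_distrib_right)
    also have "(\<Sum>j=1..n. (Z (j - 1) - Z j) * th (n - j) * x ^ n) = (\<Sum>j=1..n. A j * t (n - j))"
    proof (rule sum.cong[OF refl])
      fix j assume "j \<in> {1..n}"
      then have "x ^ n = x ^ j * x ^ (n - j)" "j \<noteq> 0" by (auto simp: power_add[symmetric])
      then show "(Z (j - 1) - Z j) * th (n - j) * x ^ n = A j * t (n - j)" by (simp add: A_def t_def)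
    qed
    also have "\<dots> = (\<Sum>j\<le>n. A j * t (n - j))"
      by (rule sum.mono_neutral_left) (auto simp: A_def)
    finally show ?thesis .
  qed
  have "(\<Sum>n\<le>N. A n) \<le> Z 0 + (x - 1) * S"
  proof -
    have "(\<Sum>n\<le>N. A n) = Z 0 + (x - 1) * (\<Sum>n\<le>N. Z n * x ^ n) - Z N * x ^ Suc N"
      by (induction N) (auto simp: A_def algebra_simps)
    then show ?thesis using Z[of N] x0 by (simp add: S_def)
  qed
  moreover have "S \<le> Z 0 * (\<Sum>n\<le>N. t n) + E * ((\<Sum>n\<le>N. A n) * (\<Sum>n\<le>N. t n))"
  proof -
    have "S \<le> (\<Sum>n\<le>N. Z 0 * t n + E * (\<Sum>j\<le>n. A j * t (n - j)))"
      unfolding S_def by (intro sum_mono summand)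
    also have "\<dots> = Z 0 * (\<Sum>n\<le>N. t n) + E * (\<Sum>n\<le>N. \<Sum>j\<le>n. A j * t (n - j))"
      by (simp add: sum.distrib sum_distrib_left)
    also have "\<dots> \<le> Z 0 * (\<Sum>n\<le>N. t n) + E * ((\<Sum>n\<le>N. A n) * (\<Sum>n\<le>N. t n))"
      using E A0 th x0 by (intro add_left_mono mult_left_mono triangle_sum_le) (auto simp: t_def)
    finally show ?thesis .
  qed
  moreover have "Z 0 * (\<Sum>n\<le>N. t n) \<le> Z 0 * T" using T Z by (intro mult_left_mono) (auto simp: t_def)
  moreover have "E * ((\<Sum>n\<le>N. A n) * (\<Sum>n\<le>N. t n)) \<le> E * ((Z 0 + (x - 1) * S) * T)"
    using calculation(1) T E A0 T0 S0 Z th x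
    by (intro mult_left_mono mult_mono) (auto simp: t_def intro!: sum_nonneg)
  ultimately have "S \<le> Z 0 * T + E * ((Z 0 + (x - 1) * S) * T)" by linarith
  also have "\<dots> = T * (1 + E) * Z 0 + (E * T * (x - 1)) * S" by (simp add: algebra_simps)
  also have "\<dots> \<le> T * (1 + E) * Z 0 + 1 / 2 * S" using small S0 by (intro add_left_mono mult_right_mono) auto
  finally show ?thesis unfolding S_def by simp
qed

text \<open>
  For stays that are longer than \<open>M\<close> use \<open>th M\<close>; the others have begun during the last \<open>M\<close> steps,
  and there the recursion telescopes to \<open>Z (n - M - 1) - Z n\<close>. Dividing by \<open>1 + E\<close> gives a
  contraction by \<open>E / (1 + E)\<close>.
\<close>

lemma regen_window:
  fixes th Z :: "nat \<Rightarrow> real"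
  assumes th: "\<And>n. 0 \<le> th n" "\<And>n. th n \<le> 1" "\<And>m n. m \<le> n \<Longrightarrow> th n \<le> th m"
    and E: "E \<ge> 0" and Z: "\<And>n. 0 \<le> Z n" and dec: "\<And>n. Z (Suc n) \<le> Z n"
    and rec: "\<And>n. Z n \<le> Z 0 * th n + E * (\<Sum>j=1..n. (Z (j - 1) - Z j) * th (n - j))"
    and M: "M < n"
  shows "(1 + E) * Z n \<le> E * Z (n - M - 1) + Z 0 * ((1 + E) * th M)"
proof -
  let ?d = "\<lambda>j. Z (j - 1) - Z j"
  have d0: "0 \<le> ?d j" if "j \<ge> 1" for j using dec[of "j - 1"] that by simp
  have tel: "(\<Sum>j=a+1..b. ?d j) = Z a - Z b" if "a \<le> b" for a b
    using that by (induction b rule: dec_induct) (auto)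
  have "(\<Sum>j=1..n. ?d j * th (n - j)) = (\<Sum>j=1..n-M-1. ?d j * th (n - j)) + (\<Sum>j=n-M-1+1..n. ?d j * th (n - j))"
  proof -
    have n: "n = (n - M - 1) + (M + 1)" using M by simp
    have "sum f {1..(n - M - 1) + (M + 1)} = sum f {1..n-M-1} + sum f {n-M-1+1..(n - M - 1) + (M + 1)}"
      for f :: "nat \<Rightarrow> real" by (rule sum.ub_add_nat) simp
    then show ?thesis unfolding n[symmetric] .
  qed
  also have "(\<Sum>j=1..n-M-1. ?d j * th (n - j)) \<le> (\<Sum>j=0+1..n-M-1. ?d j * th M)"
    unfolding add_0 by (intro sum_mono mult_left_mono th(3) d0) auto
  also have "\<dots> = (Z 0 - Z (n - M - 1)) * th M" by (simp only: sum_distrib_right[symmetric] tel[OF le0])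
  also have "\<dots> \<le> Z 0 * th M" using Z th by (simp add: mult_right_mono)
  also have "(\<Sum>j=n-M-1+1..n. ?d j * th (n - j)) \<le> (\<Sum>j=n-M-1+1..n. ?d j)"
    using d0 th by (intro sum_mono) (auto intro!: mult_right_le_one_le)
  also have "\<dots> = Z (n - M - 1) - Z n" by (rule tel) auto
  finally have "E * (\<Sum>j=1..n. ?d j * th (n - j)) \<le> E * (Z 0 * th M + (Z (n - M - 1) - Z n))"
    using E by (intro mult_left_mono) auto
  moreover have "Z 0 * th n \<le> Z 0 * th M" using M Z by (intro mult_left_mono th) auto
  ultimately show ?thesis using rec[of n] by (simp add: algebra_simps)
qed

section \<open>The return map and its good points\<close>

locale distorted_tower = tower T for T :: "'a tower_data" +
  fixes C\<^sub>0 \<beta> :: real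
  assumes C\<^sub>0_pos: "0 < C\<^sub>0" and \<beta>_pos: "0 < \<beta>" and \<beta>_less: "\<beta> < 1"
    and distortion: "x \<in> part T i \<inter> good_base T \<Longrightarrow> y \<in> part T i \<inter> good_base T \<Longrightarrow>
      \<bar>jac T x / jac T y - 1\<bar> \<le> C\<^sub>0 * power_enat \<beta> (sep_base T (ret T x) (ret T y))"
begin

abbreviation "M \<equiv> base T"

definition idx :: "'a \<Rightarrow> nat" where "idx z = (LEAST i. z \<in> part T i)"
definition inv_branch :: "nat \<Rightarrow> 'a \<Rightarrow> 'a" where "inv_branch i = the_inv_into (part T i) (ret T)"

declare part_sets[measurable] ret_measurable[measurable] rtime_measurable[measurable] jac_measurable[measurable]

lemma inv_branch_measurable[measurable]: "inv_branch i \<in> M \<rightarrow>\<^sub>M M"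
  unfolding inv_branch_def by (rule ret_inv_measurable)

lemma idx_measurable[measurable]: "idx \<in> M \<rightarrow>\<^sub>M count_space UNIV"
  unfolding idx_def by measurable

lemma funpow_ret_measurable[measurable]: "(ret T ^^ n) \<in> M \<rightarrow>\<^sub>M M"
  by (induction n) (auto simp: comp_def)

lemma part_subset: "part T i \<subseteq> space M"
  using part_sets by (rule sets.sets_into_space)

lemma inv_branch_in: "y \<in> space M \<Longrightarrow> inv_branch i y \<in> part T i"
  unfolding inv_branch_def using ret_bij[of i] by (intro the_inv_into_into) (auto simp: bij_betw_def)

lemma ret_inv_branch: "y \<in> space M \<Longrightarrow> ret T (inv_branch i y) = y"
  unfolding inv_branch_def using ret_bij[of i] by (intro f_the_inv_into_f) (auto simp: bij_betw_def)

lemma inv_branch_ret: "x \<in> part T i \<Longrightarrow> inv_branch i (ret T x) = x"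
  unfolding inv_branch_def using ret_bij[of i] by (intro the_inv_into_f_f) (auto simp: bij_betw_def)

lemma ret_space: "x \<in> space M \<Longrightarrow> ret T x \<in> space M"
  using ret_measurable by (rule measurable_space)

text \<open>
  The Jacobian on one branch, as a change of variables. Every measurable set is the image of a
  measurable subset of the part, so this is the formula \<open>jacobian\<close>.
\<close>

lemma distr_branch:
  "distr (density M (\<lambda>z. indicator (part T i) z * ennreal (jac T z))) M (ret T) = M"
proof (rule measure_eqI)
  fix A assume "A \<in> sets (distr (density M (\<lambda>z. indicator (part T i) z * ennreal (jac T z))) M (ret T))"
  then have A[measurable]: "A \<in> sets M" by simp
  define E where "E = part T i \<inter> (ret T -` A \<inter> space M)"
  have E[measurable]: "E \<in> sets M" unfolding E_def by measurable
  have img: "ret T ` E = A"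
  proof
    show "ret T ` E \<subseteq> A" by (auto simp: E_def)
    show "A \<subseteq> ret T ` E"
    proof
      fix y assume y: "y \<in> A"
      then have "y \<in> space M" using sets.sets_into_space[OF A] by auto
      then have "inv_branch i y \<in> E" "y = ret T (inv_branch i y)"
        using inv_branch_in[of y i] ret_inv_branch[of y i] y part_subset by (auto simp: E_def)
      then show "y \<in> ret T ` E" by blast
    qed
  qed
  have inj: "inj_on (ret T) E"
    using ret_bij[of i] by (auto simp: E_def bij_betw_def intro: inj_on_subset)
  have "emeasure (distr (density M (\<lambda>z. indicator (part T i) z * ennreal (jac T z))) M (ret T)) A
      = emeasure (density M (\<lambda>z. indicator (part T i) z * ennreal (jac T z))) (ret T -` A \<inter> space M)"
    by (subst emeasure_distr) auto
  also have "\<dots> = (\<integral>\<^sup>+z. (indicator (part T i) z * ennreal (jac T z)) * indicator (ret T -` A \<inter> space M) z \<partial>M)"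
    by (subst emeasure_density) (auto intro!: measurable_sets[OF ret_measurable A])
  also have "\<dots> = (\<integral>\<^sup>+z\<in>E. ennreal (jac T z) \<partial>M)"
    by (intro nn_integral_cong) (auto simp: E_def indicator_def)
  also have "\<dots> = emeasure M (ret T ` E)"
    by (rule jacobian[symmetric]) (use inj img in auto)
  finally show "emeasure (distr (density M (\<lambda>z. indicator (part T i) z * ennreal (jac T z))) M (ret T)) A = emeasure M A"
    using img by simp
qed simp

lemma nn_integral_branch:
  assumes [measurable]: "u \<in> borel_measurable M"
  shows "(\<integral>\<^sup>+y. u y \<partial>M) = (\<integral>\<^sup>+z. indicator (part T i) z * ennreal (jac T z) * u (ret T z) \<partial>M)"
proof -
  have "(\<integral>\<^sup>+y. u y \<partial>M) = (\<integral>\<^sup>+y. u y \<partial>distr (density M (\<lambda>z. indicator (part T i) z * ennreal (jac T z))) M (ret T))"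
    by (simp only: distr_branch)
  also have "\<dots> = (\<integral>\<^sup>+z. u (ret T z) \<partial>density M (\<lambda>z. indicator (part T i) z * ennreal (jac T z)))"
    by (subst nn_integral_distr) auto
  also have "\<dots> = (\<integral>\<^sup>+z. indicator (part T i) z * ennreal (jac T z) * u (ret T z) \<partial>M)"
    by (subst nn_integral_density) auto
  finally show ?thesis .
qed

lemma AE_part: "AE z in M. (\<exists>!i. z \<in> part T i)"
proof -
  have "AE z in M. \<forall>i j. i \<noteq> j \<longrightarrow> z \<notin> part T i \<inter> part T j"
  proof (unfold AE_all_countable, intro allI)
    fix i j
    show "AE z in M. i \<noteq> j \<longrightarrow> z \<notin> part T i \<inter> part T j"
      using AE_not_in[OF part_disjoint[of i j]] by (cases "i = j") auto
  qed
  moreover have "AE z in M. z \<notin> space M - (\<Union>i. part T i)"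
    by (rule AE_not_in[OF part_covers])
  ultimately show ?thesis using AE_space by eventually_elim blast
qed

text \<open>
  As the Jacobian is positive almost everywhere, the part of the preimage of a null set in each
  branch is null.
\<close>

lemma AE_ret:
  assumes "AE z in M. P z"
  shows "AE z in M. P (ret T z)"
proof -
  obtain N where N: "{z \<in> space M. \<not> P z} \<subseteq> N" "N \<in> null_sets M"
    using assms by (auto simp: eventually_ae_filter)
  have [measurable]: "N \<in> sets M" using N by auto
  have "AE z in M. z \<in> part T i \<longrightarrow> ret T z \<notin> N" for i
  proof -
    have "(\<integral>\<^sup>+z. indicator (part T i) z * ennreal (jac T z) * indicator N (ret T z) \<partial>M) = (\<integral>\<^sup>+y. indicator N y \<partial>M)"
      by (rule nn_integral_branch[symmetric]) simp
    also have "\<dots> = 0" using N(2) by (simp add: null_setsD1)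
    finally have "AE z in M. indicator (part T i) z * ennreal (jac T z) * indicator N (ret T z) = (0::ennreal)"
      by (subst (asm) nn_integral_0_iff_AE) auto
    with jac_pos show ?thesis by eventually_elim (auto simp: indicator_def ennreal_eq_0_iff split: if_splits)
  qed
  then have "AE z in M. \<forall>i. z \<in> part T i \<longrightarrow> ret T z \<notin> N" unfolding AE_all_countable by blast
  with AE_part AE_space show ?thesis
  proof eventually_elim
    case (elim z)
    then have "ret T z \<notin> N" by blast
    then show ?case using N(1) ret_space[OF elim(2)] by blast
  qed
qed

text \<open>
  By the Jacobian formula the return map carries null subsets of a part to null sets.
\<close>

lemma AE_inv_branch:
  assumes "AE z in M. P z"
  shows "AE y in M. P (inv_branch i y)"
proof -
  obtain N where N: "{z \<in> space M. \<not> P z} \<subseteq> N" "N \<in> null_sets M"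
    using assms by (auto simp: eventually_ae_filter)
  have [measurable]: "N \<in> sets M" using N by auto
  have "(\<integral>\<^sup>+y. indicator N (inv_branch i y) \<partial>M) = (\<integral>\<^sup>+z. indicator (part T i) z * ennreal (jac T z) * indicator N (inv_branch i (ret T z)) \<partial>M)"
    by (rule nn_integral_branch) simp
  also have "\<dots> = (\<integral>\<^sup>+z. indicator (part T i) z * ennreal (jac T z) * indicator N z \<partial>M)"
    by (intro nn_integral_cong) (auto simp: indicator_def inv_branch_ret)
  also have "\<dots> = (\<integral>\<^sup>+z. 0 \<partial>M)"
    by (rule nn_integral_cong_AE) (use AE_not_in[OF N(2)] in \<open>eventually_elim, simp\<close>)
  also have "\<dots> = 0" by simp
  finally have "AE y in M. indicator N (inv_branch i y) = (0::ennreal)"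
    by (subst (asm) nn_integral_0_iff_AE) auto
  with AE_space show ?thesis
  proof eventually_elim
    case (elim y)
    then have "inv_branch i y \<notin> N" by (auto simp: indicator_def split: if_splits)
    moreover have "inv_branch i y \<in> space M" using inv_branch_in[OF elim(1)] part_subset by blast
    ultimately show ?case using N(1) by blast
  qed
qed

lemma AE_funpow_ret:
  assumes P: "AE z in M. P z"
  shows "AE z in M. P ((ret T ^^ n) z)"
proof (induction n)
  case 0
  show ?case using P by simp
next
  case (Suc n)
  from AE_ret[OF Suc] show ?case by (simp add: funpow_swap1)
qed

lemma AE_good_base: "AE z in M. z \<in> good_base T"
proof -
  have "AE z in M. (\<exists>!i. z \<in> part T i) \<and> 0 < jac T z"
    using AE_part jac_pos by eventually_elim auto
  then have "AE z in M. \<forall>n. (\<exists>!i. (ret T ^^ n) z \<in> part T i) \<and> 0 < jac T ((ret T ^^ n) z)"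
    unfolding AE_all_countable by (intro allI AE_funpow_ret)
  with AE_space show ?thesis by eventually_elim (simp add: good_base_def)
qed

lemma good_base_sets[measurable]: "good_base T \<in> sets M"
proof -
  define U where "U = (\<Union>i. part T i - (\<Union>j\<in>-{i}. part T j))"
  have U[measurable]: "U \<in> sets M" unfolding U_def by measurable
  have U_iff: "(\<exists>!i. z \<in> part T i) \<longleftrightarrow> z \<in> U" for z
    unfolding U_def by auto
  have "good_base T = {x \<in> space M. \<forall>n. (ret T ^^ n) x \<in> U \<and> 0 < jac T ((ret T ^^ n) x)}"
    unfolding good_base_def U_iff by auto
  also have "\<dots> \<in> sets M" by measurable
  finally show ?thesis .
qed

lemma good_base_subset: "good_base T \<subseteq> space M" by (auto simp: good_base_def)

lemma good_jac_part: assumes "z \<in> good_base T" shows "(\<exists>!i. z \<in> part T i) \<and> 0 < jac T z"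
proof -
  have "(\<exists>!i. (ret T ^^ 0) z \<in> part T i) \<and> 0 < jac T ((ret T ^^ 0) z)"
    using assms unfolding good_base_def by blast
  then show ?thesis by simp
qed

lemmas good_part = good_jac_part[THEN conjunct1]
lemmas good_jac = good_jac_part[THEN conjunct2]

lemma good_ret: assumes "z \<in> good_base T" shows "ret T z \<in> good_base T"
proof -
  have "ret T z \<in> space M" using assms ret_space by (auto simp: good_base_def)
  moreover have "(\<exists>!i. (ret T ^^ n) (ret T z) \<in> part T i) \<and> 0 < jac T ((ret T ^^ n) (ret T z))" for n
  proof -
    have "(\<exists>!i. (ret T ^^ Suc n) z \<in> part T i) \<and> 0 < jac T ((ret T ^^ Suc n) z)"
      using assms unfolding good_base_def by blast
    then show ?thesis by (simp only: funpow_Suc_right comp_def)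
  qed
  ultimately show ?thesis by (auto simp: good_base_def)
qed

lemma good_funpow_ret: "z \<in> good_base T \<Longrightarrow> (ret T ^^ n) z \<in> good_base T"
  by (induction n) (auto intro: good_ret)

lemma idx_in: "z \<in> good_base T \<Longrightarrow> z \<in> part T (idx z)"
  unfolding idx_def using good_part by (metis LeastI)

lemma idx_eq: "z \<in> good_base T \<Longrightarrow> z \<in> part T i \<Longrightarrow> idx z = i"
  using good_part idx_in by blast

text \<open>
  Good points have good images but not always good preimages. The set \<open>G\<close> of full measure consists
  of the points all of whose preimages under compositions of inverse branches are good; pointwise
  estimates for transfer operators are possible there.
\<close>

primrec iter_good :: "nat \<Rightarrow> 'a set" where
  "iter_good 0 = good_base T"
| "iter_good (Suc n) = {y \<in> iter_good n. \<forall>i. inv_branch i y \<in> iter_good n}"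

definition G :: "'a set" where "G = (\<Inter>n. iter_good n)"

lemma iter_good_subset: "iter_good n \<subseteq> good_base T" by (induction n) auto

lemma iter_good_sets[measurable]: "iter_good n \<in> sets M"
proof (induction n)
  case (Suc n)
  note [measurable] = Suc
  have "iter_good (Suc n) = {y \<in> space M. y \<in> iter_good n \<and> (\<forall>i. inv_branch i y \<in> iter_good n)}"
    using iter_good_subset good_base_subset by fastforce
  also have "\<dots> \<in> sets M" by measurable
  finally show ?case .
qed simp

lemma G_sets[measurable]: "G \<in> sets M" unfolding G_def by measurable

lemma AE_G: "AE z in M. z \<in> G"
proof -
  have "AE z in M. z \<in> iter_good n" for n
  proof (induction n)
    case (Suc n)
    then have "AE z in M. \<forall>i. inv_branch i z \<in> iter_good n"
      unfolding AE_all_countable by (intro allI AE_inv_branch)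
    with Suc show ?case by eventually_elim simp
  qed (simp add: AE_good_base)
  then show ?thesis unfolding G_def by (simp add: AE_all_countable)
qed

lemma G_good: "G \<subseteq> good_base T" using iter_good_subset unfolding G_def by blast
lemma G_space: "G \<subseteq> space M" using G_good good_base_subset by blast
lemma inv_branch_G: assumes "y \<in> G" shows "inv_branch i y \<in> G"
proof -
  have "inv_branch i y \<in> iter_good n" for n
  proof -
    have "y \<in> iter_good (Suc n)" using assms unfolding G_def by blast
    then show ?thesis by simp
  qed
  then show ?thesis unfolding G_def by blast
qed

lemma G_nonempty: "G \<noteq> {}"
proof
  assume "G = {}"
  with AE_G have "AE z in M. False" by simp
  then have "emeasure M (space M) = 0"
    by (subst (asm) AE_iff_measurable[of "space M"]) auto
  with base_nonnull show False by simp
qed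

section \<open>Separation and transfer operators\<close>

abbreviation sep_dist :: "'a \<Rightarrow> 'a \<Rightarrow> real" where "sep_dist x y \<equiv> power_enat \<beta> (sep_base T x y)"

lemma sep_base_commute: "sep_base T x y = sep_base T y x"
  unfolding sep_base_def by (simp add: conj_commute)

lemma power_enat_bounds: "0 \<le> power_enat \<beta> s" "power_enat \<beta> s \<le> 1"
  unfolding power_enat_def using \<beta>_pos \<beta>_less by (auto split: enat.split simp: power_le_one)

lemma power_enat_eSuc: "eSuc s \<le> t \<Longrightarrow> power_enat \<beta> t \<le> \<beta> * power_enat \<beta> s"
  unfolding power_enat_def using \<beta>_pos \<beta>_less
  by (cases s; cases t) (auto simp: eSuc_enat simp flip: power_Suc intro!: power_decreasing)

lemma sep_base_inv_branch:
  assumes "x \<in> space M" "y \<in> space M"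
  shows "eSuc (sep_base T x y) \<le> sep_base T (inv_branch i x) (inv_branch i y)"
  unfolding sep_base_def[of T "inv_branch i x"]
proof (rule INF_greatest)
  fix n assume n: "n \<in> {n. \<not> (\<exists>j. (ret T ^^ n) (inv_branch i x) \<in> part T j \<and> (ret T ^^ n) (inv_branch i y) \<in> part T j)}"
  have "n \<noteq> 0" using n inv_branch_in[OF assms(1), of i] inv_branch_in[OF assms(2), of i] by (metis (mono_tags, lifting) funpow_0 mem_Collect_eq)
  then obtain m where m: "n = Suc m" by (cases n) auto
  have "\<not> (\<exists>j. (ret T ^^ m) x \<in> part T j \<and> (ret T ^^ m) y \<in> part T j)"
    using n assms unfolding m funpow_Suc_right comp_def mem_Collect_eq by (simp only: ret_inv_branch) blast
  then have "sep_base T x y \<le> enat m" unfolding sep_base_def by (intro INF_lower) auto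
  then show "eSuc (sep_base T x y) \<le> enat n" unfolding m by (simp flip: eSuc_enat)
qed

lemma sep_dist_inv_branch: "x \<in> space M \<Longrightarrow> y \<in> space M \<Longrightarrow> sep_dist (inv_branch i x) (inv_branch i y) \<le> \<beta> * sep_dist x y"
  by (intro power_enat_eSuc sep_base_inv_branch)

text \<open>
  The transfer operator of the return map, with a weight \<open>V i\<close> on the branch \<open>i\<close>. Weights 0 and 1
  select the branches with a given return time or a single cylinder, and the weights \<open>x ^ R\<close> serve
  for exponential moments.
\<close>

definition transfer_op :: "(nat \<Rightarrow> ennreal) \<Rightarrow> ('a \<Rightarrow> ennreal) \<Rightarrow> 'a \<Rightarrow> ennreal" where
  "transfer_op V f y = (\<Sum>i. V i * (f (inv_branch i y) * inverse (ennreal (jac T (inv_branch i y)))))"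

lemma transfer_op_measurable[measurable]:
  assumes [measurable]: "f \<in> borel_measurable M"
  shows "transfer_op V f \<in> borel_measurable M"
  unfolding transfer_op_def by measurable

text \<open>
  Duality between the transfer operator and composition with the return map.
\<close>

lemma nn_integral_transfer_op:
  assumes [measurable]: "f \<in> borel_measurable M" "k \<in> borel_measurable M"
  shows "(\<integral>\<^sup>+y. transfer_op V f y * k y \<partial>M) = (\<integral>\<^sup>+z. V (idx z) * f z * k (ret T z) \<partial>M)"
proof -
  have "(\<integral>\<^sup>+y. transfer_op V f y * k y \<partial>M)
      = (\<integral>\<^sup>+y. (\<Sum>i. V i * (f (inv_branch i y) * inverse (ennreal (jac T (inv_branch i y)))) * k y) \<partial>M)"
    unfolding transfer_op_def by (simp only: ennreal_suminf_multc)
  also have "\<dots> = (\<Sum>i. \<integral>\<^sup>+y. V i * (f (inv_branch i y) * inverse (ennreal (jac T (inv_branch i y)))) * k y \<partial>M)"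
    by (rule nn_integral_suminf) measurable
  also have "\<dots> = (\<Sum>i. \<integral>\<^sup>+z. V i * f z * k (ret T z) * indicator (part T i) z \<partial>M)"
  proof (intro suminf_cong)
    fix i
    have "(\<integral>\<^sup>+y. V i * (f (inv_branch i y) * inverse (ennreal (jac T (inv_branch i y)))) * k y \<partial>M)
        = (\<integral>\<^sup>+z. indicator (part T i) z * ennreal (jac T z) *
            (V i * (f (inv_branch i (ret T z)) * inverse (ennreal (jac T (inv_branch i (ret T z))))) * k (ret T z)) \<partial>M)"
      by (rule nn_integral_branch) measurable
    also have "\<dots> = (\<integral>\<^sup>+z. V i * f z * k (ret T z) * indicator (part T i) z \<partial>M)"
    proof (rule nn_integral_cong_AE)
      show "AE z in M. indicator (part T i) z * ennreal (jac T z) *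
            (V i * (f (inv_branch i (ret T z)) * inverse (ennreal (jac T (inv_branch i (ret T z))))) * k (ret T z))
          = V i * f z * k (ret T z) * indicator (part T i) z"
        using jac_pos
      proof eventually_elim
        case (elim z)
        have J: "ennreal (jac T z) * inverse (ennreal (jac T z)) = 1"
          using elim by (simp add: inverse_ennreal ennreal_mult'[symmetric])
        show ?case
        proof (cases "z \<in> part T i")
          case True
          have "ennreal (jac T z) * (V i * (f z * inverse (ennreal (jac T z))) * k (ret T z)) =
              (ennreal (jac T z) * inverse (ennreal (jac T z))) * (V i * f z * k (ret T z))"
            by (simp only: mult_ac)
          with True J show ?thesis by (simp add: inv_branch_ret)
        qed simp
      qed
    qed
    finally show "(\<integral>\<^sup>+y. V i * (f (inv_branch i y) * inverse (ennreal (jac T (inv_branch i y)))) * k y \<partial>M)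
      = (\<integral>\<^sup>+z. V i * f z * k (ret T z) * indicator (part T i) z \<partial>M)" .
  qed
  also have "\<dots> = (\<integral>\<^sup>+z. (\<Sum>i. V i * f z * k (ret T z) * indicator (part T i) z) \<partial>M)"
    by (rule nn_integral_suminf[symmetric]) measurable
  also have "\<dots> = (\<integral>\<^sup>+z. V (idx z) * f z * k (ret T z) \<partial>M)"
  proof (rule nn_integral_cong_AE)
    show "AE z in M. (\<Sum>i. V i * f z * k (ret T z) * indicator (part T i) z) = V (idx z) * f z * k (ret T z)"
      using AE_good_base
    proof eventually_elim
      case (elim z)
      have "(\<Sum>i. V i * f z * k (ret T z) * indicator (part T i) z) =
          (\<Sum>i\<in>{idx z}. V i * f z * k (ret T z) * indicator (part T i) z)"
        using idx_eq[OF elim] by (intro suminf_finite) (auto simp: indicator_def)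
      then show ?case using idx_in[OF elim] by simp
    qed
  qed
  finally show ?thesis .
qed

text \<open>
  Up to the value 0, the logarithm of \<open>f\<close> is Lipschitz with constant \<open>\<kappa>\<close> for the metric
  \<open>\<beta> ^ s(x, y)\<close>. The formulation without logarithms makes stability under sums and limits obvious.
\<close>

definition reg :: "real \<Rightarrow> ('a \<Rightarrow> ennreal) \<Rightarrow> bool" where
  "reg \<kappa> f \<longleftrightarrow> f \<in> borel_measurable M \<and> (\<forall>x\<in>G. \<forall>y\<in>G. f x \<le> ennreal (exp (\<kappa> * sep_dist x y)) * f y)"

lemma reg_measurable[measurable_dest]: "reg \<kappa> f \<Longrightarrow> f \<in> borel_measurable M"
  by (simp add: reg_def)

lemma regD: "reg \<kappa> f \<Longrightarrow> x \<in> G \<Longrightarrow> y \<in> G \<Longrightarrow> f x \<le> ennreal (exp (\<kappa> * sep_dist x y)) * f y"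
  by (simp add: reg_def)

lemma reg_mono:
  assumes "reg \<kappa> f" "\<kappa> \<le> \<kappa>'" shows "reg \<kappa>' f"
  unfolding reg_def
proof (intro conjI ballI)
  show "f \<in> borel_measurable M" using assms by (simp add: reg_def)
  fix x y assume xy: "x \<in> G" "y \<in> G"
  have "f x \<le> ennreal (exp (\<kappa> * sep_dist x y)) * f y" using assms xy by (simp add: reg_def)
  also have "\<dots> \<le> ennreal (exp (\<kappa>' * sep_dist x y)) * f y"
    using assms power_enat_bounds by (intro mult_right_mono ennreal_leI) (auto intro!: mult_right_mono)
  finally show "f x \<le> ennreal (exp (\<kappa>' * sep_dist x y)) * f y" .
qed

lemma reg_const: "0 \<le> \<kappa> \<Longrightarrow> reg \<kappa> (\<lambda>_. a)"
  unfolding reg_def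
proof (intro conjI ballI)
  fix x y assume k: "0 \<le> \<kappa>"
  have "1 * a \<le> ennreal (exp (\<kappa> * sep_dist x y)) * a"
    using k power_enat_bounds by (intro mult_right_mono) (auto simp: ennreal_ge_1)
  then show "a \<le> ennreal (exp (\<kappa> * sep_dist x y)) * a" by simp
qed simp

lemma reg_sum: "(\<And>i. i \<in> I \<Longrightarrow> reg \<kappa> (f i)) \<Longrightarrow> reg \<kappa> (\<lambda>y. \<Sum>i\<in>I. f i y)"
  unfolding reg_def by (auto simp: sum_distrib_left intro!: sum_mono borel_measurable_sum)

lemma reg_suminf: "(\<And>i. reg \<kappa> (f i)) \<Longrightarrow> reg \<kappa> (\<lambda>y. \<Sum>i. f i y)"
  unfolding reg_def by (auto simp flip: ennreal_suminf_cmult intro!: suminf_le borel_measurable_suminf_order)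

text \<open>
  Bounded distortion in multiplicative form, by \<open>1 + u \<le> exp u\<close>.
\<close>

lemma inverse_jac_inv_branch:
  assumes "x \<in> G" "y \<in> G"
  shows "inverse (ennreal (jac T (inv_branch i x))) \<le> ennreal (exp (C\<^sub>0 * sep_dist x y)) * inverse (ennreal (jac T (inv_branch i y)))"
proof -
  have sp: "x \<in> space M" "y \<in> space M" using assms G_space by auto
  have g: "inv_branch i x \<in> part T i \<inter> good_base T" "inv_branch i y \<in> part T i \<inter> good_base T"
    using inv_branch_G[of _ i] G_good inv_branch_in[of _ i] sp assms by blast+
  have p: "0 < jac T (inv_branch i x)" "0 < jac T (inv_branch i y)" using g good_jac by auto
  have "jac T (inv_branch i y) / jac T (inv_branch i x) - 1 \<le> C\<^sub>0 * sep_dist y x"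
    using distortion[OF g(2,1)] sp by (simp add: ret_inv_branch)
  then have "jac T (inv_branch i y) / jac T (inv_branch i x) \<le> 1 + C\<^sub>0 * sep_dist x y" by (simp add: sep_base_commute)
  also have "\<dots> \<le> exp (C\<^sub>0 * sep_dist x y)" by (rule exp_ge_add_one_self)
  finally have "inverse (jac T (inv_branch i x)) \<le> exp (C\<^sub>0 * sep_dist x y) * inverse (jac T (inv_branch i y))"
    using p by (simp add: field_simps)
  then show ?thesis using p by (simp add: inverse_ennreal ennreal_mult'[symmetric] ennreal_leI)
qed

text \<open>
  An inverse branch contracts the metric by \<open>\<beta>\<close>, and the Jacobian contributes \<open>C\<^sub>0\<close>. The bound does
  not depend on the weights, which are constant on each branch.
\<close>

lemma reg_transfer_op:
  assumes f: "reg \<kappa> f" and k: "0 \<le> \<kappa>"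
  shows "reg (\<kappa> * \<beta> + C\<^sub>0) (transfer_op V f)"
  unfolding reg_def
proof (intro conjI ballI)
  show "transfer_op V f \<in> borel_measurable M" using reg_measurable[OF f] by measurable
  fix x y assume xy: "x \<in> G" "y \<in> G"
  let ?E = "ennreal (exp ((\<kappa> * \<beta> + C\<^sub>0) * sep_dist x y))"
  have "transfer_op V f x \<le> (\<Sum>i. ?E * (V i * (f (inv_branch i y) * inverse (ennreal (jac T (inv_branch i y))))))"
    unfolding transfer_op_def
  proof (intro suminf_le)
    fix i
    have "f (inv_branch i x) \<le> ennreal (exp (\<kappa> * sep_dist (inv_branch i x) (inv_branch i y))) * f (inv_branch i y)"
      by (intro regD[OF f] inv_branch_G xy)
    also have "\<dots> \<le> ennreal (exp (\<kappa> * \<beta> * sep_dist x y)) * f (inv_branch i y)"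
      using sep_dist_inv_branch[of x y i] G_space xy k
      by (intro mult_right_mono ennreal_leI) (auto simp: mult.assoc intro!: mult_left_mono)
    finally have "f (inv_branch i x) * inverse (ennreal (jac T (inv_branch i x))) \<le>
        (ennreal (exp (\<kappa> * \<beta> * sep_dist x y)) * f (inv_branch i y)) *
        (ennreal (exp (C\<^sub>0 * sep_dist x y)) * inverse (ennreal (jac T (inv_branch i y))))"
      by (intro mult_mono inverse_jac_inv_branch xy) auto
    also have "\<dots> = ?E * (f (inv_branch i y) * inverse (ennreal (jac T (inv_branch i y))))"
      by (simp add: distrib_right exp_add ennreal_mult' mult_ac)
    finally have "V i * (f (inv_branch i x) * inverse (ennreal (jac T (inv_branch i x)))) \<le>
        V i * (?E * (f (inv_branch i y) * inverse (ennreal (jac T (inv_branch i y)))))"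
      by (intro mult_left_mono) auto
    then show "V i * (f (inv_branch i x) * inverse (ennreal (jac T (inv_branch i x)))) \<le>
        ?E * (V i * (f (inv_branch i y) * inverse (ennreal (jac T (inv_branch i y)))))"
      by (simp only: mult.left_commute)
  qed auto
  then show "transfer_op V f x \<le> ?E * transfer_op V f y" unfolding transfer_op_def by simp
qed

definition c :: real where "c = measure M (space M)"

lemma c_pos: "c > 0" and c_eq: "emeasure M (space M) = ennreal c"
proof -
  show "emeasure M (space M) = ennreal c" by (simp add: c_def emeasure_eq_measure)
  then show "c > 0" using base_nonnull by (metis ennreal_less_zero_iff)
qed

text \<open>
  As the metric is bounded by 1, the values of a regular density are all comparable with each other
  and with its mean.
\<close>

lemma reg_upper:
  assumes f: "reg \<kappa> f" and k: "0 \<le> \<kappa>" and x: "x \<in> G"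
  shows "f x * ennreal c \<le> ennreal (exp \<kappa>) * (\<integral>\<^sup>+y. f y \<partial>M)"
proof -
  note [measurable] = reg_measurable[OF f]
  have "f x * ennreal c = (\<integral>\<^sup>+y. f x \<partial>M)" by (simp add: c_eq)
  also have "\<dots> \<le> (\<integral>\<^sup>+y. ennreal (exp \<kappa>) * f y \<partial>M)"
  proof (rule nn_integral_mono_AE)
    show "AE y in M. f x \<le> ennreal (exp \<kappa>) * f y" using AE_G
    proof eventually_elim
      case (elim y)
      have "f x \<le> ennreal (exp (\<kappa> * sep_dist x y)) * f y" by (rule regD[OF f x elim])
      also have "\<dots> \<le> ennreal (exp \<kappa>) * f y"
        using k power_enat_bounds by (intro mult_right_mono ennreal_leI) (auto intro!: mult_left_le)
      finally show ?case .
    qed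
  qed
  also have "\<dots> = ennreal (exp \<kappa>) * (\<integral>\<^sup>+y. f y \<partial>M)" by (rule nn_integral_cmult) measurable
  finally show ?thesis .
qed

lemma reg_lower:
  assumes f: "reg \<kappa> f" and k: "0 \<le> \<kappa>" and x: "x \<in> G"
  shows "(\<integral>\<^sup>+y. f y \<partial>M) \<le> ennreal (exp \<kappa>) * f x * ennreal c"
proof -
  have "(\<integral>\<^sup>+y. f y \<partial>M) \<le> (\<integral>\<^sup>+y. ennreal (exp \<kappa>) * f x \<partial>M)"
  proof (rule nn_integral_mono_AE)
    show "AE y in M. f y \<le> ennreal (exp \<kappa>) * f x" using AE_G
    proof eventually_elim
      case (elim y)
      have "f y \<le> ennreal (exp (\<kappa> * sep_dist y x)) * f x" by (rule regD[OF f elim x])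
      also have "\<dots> \<le> ennreal (exp \<kappa>) * f x"
        using k power_enat_bounds by (intro mult_right_mono ennreal_leI) (auto intro!: mult_left_le)
      finally show ?case .
    qed
  qed
  then show ?thesis by (simp add: c_eq)
qed

end

section \<open>Regeneration of regular densities\<close>

context distorted_tower
begin

text \<open>
  One application of a transfer operator replaces the constant \<open>\<kappa>\<close> by \<open>\<kappa> * \<beta> + C\<^sub>0\<close>, with fixed
  point \<open>C\<^sub>0 / (1 - \<beta>)\<close>. The value \<open>K\<close> is twice as large, and \<open>K1 > K\<close> is the constant that is
  mapped to \<open>K\<close>. The fraction \<open>eps\<close> is chosen such that removing \<open>eps\<close> times the mean from a density
  that is regular with constant \<open>K\<close> relaxes the constant to \<open>K1\<close> and not more.
\<close>

definition K :: real where "K = 2 * C\<^sub>0 / (1 - \<beta>)"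
definition K1 :: real where "K1 = K * (1 + \<beta>) / (2 * \<beta>)"
definition eps :: real where "eps = exp (- K) * ((1 - \<beta>) / (1 + \<beta>))"

lemma K_pos: "0 < K" unfolding K_def using C\<^sub>0_pos \<beta>_less by simp
lemma K_le_K1: "K \<le> K1" unfolding K1_def using K_pos \<beta>_pos \<beta>_less by (simp add: field_simps)
lemma K1_pos: "0 < K1" using K_pos K_le_K1 by simp
lemma K1_step: "K1 * \<beta> + C\<^sub>0 = K"
  unfolding K1_def K_def using \<beta>_pos \<beta>_less by (simp add: field_simps)
lemma eps_pos: "0 < eps" unfolding eps_def using \<beta>_pos \<beta>_less by simp
lemma eps_less: "eps < 1"
proof -
  have "exp (- K) < 1" using K_pos by simp
  moreover have "0 < (1 - \<beta>) / (1 + \<beta>)" "(1 - \<beta>) / (1 + \<beta>) < 1" using \<beta>_pos \<beta>_less by auto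
  ultimately have "exp (- K) * ((1 - \<beta>) / (1 + \<beta>)) < 1 * 1" by (intro mult_strict_mono) auto
  then show ?thesis by (simp add: eps_def)
qed

lemma reg_transfer_op_K: "reg K1 f \<Longrightarrow> reg K (transfer_op V f)"
  using reg_transfer_op[of K1 f V] K1_pos K1_step by simp

lemma reg_finite:
  assumes f: "reg \<kappa> f" "0 \<le> \<kappa>" and fin: "(\<integral>\<^sup>+y. f y \<partial>M) < \<infinity>" and x: "x \<in> G"
  shows "f x < \<infinity>"
proof -
  have "f x * ennreal c < \<infinity>"
    by (rule le_less_trans[OF reg_upper[OF f x]]) (use fin in \<open>simp add: ennreal_mult_less_top\<close>)
  then show ?thesis using c_pos by (auto simp: ennreal_mult_less_top ennreal_mult_eq_top_iff top.not_eq_extremum split: if_splits)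
qed

definition regen_part :: "('a \<Rightarrow> ennreal) \<Rightarrow> ennreal" where
  "regen_part b = ennreal (eps / c) * (\<integral>\<^sup>+y. b y \<partial>M)"

text \<open>
  The two inequalities behind the choice of \<open>eps\<close>, where \<open>A\<close> and \<open>B\<close> are two values of a density
  with mean \<open>a\<close> and \<open>\<delta>\<close> is given by \<open>K1 = (1 + \<delta>) K\<close>: the part removed is at most \<open>\<delta>\<close> times what
  remains, and \<open>exp u + \<delta> (exp u - 1) \<le> exp ((1 + \<delta>) u)\<close>.
\<close>

lemma exp_shift_real:
  fixes a A B d :: real
  assumes B: "B \<le> exp (K * d) * A" and A: "exp (- K) * a \<le> A" and a: "0 \<le> a" and d: "0 \<le> d"
  shows "B - eps * a \<le> exp (K1 * d) * (A - eps * a)"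
proof -
  define \<delta> where "\<delta> = (1 - \<beta>) / (2 * \<beta>)"
  have \<delta>: "\<delta> > 0" using \<beta>_pos \<beta>_less by (simp add: \<delta>_def)
  have K1: "K1 = K * (1 + \<delta>)" using \<beta>_pos unfolding K1_def \<delta>_def by (simp add: field_simps)
  have eps: "eps * (1 + \<delta>) = exp (- K) * \<delta>"
    using \<beta>_pos \<beta>_less unfolding eps_def \<delta>_def by (simp add: divide_simps)
  define u where "u = K * d"
  have u: "u \<ge> 0" using K_pos d by (simp add: u_def)
  \<comment> \<open>the part removed is small compared with what remains\<close>
  have 1: "eps * a \<le> \<delta> * (A - eps * a)"
  proof -
    have "eps * a * (1 + \<delta>) = \<delta> * (exp (- K) * a)" using eps by (simp add: mult_ac)
    also have "\<dots> \<le> \<delta> * A" using A \<delta> by (intro mult_left_mono) auto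
    finally show ?thesis by (simp add: algebra_simps)
  qed
  have A0: "0 \<le> A - eps * a"
  proof -
    have "eps * a \<le> exp (- K) * a" using a \<beta>_pos \<beta>_less unfolding eps_def
      by (intro mult_right_mono mult_left_le) auto
    with A show ?thesis by simp
  qed
  have 2: "exp u + \<delta> * (exp u - 1) \<le> exp ((1 + \<delta>) * u)"
  proof -
    have "1 - u \<le> exp (- u)" using exp_ge_add_one_self[of "- u"] by simp
    then have "exp u * (1 - u) \<le> exp u * exp (- u)" by (intro mult_left_mono) auto
    then have "exp u - 1 \<le> exp u * u" by (simp add: exp_minus algebra_simps)
    then have "\<delta> * (exp u - 1) \<le> \<delta> * (exp u * u)" using \<delta> by (intro mult_left_mono) auto
    also have "\<dots> = exp u * (\<delta> * u)" by simp
    also have "\<dots> \<le> exp u * (exp (\<delta> * u) - 1)"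
    proof (intro mult_left_mono)
      show "\<delta> * u \<le> exp (\<delta> * u) - 1" using exp_ge_add_one_self[of "\<delta> * u"] by linarith
    qed simp
    finally show ?thesis by (simp add: algebra_simps flip: exp_add)
  qed
  have "B - eps * a \<le> exp u * (A - eps * a) + eps * a * (exp u - 1)" using B by (simp add: u_def algebra_simps)
  also have "\<dots> \<le> exp u * (A - eps * a) + \<delta> * (A - eps * a) * (exp u - 1)"
    using 1 u by (intro add_left_mono mult_right_mono) auto
  also have "\<dots> = (exp u + \<delta> * (exp u - 1)) * (A - eps * a)" by (simp add: algebra_simps)
  also have "\<dots> \<le> exp ((1 + \<delta>) * u) * (A - eps * a)" using 2 A0 by (intro mult_right_mono) auto
  also have "(1 + \<delta>) * u = K1 * d" by (simp add: K1 u_def)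
  finally show ?thesis .
qed

lemma
  assumes b: "reg K b" and fin: "(\<integral>\<^sup>+y. b y \<partial>M) < \<infinity>"
  shows regen_part_le: "y \<in> G \<Longrightarrow> regen_part b \<le> b y" and reg_minus_regen_part: "reg K1 (\<lambda>y. b y - regen_part b)"
proof -
  define m where "m = enn2real (\<integral>\<^sup>+y. b y \<partial>M)"
  have m: "(\<integral>\<^sup>+y. b y \<partial>M) = ennreal m" "0 \<le> m" using fin by (auto simp: m_def)
  define a where "a = m / c"
  have a: "0 \<le> a" using m c_pos by (simp add: a_def)
  have rp: "regen_part b = ennreal (eps * a)"
    using m c_pos eps_pos by (simp add: regen_part_def a_def ennreal_mult'[symmetric])
  have real: "\<exists>B. b y = ennreal B \<and> 0 \<le> B \<and> exp (- K) * a \<le> B" if y: "y \<in> G" for y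
  proof -
    have "b y < \<infinity>" using reg_finite[OF b _ fin y] K_pos by simp
    then obtain B where B: "b y = ennreal B" "0 \<le> B" by (metis ennreal_cases infinity_ennreal_def less_irrefl)
    have "ennreal m \<le> ennreal (exp K) * ennreal B * ennreal c"
      using reg_lower[OF b _ y] K_pos m B by simp
    then have "m \<le> exp K * B * c" using B c_pos by (simp add: ennreal_mult'[symmetric])
    then have "exp (- K) * a \<le> B" using c_pos by (simp add: a_def exp_minus field_simps)
    with B show ?thesis by blast
  qed
  have eps_a: "eps * a \<le> exp (- K) * a" using a \<beta>_pos \<beta>_less unfolding eps_def
      by (intro mult_right_mono mult_left_le) auto
  show "regen_part b \<le> b y" if "y \<in> G" for y
    using real[OF that] eps_a a eps_pos by (auto simp: rp intro!: ennreal_leI)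
  show "reg K1 (\<lambda>y. b y - regen_part b)"
    unfolding reg_def
  proof (intro conjI ballI)
    show "(\<lambda>y. b y - regen_part b) \<in> borel_measurable M" using reg_measurable[OF b] by measurable
    fix x y assume xy: "x \<in> G" "y \<in> G"
    obtain B A where B: "b x = ennreal B" "0 \<le> B" "exp (- K) * a \<le> B"
      and A: "b y = ennreal A" "0 \<le> A" "exp (- K) * a \<le> A" using real xy by blast
    have "ennreal B \<le> ennreal (exp (K * sep_dist x y)) * ennreal A" using regD[OF b xy] A B by simp
    then have "B \<le> exp (K * sep_dist x y) * A" using A by (simp add: ennreal_mult'[symmetric])
    then have "B - eps * a \<le> exp (K1 * sep_dist x y) * (A - eps * a)"
      by (rule exp_shift_real) (use A a power_enat_bounds in auto)
    then show "b x - regen_part b \<le> ennreal (exp (K1 * sep_dist x y)) * (b y - regen_part b)"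
      unfolding A B rp using A B a eps_pos eps_a
      by (simp add: ennreal_minus ennreal_mult'[symmetric] ennreal_leI)
  qed
qed

text \<open>
  The common value of the return time on a part of the partition, so that it can be used as a weight
  of \<open>transfer_op\<close>.
\<close>

definition branch_time :: "nat \<Rightarrow> nat" where "branch_time i = rtime T (SOME x. x \<in> part T i)"

lemma branch_time_eq: "x \<in> part T i \<Longrightarrow> rtime T x = branch_time i"
  unfolding branch_time_def by (rule rtime_const[where i = i]) (auto intro: someI)

lemma rtime_idx: "z \<in> good_base T \<Longrightarrow> rtime T z = branch_time (idx z)"
  using branch_time_eq idx_in by blast

definition L :: "nat \<Rightarrow> ('a \<Rightarrow> ennreal) \<Rightarrow> 'a \<Rightarrow> ennreal" where
  "L k f = transfer_op (\<lambda>i. if branch_time i = k then 1 else 0) f"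

lemma L_measurable[measurable]:
  assumes [measurable]: "f \<in> borel_measurable M" shows "L k f \<in> borel_measurable M"
  unfolding L_def by measurable

lemma nn_integral_L:
  assumes [measurable]: "f \<in> borel_measurable M" "k \<in> borel_measurable M"
  shows "(\<integral>\<^sup>+y. L n f y * k y \<partial>M) = (\<integral>\<^sup>+z. indicator {z. rtime T z = n} z * f z * k (ret T z) \<partial>M)"
  unfolding L_def nn_integral_transfer_op[OF assms]
proof (rule nn_integral_cong_AE)
  show "AE z in M. (if branch_time (idx z) = n then 1 else 0) * f z * k (ret T z) = indicator {z. rtime T z = n} z * f z * k (ret T z)"
    using AE_good_base by eventually_elim (simp add: rtime_idx indicator_def)
qed

lemma nn_integral_L_le:
  assumes [measurable]: "f \<in> borel_measurable M"
  shows "(\<integral>\<^sup>+y. L n f y \<partial>M) \<le> (\<integral>\<^sup>+z. f z \<partial>M)"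
proof -
  have "(\<integral>\<^sup>+y. L n f y \<partial>M) = (\<integral>\<^sup>+z. indicator {z. rtime T z = n} z * f z \<partial>M)"
    using nn_integral_L[of f "\<lambda>_. 1" n] by simp
  also have "\<dots> \<le> (\<integral>\<^sup>+z. f z \<partial>M)" by (intro nn_integral_mono) (auto simp: indicator_def)
  finally show ?thesis .
qed

text \<open>
  The splitting of the mass started from the density \<open>f\<close> at time 0. At time \<open>n\<close> the mass that
  arrives at the base without having regenerated before has density \<open>arriving f n\<close>; of this the constant
  \<open>regenerated f n\<close> regenerates and the residual density \<open>residual f n\<close> goes on. At time 0 nothing regenerates.
\<close>

function residual :: "('a \<Rightarrow> ennreal) \<Rightarrow> nat \<Rightarrow> 'a \<Rightarrow> ennreal" where
  "residual f n = (if n = 0 then f else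
     (\<lambda>y. (\<Sum>k<n. L (n - k) (residual f k) y) - regen_part (\<lambda>y. \<Sum>k<n. L (n - k) (residual f k) y)))"
  by auto
termination by (relation "Wellfounded.measure snd") auto
declare residual.simps[simp del]

definition arriving :: "('a \<Rightarrow> ennreal) \<Rightarrow> nat \<Rightarrow> 'a \<Rightarrow> ennreal" where
  "arriving f n y = (\<Sum>k<n. L (n - k) (residual f k) y)"
definition regenerated :: "('a \<Rightarrow> ennreal) \<Rightarrow> nat \<Rightarrow> ennreal" where
  "regenerated f n = regen_part (arriving f n)"

lemma residual_0: "residual f 0 = f" by (subst residual.simps) simp
lemma residual_pos: "n > 0 \<Longrightarrow> residual f n = (\<lambda>y. arriving f n y - regenerated f n)"
  by (subst residual.simps) (simp add: arriving_def[abs_def] regenerated_def)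

text \<open>
  Every arriving density is in the range of a transfer operator, hence regular with the smaller
  constant \<open>K\<close>; this is what allows the next splitting.
\<close>

lemma reg_arriving_aux:
  assumes "\<And>k. k < n \<Longrightarrow> reg K1 (residual f k) \<and> (\<integral>\<^sup>+y. residual f k y \<partial>M) < \<infinity>"
  shows "reg K (arriving f n)" "(\<integral>\<^sup>+y. arriving f n y \<partial>M) < \<infinity>"
proof -
  have m: "residual f k \<in> borel_measurable M" if "k < n" for k
    using reg_measurable[OF conjunct1[OF assms[OF that]]] .
  have "reg K (L (n - k) (residual f k))" if "k \<in> {..<n}" for k
    unfolding L_def using that by (intro reg_transfer_op_K conjunct1[OF assms]) simp
  then have "reg K (\<lambda>y. \<Sum>k<n. L (n - k) (residual f k) y)"
    by (rule reg_sum)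
  then show "reg K (arriving f n)" by (simp add: arriving_def[abs_def])
  have "(\<integral>\<^sup>+y. arriving f n y \<partial>M) = (\<Sum>k<n. \<integral>\<^sup>+y. L (n - k) (residual f k) y \<partial>M)"
    unfolding arriving_def using m by (intro nn_integral_sum) auto
  also have "\<dots> \<le> (\<Sum>k<n. \<integral>\<^sup>+y. residual f k y \<partial>M)"
    using m by (intro sum_mono nn_integral_L_le) auto
  also have "\<dots> < \<infinity>"
    using conjunct2[OF assms] unfolding infinity_ennreal_def
    by (subst ennreal_sum_less_top[OF finite_lessThan]) blast
  finally show "(\<integral>\<^sup>+y. arriving f n y \<partial>M) < \<infinity>" .
qed

lemma residual_reg:
  assumes f: "reg K1 f" "(\<integral>\<^sup>+y. f y \<partial>M) < \<infinity>"
  shows "reg K1 (residual f n)" "(\<integral>\<^sup>+y. residual f n y \<partial>M) < \<infinity>"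
proof -
  have "reg K1 (residual f n) \<and> (\<integral>\<^sup>+y. residual f n y \<partial>M) < \<infinity>"
  proof (induction n rule: less_induct)
    case (less n)
    have b: "reg K (arriving f n)" "(\<integral>\<^sup>+y. arriving f n y \<partial>M) < \<infinity>"
      by (rule reg_arriving_aux; rule less; assumption)+
    show ?case
    proof (cases "n = 0")
      case False
      then have w: "residual f n = (\<lambda>y. arriving f n y - regen_part (arriving f n))" using residual_pos[of n f] by (simp add: regenerated_def)
      have "(\<integral>\<^sup>+y. arriving f n y - regen_part (arriving f n) \<partial>M) \<le> (\<integral>\<^sup>+y. arriving f n y \<partial>M)"
        by (intro nn_integral_mono) (simp add: diff_le_self_ennreal)
      then have "(\<integral>\<^sup>+y. arriving f n y - regen_part (arriving f n) \<partial>M) < \<infinity>" using b(2) by (rule le_less_trans)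
      then show ?thesis unfolding w using reg_minus_regen_part[OF b] by blast
    qed (use f in \<open>simp add: residual_0\<close>)
  qed
  then show "reg K1 (residual f n)" "(\<integral>\<^sup>+y. residual f n y \<partial>M) < \<infinity>" by auto
qed

lemma arriving_reg:
  assumes f: "reg K1 f" "(\<integral>\<^sup>+y. f y \<partial>M) < \<infinity>"
  shows "reg K (arriving f n)" "(\<integral>\<^sup>+y. arriving f n y \<partial>M) < \<infinity>"
proof -
  have "reg K1 (residual f k) \<and> (\<integral>\<^sup>+y. residual f k y \<partial>M) < \<infinity>" if "k < n" for k
    using residual_reg[OF f] by blast
  then show "reg K (arriving f n)" "(\<integral>\<^sup>+y. arriving f n y \<partial>M) < \<infinity>"
    using reg_arriving_aux[of n f] by blast+
qed

lemma arriving_split: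
  assumes f: "reg K1 f" "(\<integral>\<^sup>+y. f y \<partial>M) < \<infinity>" and n: "n > 0" and y: "y \<in> G"
  shows "arriving f n y = residual f n y + regenerated f n"
proof -
  have "regenerated f n \<le> arriving f n y" unfolding regenerated_def by (rule regen_part_le[OF arriving_reg[OF f] y])
  moreover have "arriving f n y < \<infinity>"
    by (rule reg_finite[OF arriving_reg(1)[OF f] less_imp_le[OF K_pos] arriving_reg(2)[OF f] y])
  ultimately show ?thesis unfolding residual_pos[OF n]
    by (intro diff_add_cancel_ennreal[symmetric])
qed

section \<open>Orbits in the tower\<close>

definition level_meas :: "('a \<times> nat \<Rightarrow> ennreal) \<Rightarrow> bool" where
  "level_meas \<phi> \<longleftrightarrow> (\<forall>l. (\<lambda>z. \<phi> (z, l)) \<in> borel_measurable M)"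

lemma level_meas_funpow:
  assumes "level_meas \<phi>" shows "(\<lambda>z. \<phi> ((tower_map T ^^ n) (z, l))) \<in> borel_measurable M"
proof (induction n arbitrary: l)
  case 0
  then show ?case using assms by (simp add: level_meas_def)
next
  case (Suc n)
  have [measurable]: "(\<lambda>z. \<phi> ((tower_map T ^^ n) (z, l + 1))) \<in> borel_measurable M"
    "(\<lambda>z. \<phi> ((tower_map T ^^ n) (z, 0))) \<in> borel_measurable M" by (fact Suc)+
  have [measurable]: "(\<lambda>z. \<phi> ((tower_map T ^^ n) (ret T z, 0))) \<in> borel_measurable M"
    by (rule measurable_compose[OF ret_measurable Suc])
  have eq: "(\<lambda>z. \<phi> ((tower_map T ^^ Suc n) (z, l))) =
    (\<lambda>z. if l + 1 < rtime T z then \<phi> ((tower_map T ^^ n) (z, l + 1)) else \<phi> ((tower_map T ^^ n) (ret T z, 0)))"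
    unfolding funpow_Suc_right comp_def by (intro ext) simp
  show ?case unfolding eq by measurable
qed

text \<open>
  Climb to the top of the column, then continue from the base.
\<close>

lemma tower_orbit:
  assumes "l < rtime T z"
  shows "(tower_map T ^^ n) (z, l) =
    (if l + n < rtime T z then (z, l + n) else (tower_map T ^^ (n - (rtime T z - l))) (ret T z, 0))"
  using assms
proof (induction n arbitrary: l)
  case (Suc n)
  show ?case
  proof (cases "l + 1 < rtime T z")
    case True
    have "(tower_map T ^^ Suc n) (z, l) = (tower_map T ^^ n) (z, l + 1)"
      using True by (simp only: funpow_Suc_right comp_def tower_map.simps if_True)
    also have "\<dots> = (if l + 1 + n < rtime T z then (z, l + 1 + n) else (tower_map T ^^ (n - (rtime T z - (l + 1)))) (ret T z, 0))"
      by (rule Suc.IH[OF True])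
    also have "n - (rtime T z - (l + 1)) = Suc n - (rtime T z - l)" using True by linarith
    finally show ?thesis by simp
  next
    case False
    then have R: "rtime T z = l + 1" using Suc.prems by simp
    have "(tower_map T ^^ Suc n) (z, l) = (tower_map T ^^ n) (ret T z, 0)"
      using False by (simp only: funpow_Suc_right comp_def tower_map.simps if_False)
    then show ?thesis using R by simp
  qed
qed simp

text \<open>
  The integral of \<open>\<phi>\<close> at time \<open>n\<close> against a density on the base, and the part of it that has not
  returned to the base up to time \<open>n\<close>.
\<close>

definition I :: "('a \<times> nat \<Rightarrow> ennreal) \<Rightarrow> nat \<Rightarrow> ('a \<Rightarrow> ennreal) \<Rightarrow> ennreal" where
  "I \<phi> n f = (\<integral>\<^sup>+z. \<phi> ((tower_map T ^^ n) (z, 0)) * f z \<partial>M)"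
definition H :: "('a \<times> nat \<Rightarrow> ennreal) \<Rightarrow> nat \<Rightarrow> ('a \<Rightarrow> ennreal) \<Rightarrow> ennreal" where
  "H \<phi> n f = (\<integral>\<^sup>+z. indicator {z. n < rtime T z} z * \<phi> (z, n) * f z \<partial>M)"

lemma return_set[measurable]: "Measurable.pred M (\<lambda>z. z \<in> {z. rtime T z = n})" "Measurable.pred M (\<lambda>z. z \<in> {z. n < rtime T z})"
  by simp_all

text \<open>
  Decomposition according to the time of the first return to the base.
\<close>

lemma I_rec:
  assumes \<phi>: "level_meas \<phi>" and f[measurable]: "f \<in> borel_measurable M"
  shows "I \<phi> n f = H \<phi> n f + (\<Sum>k=1..n. I \<phi> (n - k) (L k f))"
proof -
  note [measurable] = level_meas_funpow[OF \<phi>] measurable_compose[OF ret_measurable level_meas_funpow[OF \<phi>]]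
  have [measurable]: "(\<lambda>z. \<phi> (z, n)) \<in> borel_measurable M" using \<phi> by (simp add: level_meas_def)
  have "I \<phi> n f = (\<integral>\<^sup>+z. indicator {z. n < rtime T z} z * \<phi> (z, n) * f z +
     (\<Sum>k=1..n. indicator {z. rtime T z = k} z * f z * \<phi> ((tower_map T ^^ (n - k)) (ret T z, 0))) \<partial>M)"
    unfolding I_def
  proof (intro nn_integral_cong)
    fix z assume "z \<in> space M"
    then have R: "0 < rtime T z" by (rule rtime_pos)
    show "\<phi> ((tower_map T ^^ n) (z, 0)) * f z = indicator {z. n < rtime T z} z * \<phi> (z, n) * f z +
     (\<Sum>k=1..n. indicator {z. rtime T z = k} z * f z * \<phi> ((tower_map T ^^ (n - k)) (ret T z, 0)))"
    proof (cases "n < rtime T z")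
      case True
      then have "(\<Sum>k=1..n. indicator {z. rtime T z = k} z * f z * \<phi> ((tower_map T ^^ (n - k)) (ret T z, 0))) = 0"
        by (intro sum.neutral) auto
      then show ?thesis using True tower_orbit[OF R, of n] by simp
    next
      case False
      have "(\<Sum>k=1..n. indicator {z. rtime T z = k} z * f z * \<phi> ((tower_map T ^^ (n - k)) (ret T z, 0)))
          = (\<Sum>k\<in>{rtime T z}. indicator {z. rtime T z = k} z * f z * \<phi> ((tower_map T ^^ (n - k)) (ret T z, 0)))"
        using False R by (intro sum.mono_neutral_right) auto
      then show ?thesis using False tower_orbit[OF R, of n] by (simp add: mult.commute)
    qed
  qed
  also have "\<dots> = H \<phi> n f + (\<Sum>k=1..n. (\<integral>\<^sup>+z. indicator {z. rtime T z = k} z * f z * \<phi> ((tower_map T ^^ (n - k)) (ret T z, 0)) \<partial>M))"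
    unfolding H_def by (subst nn_integral_add) (auto simp: nn_integral_sum)
  also have "(\<Sum>k=1..n. (\<integral>\<^sup>+z. indicator {z. rtime T z = k} z * f z * \<phi> ((tower_map T ^^ (n - k)) (ret T z, 0)) \<partial>M))
      = (\<Sum>k=1..n. I \<phi> (n - k) (L k f))"
    unfolding I_def by (intro sum.cong refl, subst nn_integral_L[symmetric]) (auto simp: mult.commute)
  finally show ?thesis .
qed

text \<open>
  The contribution at time \<open>n\<close> of all residual densities that are still in the column they entered
  last.
\<close>

definition h :: "('a \<times> nat \<Rightarrow> ennreal) \<Rightarrow> ('a \<Rightarrow> ennreal) \<Rightarrow> nat \<Rightarrow> ennreal" where
  "h \<phi> f n = (\<Sum>j\<le>n. H \<phi> (n - j) (residual f j))"

lemma sum_triangle_shift: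
  fixes F :: "nat \<Rightarrow> nat \<Rightarrow> 'b :: comm_monoid_add"
  shows "(\<Sum>j\<le>n. \<Sum>k=1..n - j. F j k) = (\<Sum>m=1..n. \<Sum>j<m. F j (m - j))"
  unfolding sum.Sigma[OF finite_atMost ballI[OF finite_atLeastAtMost]]
    sum.Sigma[OF finite_atLeastAtMost ballI[OF finite_lessThan]]
  by (rule sum.reindex_bij_witness[of _ "\<lambda>(m, j). (j, m - j)" "\<lambda>(j, k). (j + k, j)"]) auto

lemma I_sum:
  assumes "level_meas \<phi>" "\<And>i. i \<in> J \<Longrightarrow> f i \<in> borel_measurable M"
  shows "I \<phi> n (\<lambda>y. \<Sum>i\<in>J. f i y) = (\<Sum>i\<in>J. I \<phi> n (f i))"
  unfolding I_def sum_distrib_left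
  by (rule nn_integral_sum) (use level_meas_funpow[OF assms(1)] assms(2) in auto)

text \<open>
  Apply the decomposition by first returns to all residual densities and collect the returns at time
  \<open>m\<close>. They add up to the arriving density, which is the sum of the next residual density and of a
  constant. The residual terms occur on both sides and cancel.
\<close>

theorem regeneration:
  assumes \<phi>: "level_meas \<phi>" "\<And>x. \<phi> x \<le> 1" and f: "reg K1 f" "(\<integral>\<^sup>+y. f y \<partial>M) < \<infinity>"
  shows "I \<phi> n f = h \<phi> f n + (\<Sum>m=1..n. regenerated f m * I \<phi> (n - m) (\<lambda>_. 1))"
proof -
  have wm[measurable]: "residual f j \<in> borel_measurable M" for j using residual_reg[OF f] reg_measurable by blast
  have Ifin: "I \<phi> k (residual f j) < \<infinity>" for k j
  proof -
    have "I \<phi> k (residual f j) \<le> (\<integral>\<^sup>+z. 1 * residual f j z \<partial>M)"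
      unfolding I_def by (intro nn_integral_mono mult_right_mono \<phi>(2)) auto
    then show ?thesis using residual_reg(2)[OF f, of j] by (simp add: le_less_trans)
  qed
  have b: "I \<phi> (n - m) (arriving f m) = I \<phi> (n - m) (residual f m) + regenerated f m * I \<phi> (n - m) (\<lambda>_. 1)" if "m > 0" for m
  proof -
    have "I \<phi> (n - m) (arriving f m) = (\<integral>\<^sup>+z. \<phi> ((tower_map T ^^ (n - m)) (z, 0)) * residual f m z +
        regenerated f m * (\<phi> ((tower_map T ^^ (n - m)) (z, 0)) * 1) \<partial>M)"
      unfolding I_def
    proof (rule nn_integral_cong_AE)
      show "AE z in M. \<phi> ((tower_map T ^^ (n - m)) (z, 0)) * arriving f m z = \<phi> ((tower_map T ^^ (n - m)) (z, 0)) * residual f m z +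
        regenerated f m * (\<phi> ((tower_map T ^^ (n - m)) (z, 0)) * 1)"
        using AE_G by eventually_elim (simp add: arriving_split[OF f that] distrib_left mult_ac)
    qed
    also have "\<dots> = I \<phi> (n - m) (residual f m) + regenerated f m * I \<phi> (n - m) (\<lambda>_. 1)"
      unfolding I_def using level_meas_funpow[OF \<phi>(1)] by (subst nn_integral_add) (auto simp: nn_integral_cmult)
    finally show ?thesis .
  qed
  define S where "S = (\<Sum>m=1..n. I \<phi> (n - m) (residual f m))"
  have Sfin: "S < \<infinity>" unfolding S_def using Ifin by (simp add: ennreal_sum_less_top)
  have e1: "(\<Sum>j\<le>n. I \<phi> (n - j) (residual f j)) = I \<phi> n f + S"
  proof -
    have "{..n} = insert 0 {1..n}" by auto
    then show ?thesis unfolding S_def by (simp add: residual_0)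
  qed
  have e2: "(\<Sum>j\<le>n. I \<phi> (n - j) (residual f j)) =
      h \<phi> f n + (\<Sum>j\<le>n. \<Sum>k=1..n - j. I \<phi> (n - j - k) (L k (residual f j)))"
    unfolding h_def by (simp add: I_rec[OF \<phi>(1) wm] sum.distrib)
  have e3: "(\<Sum>j\<le>n. \<Sum>k=1..n - j. I \<phi> (n - j - k) (L k (residual f j)))
      = (\<Sum>m=1..n. I \<phi> (n - m) (arriving f m))"
    unfolding sum_triangle_shift arriving_def[abs_def]
    by (intro sum.cong refl, subst I_sum[OF \<phi>(1)]) (auto intro!: sum.cong)
  have e4: "(\<Sum>m=1..n. I \<phi> (n - m) (arriving f m)) = S + (\<Sum>m=1..n. regenerated f m * I \<phi> (n - m) (\<lambda>_. 1))"
    unfolding S_def by (simp add: b sum.distrib)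
  have "S + I \<phi> n f = S + (h \<phi> f n + (\<Sum>m=1..n. regenerated f m * I \<phi> (n - m) (\<lambda>_. 1)))"
    using e1 unfolding e2 e3 e4 by (metis add.commute add.left_commute)
  then show ?thesis using Sfin unfolding ennreal_add_left_cancel by auto
qed

end

section \<open>The distribution of the regeneration time\<close>

lemma ennreal_suminf_commute: "(\<Sum>n. \<Sum>j. F n j) = (\<Sum>j. \<Sum>n. F n j :: ennreal)"
  using nn_integral_suminf[of "\<lambda>j n. F n j" "count_space (UNIV :: nat set)"]
  by (simp add: nn_integral_count_space_nat)

lemma ennreal_suminf_triangle:
  fixes a :: "nat \<Rightarrow> nat \<Rightarrow> ennreal"
  shows "(\<Sum>n. \<Sum>j\<le>n. a j (n - j)) = (\<Sum>j. \<Sum>k. a j k)"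
proof -
  have "(\<Sum>n. \<Sum>j\<le>n. a j (n - j)) = (\<Sum>n. \<Sum>j. if j \<le> n then a j (n - j) else 0)"
  proof (rule suminf_cong)
    fix n
    have "(\<Sum>j. if j \<le> n then a j (n - j) else 0) = (\<Sum>j\<le>n. if j \<le> n then a j (n - j) else 0)"
      by (rule suminf_finite) auto
    then show "(\<Sum>j\<le>n. a j (n - j)) = (\<Sum>j. if j \<le> n then a j (n - j) else 0)" by simp
  qed
  also have "\<dots> = (\<Sum>j. \<Sum>n. if j \<le> n then a j (n - j) else 0)" by (rule ennreal_suminf_commute)
  also have "\<dots> = (\<Sum>j. \<Sum>k. a j k)"
  proof (rule suminf_cong)
    fix j
    have "(\<Sum>n. if j \<le> n then a j (n - j) else 0) =
        (\<Sum>n. if j \<le> n + j then a j (n + j - j) else 0) + (\<Sum>n<j. if j \<le> n then a j (n - j) else 0)"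
      by (rule suminf_offset) simp
    then show "(\<Sum>n. if j \<le> n then a j (n - j) else 0) = (\<Sum>k. a j k)" by simp
  qed
  finally show ?thesis .
qed

lemma enn2real_sum: "(\<And>i. i \<in> J \<Longrightarrow> f i < \<infinity>) \<Longrightarrow> enn2real (\<Sum>i\<in>J. f i) = (\<Sum>i\<in>J. enn2real (f i))"
proof (induction J rule: infinite_finite_induct)
  case (insert x F)
  then show ?case by (simp add: enn2real_plus ennreal_sum_less_top)
qed auto

context distorted_tower
begin

text \<open>
  The initial densities for which regeneration works.
\<close>

definition regular :: "('a \<Rightarrow> ennreal) \<Rightarrow> bool" where
  "regular f \<longleftrightarrow> reg K1 f \<and> (\<integral>\<^sup>+y. f y \<partial>M) < \<infinity>"

definition mass :: "('a \<Rightarrow> ennreal) \<Rightarrow> real" where "mass f = enn2real (\<integral>\<^sup>+y. f y \<partial>M)"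

text \<open>
  Real versions of the masses in the decomposition. With the constant observable 1 the quantity
  \<open>Z f n\<close> is the mass that has not regenerated by time \<open>n\<close> (\<open>mass_balance\<close>).
\<close>

definition W :: "('a \<Rightarrow> ennreal) \<Rightarrow> nat \<Rightarrow> real" where "W f n = mass (residual f n)"
definition P :: "('a \<Rightarrow> ennreal) \<Rightarrow> nat \<Rightarrow> real" where "P f n = enn2real (regenerated f n)"
definition hr :: "('a \<times> nat \<Rightarrow> ennreal) \<Rightarrow> ('a \<Rightarrow> ennreal) \<Rightarrow> nat \<Rightarrow> real" where "hr \<phi> f n = enn2real (h \<phi> f n)"
definition Ir :: "('a \<times> nat \<Rightarrow> ennreal) \<Rightarrow> nat \<Rightarrow> ('a \<Rightarrow> ennreal) \<Rightarrow> real" where "Ir \<phi> n f = enn2real (I \<phi> n f)"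
abbreviation Z :: "('a \<Rightarrow> ennreal) \<Rightarrow> nat \<Rightarrow> real" where "Z f n \<equiv> hr (\<lambda>_. 1) f n"
abbreviation one :: "'a \<Rightarrow> ennreal" where "one \<equiv> (\<lambda>_. 1)"

text \<open>
  The ratio of residual to regenerated mass at each arrival (\<open>W_eq\<close>).
\<close>

definition E :: real where "E = (1 - eps) / eps"

definition obs :: "('a \<times> nat \<Rightarrow> ennreal) \<Rightarrow> bool" where
  "obs \<phi> \<longleftrightarrow> level_meas \<phi> \<and> (\<forall>x. \<phi> x \<le> 1)"

lemma obs_le: "obs \<phi> \<Longrightarrow> \<phi> x \<le> 1"
  unfolding obs_def by blast

lemma obs_one: "obs (\<lambda>_. 1)" by (simp add: obs_def level_meas_def)

lemma E_nonneg: "0 \<le> E" unfolding E_def using eps_pos eps_less by simp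

lemma mass_nonneg: "0 \<le> mass f" by (simp add: mass_def)

lemma ennreal_mass: "regular f \<Longrightarrow> (\<integral>\<^sup>+y. f y \<partial>M) = ennreal (mass f)"
  by (simp add: mass_def regular_def)

lemma regular_one: "regular one"
  unfolding regular_def using reg_const[of K1 1] K1_pos by (simp add: c_eq)

lemma mass_one: "mass one = c" unfolding mass_def using c_pos by (simp add: c_eq)

lemma regular_residual: "regular f \<Longrightarrow> regular (residual f n)" unfolding regular_def using residual_reg by blast

lemma regular_measurable: "regular f \<Longrightarrow> f \<in> borel_measurable M" unfolding regular_def using reg_measurable by blast

lemma I_le: assumes "obs \<phi>" shows "I \<phi> n f \<le> (\<integral>\<^sup>+y. f y \<partial>M)"
proof -
  have "I \<phi> n f \<le> (\<integral>\<^sup>+z. 1 * f z \<partial>M)"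
    unfolding I_def using obs_le[OF assms] by (intro nn_integral_mono mult_right_mono) auto
  then show ?thesis by simp
qed

lemma I_finite: "obs \<phi> \<Longrightarrow> regular f \<Longrightarrow> I \<phi> n f < \<infinity>"
  using I_le[of \<phi> n f] by (auto simp: regular_def intro: le_less_trans)

lemma regeneration':
  assumes "obs \<phi>" "regular f"
  shows "I \<phi> n f = h \<phi> f n + (\<Sum>m=1..n. regenerated f m * I \<phi> (n - m) one)"
  using assms regeneration unfolding obs_def regular_def by blast

lemma h_finite: assumes "obs \<phi>" "regular f" shows "h \<phi> f n < \<infinity>"
proof -
  have "h \<phi> f n \<le> I \<phi> n f" unfolding regeneration'[OF assms] by simp
  then show ?thesis using I_finite[OF assms] by (rule le_less_trans)
qed

lemma arriving_finite: "regular f \<Longrightarrow> (\<integral>\<^sup>+y. arriving f n y \<partial>M) < \<infinity>"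
  unfolding regular_def using arriving_reg by blast

lemma regenerated_finite: assumes "regular f" shows "regenerated f n < \<infinity>"
  unfolding regenerated_def regen_part_def using arriving_finite[OF assms] by (simp add: ennreal_mult_less_top)

lemma P_nonneg: "0 \<le> P f n" by (simp add: P_def)

lemma regeneration_real:
  assumes "obs \<phi>" "regular f"
  shows "Ir \<phi> n f = hr \<phi> f n + (\<Sum>m=1..n. P f m * Ir \<phi> (n - m) one)"
proof -
  have fin: "regenerated f m * I \<phi> (n - m) one < \<infinity>" for m
    using regenerated_finite[OF assms(2), of m] I_finite[OF assms(1) regular_one, of "n - m"] by (simp add: ennreal_mult_less_top)
  then have "(\<Sum>m=1..n. regenerated f m * I \<phi> (n - m) one) < \<infinity>" by (simp add: ennreal_sum_less_top)
  then have "Ir \<phi> n f = hr \<phi> f n + enn2real (\<Sum>m=1..n. regenerated f m * I \<phi> (n - m) one)"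
    unfolding Ir_def hr_def regeneration'[OF assms] using h_finite[OF assms, of n] by (intro enn2real_plus) auto
  also have "enn2real (\<Sum>m=1..n. regenerated f m * I \<phi> (n - m) one) = (\<Sum>m=1..n. P f m * Ir \<phi> (n - m) one)"
    by (subst enn2real_sum) (use fin in \<open>auto simp: P_def Ir_def enn2real_mult\<close>)
  finally show ?thesis .
qed

lemma Ir_one: "Ir (\<lambda>_. 1) n f = mass f"
  unfolding Ir_def I_def mass_def by simp

text \<open>
  The regeneration identity for the observable 1: total mass is conserved.
\<close>

lemma mass_balance: "regular f \<Longrightarrow> mass f = Z f n + c * (\<Sum>m=1..n. P f m)"
  using regeneration_real[OF obs_one, of f n] by (simp add: Ir_one mass_one sum_distrib_left mult.commute)

lemma Z_nonneg: "0 \<le> Z f n" by (simp add: hr_def)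
lemma Z_0: "regular f \<Longrightarrow> Z f 0 = mass f" using mass_balance[of f 0] by simp
lemma Z_step: "regular f \<Longrightarrow> Z f n - Z f (Suc n) = c * P f (Suc n)"
  using mass_balance[of f n] mass_balance[of f "Suc n"] by (simp add: algebra_simps)
lemma Z_dec: "regular f \<Longrightarrow> Z f (Suc n) \<le> Z f n"
  using Z_step[of f n] P_nonneg[of f "Suc n"] c_pos by (metis diff_ge_0_iff_ge less_imp_le mult_nonneg_nonneg)
lemma Z_antimono: "regular f \<Longrightarrow> m \<le> n \<Longrightarrow> Z f n \<le> Z f m"
  by (rule lift_Suc_antimono_le[of "Z f"]) (auto intro: Z_dec)

lemma H_mono: "obs \<phi> \<Longrightarrow> H \<phi> n f \<le> H (\<lambda>_. 1) n f"
  unfolding H_def by (intro nn_integral_mono mult_right_mono mult_left_mono obs_le) auto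

lemma hr_le: assumes "obs \<phi>" "regular f" shows "hr \<phi> f n \<le> Z f n"
proof -
  have "h \<phi> f n \<le> h (\<lambda>_. 1) f n" unfolding h_def by (intro sum_mono H_mono assms)
  then show ?thesis unfolding hr_def using h_finite[OF obs_one assms(2)] by (intro enn2real_mono) auto
qed

lemma hr_nonneg: "0 \<le> hr \<phi> f n" by (simp add: hr_def)

lemma W_eq: assumes f: "regular f" and n: "n > 0" shows "W f n = E * (c * P f n)"
proof -
  define B where "B = mass (arriving f n)"
  have B: "(\<integral>\<^sup>+y. arriving f n y \<partial>M) = ennreal B" using arriving_finite[OF f, of n] by (simp add: B_def mass_def)
  have B0: "0 \<le> B" by (simp add: B_def mass_nonneg)
  have P: "P f n = eps / c * B"
    unfolding P_def regenerated_def regen_part_def B using eps_pos c_pos B0 by (simp add: enn2real_mult)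
  have [measurable]: "residual f n \<in> borel_measurable M" by (rule regular_measurable[OF regular_residual[OF f]])
  have "(\<integral>\<^sup>+y. arriving f n y \<partial>M) = (\<integral>\<^sup>+y. residual f n y + regenerated f n \<partial>M)"
    by (rule nn_integral_cong_AE) (use AE_G arriving_split[OF _ _ n] f in \<open>auto simp: regular_def\<close>)
  also have "\<dots> = (\<integral>\<^sup>+y. residual f n y \<partial>M) + regenerated f n * ennreal c" by (subst nn_integral_add) (auto simp: c_eq)
  finally have "ennreal B = ennreal (W f n) + ennreal (P f n) * ennreal c"
    unfolding B W_def P_def using ennreal_mass[OF regular_residual[OF f]] regenerated_finite[OF f, of n] by simp
  then have "ennreal B = ennreal (W f n + P f n * c)"
    using P_nonneg c_pos mass_nonneg by (simp add: W_def ennreal_mult'[symmetric])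
  then have "B = W f n + P f n * c"
    using B0 P_nonneg[of f n] c_pos mass_nonneg by (subst (asm) ennreal_inj) (auto simp: W_def)
  then have "W f n = (1 - eps) * B" unfolding P using c_pos by (simp add: algebra_simps)
  then show ?thesis unfolding P E_def using eps_pos c_pos by simp
qed

lemma emeasure_tail: "emeasure M {x \<in> space M. n < rtime T x} = ennreal (tail T n)"
  unfolding tail_def by (rule emeasure_eq_measure)

text \<open>
  A bound for the tail of the time that a regular density of mass 1 spends in its column.
\<close>

definition th :: "nat \<Rightarrow> real" where "th n = min 1 (exp K1 / c * tail T n)"

lemma tail_nonneg: "0 \<le> tail T n" by (simp add: tail_def)

lemma tail_antimono: "m \<le> n \<Longrightarrow> tail T n \<le> tail T m"
  unfolding tail_def by (intro finite_measure_mono) auto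

lemma th_bounds: "0 \<le> th n" "th n \<le> 1" "m \<le> n \<Longrightarrow> th n \<le> th m"
proof -
  show "0 \<le> th n" "th n \<le> 1" using c_pos tail_nonneg[of n] by (auto simp: th_def)
  show "th n \<le> th m" if "m \<le> n"
    unfolding th_def using tail_antimono[OF that] c_pos by (intro min.mono order_refl mult_left_mono) auto
qed

lemma reg_upper_mass:
  assumes f: "regular f" and x: "x \<in> G" shows "f x \<le> ennreal (exp K1 / c * mass f)"
proof -
  have fx: "f x < \<infinity>" using f x K1_pos reg_finite[of K1 f x] by (auto simp: regular_def)
  then obtain B where B: "f x = ennreal B" "0 \<le> B" by (metis ennreal_cases infinity_ennreal_def less_irrefl)
  have "f x * ennreal c \<le> ennreal (exp K1) * (\<integral>\<^sup>+y. f y \<partial>M)"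
    using f K1_pos x by (intro reg_upper) (auto simp: regular_def)
  then have "ennreal (B * c) \<le> ennreal (exp K1 * mass f)"
    unfolding ennreal_mass[OF f] B using B c_pos mass_nonneg by (simp add: ennreal_mult'[symmetric] ennreal_mult''[symmetric])
  then have "B * c \<le> exp K1 * mass f" using mass_nonneg by (subst (asm) ennreal_le_iff) auto
  then show ?thesis unfolding B using c_pos by (intro ennreal_leI) (simp add: field_simps)
qed

text \<open>
  A regular density is bounded by a multiple of its mass, so the part of it with large return time
  is controlled by the tail of \<open>R\<close>.
\<close>

lemma H_le: assumes w: "regular w" shows "H (\<lambda>_. 1) k w \<le> ennreal (th k * mass w)"
proof -
  have [measurable]: "w \<in> borel_measurable M" by (rule regular_measurable[OF w])
  have "H (\<lambda>_. 1) k w \<le> (\<integral>\<^sup>+z. w z \<partial>M)"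
    unfolding H_def by (intro nn_integral_mono) (auto simp: indicator_def)
  then have 1: "H (\<lambda>_. 1) k w \<le> ennreal (mass w)" using ennreal_mass[OF w] by simp
  have "H (\<lambda>_. 1) k w \<le> (\<integral>\<^sup>+z. ennreal (exp K1 / c * mass w) * indicator {x \<in> space M. k < rtime T x} z \<partial>M)"
    unfolding H_def
  proof (rule nn_integral_mono_AE)
    show "AE z in M. indicator {z. k < rtime T z} z * 1 * w z \<le> ennreal (exp K1 / c * mass w) * indicator {x \<in> space M. k < rtime T x} z"
      using AE_G AE_space by eventually_elim (use reg_upper_mass[OF w] in \<open>auto simp: indicator_def\<close>)
  qed
  also have "\<dots> = ennreal (exp K1 / c * mass w) * ennreal (tail T k)"
    unfolding emeasure_tail[symmetric] by (rule nn_integral_cmult_indicator) measurable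
  also have "\<dots> = ennreal (exp K1 / c * tail T k * mass w)"
    using mass_nonneg tail_nonneg c_pos by (simp add: ennreal_mult'[symmetric] mult_ac)
  finally have 2: "H (\<lambda>_. 1) k w \<le> ennreal (exp K1 / c * tail T k * mass w)" .
  show ?thesis using 1 2 by (auto simp: th_def min_def)
qed

lemma Z_rec_W: assumes f: "regular f" shows "Z f n \<le> (\<Sum>j\<le>n. W f j * th (n - j))"
proof -
  have "h (\<lambda>_. 1) f n \<le> (\<Sum>j\<le>n. ennreal (th (n - j) * W f j))"
    unfolding h_def W_def by (intro sum_mono H_le regular_residual f)
  also have "\<dots> = ennreal (\<Sum>j\<le>n. th (n - j) * W f j)"
    using th_bounds(1,2) mass_nonneg by (intro sum_ennreal) (auto simp: W_def)
  finally have "Z f n \<le> (\<Sum>j\<le>n. th (n - j) * W f j)"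
    unfolding hr_def using th_bounds(1,2) mass_nonneg by (intro enn2real_leI) (auto simp: W_def intro!: sum_nonneg)
  then show ?thesis by (simp add: mult.commute)
qed

text \<open>
  By \<open>W_eq\<close> the residual masses are multiples of the regenerated ones, which are the decrements of
  \<open>Z\<close>.
\<close>

lemma Z_rec: assumes f: "regular f"
  shows "Z f n \<le> Z f 0 * th n + E * (\<Sum>j=1..n. (Z f (j - 1) - Z f j) * th (n - j))"
proof -
  have "{..n} = insert 0 {1..n}" by auto
  then have "(\<Sum>j\<le>n. W f j * th (n - j)) = W f 0 * th n + (\<Sum>j=1..n. W f j * th (n - j))" by simp
  also have "W f 0 = Z f 0" using Z_0[OF f] by (simp add: W_def residual_0)
  also have "(\<Sum>j=1..n. W f j * th (n - j)) = E * (\<Sum>j=1..n. (Z f (j - 1) - Z f j) * th (n - j))"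
    unfolding sum_distrib_left
  proof (rule sum.cong[OF refl])
    fix j assume "j \<in> {1..n}"
    then have "Z f (j - 1) - Z f j = c * P f j" "j > 0" using Z_step[OF f, of "j - 1"] by auto
    then show "W f j * th (n - j) = E * ((Z f (j - 1) - Z f j) * th (n - j))" using W_eq[OF f] by simp
  qed
  finally show ?thesis using Z_rec_W[OF f, of n] by simp
qed

lemma suminf_indicator_less: "(\<Sum>n. indicator {z. n < r z} z :: ennreal) = of_nat (r z)"
proof -
  have "(\<Sum>n. indicator {z. n < r z} z :: ennreal) = (\<Sum>n<r z. indicator {z. n < r z} z)"
    by (rule suminf_finite) auto
  then show ?thesis by simp
qed

lemma tail_summable: "summable (tail T)"
proof -
  have "(\<Sum>n. ennreal (tail T n)) = (\<Sum>n. \<integral>\<^sup>+z. indicator {z. n < rtime T z} z \<partial>M)"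
  proof (rule suminf_cong)
    fix n
    have "(\<integral>\<^sup>+z. indicator {z. n < rtime T z} z \<partial>M) = (\<integral>\<^sup>+z. indicator {x \<in> space M. n < rtime T x} z \<partial>M)"
      by (intro nn_integral_cong) (auto simp: indicator_def)
    then show "ennreal (tail T n) = (\<integral>\<^sup>+z. indicator {z. n < rtime T z} z \<partial>M)" by (simp add: emeasure_tail)
  qed
  also have "\<dots> = (\<integral>\<^sup>+z. (\<Sum>n. indicator {z. n < rtime T z} z) \<partial>M)"
    by (rule nn_integral_suminf[symmetric]) measurable
  also have "\<dots> = (\<integral>\<^sup>+z. ennreal (real (rtime T z)) \<partial>M)" by (simp only: suminf_indicator_less ennreal_of_nat_eq_real_of_nat)
  also have "\<dots> < \<infinity>" using rtime_integrable by (simp add: integrable_iff_bounded)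
  finally show ?thesis by (intro summable_suminf_not_top tail_nonneg) auto
qed

lemma th_summable: "summable th"
  by (rule summable_comparison_test'[OF summable_mult[OF tail_summable, of "exp K1 / c"], where N = 0])
     (use th_bounds(1,2) in \<open>auto simp: th_def\<close>)

lemma Z_sum_le: assumes f: "regular f" shows "(\<Sum>n\<le>N. Z f n) \<le> 2 * suminf th * (1 + E) * Z f 0"
proof -
  have "(\<Sum>n\<le>N. Z f n * 1 ^ n) \<le> 2 * suminf th * (1 + E) * Z f 0"
  proof (rule regen_sum[OF th_bounds(1) E_nonneg Z_nonneg Z_dec[OF f] Z_rec[OF f]])
    show "(\<Sum>n\<le>N. th n * 1 ^ n) \<le> suminf th" for N
      using th_bounds(1,2) by (simp add: sum_le_suminf[OF th_summable])
  qed auto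
  then show ?thesis by simp
qed

text \<open>
  The tail of the regeneration time in the worst case over all regular initial densities.
\<close>

definition t :: "nat \<Rightarrow> real" where "t n = (SUP f\<in>{f. regular f \<and> 0 < Z f 0}. Z f n / Z f 0)"

lemma t_nonempty: "{f. regular f \<and> 0 < Z f 0} \<noteq> {}"
  using regular_one Z_0[OF regular_one] mass_one c_pos by auto

lemma t_bdd: "bdd_above ((\<lambda>f. Z f n / Z f 0) ` {f. regular f \<and> 0 < Z f 0})"
  by (rule bdd_aboveI2[where M = 1]) (use Z_antimono[of _ 0 n] in auto)

lemma Z_le_t: assumes f: "regular f" shows "Z f n \<le> Z f 0 * t n"
proof (cases "0 < Z f 0")
  case True
  then have "Z f n / Z f 0 \<le> t n" unfolding t_def using f by (intro cSUP_upper t_bdd) auto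
  then show ?thesis using True by (simp add: field_simps)
next
  case False
  then have "Z f 0 = 0" using Z_nonneg[of f 0] by simp
  then show ?thesis using Z_antimono[OF f, of 0 n] by simp
qed

lemma t_leI: assumes "\<And>f. regular f \<Longrightarrow> Z f n \<le> B * Z f 0" shows "t n \<le> B"
  unfolding t_def
proof (rule cSUP_least[OF t_nonempty])
  fix f assume "f \<in> {f. regular f \<and> 0 < Z f 0}"
  then have f: "regular f" "0 < Z f 0" by auto
  show "Z f n / Z f 0 \<le> B" using assms[OF f(1)] f(2) by (simp only: pos_divide_le_eq)
qed

lemma t_nonneg: "0 \<le> t n"
proof -
  have "0 \<le> c * t n" using Z_le_t[OF regular_one, of n] Z_nonneg[of one n] Z_0[OF regular_one] mass_one by simp
  then show ?thesis using c_pos by (simp add: zero_le_mult_iff)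
qed

lemma t_antimono: "m \<le> n \<Longrightarrow> t n \<le> t m"
  by (rule t_leI, rule order_trans[OF Z_antimono], assumption, assumption)
    (subst mult.commute, rule Z_le_t)

lemma t_tendsto: "t \<longlonglongrightarrow> 0"
proof -
  let ?C = "2 * suminf th * (1 + E)"
  have le: "t n \<le> ?C / real (n + 1)" for n
  proof (rule t_leI)
    fix f assume f: "regular f"
    have "real (n + 1) * Z f n = (\<Sum>k\<le>n. Z f n)" by simp
    also have "\<dots> \<le> (\<Sum>k\<le>n. Z f k)" by (intro sum_mono Z_antimono[OF f]) auto
    also have "\<dots> \<le> ?C * Z f 0" by (rule Z_sum_le[OF f])
    finally have "Z f n * real (n + 1) \<le> ?C * Z f 0" by (simp only: mult.commute)
    then have "Z f n \<le> ?C * Z f 0 / real (n + 1)" by (simp only: pos_le_divide_eq of_nat_0_less_iff zero_less_Suc Suc_eq_plus1[symmetric])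
    then show "Z f n \<le> ?C / real (n + 1) * Z f 0" by (simp only: times_divide_eq_left)
  qed
  have lim: "(\<lambda>n. C / real (n + 1)) \<longlonglongrightarrow> 0" for C :: real by real_asymp
  show ?thesis
    by (rule tendsto_sandwich[OF always_eventually always_eventually tendsto_const lim])
      (rule allI, rule t_nonneg, rule allI, rule le)
qed

lemma th_poly: assumes "poly_decay \<alpha> (tail T)" shows "poly_decay \<alpha> th"
  by (rule poly_decay_mono[OF poly_decay_cmult[OF assms, of "exp K1 / c"]])
     (use th_bounds(1,2) tail_nonneg c_pos in \<open>auto simp: th_def abs_mult\<close>)

lemma th_exp: assumes "exp_decay (tail T)" shows "exp_decay th"
  by (rule exp_decay_mono[OF exp_decay_cmult[OF assms, of "exp K1 / c"]])
     (use th_bounds(1,2) tail_nonneg c_pos in \<open>auto simp: th_def abs_mult\<close>)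

text \<open>
  The factor \<open>1 - eps\<close> is \<open>E / (1 + E)\<close>.
\<close>

lemma t_window: assumes "M0 < n" shows "t n \<le> (1 - eps) * t (n - M0 - 1) + th M0"
proof (rule t_leI)
  fix f assume f: "regular f"
  have e: "E / (1 + E) = 1 - eps" "1 + E > 0" unfolding E_def using eps_pos by (auto simp: field_simps)
  have "(1 + E) * Z f n \<le> E * Z f (n - M0 - 1) + Z f 0 * ((1 + E) * th M0)"
    by (rule regen_window[OF th_bounds E_nonneg Z_nonneg Z_dec[OF f] Z_rec[OF f] assms])
  also have "\<dots> \<le> E * (Z f 0 * t (n - M0 - 1)) + Z f 0 * ((1 + E) * th M0)"
    by (intro add_right_mono mult_left_mono Z_le_t f E_nonneg)
  finally have "Z f n \<le> (E * (Z f 0 * t (n - M0 - 1)) + Z f 0 * ((1 + E) * th M0)) / (1 + E)"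
    using e(2) by (simp add: field_simps)
  also have "\<dots> = (E / (1 + E) * t (n - M0 - 1) + th M0) * Z f 0"
    using e(2) by (simp add: field_simps)
  finally show "Z f n \<le> ((1 - eps) * t (n - M0 - 1) + th M0) * Z f 0" by (simp only: e(1))
qed

lemma t_le_1: "t n \<le> 1"
  by (rule t_leI) (use Z_antimono[of _ 0 n] in auto)

text \<open>
  For large \<open>n\<close> take \<open>M0\<close> proportional to \<open>n\<close> in \<open>t_window\<close> and apply \<open>window_bootstrap\<close>.
\<close>

lemma t_poly:
  assumes \<alpha>: "\<alpha> > 0" and tl: "poly_decay \<alpha> (tail T)" shows "poly_decay \<alpha> t"
proof (rule window_bootstrap[of "1 - eps"])
  fix \<eta> :: real assume eta: "0 < \<eta>" "\<eta> < 1"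
  obtain C where C: "C > 0" "\<And>n. \<bar>th n\<bar> \<le> C * real (n + 1) powr (- \<alpha>)"
    using poly_decayE[OF th_poly[OF tl]] by blast
  define B where "B = C * (\<eta> / 4) powr (- \<alpha>) + (2 / \<eta> + 1) powr \<alpha>"
  have "\<exists>m\<le>n. (1 - \<eta>) * real (n + 1) \<le> real (m + 1) \<and> t n \<le> (1 - eps) * t m + B * real (n + 1) powr (- \<alpha>)" for n
  proof (cases "2 / \<eta> \<le> real n")
    case True
    define M0 where "M0 = nat \<lfloor>\<eta> * real n / 2\<rfloor>"
    have n0: "real n > 0" using True eta by (smt (verit) divide_pos_pos)
    have M0: "real M0 \<le> \<eta> * real n / 2" "\<eta> * real n / 2 < real M0 + 1"
      using eta by (auto simp: M0_def) linarith+
    have en: "1 \<le> \<eta> * real n / 2" using True eta by (simp add: field_simps)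
    have "\<eta> * real n / 2 < real n" using n0 eta by simp
    then have Mn: "M0 < n" using M0 by linarith
    have w: "(1 - \<eta>) * real (n + 1) \<le> real (n - M0 - 1 + 1)"
      using Mn M0 en eta by (simp add: of_nat_diff algebra_simps)
    have "\<eta> / 4 * real (n + 1) \<le> \<eta> / 4 * (2 * real n)" using n0 eta by (intro mult_left_mono) auto
    then have "\<eta> / 4 * real (n + 1) \<le> real (M0 + 1)" using M0 by simp
    then have "real (M0 + 1) powr (- \<alpha>) \<le> (\<eta> / 4 * real (n + 1)) powr (- \<alpha>)"
      using eta \<alpha> by (intro powr_mono2') auto
    also have "\<dots> = (\<eta> / 4) powr (- \<alpha>) * real (n + 1) powr (- \<alpha>)" by (rule powr_mult)
    finally have "th M0 \<le> C * ((\<eta> / 4) powr (- \<alpha>) * real (n + 1) powr (- \<alpha>))"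
      using C(2)[of M0] C(1) by (meson abs_ge_self mult_left_mono less_imp_le order_trans)
    also have "\<dots> \<le> B * real (n + 1) powr (- \<alpha>)"
      unfolding B_def mult.assoc[symmetric] by (intro mult_right_mono) auto
    finally have "t n \<le> (1 - eps) * t (n - M0 - 1) + B * real (n + 1) powr (- \<alpha>)"
      using t_window[OF Mn] by simp
    with w show ?thesis by (intro exI[of _ "n - M0 - 1"]) auto
  next
    case False
    have "1 = real (n + 1) powr \<alpha> * real (n + 1) powr (- \<alpha>)" by (simp flip: powr_add)
    also have "\<dots> \<le> (2 / \<eta> + 1) powr \<alpha> * real (n + 1) powr (- \<alpha>)"
      using False \<alpha> eta by (intro mult_right_mono powr_mono2) auto
    also have "\<dots> \<le> B * real (n + 1) powr (- \<alpha>)"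
      unfolding B_def using C by (intro mult_right_mono) auto
    finally have "t n \<le> B * real (n + 1) powr (- \<alpha>)" using t_le_1[of n] by simp
    moreover have "0 \<le> (1 - eps) * t n" using t_nonneg eps_less by simp
    ultimately show ?thesis using eta by (intro exI[of _ n]) (auto simp: mult_left_le_one_le)
  qed
  then show "\<exists>C. \<forall>n. \<exists>m\<le>n. (1 - \<eta>) * real (n + 1) \<le> real (m + 1) \<and> t n \<le> (1 - eps) * t m + C * real (n + 1) powr (- \<alpha>)"
    by blast
qed (use eps_pos eps_less \<alpha> t_nonneg in auto)

text \<open>
  Apply \<open>regen_sum\<close> with a weight \<open>x > 1\<close> close enough to 1.
\<close>

lemma t_exp:
  assumes tl: "exp_decay (tail T)" shows "exp_decay t"
proof -
  obtain C \<theta> where C: "C > 0" "0 < \<theta>" "\<theta> < 1" "\<And>n. \<bar>th n\<bar> \<le> C * \<theta> ^ n"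
    using exp_decayE[OF th_exp[OF tl]] by blast
  define x0 where "x0 = (1 + 1 / \<theta>) / 2"
  have x0: "1 < x0" "x0 * \<theta> < 1" using C by (auto simp: x0_def field_simps)
  define TT where "TT = C * (1 / (1 - x0 * \<theta>))"
  have TT: "TT > 0" using C x0 by (simp add: TT_def)
  have Tb: "(\<Sum>n\<le>N. th n * x ^ n) \<le> TT" if x: "1 \<le> x" "x \<le> x0" for x N
  proof -
    have "(\<Sum>n\<le>N. th n * x ^ n) \<le> (\<Sum>n\<le>N. C * (x0 * \<theta>) ^ n)"
    proof (intro sum_mono)
      fix n
      have "th n * x ^ n \<le> (C * \<theta> ^ n) * x0 ^ n"
        using C(4)[of n] x C(1,2) by (intro mult_mono power_mono) auto
      then show "th n * x ^ n \<le> C * (x0 * \<theta>) ^ n" by (simp add: power_mult_distrib mult_ac)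
    qed
    also have "\<dots> = C * (\<Sum>n\<le>N. (x0 * \<theta>) ^ n)" by (simp add: sum_distrib_left)
    also have "\<dots> \<le> C * (\<Sum>n. (x0 * \<theta>) ^ n)"
      using C x0 by (intro mult_left_mono sum_le_suminf summable_geometric) auto
    also have "\<dots> = TT" unfolding TT_def using C x0 by (subst suminf_geometric) auto
    finally show ?thesis .
  qed
  define x where "x = min x0 (1 + 1 / (2 * (E * TT + 1)))"
  have ET: "0 \<le> E * TT" using E_nonneg TT by simp
  have x: "1 < x" "x \<le> x0" using x0 ET by (auto simp: x_def)
  have small: "E * TT * (x - 1) \<le> 1 / 2"
  proof -
    have "E * TT * (x - 1) \<le> E * TT * (1 / (2 * (E * TT + 1)))" using ET by (intro mult_left_mono) (auto simp: x_def)
    also have "\<dots> \<le> 1 / 2" using ET by (simp add: field_simps)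
    finally show ?thesis .
  qed
  have "t n \<le> (2 * TT * (1 + E)) * (1 / x) ^ n" for n
  proof (rule t_leI)
    fix f assume f: "regular f"
    have "Z f n * x ^ n \<le> (\<Sum>n\<le>n. Z f n * x ^ n)" using x Z_nonneg by (intro member_le_sum) auto
    also have "\<dots> \<le> 2 * TT * (1 + E) * Z f 0"
      by (rule regen_sum[OF th_bounds(1) E_nonneg Z_nonneg Z_dec[OF f] Z_rec[OF f] _ Tb small]) (use x in auto)
    finally show "Z f n \<le> 2 * TT * (1 + E) * (1 / x) ^ n * Z f 0"
      using x by (simp add: field_simps power_one_over)
  qed
  then have "\<bar>t n\<bar> \<le> (2 * TT * (1 + E)) * (1 / x) ^ n" for n using t_nonneg[of n] by simp
  moreover have "0 < 1 / x" "1 / x < 1" using x by auto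
  ultimately show ?thesis unfolding exp_decay_def by blast
qed

section \<open>Convergence to equilibrium for regular densities\<close>

text \<open>
  The tail of the regeneration time for the uniform density, normalised.
\<close>

definition zb :: "nat \<Rightarrow> real" where "zb n = Z one n / c"

lemma part_pos: "0 < emeasure M (part T i)"
proof (rule ccontr)
  assume "\<not> 0 < emeasure M (part T i)"
  then have null: "part T i \<in> null_sets M" using part_sets by (auto simp: null_sets_def)
  have "emeasure M (space M) = (\<integral>\<^sup>+z. indicator (part T i) z * ennreal (jac T z) * 1 \<partial>M)"
    using nn_integral_branch[of "\<lambda>_. 1" i] by simp
  also have "\<dots> = (\<integral>\<^sup>+z. 0 \<partial>M)"
    by (rule nn_integral_cong_AE) (use AE_not_in[OF null] in \<open>eventually_elim, simp\<close>)
  finally show False using base_nonnull by simp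
qed

text \<open>
  Every value of the return time on a good point is a possible regeneration time, since each part of
  the partition is mapped onto the whole base and so has positive measure. This transfers
  aperiodicity from \<open>R\<close> to the renewal equation.
\<close>

lemma P_one_pos: assumes "x \<in> good_base T" shows "P one (rtime T x) > 0"
proof -
  let ?r = "rtime T x"
  have r: "?r > 0" using assms good_base_subset rtime_pos by auto
  have "emeasure M (part T (idx x)) \<le> (\<integral>\<^sup>+z. indicator {z. rtime T z = ?r} z * 1 * 1 \<partial>M)"
  proof -
    have "emeasure M (part T (idx x)) = (\<integral>\<^sup>+z. indicator (part T (idx x)) z \<partial>M)" using part_sets by simp
    also have "\<dots> \<le> (\<integral>\<^sup>+z. indicator {z. rtime T z = ?r} z * 1 * 1 \<partial>M)"
    proof (rule nn_integral_mono)
      fix z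
      have "z \<in> part T (idx x) \<Longrightarrow> rtime T z = ?r" by (rule rtime_const[OF _ idx_in[OF assms]])
      then show "indicator (part T (idx x)) z \<le> (indicator {z. rtime T z = ?r} z * 1 * 1 :: ennreal)"
        by (cases "z \<in> part T (idx x)") simp_all
    qed
    finally show ?thesis .
  qed
  also have "\<dots> = (\<integral>\<^sup>+y. L ?r one y * 1 \<partial>M)" by (rule nn_integral_L[symmetric]) auto
  also have "\<dots> \<le> (\<integral>\<^sup>+y. arriving one ?r y \<partial>M)"
  proof (rule nn_integral_mono)
    fix y
    have "L (?r - 0) (residual one 0) y \<le> arriving one ?r y"
      unfolding arriving_def using r by (intro member_le_sum) auto
    then show "L ?r one y * 1 \<le> arriving one ?r y" by (simp add: residual_0)
  qed
  finally have le: "emeasure M (part T (idx x)) \<le> (\<integral>\<^sup>+y. arriving one ?r y \<partial>M)" .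
  have "0 < (\<integral>\<^sup>+y. arriving one ?r y \<partial>M)" by (rule less_le_trans[OF part_pos le])
  then have "0 < regenerated one ?r" unfolding regenerated_def regen_part_def using eps_pos c_pos
    by (simp add: ennreal_zero_less_mult_iff)
  then show ?thesis unfolding P_def using regenerated_finite[OF regular_one] by (simp add: enn2real_positive_iff)
qed

sublocale ren: renewal_tail zb
proof
  show "0 \<le> zb n" for n unfolding zb_def using Z_nonneg c_pos by simp
  show "zb (Suc n) \<le> zb n" for n unfolding zb_def using Z_dec[OF regular_one] c_pos by (intro divide_right_mono) auto
  show "zb 0 = 1" unfolding zb_def using Z_0[OF regular_one] mass_one c_pos by simp
  have "summable (Z one)"
    using Z_sum_le[OF regular_one] Z_nonneg by (intro bounded_imp_summable) auto
  then show "summable zb" unfolding zb_def[abs_def] by (rule summable_divide)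
  have "r \<in> {n. zb n < zb (n - 1)}" if rG: "r \<in> rtime T ` good_base T" for r
  proof -
    obtain x where x: "x \<in> good_base T" "r = rtime T x" using rG by auto
    have r: "r > 0" using x good_base_subset rtime_pos by auto
    have "Z one (r - 1) - Z one r = c * P one r" using Z_step[OF regular_one, of "r - 1"] r by simp
    moreover have "c * P one r > 0" using P_one_pos[OF x(1)] x(2) c_pos by simp
    ultimately show ?thesis unfolding zb_def using c_pos by (simp add: divide_strict_right_mono)
  qed
  then have "Gcd {n. zb n < zb (n - 1)} dvd Gcd (rtime T ` good_base T)"
    by (intro Gcd_greatest Gcd_dvd) auto
  then show "Gcd {n. zb n < zb (n - 1)} = 1" using aperiodic by simp
qed

text \<open>
  The limit given by the renewal theorem. It will be the integral of \<open>\<phi>\<close> with respect to the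
  invariant measure.
\<close>

definition N :: "('a \<times> nat \<Rightarrow> ennreal) \<Rightarrow> real" where "N \<phi> = (\<Sum>n. hr \<phi> one n / c) / suminf zb"

lemma zb_sum_pos: "suminf zb \<ge> 1"
proof -
  have "sum zb {0} \<le> suminf zb" using ren.summable_zb ren.zb_nonneg by (intro sum_le_suminf) auto
  then show ?thesis by (simp add: ren.zb_0)
qed

lemma hr_one_bounds: "obs \<phi> \<Longrightarrow> 0 \<le> hr \<phi> one n / c" "obs \<phi> \<Longrightarrow> hr \<phi> one n / c \<le> zb n"
  using hr_nonneg[of \<phi> one n] hr_le[OF _ regular_one, of \<phi> n] c_pos by (auto simp: zb_def divide_right_mono)

lemma hr_one_summable: "obs \<phi> \<Longrightarrow> summable (\<lambda>n. hr \<phi> one n / c)"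
  by (rule summable_comparison_test'[OF ren.summable_zb, where N = 0])
     (simp only: real_norm_def abs_of_nonneg[OF hr_one_bounds(1)] hr_one_bounds(2))

lemma N_bounds: assumes "obs \<phi>" shows "0 \<le> N \<phi>" "N \<phi> \<le> 1"
proof -
  have "0 \<le> (\<Sum>n. hr \<phi> one n / c)" using hr_one_bounds[OF assms] by (intro suminf_nonneg hr_one_summable assms) auto
  then show "0 \<le> N \<phi>" unfolding N_def using zb_sum_pos by simp
  have "(\<Sum>n. hr \<phi> one n / c) \<le> suminf zb"
    using hr_one_bounds[OF assms] by (intro suminf_le hr_one_summable assms ren.summable_zb) auto
  then show "N \<phi> \<le> 1" unfolding N_def using zb_sum_pos by simp
qed

text \<open>
  For the uniform density the regeneration identity is the renewal equation with
  \<open>x n = I \<phi> n one / c\<close>.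
\<close>

lemma x_rate: assumes \<phi>: "obs \<phi>" shows "\<bar>Ir \<phi> n one - c * N \<phi>\<bar> \<le> c * ren.renewal_err (Suc n)"
proof -
  have "\<bar>Ir \<phi> n one / c - suminf (\<lambda>n. hr \<phi> one n / c) / suminf zb\<bar> \<le> ren.renewal_err (Suc n)"
  proof (rule ren.renewal_rate[where x = "\<lambda>n. Ir \<phi> n one / c"])
    fix n
    have "Ir \<phi> n one / c = hr \<phi> one n / c + (\<Sum>m=1..n. P one m * (Ir \<phi> (n - m) one / c))"
      unfolding regeneration_real[OF \<phi> regular_one, of n] by (simp add: add_divide_distrib sum_divide_distrib)
    also have "(\<Sum>m=1..n. P one m * (Ir \<phi> (n - m) one / c)) = (\<Sum>m=1..n. (zb (m - 1) - zb m) * (Ir \<phi> (n - m) one / c))"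
    proof (rule sum.cong[OF refl])
      fix m assume "m \<in> {1..n}"
      then have "Z one (m - 1) - Z one m = c * P one m" using Z_step[OF regular_one, of "m - 1"] by auto
      then have "zb (m - 1) - zb m = P one m" unfolding zb_def using c_pos by (simp add: diff_divide_distrib[symmetric])
      then show "P one m * (Ir \<phi> (n - m) one / c) = (zb (m - 1) - zb m) * (Ir \<phi> (n - m) one / c)" by simp
    qed
    finally show "Ir \<phi> n one / c = hr \<phi> one n / c + (\<Sum>m=1..n. (zb (m - 1) - zb m) * (Ir \<phi> (n - m) one / c))" .
    show "\<bar>hr \<phi> one n / c\<bar> \<le> zb n" using hr_one_bounds[OF \<phi>, of n] by simp
  qed
  then have "c * \<bar>Ir \<phi> n one / c - N \<phi>\<bar> \<le> c * ren.renewal_err (Suc n)"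
    unfolding N_def using c_pos by (intro mult_left_mono) auto
  moreover have "c * \<bar>Ir \<phi> n one / c - N \<phi>\<bar> = \<bar>Ir \<phi> n one - c * N \<phi>\<bar>"
  proof -
    have "c * \<bar>Ir \<phi> n one / c - N \<phi>\<bar> = \<bar>c * (Ir \<phi> n one / c - N \<phi>)\<bar>" using c_pos by (simp add: abs_mult)
    also have "c * (Ir \<phi> n one / c - N \<phi>) = Ir \<phi> n one - c * N \<phi>" using c_pos by (simp add: right_diff_distrib)
    finally show ?thesis .
  qed
  ultimately show ?thesis by simp
qed

definition regular_err :: "nat \<Rightarrow> real" where
  "regular_err n = (1 + ren.renewal_err 0) * t (n div 2) + ren.renewal_err (n div 2)"

text \<open>
  By the regeneration identity the mass regenerated at time \<open>m\<close> is within \<open>x_rate\<close> of the limit at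
  the remaining time \<open>n - m\<close>. If \<open>m \<le> n / 2\<close> the remaining time is at least \<open>n / 2\<close>; the mass
  regenerated later is at most the tail of the regeneration time at \<open>n / 2\<close>.
\<close>

theorem regular_rate:
  assumes \<phi>: "obs \<phi>" and f: "regular f"
  shows "\<bar>Ir \<phi> n f - mass f * N \<phi>\<bar> \<le> mass f * regular_err n"
proof -
  let ?e = ren.renewal_err and ?k = "n div 2"
  have "Ir \<phi> n f - mass f * N \<phi> = (hr \<phi> f n - Z f n * N \<phi>) + (\<Sum>m=1..n. P f m * (Ir \<phi> (n - m) one - c * N \<phi>))"
    unfolding regeneration_real[OF \<phi> f, of n] mass_balance[OF f, of n]
    by (simp add: algebra_simps sum_distrib_left sum_subtractf)
  then have "\<bar>Ir \<phi> n f - mass f * N \<phi>\<bar> \<le> \<bar>hr \<phi> f n - Z f n * N \<phi>\<bar> + (\<Sum>m=1..n. P f m * (c * ?e (Suc (n - m))))"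
    using x_rate[OF \<phi>] P_nonneg
    by (auto intro!: order_trans[OF abs_triangle_ineq] add_mono order_trans[OF sum_abs] sum_mono mult_left_mono simp: abs_mult)
  also have "\<bar>hr \<phi> f n - Z f n * N \<phi>\<bar> \<le> Z f n"
  proof -
    have "0 \<le> Z f n * N \<phi>" "Z f n * N \<phi> \<le> Z f n" using N_bounds[OF \<phi>] Z_nonneg[of f n] by (auto simp: mult_left_le)
    then show ?thesis using hr_nonneg[of \<phi> f n] hr_le[OF \<phi> f, of n] by simp
  qed
  also have "Z f n \<le> Z f ?k" by (rule Z_antimono[OF f]) simp
  also have "(\<Sum>m=1..n. P f m * (c * ?e (Suc (n - m)))) \<le> mass f * ?e ?k + Z f ?k * ?e 0"
  proof -
    have "{1..n} = {1..?k} \<union> {?k+1..n}" "{1..?k} \<inter> {?k+1..n} = {}" by auto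
    then have "(\<Sum>m=1..n. P f m * (c * ?e (Suc (n - m)))) =
        (\<Sum>m=1..?k. P f m * (c * ?e (Suc (n - m)))) + (\<Sum>m=?k+1..n. P f m * (c * ?e (Suc (n - m))))"
      by (simp add: sum.union_disjoint)
    also have "(\<Sum>m=1..?k. P f m * (c * ?e (Suc (n - m)))) \<le> (\<Sum>m=1..?k. P f m * (c * ?e ?k))"
      using c_pos P_nonneg by (intro sum_mono mult_left_mono ren.renewal_err_antimono) auto
    also have "\<dots> = (c * (\<Sum>m=1..?k. P f m)) * ?e ?k" by (simp add: sum_distrib_left sum_distrib_right mult_ac)
    also have "\<dots> \<le> mass f * ?e ?k"
      using mass_balance[OF f, of ?k] Z_nonneg[of f ?k] ren.renewal_err_nonneg by (intro mult_right_mono) auto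
    also have "(\<Sum>m=?k+1..n. P f m * (c * ?e (Suc (n - m)))) \<le> (\<Sum>m=?k+1..n. P f m * (c * ?e 0))"
      using c_pos P_nonneg by (intro sum_mono mult_left_mono ren.renewal_err_antimono) auto
    also have "\<dots> = (c * (\<Sum>m=?k+1..n. P f m)) * ?e 0" by (simp add: sum_distrib_left sum_distrib_right mult_ac)
    also have "c * (\<Sum>m=?k+1..n. P f m) = Z f ?k - Z f n"
    proof -
      have "{1..n} = {1..?k} \<union> {?k+1..n}" "{1..?k} \<inter> {?k+1..n} = {}" by auto
      then have "(\<Sum>m=1..n. P f m) = (\<Sum>m=1..?k. P f m) + (\<Sum>m=?k+1..n. P f m)" by (simp add: sum.union_disjoint)
      then show ?thesis using mass_balance[OF f, of ?k] mass_balance[OF f, of n] by (simp add: algebra_simps)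
    qed
    also have "(Z f ?k - Z f n) * ?e 0 \<le> Z f ?k * ?e 0"
      using Z_nonneg[of f n] ren.renewal_err_nonneg by (intro mult_right_mono) auto
    finally show ?thesis by simp
  qed
  also have "Z f ?k + (mass f * ?e ?k + Z f ?k * ?e 0) = (1 + ?e 0) * Z f ?k + mass f * ?e ?k" by (simp add: algebra_simps)
  also have "\<dots> \<le> (1 + ?e 0) * (mass f * t ?k) + mass f * ?e ?k"
    using Z_le_t[OF f, of ?k] Z_0[OF f] ren.renewal_err_nonneg[of 0] by (intro add_right_mono mult_left_mono) auto
  also have "\<dots> = mass f * regular_err n" by (simp add: regular_err_def algebra_simps)
  finally show ?thesis by simp
qed

lemma regular_err_nonneg: "0 \<le> regular_err n"
  unfolding regular_err_def using t_nonneg ren.renewal_err_nonneg by (intro add_nonneg_nonneg mult_nonneg_nonneg) auto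

lemma regular_err_antimono: "m \<le> n \<Longrightarrow> regular_err n \<le> regular_err m"
  unfolding regular_err_def using ren.renewal_err_nonneg[of 0]
  by (intro add_mono mult_left_mono t_antimono ren.renewal_err_antimono div_le_mono) auto

lemma regular_err_tendsto: "regular_err \<longlonglongrightarrow> 0"
proof -
  note f = filterlim_half
  have "(\<lambda>n. (1 + ren.renewal_err 0) * t (n div 2) + ren.renewal_err (n div 2)) \<longlonglongrightarrow> (1 + ren.renewal_err 0) * 0 + 0"
    by (intro tendsto_intros filterlim_compose[OF t_tendsto f] filterlim_compose[OF ren.renewal_err_tendsto f])
  then show ?thesis unfolding regular_err_def[abs_def] by simp
qed

lemma poly_decay_half: assumes "poly_decay \<alpha> f" "0 \<le> \<alpha>" shows "poly_decay \<alpha> (\<lambda>n. f (n div 2))"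
proof -
  obtain C where C: "C > 0" "\<And>n. \<bar>f n\<bar> \<le> C * real (n + 1) powr (- \<alpha>)" using poly_decayE[OF assms(1)] by blast
  have "\<bar>f (n div 2)\<bar> \<le> (C * (1/2) powr (- \<alpha>)) * real (n + 1) powr (- \<alpha>)" for n
  proof -
    have "n \<le> 2 * (n div 2) + 1" by linarith
    then have "real n \<le> real (2 * (n div 2) + 1)" by (simp only: of_nat_le_iff)
    then have "1 / 2 * real (n + 1) \<le> real (n div 2 + 1)" by simp
    then have "real (n div 2 + 1) powr (- \<alpha>) \<le> (1 / 2 * real (n + 1)) powr (- \<alpha>)"
      using assms(2) by (intro powr_mono2') auto
    also have "\<dots> = (1/2) powr (- \<alpha>) * real (n + 1) powr (- \<alpha>)" by (rule powr_mult)
    finally show ?thesis using C(1) by (intro order_trans[OF C(2)]) (simp only: mult.assoc mult_left_mono)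
  qed
  then show ?thesis unfolding poly_decay_def by blast
qed

lemma exp_decay_half: assumes "exp_decay f" shows "exp_decay (\<lambda>n. f (n div 2))"
proof -
  obtain C \<theta> where C: "C > 0" "0 < \<theta>" "\<theta> < 1" "\<And>n. \<bar>f n\<bar> \<le> C * \<theta> ^ n" using exp_decayE[OF assms] by blast
  have "\<bar>f (n div 2)\<bar> \<le> (C / \<theta>) * sqrt \<theta> ^ n" for n
  proof -
    have "\<theta> * \<theta> ^ (n div 2) = sqrt \<theta> ^ (2 + 2 * (n div 2))"
      using C by (simp add: power_add power_mult)
    also have "\<dots> \<le> sqrt \<theta> ^ n" using C by (intro power_decreasing) auto
    finally have "C * (\<theta> * \<theta> ^ (n div 2)) \<le> C * sqrt \<theta> ^ n" using C by (intro mult_left_mono) auto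
    then have "C * \<theta> ^ (n div 2) \<le> (C / \<theta>) * sqrt \<theta> ^ n" using C by (simp add: field_simps)
    then show ?thesis using C(4)[of "n div 2"] by linarith
  qed
  moreover have "0 < sqrt \<theta>" "sqrt \<theta> < 1" using C by auto
  ultimately show ?thesis unfolding exp_decay_def by blast
qed

lemma zb_le_t: "zb n \<le> t n"
proof -
  have "Z one n \<le> c * t n" using Z_le_t[OF regular_one, of n] Z_0[OF regular_one] mass_one by simp
  then show ?thesis unfolding zb_def using c_pos by (simp add: field_simps)
qed

lemma poly_decay_mono_exponent: assumes "poly_decay \<alpha> f" "\<alpha>' \<le> \<alpha>" shows "poly_decay \<alpha>' f"
proof -
  obtain C where C: "C > 0" "\<And>n. \<bar>f n\<bar> \<le> C * real (n + 1) powr (- \<alpha>)" using poly_decayE[OF assms(1)] by blast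
  have "\<bar>f n\<bar> \<le> C * real (n + 1) powr (- \<alpha>')" for n
    by (rule order_trans[OF C(2)]) (use C(1) assms(2) in \<open>intro mult_left_mono powr_mono, auto\<close>)
  then show ?thesis unfolding poly_decay_def by blast
qed

lemma regular_err_poly:
  assumes \<alpha>: "\<alpha> > 1" and tl: "poly_decay \<alpha> (tail T)" shows "poly_decay (\<alpha> - 1) regular_err"
proof -
  have t: "poly_decay \<alpha> t" using t_poly[OF _ tl] \<alpha> by simp
  have "poly_decay \<alpha> zb" by (rule poly_decay_mono[OF t]) (use zb_le_t ren.zb_nonneg t_nonneg in simp)
  then have r: "poly_decay (\<alpha> - 1) ren.renewal_err" by (rule ren.renewal_err_poly[OF \<alpha>])
  show ?thesis unfolding regular_err_def[abs_def]
    by (intro poly_decay_add poly_decay_cmult poly_decay_half r poly_decay_mono_exponent[OF t]) (use \<alpha> in auto)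
qed

lemma regular_err_exp: assumes tl: "exp_decay (tail T)" shows "exp_decay regular_err"
proof -
  have t: "exp_decay t" by (rule t_exp[OF tl])
  have "exp_decay zb" by (rule exp_decay_mono[OF t]) (use zb_le_t ren.zb_nonneg t_nonneg in simp)
  then have r: "exp_decay ren.renewal_err" by (rule ren.renewal_err_exp)
  show ?thesis unfolding regular_err_def[abs_def]
    by (intro exp_decay_add exp_decay_cmult exp_decay_half r t)
qed

end

section \<open>The invariant measure\<close>

lemma pred_less_nat:
  fixes f g :: "'b \<Rightarrow> nat"
  assumes "f \<in> N \<rightarrow>\<^sub>M count_space UNIV" "g \<in> N \<rightarrow>\<^sub>M count_space UNIV"
  shows "Measurable.pred N (\<lambda>x. f x < g x)"
  by (rule measurable_compose_countable[where f = "\<lambda>i x. i < g x" and g = f, OF _ assms(1)])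
     (rule measurable_compose[OF assms(2) measurable_count_space])

context distorted_tower
begin

abbreviation "TM \<equiv> tower_measure T"
abbreviation "\<Omega> \<equiv> tower_space T"
abbreviation "F \<equiv> tower_map T"

lemma space_TM: "space TM = \<Omega>"
  unfolding tower_measure_def space_restrict_space space_pair_measure by (auto simp: tower_space_def)

lemma \<Omega>_sets': "\<Omega> \<inter> space (M \<Otimes>\<^sub>M count_space UNIV) \<in> sets (M \<Otimes>\<^sub>M count_space UNIV)"
  using tower_space_sets by auto

text \<open>
  Extension by zero. The integrals over the base evaluate observables at all pairs \<open>(z, l)\<close>, whereas
  a measurable function on the tower is arbitrary outside the tower.
\<close>

definition ext :: "('a \<times> nat \<Rightarrow> ennreal) \<Rightarrow> 'a \<times> nat \<Rightarrow> ennreal" where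
  "ext \<phi> x = \<phi> x * indicator \<Omega> x"

lemma ext_measurable: "\<phi> \<in> borel_measurable TM \<Longrightarrow> ext \<phi> \<in> borel_measurable (M \<Otimes>\<^sub>M count_space UNIV)"
  unfolding tower_measure_def ext_def[abs_def] by (subst (asm) borel_measurable_restrict_space_iff_ennreal[OF \<Omega>_sets'])

lemma level_meas_iff: "level_meas \<phi> \<longleftrightarrow> \<phi> \<in> borel_measurable (M \<Otimes>\<^sub>M count_space UNIV)"
proof
  assume "level_meas \<phi>"
  then have "(\<lambda>x. \<phi> (fst x, snd x)) \<in> borel_measurable (M \<Otimes>\<^sub>M count_space UNIV)"
    unfolding level_meas_def
    by (intro measurable_compose_countable[where f = "\<lambda>l x. \<phi> (fst x, l)" and g = snd]) (auto intro: measurable_compose[OF measurable_fst])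
  then show "\<phi> \<in> borel_measurable (M \<Otimes>\<^sub>M count_space UNIV)" by simp
next
  assume "\<phi> \<in> borel_measurable (M \<Otimes>\<^sub>M count_space UNIV)"
  then show "level_meas \<phi>"
    unfolding level_meas_def by (intro allI measurable_compose[of "\<lambda>z. (z, _)" M "M \<Otimes>\<^sub>M count_space UNIV" \<phi>]) measurable
qed

lemma level_meas_ext: "\<phi> \<in> borel_measurable TM \<Longrightarrow> level_meas (ext \<phi>)"
  unfolding level_meas_iff by (rule ext_measurable)

lemma level_meas_TM: "level_meas \<phi> \<Longrightarrow> \<phi> \<in> borel_measurable TM"
  unfolding level_meas_iff tower_measure_def by (rule measurable_restrict_space1)

lemma nn_integral_TM:
  assumes "\<phi> \<in> borel_measurable TM"
  shows "(\<integral>\<^sup>+x. \<phi> x \<partial>TM) = (\<Sum>l. \<integral>\<^sup>+z. indicator {z. l < rtime T z} z * \<phi> (z, l) \<partial>M)"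
proof -
  interpret C: sigma_finite_measure "count_space UNIV :: nat measure"
    by (rule sigma_finite_measure_count_space)
  note [measurable] = ext_measurable[OF assms]
  have "(\<integral>\<^sup>+x. \<phi> x \<partial>TM) = (\<integral>\<^sup>+x. ext \<phi> x \<partial>(M \<Otimes>\<^sub>M count_space UNIV))"
    unfolding tower_measure_def ext_def by (rule nn_integral_restrict_space[OF \<Omega>_sets'])
  also have "\<dots> = (\<integral>\<^sup>+z. (\<integral>\<^sup>+l. ext \<phi> (z, l) \<partial>count_space UNIV) \<partial>M)"
    by (rule C.nn_integral_fst[symmetric]) simp
  also have "\<dots> = (\<integral>\<^sup>+z. (\<Sum>l. ext \<phi> (z, l)) \<partial>M)" by (simp add: nn_integral_count_space_nat)
  also have "\<dots> = (\<Sum>l. \<integral>\<^sup>+z. ext \<phi> (z, l) \<partial>M)" by (rule nn_integral_suminf) measurable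
  also have "\<dots> = (\<Sum>l. \<integral>\<^sup>+z. indicator {z. l < rtime T z} z * \<phi> (z, l) \<partial>M)"
    by (rule suminf_cong, rule nn_integral_cong) (auto simp: ext_def tower_space_def indicator_def)
  finally show ?thesis .
qed

lemma tower_map_eq: "F x = (if snd x + 1 < rtime T (fst x) then (fst x, snd x + 1) else (ret T (fst x), 0))"
  by (cases x) simp

lemma tower_map_measurable_pair: "F \<in> (M \<Otimes>\<^sub>M count_space UNIV) \<rightarrow>\<^sub>M (M \<Otimes>\<^sub>M count_space UNIV)"
proof -
  have [measurable]: "(\<lambda>x. rtime T (fst x)) \<in> (M \<Otimes>\<^sub>M count_space (UNIV :: nat set)) \<rightarrow>\<^sub>M count_space UNIV"
    by (rule measurable_compose[OF measurable_fst rtime_measurable])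
  have [measurable]: "(\<lambda>x. snd x + 1) \<in> (M \<Otimes>\<^sub>M count_space (UNIV :: nat set)) \<rightarrow>\<^sub>M count_space UNIV"
    by (rule measurable_compose[OF measurable_snd measurable_count_space])
  have [measurable]: "Measurable.pred (M \<Otimes>\<^sub>M count_space UNIV) (\<lambda>x. snd x + 1 < rtime T (fst x))"
    by (rule pred_less_nat) measurable
  show ?thesis unfolding tower_map_eq[abs_def] by measurable
qed

lemma tower_map_space: "x \<in> \<Omega> \<Longrightarrow> F x \<in> \<Omega>"
  by (cases x) (auto simp: tower_space_def intro: ret_space rtime_pos)

lemma tower_map_measurable[measurable]: "F \<in> TM \<rightarrow>\<^sub>M TM"
  unfolding tower_measure_def
  by (rule measurable_restrict_space3[OF tower_map_measurable_pair]) (use tower_map_space in auto)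

lemma tower_pow_space: "x \<in> \<Omega> \<Longrightarrow> (F ^^ n) x \<in> \<Omega>"
  by (induction n) (auto intro: tower_map_space)

lemma tower_pow_measurable[measurable]: "(F ^^ n) \<in> TM \<rightarrow>\<^sub>M TM"
  by (induction n) (auto simp: comp_def)

text \<open>
  The density of the invariant measure, before normalisation, is the sum of the residual densities
  issuing from the uniform one. On level \<open>l\<close> it is restricted to the points whose column is higher
  than \<open>l\<close>.
\<close>

definition \<rho> :: "'a \<Rightarrow> ennreal" where "\<rho> z = (\<Sum>j. residual one j z)"

lemma residual_one_measurable[measurable]: "residual one j \<in> borel_measurable M"
  by (rule regular_measurable[OF regular_residual[OF regular_one]])

lemma \<rho>_measurable[measurable]: "\<rho> \<in> borel_measurable M"
  unfolding \<rho>_def[abs_def] by measurable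

lemma sum_h: assumes \<phi>: "level_meas \<phi>" shows "(\<Sum>n. h \<phi> one n) = (\<Sum>k. H \<phi> k \<rho>)"
proof -
  have [measurable]: "(\<lambda>z. \<phi> (z, l)) \<in> borel_measurable M" for l using \<phi> by (simp add: level_meas_def)
  have "(\<Sum>n. h \<phi> one n) = (\<Sum>j. \<Sum>k. H \<phi> k (residual one j))"
    unfolding h_def by (rule ennreal_suminf_triangle[of "\<lambda>j k. H \<phi> k (residual one j)"])
  also have "\<dots> = (\<Sum>k. \<Sum>j. H \<phi> k (residual one j))" by (rule ennreal_suminf_commute)
  also have "\<dots> = (\<Sum>k. H \<phi> k \<rho>)"
    unfolding H_def \<rho>_def by (rule suminf_cong, subst nn_integral_suminf[symmetric]) auto
  finally show ?thesis .
qed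

lemma sum_h_obs: assumes \<phi>: "obs \<phi>" shows "(\<Sum>n. h \<phi> one n) = ennreal (c * suminf zb * N \<phi>)"
proof -
  have "summable (\<lambda>n. c * (hr \<phi> one n / c))" by (rule summable_mult[OF hr_one_summable[OF \<phi>]])
  then have s: "summable (hr \<phi> one)" using c_pos by simp
  have "(\<Sum>n. h \<phi> one n) = (\<Sum>n. ennreal (hr \<phi> one n))"
    unfolding hr_def using h_finite[OF \<phi> regular_one] by simp
  also have "\<dots> = ennreal (suminf (hr \<phi> one))" by (rule suminf_ennreal2[OF hr_nonneg s])
  also have "suminf (hr \<phi> one) = c * (\<Sum>n. hr \<phi> one n / c)"
    using suminf_mult[OF hr_one_summable[OF \<phi>], of c] c_pos by simp
  also have "\<dots> = c * suminf zb * N \<phi>" unfolding N_def using zb_sum_pos by simp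
  finally show ?thesis .
qed

lemma \<rho>_finite: "(\<integral>\<^sup>+z. \<rho> z \<partial>M) < \<infinity>"
proof -
  have "(\<integral>\<^sup>+z. \<rho> z \<partial>M) = H (\<lambda>_. 1) 0 \<rho>"
    unfolding H_def using rtime_pos by (intro nn_integral_cong) (auto simp: indicator_def)
  also have "\<dots> \<le> (\<Sum>k. H (\<lambda>_. 1) k \<rho>)" using sum_le_suminf[of "\<lambda>k. H (\<lambda>_. 1) k \<rho>" "{0}"] by simp
  also have "\<dots> = (\<Sum>n. h (\<lambda>_. 1) one n)" using obs_one by (intro sum_h[symmetric]) (simp add: obs_def)
  also have "\<dots> < \<infinity>" unfolding sum_h_obs[OF obs_one] by simp
  finally show ?thesis .
qed

lemma regular_\<rho>: "regular \<rho>"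
  unfolding regular_def \<rho>_def[abs_def] using \<rho>_finite
  by (auto simp: \<rho>_def intro!: reg_suminf) (use regular_residual[OF regular_one] in \<open>simp add: regular_def\<close>)

lemma \<rho>_pos: assumes "z \<in> G" shows "0 < \<rho> z"
proof -
  have "0 < residual one 0 z" by (simp add: residual_0)
  also have "\<dots> \<le> \<rho> z" unfolding \<rho>_def using sum_le_suminf[of "\<lambda>j. residual one j z" "{0}"] by simp
  finally show ?thesis .
qed

definition \<nu> :: "('a \<times> nat) measure" where
  "\<nu> = density TM (\<lambda>x. ennreal (1 / (c * suminf zb)) * \<rho> (fst x))"

lemma sets_\<nu>[measurable_cong, simp]: "sets \<nu> = sets TM" and space_\<nu>: "space \<nu> = \<Omega>"
  unfolding \<nu>_def by (auto simp: space_TM)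

lemma measurable_\<nu>: "measurable \<nu> A = measurable TM A" "measurable A \<nu> = measurable A TM"
  by (rule measurable_cong_sets[OF sets_\<nu> refl], rule measurable_cong_sets[OF refl sets_\<nu>])

lemma fst_TM[measurable]: "fst \<in> TM \<rightarrow>\<^sub>M M" and snd_TM[measurable]: "snd \<in> TM \<rightarrow>\<^sub>M count_space UNIV"
  unfolding tower_measure_def by (auto intro: measurable_restrict_space1)

lemma nn_integral_\<nu>:
  assumes [measurable]: "\<phi> \<in> borel_measurable TM"
  shows "(\<integral>\<^sup>+x. \<phi> x \<partial>\<nu>) = ennreal (1 / (c * suminf zb)) * (\<Sum>l. H \<phi> l \<rho>)"
proof -
  have "(\<integral>\<^sup>+x. \<phi> x \<partial>\<nu>) = (\<integral>\<^sup>+x. ennreal (1 / (c * suminf zb)) * (\<rho> (fst x) * \<phi> x) \<partial>TM)"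
    unfolding \<nu>_def by (subst nn_integral_density) (auto simp: mult.assoc)
  also have "\<dots> = ennreal (1 / (c * suminf zb)) * (\<integral>\<^sup>+x. \<rho> (fst x) * \<phi> x \<partial>TM)"
    by (rule nn_integral_cmult) measurable
  also have "(\<integral>\<^sup>+x. \<rho> (fst x) * \<phi> x \<partial>TM) = (\<Sum>l. H \<phi> l \<rho>)"
    by (subst nn_integral_TM) (auto simp: H_def mult_ac)
  finally show ?thesis .
qed

lemma nn_integral_\<nu>_obs: assumes \<phi>: "obs \<phi>" shows "(\<integral>\<^sup>+x. \<phi> x \<partial>\<nu>) = ennreal (N \<phi>)"
proof -
  have level_meas: "level_meas \<phi>" using \<phi> by (simp add: obs_def)
  have "(\<integral>\<^sup>+x. \<phi> x \<partial>\<nu>) = ennreal (1 / (c * suminf zb)) * ennreal (c * suminf zb * N \<phi>)"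
    unfolding nn_integral_\<nu>[OF level_meas_TM[OF level_meas]] sum_h[OF level_meas, symmetric] sum_h_obs[OF \<phi>] ..
  also have "\<dots> = ennreal (N \<phi>)"
    using c_pos zb_sum_pos by (simp add: ennreal_mult'[symmetric])
  finally show ?thesis .
qed

lemma N_one: "N (\<lambda>_. 1) = 1"
  unfolding N_def using zb_sum_pos by (simp add: zb_def[symmetric])

lemma prob_space_\<nu>: "prob_space \<nu>"
proof
  have "emeasure \<nu> (space \<nu>) = (\<integral>\<^sup>+x. 1 \<partial>\<nu>)" by simp
  also have "\<dots> = 1" unfolding nn_integral_\<nu>_obs[OF obs_one] N_one by simp
  finally show "emeasure \<nu> (space \<nu>) = 1" .
qed

lemma N_limit: assumes "obs \<phi>" shows "(\<lambda>n. Ir \<phi> n one / c) \<longlonglongrightarrow> N \<phi>"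
proof (rule LIM_zero_cancel, rule Lim_null_comparison)
  show "\<forall>\<^sub>F n in sequentially. norm (Ir \<phi> n one / c - N \<phi>) \<le> ren.renewal_err (Suc n)"
  proof (rule always_eventually, rule allI)
    fix n
    have "\<bar>Ir \<phi> n one / c - N \<phi>\<bar> = \<bar>Ir \<phi> n one - c * N \<phi>\<bar> / c"
      using c_pos by (simp add: diff_divide_distrib abs_div_pos)
    also have "\<dots> \<le> ren.renewal_err (Suc n)" using x_rate[OF assms, of n] c_pos by (simp add: field_simps)
    finally show "norm (Ir \<phi> n one / c - N \<phi>) \<le> ren.renewal_err (Suc n)" by simp
  qed
  show "(\<lambda>n. ren.renewal_err (Suc n)) \<longlonglongrightarrow> 0" by (rule LIMSEQ_Suc[OF ren.renewal_err_tendsto])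
qed

lemma N_shift: assumes \<phi>: "obs \<phi>" shows "N (\<lambda>x. \<phi> (F x)) = N \<phi>"
proof -
  have o: "obs (\<lambda>x. \<phi> (F x))"
    using level_meas_funpow[of \<phi> 1] \<phi> unfolding obs_def level_meas_def by simp
  have "Ir (\<lambda>x. \<phi> (F x)) n one = Ir \<phi> (Suc n) one" for n by (simp add: Ir_def I_def)
  then have "(\<lambda>n. Ir \<phi> (Suc n) one / c) \<longlonglongrightarrow> N (\<lambda>x. \<phi> (F x))" using N_limit[OF o] by simp
  moreover have "(\<lambda>n. Ir \<phi> (Suc n) one / c) \<longlonglongrightarrow> N \<phi>" by (rule LIMSEQ_Suc[OF N_limit[OF \<phi>]])
  ultimately show ?thesis by (rule LIMSEQ_unique)
qed

text \<open>
  Invariance is a consequence of convergence, since composing \<open>\<phi>\<close> with \<open>F\<close> shifts the time by one.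
\<close>

lemma acip_\<nu>: "acip T \<nu>"
  unfolding acip_def invariant_measure_def
proof (intro conjI)
  show "sets \<nu> = sets TM" by simp
  show "prob_space \<nu>" by (rule prob_space_\<nu>)
  show F: "F \<in> \<nu> \<rightarrow>\<^sub>M \<nu>" by (simp add: measurable_\<nu>)
  show "absolutely_continuous TM \<nu>" unfolding \<nu>_def by (rule absolutely_continuousI_density) measurable
  show "distr \<nu> \<nu> F = \<nu>"
  proof (rule measure_eqI)
    fix A assume "A \<in> sets (distr \<nu> \<nu> F)"
    then have A[measurable]: "A \<in> sets TM" by simp
    then have sub: "A \<subseteq> \<Omega>" using sets.sets_into_space space_TM by blast
    have e: "ext (indicator A) = (indicator A :: _ \<Rightarrow> ennreal)"
      using sub by (auto simp: ext_def indicator_def fun_eq_iff)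
    have o: "obs (indicator A)" unfolding obs_def using level_meas_ext[of "indicator A"] by (simp add: e indicator_def)
    then have o': "obs (\<lambda>x. indicator A (F x))"
      using level_meas_funpow[of "indicator A" 1] unfolding obs_def level_meas_def by simp
    have "emeasure (distr \<nu> \<nu> F) A = (\<integral>\<^sup>+x. indicator A (F x) \<partial>\<nu>)"
      using F by (subst nn_integral_indicator[symmetric], simp, subst nn_integral_distr) auto
    also have "\<dots> = (\<integral>\<^sup>+x. indicator A x \<partial>\<nu>)"
      unfolding nn_integral_\<nu>_obs[OF o'] nn_integral_\<nu>_obs[OF o] N_shift[OF o] ..
    also have "\<dots> = emeasure \<nu> A" by simp
    finally show "emeasure (distr \<nu> \<nu> F) A = emeasure \<nu> A" .
  qed simp
qed

section \<open>Itineraries\<close>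

text \<open>
  The indices of the parts visited by the first \<open>k\<close> iterates under the return map, and the time of
  the \<open>k\<close>-th return to the base. Unlike the cylinders themselves, itineraries form a countable type,
  over which integrals can be decomposed.
\<close>

primrec itinerary :: "nat \<Rightarrow> 'a \<Rightarrow> nat list" where
  "itinerary 0 z = []"
| "itinerary (Suc k) z = idx z # itinerary k (ret T z)"

primrec return_sum :: "nat \<Rightarrow> 'a \<Rightarrow> nat" where
  "return_sum 0 z = 0"
| "return_sum (Suc k) z = rtime T z + return_sum k (ret T z)"

text \<open>
  The density on the base, after the returns prescribed by a word, of the mass in the corresponding
  cylinder.
\<close>

primrec word_op :: "nat list \<Rightarrow> ('a \<Rightarrow> ennreal) \<Rightarrow> 'a \<Rightarrow> ennreal" where
  "word_op [] f = f"
| "word_op (i # w) f = word_op w (transfer_op (\<lambda>j. if j = i then 1 else 0) f)"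

lemma itinerary_measurable[measurable]: "itinerary k \<in> M \<rightarrow>\<^sub>M count_space UNIV"
proof (induction k)
  case (Suc k)
  note [measurable] = measurable_compose[OF ret_measurable Suc]
  have "(\<lambda>z. idx z # itinerary k (ret T z)) \<in> M \<rightarrow>\<^sub>M count_space UNIV"
    by (rule measurable_compose_countable[where f = "\<lambda>w z. idx z # w" and g = "\<lambda>z. itinerary k (ret T z)"])
      (auto intro: measurable_compose[OF idx_measurable])
  then show ?case by simp
qed simp

lemma return_sum_measurable[measurable]: "return_sum k \<in> M \<rightarrow>\<^sub>M count_space UNIV"
proof (induction k)
  case (Suc k)
  note [measurable] = measurable_compose[OF ret_measurable Suc]
  have "(\<lambda>z. rtime T z + return_sum k (ret T z)) \<in> M \<rightarrow>\<^sub>M count_space UNIV" by measurable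
  then show ?case by simp
qed simp

lemma length_itinerary: "length (itinerary k z) = k" by (induction k arbitrary: z) auto

lemma return_sum_itinerary: "z \<in> good_base T \<Longrightarrow> return_sum k z = sum_list (map branch_time (itinerary k z))"
  by (induction k arbitrary: z) (auto simp: rtime_idx good_ret)

lemma regular_transfer_op: assumes f: "regular f" and V: "\<And>i. V i \<le> 1" shows "regular (transfer_op V f)" "(\<integral>\<^sup>+y. transfer_op V f y \<partial>M) \<le> (\<integral>\<^sup>+y. f y \<partial>M)"
proof -
  have [measurable]: "f \<in> borel_measurable M" by (rule regular_measurable[OF f])
  have "(\<integral>\<^sup>+y. transfer_op V f y \<partial>M) = (\<integral>\<^sup>+z. V (idx z) * f z \<partial>M)" using nn_integral_transfer_op[of f one V] by simp
  also have "\<dots> \<le> (\<integral>\<^sup>+z. 1 * f z \<partial>M)" by (intro nn_integral_mono mult_right_mono V) auto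
  finally show "(\<integral>\<^sup>+y. transfer_op V f y \<partial>M) \<le> (\<integral>\<^sup>+y. f y \<partial>M)" by simp
  moreover have "reg K1 (transfer_op V f)" using f reg_mono[OF reg_transfer_op_K K_le_K1] by (simp add: regular_def)
  ultimately show "regular (transfer_op V f)" using f by (auto simp: regular_def intro: le_less_trans)
qed

lemma regular_word_op: "regular f \<Longrightarrow> regular (word_op w f)"
proof (induction w arbitrary: f)
  case (Cons i w)
  have "regular (transfer_op (\<lambda>j. if j = i then 1 else 0) f)" by (rule regular_transfer_op(1)[OF Cons.prems]) simp
  from Cons.IH[OF this] show ?case by simp
qed simp

text \<open>
  Duality, iterated along the word.
\<close>

lemma nn_integral_word_op:
  assumes "regular f" "k \<in> borel_measurable M"
  shows "(\<integral>\<^sup>+y. word_op w f y * k y \<partial>M) = (\<integral>\<^sup>+z. indicator {z. itinerary (length w) z = w} z * f z * k ((ret T ^^ length w) z) \<partial>M)"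
  using assms
proof (induction w arbitrary: f)
  case (Cons i w)
  let ?V = "\<lambda>j. if j = i then 1 else (0 :: ennreal)"
  note [measurable] = regular_measurable[OF Cons.prems(1)] Cons.prems(2)
  have [measurable]: "(\<lambda>z. k ((ret T ^^ length w) z)) \<in> borel_measurable M"
    by (rule measurable_compose[OF funpow_ret_measurable]) simp
  have [measurable]: "Measurable.pred M (\<lambda>z. z \<in> {z. itinerary (length w) z = w})" by simp
  have "(\<integral>\<^sup>+y. word_op (i # w) f y * k y \<partial>M) =
      (\<integral>\<^sup>+z. transfer_op ?V f z * (indicator {z. itinerary (length w) z = w} z * k ((ret T ^^ length w) z)) \<partial>M)"
    unfolding word_op.simps by (subst Cons.IH) (use Cons.prems in \<open>auto intro!: regular_transfer_op(1) simp: mult_ac\<close>)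
  also have "\<dots> = (\<integral>\<^sup>+z. ?V (idx z) * f z * (indicator {z. itinerary (length w) z = w} (ret T z) * k ((ret T ^^ length w) (ret T z))) \<partial>M)"
    by (rule nn_integral_transfer_op) measurable
  also have "\<dots> = (\<integral>\<^sup>+z. indicator {z. itinerary (length (i # w)) z = i # w} z * f z * k ((ret T ^^ length (i # w)) z) \<partial>M)"
    by (intro nn_integral_cong) (auto simp: indicator_def funpow_swap1)
  finally show ?case .
qed simp

lemma orbit_Sk0: "z \<in> space M \<Longrightarrow> return_sum k z \<le> n \<Longrightarrow> (F ^^ n) (z, 0) = (F ^^ (n - return_sum k z)) ((ret T ^^ k) z, 0)"
proof (induction k arbitrary: z n)
  case (Suc k)
  have "(F ^^ n) (z, 0) = (F ^^ (n - rtime T z)) (ret T z, 0)"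
    using tower_orbit[OF rtime_pos[OF Suc.prems(1)], of n] Suc.prems by simp
  also have "\<dots> = (F ^^ (n - rtime T z - return_sum k (ret T z))) ((ret T ^^ k) (ret T z), 0)"
    using Suc.prems by (intro Suc.IH ret_space) auto
  finally show ?case by (simp add: funpow_swap1)
qed simp

lemma orbit_return_sum:
  assumes z: "z \<in> space M" and l: "l < rtime T z" and n: "return_sum (Suc k) z \<le> n + l"
  shows "(F ^^ n) (z, l) = (F ^^ (n + l - return_sum (Suc k) z)) ((ret T ^^ Suc k) z, 0)"
proof -
  have "(F ^^ n) (z, l) = (F ^^ (n - (rtime T z - l))) (ret T z, 0)"
    using tower_orbit[OF l, of n] n l by simp
  also have "\<dots> = (F ^^ (n - (rtime T z - l) - return_sum k (ret T z))) ((ret T ^^ k) (ret T z), 0)"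
    using n l z by (intro orbit_Sk0 ret_space) auto
  also have "n - (rtime T z - l) - return_sum k (ret T z) = n + l - return_sum (Suc k) z" using n l by simp
  finally show ?thesis by (simp add: funpow_swap1)
qed

text \<open>
  Passes from estimates on single cylinders to an arbitrary function of the itinerary.
\<close>

lemma nn_integral_partition_mono:
  assumes [measurable]: "cc \<in> M' \<rightarrow>\<^sub>M count_space (UNIV :: 'c::countable set)" "k1 \<in> borel_measurable M'" "k2 \<in> borel_measurable M'"
    and le: "\<And>j. (\<integral>\<^sup>+z. indicator {z. cc z = j} z * k1 z \<partial>M') \<le> (\<integral>\<^sup>+z. indicator {z. cc z = j} z * k2 z \<partial>M')"
  shows "(\<integral>\<^sup>+z. g (cc z) * k1 z \<partial>M') \<le> (\<integral>\<^sup>+z. g (cc z) * k2 z \<partial>M')"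
proof -
  have eq: "(\<integral>\<^sup>+z. g (cc z) * u z \<partial>M') = (\<Sum>i. \<integral>\<^sup>+z. g (from_nat i) * (indicator {z. to_nat (cc z) = i} z * u z) \<partial>M')"
    if [measurable]: "u \<in> borel_measurable M'" for u
  proof -
    have [measurable]: "Measurable.pred M' (\<lambda>z. z \<in> {z. to_nat (cc z) = i})" for i by simp
    have "(\<integral>\<^sup>+z. g (cc z) * u z \<partial>M') = (\<integral>\<^sup>+z. (\<Sum>i. g (from_nat i) * (indicator {z. to_nat (cc z) = i} z * u z)) \<partial>M')"
    proof (rule nn_integral_cong)
      fix z
      have "(\<Sum>i. g (from_nat i) * (indicator {z. to_nat (cc z) = i} z * u z))
        = (\<Sum>i\<in>{to_nat (cc z)}. g (from_nat i) * (indicator {z. to_nat (cc z) = i} z * u z))"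
        by (rule suminf_finite) auto
      then show "g (cc z) * u z = (\<Sum>i. g (from_nat i) * (indicator {z. to_nat (cc z) = i} z * u z))" by simp
    qed
    also have "\<dots> = (\<Sum>i. \<integral>\<^sup>+z. g (from_nat i) * (indicator {z. to_nat (cc z) = i} z * u z) \<partial>M')"
      by (rule nn_integral_suminf) measurable
    finally show ?thesis .
  qed
  have "(\<integral>\<^sup>+z. g (from_nat i) * (indicator {z. to_nat (cc z) = i} z * k1 z) \<partial>M')
      \<le> (\<integral>\<^sup>+z. g (from_nat i) * (indicator {z. to_nat (cc z) = i} z * k2 z) \<partial>M')" for i
  proof -
    have [measurable]: "Measurable.pred M' (\<lambda>z. z \<in> {z. to_nat (cc z) = i})" by simp
    have "(\<integral>\<^sup>+z. indicator {z. to_nat (cc z) = i} z * k1 z \<partial>M') \<le> (\<integral>\<^sup>+z. indicator {z. to_nat (cc z) = i} z * k2 z \<partial>M')"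
    proof (cases "\<exists>j::'c. to_nat j = i")
      case True
      then obtain j :: 'c where "to_nat j = i" by blast
      then have "{z. to_nat (cc z) = i} = {z. cc z = j}" by auto
      then show ?thesis using le[of j] by simp
    next
      case False
      then have "{z. to_nat (cc z) = i} = {}" by auto
      then show ?thesis by simp
    qed
    then show ?thesis by (subst (1 2) nn_integral_cmult) (auto intro!: mult_left_mono)
  qed
  then show ?thesis unfolding eq[OF assms(2)] eq[OF assms(3)] by (intro suminf_le) auto
qed

text \<open>
  The error on a single point of a cylinder. The orbit of \<open>(z, l)\<close> makes its return number \<open>k + 1\<close>
  at time \<open>return_sum (Suc k) z - l\<close>. If this is at most \<open>n / 2\<close>, at least half of the time is left for
  convergence; otherwise only the trivial bound is available.
\<close>

definition return_err :: "nat \<Rightarrow> nat \<Rightarrow> 'a \<times> nat \<Rightarrow> real" where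
  "return_err k n x = (if return_sum (Suc k) (fst x) \<le> n div 2 + snd x then regular_err (n div 2) else 1)"

text \<open>
  On a cylinder of length \<open>k + 1\<close> the time of the return number \<open>k + 1\<close> is constant. The density
  pushed forward to the base is \<open>word_op w \<rho>\<close>, which is regular, so \<open>regular_rate\<close> applies with the
  remaining time. As there is no subtraction for nonnegative integrals, the estimate has the form of
  two inequalities.
\<close>

lemma piece_estimate:
  fixes \<phi> :: "'a \<times> nat \<Rightarrow> ennreal" and n k l :: nat and w :: "nat list"
  assumes \<phi>: "obs \<phi>"
  defines "A \<equiv> \<lambda>l. (\<lambda>z. indicator {z. l < rtime T z} z * \<phi> ((F ^^ n) (z, l)) * \<rho> z)"
    and "B \<equiv> \<lambda>l. (\<lambda>z. indicator {z. l < rtime T z} z * \<rho> z)"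
  shows "(\<integral>\<^sup>+z. indicator {z. itinerary (Suc k) z = w} z * A l z \<partial>M) \<le>
      (\<integral>\<^sup>+z. indicator {z. itinerary (Suc k) z = w} z * ((ennreal (N \<phi>) + ennreal (return_err k n (z, l))) * B l z) \<partial>M)" (is ?A)
    "(\<integral>\<^sup>+z. indicator {z. itinerary (Suc k) z = w} z * (ennreal (N \<phi>) * B l z) \<partial>M) \<le>
      (\<integral>\<^sup>+z. indicator {z. itinerary (Suc k) z = w} z * (A l z + ennreal (return_err k n (z, l)) * B l z) \<partial>M)" (is ?B)
proof -
  have level_meas: "level_meas \<phi>" using \<phi> by (simp add: obs_def)
  note [measurable] = level_meas_funpow[OF level_meas]
  let ?X = "{z. itinerary (Suc k) z = w}"
  have [measurable]: "Measurable.pred M (\<lambda>z. z \<in> ?X)" by (simp del: itinerary.simps)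
  have N: "0 \<le> N \<phi>" "N \<phi> \<le> 1" using N_bounds[OF \<phi>] by auto
  show ?A ?B
  proof (atomize (full), cases "length w = Suc k \<and> l < branch_time (hd w) \<and> sum_list (map branch_time w) \<le> n div 2 + l")
    case True
    then obtain i w' where w: "w = i # w'" by (cases w) auto
    have lw: "length w = Suc k" using True by simp
    define f where "f = word_op w \<rho>"
    have f: "regular f" unfolding f_def by (rule regular_word_op[OF regular_\<rho>])
    have [measurable]: "f \<in> borel_measurable M" by (rule regular_measurable[OF f])
    define n' where "n' = n + l - sum_list (map branch_time w)"
    have n': "n div 2 \<le> n'" using True unfolding n'_def by auto
    have mf: "(\<integral>\<^sup>+z. indicator ?X z * B l z \<partial>M) = ennreal (mass f)"
    proof -
      have "(\<integral>\<^sup>+z. indicator ?X z * B l z \<partial>M) = (\<integral>\<^sup>+z. indicator {z. itinerary (length w) z = w} z * \<rho> z * 1 \<partial>M)"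
      proof (rule nn_integral_cong_AE)
        show "AE z in M. indicator ?X z * B l z = indicator {z. itinerary (length w) z = w} z * \<rho> z * 1"
          using AE_good_base
        proof eventually_elim
          case (elim z)
          show ?case
          proof (cases "itinerary (Suc k) z = w")
            case X: True
            then have "idx z = hd w" unfolding w by simp
            then have "l < rtime T z" using True rtime_idx[OF elim] by simp
            then show ?thesis using X lw by (simp add: B_def)
          qed (use lw in \<open>simp del: itinerary.simps\<close>)
        qed
      qed
      also have "\<dots> = (\<integral>\<^sup>+y. f y * 1 \<partial>M)" unfolding f_def by (rule nn_integral_word_op[OF regular_\<rho>, symmetric]) simp
      finally show ?thesis using ennreal_mass[OF f] by simp
    qed
    have mA: "(\<integral>\<^sup>+z. indicator ?X z * A l z \<partial>M) = ennreal (Ir \<phi> n' f)"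
    proof -
      have "(\<integral>\<^sup>+z. indicator ?X z * A l z \<partial>M) =
          (\<integral>\<^sup>+z. indicator {z. itinerary (length w) z = w} z * \<rho> z * \<phi> ((F ^^ n') ((ret T ^^ length w) z, 0)) \<partial>M)"
      proof (rule nn_integral_cong_AE)
        show "AE z in M. indicator ?X z * A l z =
          indicator {z. itinerary (length w) z = w} z * \<rho> z * \<phi> ((F ^^ n') ((ret T ^^ length w) z, 0))"
          using AE_good_base AE_space
        proof eventually_elim
          case (elim z)
          show ?case
          proof (cases "itinerary (Suc k) z = w")
            case X: True
            then have "idx z = hd w" unfolding w by simp
            then have l: "l < rtime T z" using True rtime_idx[OF elim(1)] by simp
            have S: "return_sum (Suc k) z = sum_list (map branch_time w)" using return_sum_itinerary[OF elim(1), of "Suc k"] by (simp only: X)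
            have "(F ^^ n) (z, l) = (F ^^ (n + l - return_sum (Suc k) z)) ((ret T ^^ Suc k) z, 0)"
              using True S by (intro orbit_return_sum elim l) auto
            then have "(F ^^ n) (z, l) = (F ^^ n') ((ret T ^^ length w) z, 0)" unfolding S lw n'_def .
            then show ?thesis using X lw l by (simp add: A_def mult_ac)
          qed (use lw in \<open>simp del: itinerary.simps\<close>)
        qed
      qed
      also have "\<dots> = (\<integral>\<^sup>+y. f y * \<phi> ((F ^^ n') (y, 0)) \<partial>M)" unfolding f_def by (rule nn_integral_word_op[OF regular_\<rho>, symmetric]) simp
      also have "\<dots> = I \<phi> n' f" unfolding I_def by (simp add: mult.commute)
      finally show ?thesis unfolding Ir_def using I_finite[OF \<phi> f, of n'] by simp
    qed
    have q: "AE z in M. indicator ?X z * (ennreal (return_err k n (z, l)) * B l z) = ennreal (regular_err (n div 2)) * (indicator ?X z * B l z)"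
      using AE_good_base
    proof eventually_elim
      case (elim z)
      show ?case
      proof (cases "itinerary (Suc k) z = w")
        case X: True
        then have S: "return_sum (Suc k) z = sum_list (map branch_time w)" using return_sum_itinerary[OF elim(1), of "Suc k"] by (simp only: X)
        then have "return_err k n (z, l) = regular_err (n div 2)" using True unfolding return_err_def by (simp del: return_sum.simps)
        then show ?thesis using X by (simp del: itinerary.simps)
      qed (simp del: itinerary.simps)
    qed
    have r: "\<bar>Ir \<phi> n' f - mass f * N \<phi>\<bar> \<le> mass f * regular_err (n div 2)"
      using regular_rate[OF \<phi> f, of n'] regular_err_antimono[OF n'] mass_nonneg[of f] by (meson mult_left_mono order_trans)
    have Bm[measurable]: "B l \<in> borel_measurable M" and Am[measurable]: "A l \<in> borel_measurable M"
      unfolding A_def B_def by measurable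
    have iq: "(\<integral>\<^sup>+z. indicator ?X z * (ennreal (return_err k n (z, l)) * B l z) \<partial>M) = ennreal (regular_err (n div 2) * mass f)"
    proof -
      have "(\<integral>\<^sup>+z. indicator ?X z * (ennreal (return_err k n (z, l)) * B l z) \<partial>M) = (\<integral>\<^sup>+z. ennreal (regular_err (n div 2)) * (indicator ?X z * B l z) \<partial>M)"
        by (rule nn_integral_cong_AE[OF q])
      also have "\<dots> = ennreal (regular_err (n div 2)) * (\<integral>\<^sup>+z. indicator ?X z * B l z \<partial>M)" by (rule nn_integral_cmult) measurable
      finally show ?thesis unfolding mf using regular_err_nonneg by (simp add: ennreal_mult'[symmetric])
    qed
    have iN: "(\<integral>\<^sup>+z. indicator ?X z * (ennreal (N \<phi>) * B l z) \<partial>M) = ennreal (N \<phi> * mass f)"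
    proof -
      have "(\<integral>\<^sup>+z. indicator ?X z * (ennreal (N \<phi>) * B l z) \<partial>M) = (\<integral>\<^sup>+z. ennreal (N \<phi>) * (indicator ?X z * B l z) \<partial>M)"
        by (simp only: mult.left_commute)
      also have "\<dots> = ennreal (N \<phi>) * (\<integral>\<^sup>+z. indicator ?X z * B l z \<partial>M)" by (rule nn_integral_cmult) measurable
      finally show ?thesis unfolding mf using N by (simp add: ennreal_mult'[symmetric])
    qed
    have [measurable]: "(\<lambda>z. return_err k n (z, l)) \<in> borel_measurable M"
      unfolding return_err_def fst_conv snd_conv by measurable
    have "(\<integral>\<^sup>+z. indicator ?X z * ((ennreal (N \<phi>) + ennreal (return_err k n (z, l))) * B l z) \<partial>M) =
      (\<integral>\<^sup>+z. indicator ?X z * (ennreal (N \<phi>) * B l z) + indicator ?X z * (ennreal (return_err k n (z, l)) * B l z) \<partial>M)"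
      by (simp only: distrib_left distrib_right)
    also have "\<dots> = ennreal (N \<phi> * mass f) + ennreal (regular_err (n div 2) * mass f)"
      by (subst nn_integral_add) (auto simp: iN iq simp del: itinerary.simps)
    also have "\<dots> = ennreal (N \<phi> * mass f + regular_err (n div 2) * mass f)"
      using N regular_err_nonneg mass_nonneg[of f] by (intro ennreal_plus[symmetric]) auto
    finally have 1: "(\<integral>\<^sup>+z. indicator ?X z * ((ennreal (N \<phi>) + ennreal (return_err k n (z, l))) * B l z) \<partial>M) =
      ennreal (N \<phi> * mass f + regular_err (n div 2) * mass f)" .
    have "(\<integral>\<^sup>+z. indicator ?X z * (A l z + ennreal (return_err k n (z, l)) * B l z) \<partial>M) =
      (\<integral>\<^sup>+z. indicator ?X z * A l z + indicator ?X z * (ennreal (return_err k n (z, l)) * B l z) \<partial>M)"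
      by (simp only: distrib_left)
    also have "\<dots> = ennreal (Ir \<phi> n' f) + ennreal (regular_err (n div 2) * mass f)"
      by (subst nn_integral_add) (auto simp: mA iq simp del: itinerary.simps)
    also have "\<dots> = ennreal (Ir \<phi> n' f + regular_err (n div 2) * mass f)"
      using regular_err_nonneg mass_nonneg[of f] by (intro ennreal_plus[symmetric]) (auto simp: Ir_def)
    finally have 2: "(\<integral>\<^sup>+z. indicator ?X z * (A l z + ennreal (return_err k n (z, l)) * B l z) \<partial>M) =
      ennreal (Ir \<phi> n' f + regular_err (n div 2) * mass f)" .
    show "?A \<and> ?B" unfolding 1 2 mA iN using r by (auto intro!: ennreal_leI simp: mult.commute abs_le_iff)
  next
    case False
    have *: "AE z in M. z \<in> ?X \<longrightarrow> B l z = 0 \<or> return_err k n (z, l) = 1"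
      using AE_good_base
    proof eventually_elim
      case (elim z)
      show ?case
      proof
        assume "z \<in> ?X"
        then have X: "itinerary (Suc k) z = w" by simp
        have lw: "length w = Suc k" using length_itinerary[of "Suc k" z] by (simp only: X)
        have "idx z = hd w" using X by auto
        then have R: "rtime T z = branch_time (hd w)" using rtime_idx[OF elim] by simp
        have S: "return_sum (Suc k) z = sum_list (map branch_time w)" using return_sum_itinerary[OF elim(1), of "Suc k"] by (simp only: X)
        show "B l z = 0 \<or> return_err k n (z, l) = 1"
        proof (cases "l < branch_time (hd w)")
          case True
          then show ?thesis using False lw S unfolding return_err_def by (simp del: return_sum.simps)
        qed (simp add: B_def R)
      qed
    qed
    have AB: "A l z \<le> B l z" for z
      unfolding A_def B_def using obs_le[OF \<phi>] by (intro mult_right_mono mult_left_le) auto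
    have N1: "ennreal (N \<phi>) \<le> 1" using N by simp
    have ?A
    proof (rule nn_integral_mono_AE, use * in eventually_elim)
      case (elim z)
      show ?case
      proof (cases "z \<in> ?X")
        case True
        then consider "B l z = 0" | "return_err k n (z, l) = 1" using elim by blast
        then show ?thesis
        proof cases
          case 1
          then show ?thesis using AB[of z] by simp
        next
          case 2
          have "A l z \<le> (ennreal (N \<phi>) + 1) * B l z"
            by (rule order_trans[OF AB]) (simp add: distrib_right)
          then show ?thesis unfolding 2 by (intro mult_left_mono) auto
        qed
      qed simp
    qed
    moreover have ?B
    proof (rule nn_integral_mono_AE, use * in eventually_elim)
      case (elim z)
      show ?case
      proof (cases "z \<in> ?X")
        case True
        then consider "B l z = 0" | "return_err k n (z, l) = 1" using elim by blast
        then show ?thesis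
        proof cases
          case 2
          have "ennreal (N \<phi>) * B l z \<le> 1 * B l z" by (intro mult_right_mono N1) auto
          also have "\<dots> \<le> A l z + ennreal 1 * B l z" by simp
          finally show ?thesis unfolding 2 by (intro mult_left_mono) auto
        qed simp
      qed simp
    qed
    ultimately show "?A \<and> ?B" ..
  qed
qed

end

section \<open>Correlations with functions of finitely many symbols\<close>

context distorted_tower
begin

definition cyl :: "nat \<Rightarrow> 'a \<times> nat \<Rightarrow> nat list \<times> nat" where "cyl k x = (itinerary (Suc k) (fst x), snd x)"

lemma cyl_measurable[measurable]: "cyl k \<in> TM \<rightarrow>\<^sub>M count_space UNIV"
proof -
  have 1: "(\<lambda>x. itinerary (Suc k) (fst x)) \<in> TM \<rightarrow>\<^sub>M count_space UNIV"
    by (rule measurable_compose[OF fst_TM itinerary_measurable])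
  have 2: "(\<lambda>x. (w, snd x)) \<in> TM \<rightarrow>\<^sub>M count_space UNIV" for w :: "nat list"
    by (rule measurable_compose[OF snd_TM measurable_count_space])
  show ?thesis unfolding cyl_def[abs_def]
    by (rule measurable_compose_countable[where f = "\<lambda>w x. (w, snd x)", OF 2 1])
qed

lemma return_err_measurable[measurable]: "return_err k n \<in> borel_measurable TM"
proof -
  have [measurable]: "(\<lambda>x. return_sum (Suc k) (fst x)) \<in> TM \<rightarrow>\<^sub>M count_space UNIV"
    by (rule measurable_compose[OF fst_TM return_sum_measurable])
  have [measurable]: "(\<lambda>x. n div 2 + snd x) \<in> TM \<rightarrow>\<^sub>M count_space UNIV"
    by (rule measurable_compose[OF snd_TM measurable_count_space])
  have "Measurable.pred TM (\<lambda>x. \<not> n div 2 + snd x < return_sum (Suc k) (fst x))"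
    by (intro pred_intros_logic pred_less_nat) measurable
  then have [measurable]: "Measurable.pred TM (\<lambda>x. return_sum (Suc k) (fst x) \<le> n div 2 + snd x)" by (simp only: not_less)
  show ?thesis unfolding return_err_def[abs_def] by measurable
qed

lemma cylinder_rate:
  fixes \<phi> :: "'a \<times> nat \<Rightarrow> ennreal" and g :: "nat list \<times> nat \<Rightarrow> ennreal"
  assumes \<phi>: "obs \<phi>"
  shows "(\<integral>\<^sup>+x. \<phi> ((F ^^ n) x) * g (cyl k x) \<partial>\<nu>) \<le> (\<integral>\<^sup>+x. (ennreal (N \<phi>) + ennreal (return_err k n x)) * g (cyl k x) \<partial>\<nu>)" (is ?A)
    "(\<integral>\<^sup>+x. ennreal (N \<phi>) * g (cyl k x) \<partial>\<nu>) \<le> (\<integral>\<^sup>+x. (\<phi> ((F ^^ n) x) + ennreal (return_err k n x)) * g (cyl k x) \<partial>\<nu>)" (is ?B)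
proof -
  have level_meas: "level_meas \<phi>" using \<phi> by (simp add: obs_def)
  note [measurable] = level_meas_funpow[OF level_meas] level_meas_TM[OF level_meas]
  have [measurable]: "(\<lambda>x. \<phi> ((F ^^ n) x)) \<in> borel_measurable TM"
    by (rule measurable_compose[OF tower_pow_measurable level_meas_TM[OF level_meas]])
  have [measurable]: "(\<lambda>x. g (cyl k x)) \<in> borel_measurable TM"
    by (rule measurable_compose[OF cyl_measurable]) simp
  have [measurable]: "(\<lambda>z. return_err k n (z, l)) \<in> borel_measurable M" for l unfolding return_err_def fst_conv snd_conv by measurable
  define A where "A l z = indicator {z. l < rtime T z} z * \<phi> ((F ^^ n) (z, l)) * \<rho> z" for l z
  define B where "B l z = indicator {z. l < rtime T z} z * \<rho> z" for l z
  have [measurable]: "A l \<in> borel_measurable M" "B l \<in> borel_measurable M" for l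
    unfolding A_def[abs_def] B_def[abs_def] by measurable
  show ?A
  proof (subst (1 2) nn_integral_\<nu>, measurable, rule mult_left_mono, rule suminf_le)
    fix l
    have "H (\<lambda>x. \<phi> ((F ^^ n) x) * g (cyl k x)) l \<rho> = (\<integral>\<^sup>+z. g (itinerary (Suc k) z, l) * A l z \<partial>M)"
      unfolding H_def A_def cyl_def by (simp add: mult_ac del: itinerary.simps)
    also have "\<dots> \<le> (\<integral>\<^sup>+z. g (itinerary (Suc k) z, l) * ((ennreal (N \<phi>) + ennreal (return_err k n (z, l))) * B l z) \<partial>M)"
      by (rule nn_integral_partition_mono[where g = "\<lambda>w. g (w, l)", OF itinerary_measurable])
         (measurable, unfold A_def[abs_def] B_def[abs_def], rule piece_estimate(1)[OF \<phi>])
    also have "\<dots> = H (\<lambda>x. (ennreal (N \<phi>) + ennreal (return_err k n x)) * g (cyl k x)) l \<rho>"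
      unfolding H_def B_def cyl_def by (simp add: mult_ac del: itinerary.simps)
    finally show "H (\<lambda>x. \<phi> ((F ^^ n) x) * g (cyl k x)) l \<rho> \<le> H (\<lambda>x. (ennreal (N \<phi>) + ennreal (return_err k n x)) * g (cyl k x)) l \<rho>" .
  qed auto
  show ?B
  proof (subst (1 2) nn_integral_\<nu>, measurable, rule mult_left_mono, rule suminf_le)
    fix l
    have "H (\<lambda>x. ennreal (N \<phi>) * g (cyl k x)) l \<rho> = (\<integral>\<^sup>+z. g (itinerary (Suc k) z, l) * (ennreal (N \<phi>) * B l z) \<partial>M)"
      unfolding H_def B_def cyl_def by (simp add: mult_ac del: itinerary.simps)
    also have "\<dots> \<le> (\<integral>\<^sup>+z. g (itinerary (Suc k) z, l) * (A l z + ennreal (return_err k n (z, l)) * B l z) \<partial>M)"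
      by (rule nn_integral_partition_mono[where g = "\<lambda>w. g (w, l)", OF itinerary_measurable])
         (measurable, unfold A_def[abs_def] B_def[abs_def], rule piece_estimate(2)[OF \<phi>])
    also have "\<dots> = H (\<lambda>x. (\<phi> ((F ^^ n) x) + ennreal (return_err k n x)) * g (cyl k x)) l \<rho>"
      unfolding H_def A_def B_def cyl_def by (simp add: mult_ac distrib_left del: itinerary.simps)
    finally show "H (\<lambda>x. ennreal (N \<phi>) * g (cyl k x)) l \<rho> \<le> H (\<lambda>x. (\<phi> ((F ^^ n) x) + ennreal (return_err k n x)) * g (cyl k x)) l \<rho>" .
  qed auto
qed

sublocale nu: prob_space \<nu> by (rule prob_space_\<nu>)

lemma F_\<nu>[measurable]: "F \<in> \<nu> \<rightarrow>\<^sub>M \<nu>" by (simp add: measurable_\<nu>)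
lemma Fn_\<nu>[measurable]: "(F ^^ n) \<in> \<nu> \<rightarrow>\<^sub>M \<nu>" by (simp add: measurable_\<nu>)

lemma distr_F: "distr \<nu> \<nu> F = \<nu>" using acip_\<nu> by (simp add: acip_def invariant_measure_def)

lemma distr_Fn: "distr \<nu> \<nu> (F ^^ n) = \<nu>"
proof (induction n)
  case 0
  show ?case by (simp add: distr_id[unfolded id_def] id_def)
next
  case (Suc n)
  have "distr \<nu> \<nu> (F ^^ Suc n) = distr (distr \<nu> \<nu> (F ^^ n)) \<nu> F"
    by (subst distr_distr) (auto simp: comp_def)
  then show ?case by (simp only: Suc distr_F)
qed

lemma AE_Fn: assumes "AE x in \<nu>. Q x" shows "AE x in \<nu>. Q ((F ^^ n) x)"
proof -
  have "AE x in distr \<nu> \<nu> (F ^^ n). Q x" using assms by (simp only: distr_Fn)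
  then show ?thesis by (rule AE_distrD[OF Fn_\<nu>])
qed

lemma integral_Fn:
  fixes f :: "'a \<times> nat \<Rightarrow> real"
  assumes "f \<in> borel_measurable TM"
  shows "(\<integral>x. f ((F ^^ n) x) \<partial>\<nu>) = (\<integral>x. f x \<partial>\<nu>)"
proof -
  have "(\<integral>x. f ((F ^^ n) x) \<partial>\<nu>) = (\<integral>x. f x \<partial>distr \<nu> \<nu> (F ^^ n))"
    by (rule integral_distr[symmetric]) (use assms in \<open>auto simp: measurable_\<nu>\<close>)
  then show ?thesis by (simp only: distr_Fn)
qed

abbreviation corr :: "('a \<times> nat \<Rightarrow> real) \<Rightarrow> ('a \<times> nat \<Rightarrow> real) \<Rightarrow> nat \<Rightarrow> real" where
  "corr \<phi> \<psi> n \<equiv> correlation F \<nu> \<phi> \<psi> n"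

text \<open>
  Observables with values in \<open>[0, 1]\<close> are enough, as correlations are affine in the observable
  (\<open>Linf_reduce\<close>).
\<close>

definition unit_obs :: "('a \<times> nat \<Rightarrow> real) \<Rightarrow> bool" where
  "unit_obs \<phi> \<longleftrightarrow> \<phi> \<in> borel_measurable TM \<and> (\<forall>x. 0 \<le> \<phi> x) \<and> (\<forall>x. \<phi> x \<le> 1)"

lemma robsD: "unit_obs \<phi> \<Longrightarrow> \<phi> \<in> borel_measurable TM" "unit_obs \<phi> \<Longrightarrow> 0 \<le> \<phi> x" "unit_obs \<phi> \<Longrightarrow> \<phi> x \<le> 1"
  unfolding unit_obs_def by blast+

lemma unit_obs_Fn: "unit_obs \<phi> \<Longrightarrow> unit_obs (\<lambda>x. \<phi> ((F ^^ n) x))"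
  unfolding unit_obs_def using measurable_compose[OF tower_pow_measurable] by blast

lemma bounded_integrable:
  fixes f :: "'a \<times> nat \<Rightarrow> real"
  assumes "f \<in> borel_measurable TM" "AE x in \<nu>. \<bar>f x\<bar> \<le> B"
  shows "integrable \<nu> f"
  by (rule nu.integrable_const_bound[of _ B]) (use assms in \<open>auto simp: measurable_\<nu>\<close>)

lemma unit_obs_integrable_mult:
  assumes "unit_obs \<phi>" "integrable \<nu> \<psi>" shows "integrable \<nu> (\<lambda>x. \<phi> x * \<psi> x)"
proof (rule Bochner_Integration.integrable_bound[OF assms(2)])
  show "(\<lambda>x. \<phi> x * \<psi> x) \<in> borel_measurable \<nu>"
    using robsD(1)[OF assms(1)] assms(2) by (auto simp: measurable_\<nu>)
  show "AE x in \<nu>. norm (\<phi> x * \<psi> x) \<le> norm (\<psi> x)"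
    using robsD(2,3)[OF assms(1)] by (auto simp: abs_mult intro!: always_eventually mult_left_le_one_le)
qed

lemma unit_obs_integrable: "unit_obs \<phi> \<Longrightarrow> integrable \<nu> \<phi>"
  by (rule bounded_integrable[where B = 1]) (use robsD in auto)

lemma unit_obs_integral_bounds: assumes "unit_obs \<phi>" shows "0 \<le> (\<integral>x. \<phi> x \<partial>\<nu>)" "(\<integral>x. \<phi> x \<partial>\<nu>) \<le> 1"
proof -
  show "0 \<le> (\<integral>x. \<phi> x \<partial>\<nu>)" using robsD(2)[OF assms] by (rule Bochner_Integration.integral_nonneg)
  have "(\<integral>x. \<phi> x \<partial>\<nu>) \<le> (\<integral>x. 1 \<partial>\<nu>)"
    by (rule integral_mono[OF unit_obs_integrable[OF assms]]) (simp, rule robsD(3)[OF assms])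
  then show "(\<integral>x. \<phi> x \<partial>\<nu>) \<le> 1" by (simp add: nu.prob_space)
qed

lemma corr_add:
  assumes "unit_obs \<phi>" "integrable \<nu> \<psi>1" "integrable \<nu> \<psi>2"
  shows "corr \<phi> (\<lambda>x. \<psi>1 x + \<psi>2 x) n = corr \<phi> \<psi>1 n + corr \<phi> \<psi>2 n"
  unfolding correlation_def
  using unit_obs_integrable_mult[OF unit_obs_Fn[OF assms(1)] assms(2)] unit_obs_integrable_mult[OF unit_obs_Fn[OF assms(1)] assms(3)] assms
  by (simp add: distrib_left)

lemma corr_cmult: "corr \<phi> (\<lambda>x. a * \<psi> x) n = a * corr \<phi> \<psi> n"
  unfolding correlation_def by (simp add: mult.left_commute[of _ a] right_diff_distrib)

lemma corr_const: "unit_obs \<phi> \<Longrightarrow> corr \<phi> (\<lambda>x. a) n = 0"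
  unfolding correlation_def using integral_Fn[of \<phi> n] robsD(1) by (simp add: nu.prob_space)

lemma corr_bound:
  assumes \<phi>: "unit_obs \<phi>" and \<psi>: "integrable \<nu> \<psi>" shows "\<bar>corr \<phi> \<psi> n\<bar> \<le> 2 * (\<integral>x. \<bar>\<psi> x\<bar> \<partial>\<nu>)"
proof -
  have "\<bar>\<integral>x. \<phi> ((F ^^ n) x) * \<psi> x \<partial>\<nu>\<bar> \<le> (\<integral>x. \<bar>\<psi> x\<bar> \<partial>\<nu>)"
  proof (rule order_trans[OF integral_abs_bound], rule integral_mono)
    show "integrable \<nu> (\<lambda>x. \<bar>\<phi> ((F ^^ n) x) * \<psi> x\<bar>)" using unit_obs_integrable_mult[OF unit_obs_Fn[OF \<phi>] \<psi>] by simp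
    show "\<bar>\<phi> ((F ^^ n) x) * \<psi> x\<bar> \<le> \<bar>\<psi> x\<bar>" for x
      unfolding abs_mult using robsD(2,3)[OF \<phi>, of "(F ^^ n) x"] by (intro mult_left_le_one_le) auto
  qed (use \<psi> in simp)
  moreover have "\<bar>(\<integral>x. \<phi> x \<partial>\<nu>) * (\<integral>x. \<psi> x \<partial>\<nu>)\<bar> \<le> 1 * (\<integral>x. \<bar>\<psi> x\<bar> \<partial>\<nu>)"
    unfolding abs_mult using unit_obs_integral_bounds[OF \<phi>] integral_abs_bound[of \<nu> \<psi>] by (intro mult_mono) auto
  ultimately show ?thesis unfolding correlation_def by linarith
qed

text \<open>
  The starting point \<open>(z, l)\<close> is already \<open>l\<close> levels up its column, so it makes its return number
  \<open>k + 1\<close> to the base at time \<open>return_sum (Suc k) z - l\<close>.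
\<close>

definition slow :: "nat \<Rightarrow> nat \<Rightarrow> real" where
  "slow k j = measure \<nu> {x \<in> \<Omega>. j + snd x < return_sum (Suc k) (fst x)}"
definition cylinder_err :: "nat \<Rightarrow> nat \<Rightarrow> real" where
  "cylinder_err k n = regular_err (n div 2) + slow k (n div 2)"

lemma slow_set[measurable]: "{x \<in> \<Omega>. j + snd x < return_sum (Suc k) (fst x)} \<in> sets TM"
proof -
  have 1: "(\<lambda>x. return_sum (Suc k) (fst x)) \<in> TM \<rightarrow>\<^sub>M count_space UNIV"
    by (rule measurable_compose[OF fst_TM return_sum_measurable])
  have 2: "(\<lambda>x. j + snd x) \<in> TM \<rightarrow>\<^sub>M count_space UNIV"
    by (rule measurable_compose[OF snd_TM measurable_count_space])
  from pred_less_nat[OF 2 1] show ?thesis unfolding pred_def space_TM .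
qed

lemma cylinder_err_nonneg: "0 \<le> cylinder_err k n" unfolding cylinder_err_def slow_def using regular_err_nonneg by simp

lemma return_err_nonneg: "0 \<le> return_err k n x" unfolding return_err_def using regular_err_nonneg by simp

lemma return_err_integral: "integrable \<nu> (return_err k n)" "(\<integral>x. return_err k n x \<partial>\<nu>) \<le> cylinder_err k n"
proof -
  show i: "integrable \<nu> (return_err k n)"
    by (rule bounded_integrable[where B = "max 1 (regular_err (n div 2))"]) (auto simp: return_err_def regular_err_nonneg)
  let ?S = "{x \<in> \<Omega>. n div 2 + snd x < return_sum (Suc k) (fst x)}"
  have iS: "integrable \<nu> (indicator ?S :: _ \<Rightarrow> real)"
  proof (rule bounded_integrable[where B = 1])
    show "(indicator ?S :: _ \<Rightarrow> real) \<in> borel_measurable TM" by (rule borel_measurable_indicator[OF slow_set])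
    show "AE x in \<nu>. \<bar>indicator ?S x :: real\<bar> \<le> 1" by (rule AE_I2) (simp add: indicator_def)
  qed
  have "(\<integral>x. return_err k n x \<partial>\<nu>) \<le> (\<integral>x. regular_err (n div 2) + indicator ?S x \<partial>\<nu>)"
  proof (rule integral_mono_AE[OF i])
    show "integrable \<nu> (\<lambda>x. regular_err (n div 2) + indicator ?S x)" using iS by simp
    show "AE x in \<nu>. return_err k n x \<le> regular_err (n div 2) + indicator ?S x"
      using AE_space by eventually_elim (auto simp: return_err_def indicator_def regular_err_nonneg space_\<nu> simp del: return_sum.simps)
  qed
  also have "\<dots> = cylinder_err k n"
  proof -
    have "(\<integral>x. regular_err (n div 2) + indicator ?S x \<partial>\<nu>) = (\<integral>x. regular_err (n div 2) \<partial>\<nu>) + (\<integral>x. indicator ?S x \<partial>\<nu>)"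
      by (rule Bochner_Integration.integral_add[OF _ iS]) simp
    moreover have "?S \<inter> space \<nu> = ?S" by (auto simp: space_\<nu>)
    ultimately show ?thesis unfolding cylinder_err_def slow_def by (simp add: nu.prob_space del: return_sum.simps)
  qed
  finally show "(\<integral>x. return_err k n x \<partial>\<nu>) \<le> cylinder_err k n" .
qed

lemma obs_of_unit_obs:
  assumes \<phi>: "unit_obs \<phi>"
  defines "\<phi>' \<equiv> ext (\<lambda>x. ennreal (\<phi> x))"
  shows "obs \<phi>'" "N \<phi>' = (\<integral>x. \<phi> x \<partial>\<nu>)" "x \<in> \<Omega> \<Longrightarrow> \<phi>' x = ennreal (\<phi> x)"
proof -
  note [measurable] = robsD(1)[OF \<phi>]
  show o: "obs \<phi>'"
    unfolding obs_def \<phi>'_def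
  proof
    show "level_meas (ext (\<lambda>x. ennreal (\<phi> x)))" by (rule level_meas_ext) measurable
    show "\<forall>x. ext (\<lambda>x. ennreal (\<phi> x)) x \<le> 1"
      unfolding ext_def using robsD(3)[OF \<phi>] by (auto simp: indicator_def)
  qed
  show eq: "x \<in> \<Omega> \<Longrightarrow> \<phi>' x = ennreal (\<phi> x)" for x by (simp add: \<phi>'_def ext_def)
  have "ennreal (N \<phi>') = (\<integral>\<^sup>+x. \<phi>' x \<partial>\<nu>)" by (rule nn_integral_\<nu>_obs[OF o, symmetric])
  also have "\<dots> = (\<integral>\<^sup>+x. ennreal (\<phi> x) \<partial>\<nu>)" by (intro nn_integral_cong eq) (simp add: space_\<nu>)
  also have "\<dots> = ennreal (\<integral>x. \<phi> x \<partial>\<nu>)"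
    by (rule nn_integral_eq_integral[OF unit_obs_integrable[OF \<phi>]]) (use robsD(2)[OF \<phi>] in simp)
  finally show "N \<phi>' = (\<integral>x. \<phi> x \<partial>\<nu>)"
    using N_bounds[OF o] unit_obs_integral_bounds[OF \<phi>] by (simp add: ennreal_inj)
qed

text \<open>
  Integrate \<open>piece_estimate\<close> over all itineraries with the weight \<open>g\<close>.
\<close>

lemma cylinder_corr:
  assumes \<phi>: "unit_obs \<phi>" and g: "\<And>w. 0 \<le> g w" "\<And>w. g w \<le> B"
  shows "\<bar>corr \<phi> (\<lambda>x. g (cyl k x)) n\<bar> \<le> B * cylinder_err k n"
proof -
  define \<phi>' where "\<phi>' = ext (\<lambda>x. ennreal (\<phi> x))"
  note o = obs_of_unit_obs[OF \<phi>, folded \<phi>'_def]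
  let ?g = "\<lambda>x. g (cyl k x)"
  have B: "0 \<le> B" using g[of undefined] by simp
  have [measurable]: "?g \<in> borel_measurable TM" by (rule measurable_compose[OF cyl_measurable]) simp
  have ig: "integrable \<nu> ?g" by (rule bounded_integrable[where B = B]) (use g in auto)
  have iF: "integrable \<nu> (\<lambda>x. \<phi> ((F ^^ n) x) * ?g x)" by (rule unit_obs_integrable_mult[OF unit_obs_Fn[OF \<phi>] ig])
  have iq: "integrable \<nu> (\<lambda>x. return_err k n x * ?g x)"
  proof (rule bounded_integrable[where B = "max 1 (regular_err (n div 2)) * B"])
    show "(\<lambda>x. return_err k n x * ?g x) \<in> borel_measurable TM" by measurable
    have "\<bar>return_err k n x * ?g x\<bar> \<le> max 1 (regular_err (n div 2)) * B" for x
      unfolding abs_mult using g return_err_nonneg by (intro mult_mono) (auto simp: return_err_def)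
    then show "AE x in \<nu>. \<bar>return_err k n x * ?g x\<bar> \<le> max 1 (regular_err (n div 2)) * B" by (intro AE_I2)
  qed
  let ?N = "\<integral>x. \<phi> x \<partial>\<nu>"
  have N0: "0 \<le> ?N" by (rule unit_obs_integral_bounds[OF \<phi>])
  have conv: "(\<integral>\<^sup>+x. ennreal (u x) \<partial>\<nu>) = ennreal (\<integral>x. u x \<partial>\<nu>)" if "integrable \<nu> u" "\<And>x. 0 \<le> u x" for u
    by (rule nn_integral_eq_integral) (use that in auto)
  have \<phi>F: "\<phi>' ((F ^^ n) x) = ennreal (\<phi> ((F ^^ n) x))" if "x \<in> space \<nu>" for x
    using that by (intro o(3) tower_pow_space) (simp add: space_\<nu>)
  have qg: "(\<integral>x. return_err k n x * ?g x \<partial>\<nu>) \<le> B * cylinder_err k n"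
  proof -
    have "(\<integral>x. return_err k n x * ?g x \<partial>\<nu>) \<le> (\<integral>x. return_err k n x * B \<partial>\<nu>)"
      by (rule integral_mono[OF iq]) (simp add: return_err_integral(1), rule mult_left_mono[OF g(2) return_err_nonneg])
    also have "\<dots> = (\<integral>x. return_err k n x \<partial>\<nu>) * B" by simp
    also have "\<dots> \<le> cylinder_err k n * B" by (intro mult_right_mono return_err_integral B)
    finally show ?thesis by (simp add: mult.commute)
  qed
  have 1: "(\<integral>x. \<phi> ((F ^^ n) x) * ?g x \<partial>\<nu>) \<le> ?N * (\<integral>x. ?g x \<partial>\<nu>) + (\<integral>x. return_err k n x * ?g x \<partial>\<nu>)"
  proof -
    have "ennreal (\<integral>x. \<phi> ((F ^^ n) x) * ?g x \<partial>\<nu>) = (\<integral>\<^sup>+x. ennreal (\<phi> ((F ^^ n) x) * ?g x) \<partial>\<nu>)"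
      by (rule conv[symmetric, OF iF]) (use g robsD(2)[OF \<phi>] in auto)
    also have "\<dots> = (\<integral>\<^sup>+x. \<phi>' ((F ^^ n) x) * ennreal (?g x) \<partial>\<nu>)"
      by (rule nn_integral_cong) (use g robsD(2)[OF \<phi>] in \<open>auto simp: \<phi>F ennreal_mult'\<close>)
    also have "\<dots> \<le> (\<integral>\<^sup>+x. (ennreal (N \<phi>') + ennreal (return_err k n x)) * ennreal (?g x) \<partial>\<nu>)"
      by (rule cylinder_rate(1)[OF o(1)])
    also have "\<dots> = (\<integral>\<^sup>+x. ennreal (?N * ?g x + return_err k n x * ?g x) \<partial>\<nu>)"
      unfolding o(2) using N0 return_err_nonneg g
      by (intro nn_integral_cong) (simp add: ennreal_plus[symmetric] ennreal_mult'[symmetric] distrib_right[symmetric] del: ennreal_plus)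
    also have "\<dots> = ennreal (\<integral>x. ?N * ?g x + return_err k n x * ?g x \<partial>\<nu>)"
      by (rule conv) (use ig iq N0 return_err_nonneg g in auto)
    also have "(\<integral>x. ?N * ?g x + return_err k n x * ?g x \<partial>\<nu>) = ?N * (\<integral>x. ?g x \<partial>\<nu>) + (\<integral>x. return_err k n x * ?g x \<partial>\<nu>)"
      using ig iq by simp
    finally show ?thesis
      by (subst (asm) ennreal_le_iff) (use N0 g return_err_nonneg in \<open>auto intro!: add_nonneg_nonneg mult_nonneg_nonneg Bochner_Integration.integral_nonneg\<close>)
  qed
  have 2: "?N * (\<integral>x. ?g x \<partial>\<nu>) \<le> (\<integral>x. \<phi> ((F ^^ n) x) * ?g x \<partial>\<nu>) + (\<integral>x. return_err k n x * ?g x \<partial>\<nu>)"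
  proof -
    have "ennreal (?N * (\<integral>x. ?g x \<partial>\<nu>)) = ennreal (\<integral>x. ?N * ?g x \<partial>\<nu>)" by simp
    also have "\<dots> = (\<integral>\<^sup>+x. ennreal (?N * ?g x) \<partial>\<nu>)"
      by (rule conv[symmetric]) (use g N0 ig in auto)
    also have "\<dots> = (\<integral>\<^sup>+x. ennreal (N \<phi>') * ennreal (?g x) \<partial>\<nu>)"
      unfolding o(2) using N0 by (simp add: ennreal_mult')
    also have "\<dots> \<le> (\<integral>\<^sup>+x. (\<phi>' ((F ^^ n) x) + ennreal (return_err k n x)) * ennreal (?g x) \<partial>\<nu>)"
      by (rule cylinder_rate(2)[OF o(1)])
    also have "\<dots> = (\<integral>\<^sup>+x. ennreal (\<phi> ((F ^^ n) x) * ?g x + return_err k n x * ?g x) \<partial>\<nu>)"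
      using robsD(2)[OF \<phi>] return_err_nonneg g
      by (intro nn_integral_cong) (simp add: \<phi>F ennreal_plus[symmetric] ennreal_mult'[symmetric] distrib_right[symmetric] del: ennreal_plus)
    also have "\<dots> = ennreal (\<integral>x. \<phi> ((F ^^ n) x) * ?g x + return_err k n x * ?g x \<partial>\<nu>)"
      by (rule conv) (use iF iq robsD(2)[OF \<phi>] return_err_nonneg g in auto)
    also have "(\<integral>x. \<phi> ((F ^^ n) x) * ?g x + return_err k n x * ?g x \<partial>\<nu>) = (\<integral>x. \<phi> ((F ^^ n) x) * ?g x \<partial>\<nu>) + (\<integral>x. return_err k n x * ?g x \<partial>\<nu>)"
      using iF iq by simp
    finally show ?thesis
      by (subst (asm) ennreal_le_iff) (use robsD(2)[OF \<phi>] g return_err_nonneg in \<open>auto intro!: add_nonneg_nonneg mult_nonneg_nonneg Bochner_Integration.integral_nonneg\<close>)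
  qed
  show ?thesis unfolding correlation_def using 1 2 qg by linarith
qed

section \<open>From itineraries to observables of small variation\<close>

lemma AE_TM: assumes "AE z in M. Q z" shows "AE x in TM. Q (fst x)"
proof -
  obtain A where A: "{z \<in> space M. \<not> Q z} \<subseteq> A" "A \<in> null_sets M"
    using assms by (auto simp: eventually_ae_filter)
  have [measurable]: "A \<in> sets M" using A by auto
  have "(\<integral>\<^sup>+x. indicator A (fst x) \<partial>TM) = (\<Sum>l. \<integral>\<^sup>+z. indicator {z. l < rtime T z} z * indicator A z \<partial>M)"
    by (subst nn_integral_TM) (auto intro: measurable_compose[OF fst_TM])
  also have "\<dots> = (\<Sum>l. \<integral>\<^sup>+z. 0 \<partial>M)"
    by (rule suminf_cong, rule nn_integral_cong_AE) (use AE_not_in[OF A(2)] in \<open>eventually_elim, simp\<close>)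
  also have "\<dots> = 0" by simp
  finally have "AE x in TM. indicator A (fst x) = (0::ennreal)"
    by (subst (asm) nn_integral_0_iff_AE) (auto intro: measurable_compose[OF fst_TM])
  with AE_space show ?thesis
  proof eventually_elim
    case (elim x)
    then have "fst x \<in> space M" "fst x \<notin> A" by (auto simp: space_TM tower_space_def indicator_def split: if_splits)
    then show ?case using A(1) by blast
  qed
qed

lemma AE_\<nu>: assumes "AE x in TM. Q x" shows "AE x in \<nu>. Q x"
proof -
  have "absolutely_continuous TM \<nu>" using acip_\<nu> by (simp add: acip_def)
  from absolutely_continuous_AE[OF sets_\<nu> this assms] show ?thesis .
qed

lemma AE_good: "AE x in TM. x \<in> good T"
  using AE_TM[OF AE_good_base] AE_space by eventually_elim (auto simp: good_def space_TM)

lemma good_nonempty: "good T \<noteq> {}"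
proof -
  obtain z where "z \<in> G" using G_nonempty by blast
  then have "z \<in> good_base T" "z \<in> space M" using G_good G_space by auto
  then have "(z, 0) \<in> good T" by (simp add: good_def tower_space_def rtime_pos)
  then show ?thesis by blast
qed

lemma sep_itinerary:
  assumes x: "x \<in> good T" and y: "y \<in> good T" and c: "cyl k x = cyl k y"
  shows "enat (Suc k) \<le> sep T x y"
proof -
  obtain x0 l where xx: "x = (x0, l)" "x0 \<in> good_base T" "l < rtime T x0" using x by (auto simp: good_def tower_space_def)
  obtain y0 l' where yy: "y = (y0, l')" "y0 \<in> good_base T" "l' < rtime T y0" using y by (auto simp: good_def tower_space_def)
  have c: "itinerary (Suc k) x0 = itinerary (Suc k) y0" "l' = l" using c xx yy by (auto simp: cyl_def simp del: itinerary.simps)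
  have ix: "itinerary m x0 = itinerary m y0 \<Longrightarrow> j < m \<Longrightarrow> idx ((ret T ^^ j) x0) = idx ((ret T ^^ j) y0)" for m j x0 y0
  proof (induction m arbitrary: j x0 y0)
    case (Suc m)
    show ?case
    proof (cases j)
      case 0
      then show ?thesis using Suc.prems by simp
    next
      case (Suc i)
      have "idx ((ret T ^^ i) (ret T x0)) = idx ((ret T ^^ i) (ret T y0))"
        by (rule Suc.IH) (use Suc.prems Suc in auto)
      then show ?thesis by (simp only: Suc funpow_Suc_right comp_def)
    qed
  qed simp
  have part: "\<exists>i. (ret T ^^ j) x0 \<in> part T i \<and> (ret T ^^ j) y0 \<in> part T i" if "j < Suc k" for j
    using idx_in[OF good_funpow_ret[OF xx(2), of j]] idx_in[OF good_funpow_ret[OF yy(2), of j]] ix[OF c(1) that] by auto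
  have "\<exists>l i. x \<in> level_part T l i \<and> y \<in> level_part T l i"
    using part[of 0] xx yy c good_base_subset unfolding level_part_def tower_space_def by fastforce
  then have "sep T x y = sep_base T x0 y0" using xx yy by (simp add: sep_def)
  also have "enat (Suc k) \<le> sep_base T x0 y0"
    unfolding sep_base_def by (rule INF_greatest) (use part in \<open>auto simp: not_less[symmetric]\<close>)
  finally show ?thesis .
qed

lemma variation_upper:
  assumes b: "\<psi> \<in> bounded_obs T" and x: "x \<in> good T" "y \<in> good T" "enat n \<le> sep T x y"
  shows "\<bar>\<psi> x - \<psi> y\<bar> \<le> variation T \<psi> n"
  unfolding variation_def
proof (rule cSup_upper)
  show "\<bar>\<psi> x - \<psi> y\<bar> \<in> {\<bar>\<psi> x - \<psi> y\<bar> |x y. x \<in> good T \<and> y \<in> good T \<and> enat n \<le> sep T x y}" using x by blast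
  obtain B where B: "\<And>x. x \<in> good T \<Longrightarrow> \<bar>\<psi> x\<bar> \<le> B" using b by (auto simp: bounded_obs_def bounded_iff)
  show "bdd_above {\<bar>\<psi> x - \<psi> y\<bar> |x y. x \<in> good T \<and> y \<in> good T \<and> enat n \<le> sep T x y}"
  proof (rule bdd_aboveI[of _ "B + B"])
    fix v assume "v \<in> {\<bar>\<psi> x - \<psi> y\<bar> |x y. x \<in> good T \<and> y \<in> good T \<and> enat n \<le> sep T x y}"
    then obtain x y where "x \<in> good T" "y \<in> good T" "v = \<bar>\<psi> x - \<psi> y\<bar>" by blast
    then show "v \<le> B + B" using B[of x] B[of y] by linarith
  qed
qed

text \<open>
  Replace \<open>\<psi>\<close> on each cylinder by its value at some good point of the cylinder. The error is at most
  the variation of order \<open>k + 1\<close>. Subtracting the infimum of \<open>\<psi>\<close> does not change correlations and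
  makes the approximation nonnegative with values at most \<open>variation T \<psi> 0\<close>, as required by
  \<open>cylinder_corr\<close>.
\<close>

theorem corr_variation:
  assumes \<phi>: "unit_obs \<phi>" and [measurable]: "\<psi> \<in> borel_measurable TM" and b: "\<psi> \<in> bounded_obs T"
  shows "\<bar>corr \<phi> \<psi> n\<bar> \<le> variation T \<psi> 0 * cylinder_err k n + 2 * variation T \<psi> (Suc k)"
proof -
  let ?osc = "variation T \<psi> 0" and ?v = "variation T \<psi> (Suc k)"
  have z: "enat 0 \<le> s" for s by (simp add: zero_enat_def[symmetric])
  obtain x1 where x1: "x1 \<in> good T" using good_nonempty by blast
  obtain B where B: "\<And>x. x \<in> good T \<Longrightarrow> \<bar>\<psi> x\<bar> \<le> B" using b by (auto simp: bounded_obs_def bounded_iff)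
  \<comment> \<open>a constant, which does not contribute to correlations\<close>
  define m where "m = Inf (\<psi> ` good T)"
  have bdd: "bdd_below (\<psi> ` good T)" by (rule bdd_belowI2[of _ "- B"]) (use B in \<open>fastforce simp: abs_le_iff\<close>)
  have m1: "m \<le> \<psi> x" if "x \<in> good T" for x unfolding m_def by (rule cINF_lower[OF bdd that])
  have m2: "\<psi> x - ?osc \<le> m" if "x \<in> good T" for x unfolding m_def
  proof (rule cINF_greatest[OF good_nonempty])
    fix y assume "y \<in> good T"
    then show "\<psi> x - ?osc \<le> \<psi> y" using variation_upper[OF b that _ z, of y] by linarith
  qed
  have v0: "0 \<le> ?osc" using variation_upper[OF b x1 x1 z] by simp
  define S where "S w = {y \<in> good T. cyl k y = w}" for w
  define g where "g w = (if S w = {} then 0 else \<psi> (SOME y. y \<in> S w) - m)" for w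
  have some: "(SOME y. y \<in> S w) \<in> S w" if "S w \<noteq> {}" for w using that some_in_eq by blast
  have g: "0 \<le> g w" "g w \<le> ?osc" for w
  proof -
    have "0 \<le> g w \<and> g w \<le> ?osc"
    proof (cases "S w = {}")
      case False
      define y where "y = (SOME y. y \<in> S w)"
      have "y \<in> good T" using some[OF False] unfolding y_def[symmetric] by (simp add: S_def)
      then show ?thesis using m1[of y] m2[of y] False by (simp add: g_def y_def[symmetric])
    qed (use v0 in \<open>simp add: g_def\<close>)
    then show "0 \<le> g w" "g w \<le> ?osc" by auto
  qed
  have near: "\<bar>\<psi> x - m - g (cyl k x)\<bar> \<le> ?v" if x: "x \<in> good T" for x
  proof -
    have "x \<in> S (cyl k x)" using x by (simp add: S_def)
    then have ne: "S (cyl k x) \<noteq> {}" by blast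
    define y where "y = (SOME y. y \<in> S (cyl k x))"
    have y: "y \<in> good T" "cyl k x = cyl k y" using some[OF ne] unfolding y_def[symmetric] by (auto simp: S_def)
    have "\<bar>\<psi> x - \<psi> y\<bar> \<le> ?v" by (intro variation_upper[OF b] x y sep_itinerary)
    then show ?thesis using ne by (simp add: g_def y_def)
  qed
  let ?g = "\<lambda>x. g (cyl k x)"
  let ?e = "\<lambda>x. \<psi> x - m - ?g x"
  have gm[measurable]: "?g \<in> borel_measurable TM" by (rule measurable_compose[OF cyl_measurable]) simp
  have ig: "integrable \<nu> ?g" by (rule bounded_integrable[where B = ?osc]) (use g in auto)
  have AEe: "AE x in \<nu>. \<bar>?e x\<bar> \<le> ?v" using AE_\<nu>[OF AE_good] by eventually_elim (rule near)
  have ie: "integrable \<nu> ?e" by (rule bounded_integrable[OF _ AEe]) measurable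
  have im: "integrable \<nu> (\<lambda>x. m)" by simp
  have "corr \<phi> \<psi> n = corr \<phi> (\<lambda>x. (m + ?g x) + ?e x) n" by simp
  also have "\<dots> = corr \<phi> (\<lambda>x. m + ?g x) n + corr \<phi> ?e n" by (rule corr_add[OF \<phi> Bochner_Integration.integrable_add[OF im ig] ie])
  also have "corr \<phi> (\<lambda>x. m + ?g x) n = corr \<phi> ?g n" by (simp add: corr_add[OF \<phi> im ig] corr_const[OF \<phi>])
  finally have "\<bar>corr \<phi> \<psi> n\<bar> \<le> \<bar>corr \<phi> ?g n\<bar> + \<bar>corr \<phi> ?e n\<bar>" by simp
  also have "\<bar>corr \<phi> ?g n\<bar> \<le> ?osc * cylinder_err k n" by (rule cylinder_corr[OF \<phi> g])
  also have "\<bar>corr \<phi> ?e n\<bar> \<le> 2 * ?v"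
  proof -
    have "(\<integral>x. \<bar>?e x\<bar> \<partial>\<nu>) \<le> (\<integral>x. ?v \<partial>\<nu>)" by (rule integral_mono_AE) (use ie AEe in auto)
    then have "(\<integral>x. \<bar>?e x\<bar> \<partial>\<nu>) \<le> ?v" by (simp add: nu.prob_space)
    then show ?thesis using corr_bound[OF \<phi> ie, of n] by linarith
  qed
  finally show ?thesis by simp
qed

end

section \<open>Integrable observables, mixing and uniqueness\<close>

context distorted_tower
begin

text \<open>
  Correlations tend to zero uniformly over the observables with values in \<open>[0, 1]\<close>. The uniformity
  makes the property closed in \<open>L\<^sup>1(\<nu>)\<close>.
\<close>

definition decorrelating :: "('a \<times> nat \<Rightarrow> real) \<Rightarrow> bool" where
  "decorrelating \<psi> \<longleftrightarrow> integrable \<nu> \<psi> \<and> (\<forall>e>0. \<exists>n0. \<forall>n\<ge>n0. \<forall>\<phi>. unit_obs \<phi> \<longrightarrow> \<bar>corr \<phi> \<psi> n\<bar> \<le> e)"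

lemma niceD: "decorrelating \<psi> \<Longrightarrow> integrable \<nu> \<psi>" "decorrelating \<psi> \<Longrightarrow> e > 0 \<Longrightarrow> \<exists>n0. \<forall>n\<ge>n0. \<forall>\<phi>. unit_obs \<phi> \<longrightarrow> \<bar>corr \<phi> \<psi> n\<bar> \<le> e"
  unfolding decorrelating_def by blast+

text \<open>
  Correlations are bounded by twice the \<open>L\<^sup>1\<close>-norm of \<open>\<psi>\<close>, whatever the observable.
\<close>

lemma decorrelating_limit:
  assumes \<psi>: "integrable \<nu> \<psi>" and ap: "\<And>e. e > 0 \<Longrightarrow> \<exists>\<psi>'. decorrelating \<psi>' \<and> (\<integral>x. \<bar>\<psi> x - \<psi>' x\<bar> \<partial>\<nu>) \<le> e"
  shows "decorrelating \<psi>"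
  unfolding decorrelating_def
proof (intro conjI allI impI \<psi>)
  fix e :: real assume e: "e > 0"
  obtain \<psi>' where \<psi>': "decorrelating \<psi>'" "(\<integral>x. \<bar>\<psi> x - \<psi>' x\<bar> \<partial>\<nu>) \<le> e / 4" using ap[of "e / 4"] e by auto
  obtain n0 where n0: "\<And>n \<phi>. n \<ge> n0 \<Longrightarrow> unit_obs \<phi> \<Longrightarrow> \<bar>corr \<phi> \<psi>' n\<bar> \<le> e / 2" using niceD(2)[OF \<psi>'(1), of "e / 2"] e by auto
  have "\<bar>corr \<phi> \<psi> n\<bar> \<le> e" if n: "n \<ge> n0" and \<phi>: "unit_obs \<phi>" for n \<phi>
  proof -
    have i: "integrable \<nu> (\<lambda>x. \<psi> x - \<psi>' x)" using \<psi> niceD(1)[OF \<psi>'(1)] by simp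
    have "corr \<phi> \<psi> n = corr \<phi> (\<lambda>x. (\<psi> x - \<psi>' x) + \<psi>' x) n" by simp
    also have "\<dots> = corr \<phi> (\<lambda>x. \<psi> x - \<psi>' x) n + corr \<phi> \<psi>' n" by (rule corr_add[OF \<phi> i niceD(1)[OF \<psi>'(1)]])
    finally show ?thesis using corr_bound[OF \<phi> i, of n] \<psi>'(2) n0[OF n \<phi>] by linarith
  qed
  then show "\<exists>n0. \<forall>n\<ge>n0. \<forall>\<phi>. unit_obs \<phi> \<longrightarrow> \<bar>corr \<phi> \<psi> n\<bar> \<le> e" by blast
qed

lemma decorrelating_add: assumes a: "decorrelating \<psi>1" and b: "decorrelating \<psi>2" shows "decorrelating (\<lambda>x. \<psi>1 x + \<psi>2 x)"
  unfolding decorrelating_def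
proof (intro conjI allI impI)
  show "integrable \<nu> (\<lambda>x. \<psi>1 x + \<psi>2 x)" using niceD(1)[OF a] niceD(1)[OF b] by simp
  fix e :: real assume e: "e > 0"
  obtain n1 where n1: "\<And>n \<phi>. n \<ge> n1 \<Longrightarrow> unit_obs \<phi> \<Longrightarrow> \<bar>corr \<phi> \<psi>1 n\<bar> \<le> e / 2" using niceD(2)[OF a, of "e / 2"] e by auto
  obtain n2 where n2: "\<And>n \<phi>. n \<ge> n2 \<Longrightarrow> unit_obs \<phi> \<Longrightarrow> \<bar>corr \<phi> \<psi>2 n\<bar> \<le> e / 2" using niceD(2)[OF b, of "e / 2"] e by auto
  have "\<bar>corr \<phi> (\<lambda>x. \<psi>1 x + \<psi>2 x) n\<bar> \<le> e" if "n \<ge> max n1 n2" "unit_obs \<phi>" for n \<phi>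
    unfolding corr_add[OF that(2) niceD(1)[OF a] niceD(1)[OF b]] using n1[of n \<phi>] n2[of n \<phi>] that by auto
  then show "\<exists>n0. \<forall>n\<ge>n0. \<forall>\<phi>. unit_obs \<phi> \<longrightarrow> \<bar>corr \<phi> (\<lambda>x. \<psi>1 x + \<psi>2 x) n\<bar> \<le> e" by blast
qed

lemma decorrelating_cmult: assumes a: "decorrelating \<psi>" shows "decorrelating (\<lambda>x. c' * \<psi> x)"
  unfolding decorrelating_def
proof (intro conjI allI impI)
  show "integrable \<nu> (\<lambda>x. c' * \<psi> x)" using niceD(1)[OF a] by simp
  fix e :: real assume e: "e > 0"
  then have "e / (\<bar>c'\<bar> + 1) > 0" by (simp add: add_nonneg_pos)
  then obtain n1 where n1: "\<And>n \<phi>. n \<ge> n1 \<Longrightarrow> unit_obs \<phi> \<Longrightarrow> \<bar>corr \<phi> \<psi> n\<bar> \<le> e / (\<bar>c'\<bar> + 1)" using niceD(2)[OF a] by meson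
  have "\<bar>corr \<phi> (\<lambda>x. c' * \<psi> x) n\<bar> \<le> e" if "n \<ge> n1" "unit_obs \<phi>" for n \<phi>
  proof -
    have "\<bar>c'\<bar> * \<bar>corr \<phi> \<psi> n\<bar> \<le> (\<bar>c'\<bar> + 1) * (e / (\<bar>c'\<bar> + 1))" using n1[OF that] by (intro mult_mono) auto
    also have "\<dots> = e" by simp
    finally show ?thesis unfolding corr_cmult abs_mult .
  qed
  then show "\<exists>n0. \<forall>n\<ge>n0. \<forall>\<phi>. unit_obs \<phi> \<longrightarrow> \<bar>corr \<phi> (\<lambda>x. c' * \<psi> x) n\<bar> \<le> e" by blast
qed

lemma decorrelating_cong_AE:
  assumes a: "decorrelating \<psi>" and eq: "AE x in \<nu>. \<psi>' x = \<psi> x" and m: "\<psi>' \<in> borel_measurable \<nu>"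
  shows "decorrelating \<psi>'"
proof (rule decorrelating_limit)
  have "integrable \<nu> \<psi> \<longleftrightarrow> integrable \<nu> \<psi>'"
    by (rule integrable_cong_AE) (use eq m niceD(1)[OF a] in auto)
  then show i: "integrable \<nu> \<psi>'" using niceD(1)[OF a] by simp
  have "(\<integral>x. \<bar>\<psi>' x - \<psi> x\<bar> \<partial>\<nu>) = 0"
    by (rule integral_eq_zero_AE) (use eq in auto)
  then show "\<exists>\<psi>''. decorrelating \<psi>'' \<and> (\<integral>x. \<bar>\<psi>' x - \<psi>'' x\<bar> \<partial>\<nu>) \<le> e" if "e > 0" for e using a that by auto
qed

lemma decorrelating_dominated:
  assumes s: "\<And>i. decorrelating (s i)" and lim: "\<And>x. x \<in> \<Omega> \<Longrightarrow> (\<lambda>i. s i x) \<longlonglongrightarrow> \<psi> x"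
    and w: "integrable \<nu> w" and bd: "\<And>i x. x \<in> \<Omega> \<Longrightarrow> \<bar>s i x\<bar> \<le> w x" and m: "\<psi> \<in> borel_measurable \<nu>"
  shows "decorrelating \<psi>"
proof -
  have si: "integrable \<nu> (s i)" for i by (rule niceD(1)[OF s])
  have sm[measurable]: "s i \<in> borel_measurable \<nu>" for i using si[of i] by auto
  note [measurable] = m
  have A: "AE x in \<nu>. (\<lambda>i. s i x) \<longlonglongrightarrow> \<psi> x" using lim by (auto simp: space_\<nu>)
  have B: "AE x in \<nu>. norm (s i x) \<le> w x" for i using bd by (auto simp: space_\<nu>)
  have i\<psi>: "integrable \<nu> \<psi>" by (rule integrable_dominated_convergence[OF m sm w A B])
  have psi_le: "\<bar>\<psi> x\<bar> \<le> w x" if "x \<in> \<Omega>" for x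
    by (rule LIMSEQ_le_const2[OF tendsto_rabs[OF lim[OF that]]]) (use bd[OF that] in auto)
  have "(\<lambda>i. \<integral>x. \<bar>\<psi> x - s i x\<bar> \<partial>\<nu>) \<longlonglongrightarrow> (\<integral>x. 0 \<partial>\<nu>)"
  proof (rule integral_dominated_convergence[where w = "\<lambda>x. 2 * w x"])
    show "AE x in \<nu>. (\<lambda>i. \<bar>\<psi> x - s i x\<bar>) \<longlonglongrightarrow> 0"
    proof (rule AE_I2)
      fix x assume "x \<in> space \<nu>"
      then have "(\<lambda>i. \<bar>\<psi> x - s i x\<bar>) \<longlonglongrightarrow> \<bar>\<psi> x - \<psi> x\<bar>" by (intro tendsto_intros lim) (simp add: space_\<nu>)
      then show "(\<lambda>i. \<bar>\<psi> x - s i x\<bar>) \<longlonglongrightarrow> 0" by simp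
    qed
    show "AE x in \<nu>. norm \<bar>\<psi> x - s i x\<bar> \<le> 2 * w x" for i
    proof (rule AE_I2)
      fix x assume "x \<in> space \<nu>"
      then have "x \<in> \<Omega>" by (simp add: space_\<nu>)
      then show "norm \<bar>\<psi> x - s i x\<bar> \<le> 2 * w x" using psi_le[of x] bd[of x i] by auto
    qed
  qed (use w in auto)
  then have L: "(\<lambda>i. \<integral>x. \<bar>\<psi> x - s i x\<bar> \<partial>\<nu>) \<longlonglongrightarrow> 0" by simp
  show ?thesis
  proof (rule decorrelating_limit[OF i\<psi>])
    fix e :: real assume "e > 0"
    then have "\<forall>\<^sub>F i in sequentially. (\<integral>x. \<bar>\<psi> x - s i x\<bar> \<partial>\<nu>) < e" using order_tendstoD(2)[OF L] by blast
    then obtain i where "(\<integral>x. \<bar>\<psi> x - s i x\<bar> \<partial>\<nu>) < e" using eventually_happens'[OF sequentially_bot] by blast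
    then show "\<exists>\<psi>'. decorrelating \<psi>' \<and> (\<integral>x. \<bar>\<psi> x - \<psi>' x\<bar> \<partial>\<nu>) \<le> e" using s[of i] by (intro exI[of _ "s i"]) auto
  qed
qed

text \<open>
  The sets of slow points decrease to the empty set.
\<close>

lemma slow_tendsto: "slow k \<longlonglongrightarrow> 0"
proof -
  let ?A = "\<lambda>j. {x \<in> \<Omega>. j + snd x < return_sum (Suc k) (fst x)}"
  have "(\<lambda>j. measure \<nu> (?A j)) \<longlonglongrightarrow> measure \<nu> (\<Inter>j. ?A j)"
    by (rule nu.finite_Lim_measure_decseq) (use slow_set in \<open>auto simp: decseq_def simp del: return_sum.simps\<close>)
  moreover have "(\<Inter>j. ?A j) = {}"
  proof -
    have "x \<notin> ?A (return_sum (Suc k) (fst x))" for x by (simp del: return_sum.simps)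
    then show ?thesis by blast
  qed
  ultimately show ?thesis unfolding slow_def[abs_def] by simp
qed

lemma cylinder_err_tendsto: "cylinder_err k \<longlonglongrightarrow> 0"
proof -
  have "(\<lambda>n. regular_err (n div 2) + slow k (n div 2)) \<longlonglongrightarrow> 0 + 0"
    by (intro tendsto_add filterlim_compose[OF regular_err_tendsto filterlim_half] filterlim_compose[OF slow_tendsto filterlim_half])
  then show ?thesis unfolding cylinder_err_def[abs_def] by simp
qed

lemma decorrelating_locally_constant:
  assumes m: "\<psi> \<in> borel_measurable TM" and b: "\<psi> \<in> bounded_obs T" "\<And>x. \<bar>\<psi> x\<bar> \<le> B" and v: "variation T \<psi> (Suc k) \<le> 0"
  shows "decorrelating \<psi>"
  unfolding decorrelating_def
proof (intro conjI allI impI)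
  show "integrable \<nu> \<psi>" by (rule bounded_integrable[OF m, where B = B]) (use b(2) in auto)
  fix e :: real assume e: "e > 0"
  have "(\<lambda>n. variation T \<psi> 0 * cylinder_err k n) \<longlonglongrightarrow> variation T \<psi> 0 * 0" by (intro tendsto_intros cylinder_err_tendsto)
  then have "\<forall>\<^sub>F n in sequentially. variation T \<psi> 0 * cylinder_err k n < e" using e by (intro order_tendstoD(2)) auto
  then obtain n0 where n0: "\<And>n. n \<ge> n0 \<Longrightarrow> variation T \<psi> 0 * cylinder_err k n < e" unfolding eventually_sequentially by blast
  have "\<bar>corr \<phi> \<psi> n\<bar> \<le> e" if "n \<ge> n0" "unit_obs \<phi>" for n \<phi>
    using corr_variation[OF that(2) m b(1), of n k] n0[OF that(1)] v by linarith
  then show "\<exists>n0. \<forall>n\<ge>n0. \<forall>\<phi>. unit_obs \<phi> \<longrightarrow> \<bar>corr \<phi> \<psi> n\<bar> \<le> e" by blast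
qed

definition level_ind :: "'a set \<Rightarrow> nat \<Rightarrow> 'a \<times> nat \<Rightarrow> real" where "level_ind A l x = indicator A (fst x) * indicator {l} (snd x)"

lemma level_ind_measurable: assumes "A \<in> sets M" shows "level_ind A l \<in> borel_measurable TM"
proof -
  have 1: "(\<lambda>x. indicator A (fst x) :: real) \<in> borel_measurable TM"
    by (rule measurable_compose[OF fst_TM borel_measurable_indicator[OF assms]])
  have 2: "(\<lambda>x. indicator {l} (snd x) :: real) \<in> borel_measurable TM"
    by (rule measurable_compose[OF snd_TM]) simp
  show ?thesis unfolding level_ind_def[abs_def] by (rule borel_measurable_times[OF 1 2])
qed

lemma level_ind_bounds: "\<bar>level_ind A l x\<bar> \<le> 1" by (simp add: level_ind_def indicator_def)

text \<open>
  Sets for which finitely many symbols of the itinerary decide membership of a good point. They form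
  a generator that is stable under intersections, as Dynkin's theorem requires.
\<close>

definition determined :: "'a set set" where
  "determined = {A \<in> sets M. \<exists>k. \<forall>x\<in>good_base T. \<forall>y\<in>good_base T.
     (\<forall>j<k. \<exists>i. (ret T ^^ j) x \<in> part T i \<and> (ret T ^^ j) y \<in> part T i) \<longrightarrow> (x \<in> A \<longleftrightarrow> y \<in> A)}"

lemma determined_decorrelating: assumes A: "A \<in> determined" shows "decorrelating (level_ind A l)"
proof -
  obtain k where k: "\<And>x y. x \<in> good_base T \<Longrightarrow> y \<in> good_base T \<Longrightarrow>
     (\<And>j. j < k \<Longrightarrow> \<exists>i. (ret T ^^ j) x \<in> part T i \<and> (ret T ^^ j) y \<in> part T i) \<Longrightarrow> (x \<in> A \<longleftrightarrow> y \<in> A)"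
    using A unfolding determined_def by blast
  have Am: "A \<in> sets M" using A by (simp add: determined_def)
  have z: "\<bar>level_ind A l x - level_ind A l y\<bar> = 0" if x: "x \<in> good T" "y \<in> good T" and s: "enat (Suc k) \<le> sep T x y" for x y
  proof -
    have "sep T x y \<noteq> 0" using s by (auto simp: zero_enat_def)
    then have ex: "\<exists>l i. x \<in> level_part T l i \<and> y \<in> level_part T l i" unfolding sep_def by (auto split: if_splits)
    then have sn: "snd x = snd y" by (auto simp: level_part_def)
    have sb: "enat (Suc k) \<le> sep_base T (fst x) (fst y)" using s ex by (simp add: sep_def)
    have "fst x \<in> A \<longleftrightarrow> fst y \<in> A"
    proof (rule k)
      show "fst x \<in> good_base T" "fst y \<in> good_base T" using x by (auto simp: good_def)
      fix j assume j: "j < k"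
      show "\<exists>i. (ret T ^^ j) (fst x) \<in> part T i \<and> (ret T ^^ j) (fst y) \<in> part T i"
      proof (rule ccontr)
        assume "\<not> ?thesis"
        then have "sep_base T (fst x) (fst y) \<le> enat j" unfolding sep_base_def by (intro INF_lower) auto
        with sb have "enat (Suc k) \<le> enat j" by (rule order_trans)
        with j show False by simp
      qed
    qed
    then show ?thesis using sn by (simp add: level_ind_def indicator_def)
  qed
  have "variation T (level_ind A l) (Suc k) \<le> 0"
    unfolding variation_def
  proof (rule cSup_least)
    obtain x where "x \<in> good T" using good_nonempty by blast
    then have "enat (Suc k) \<le> sep T x x" by (rule sep_itinerary) (simp_all add: \<open>x \<in> good T\<close>)
    with \<open>x \<in> good T\<close> show "{\<bar>level_ind A l x - level_ind A l y\<bar> |x y. x \<in> good T \<and> y \<in> good T \<and> enat (Suc k) \<le> sep T x y} \<noteq> {}" by blast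
    fix v assume "v \<in> {\<bar>level_ind A l x - level_ind A l y\<bar> |x y. x \<in> good T \<and> y \<in> good T \<and> enat (Suc k) \<le> sep T x y}"
    then show "v \<le> 0" using z by force
  qed
  moreover have "level_ind A l \<in> bounded_obs T" unfolding bounded_obs_def bounded_iff using level_ind_bounds[of A l]
    by (simp only: mem_Collect_eq ball_simps real_norm_def) blast
  ultimately show ?thesis using decorrelating_locally_constant[OF level_ind_measurable[OF Am] _ level_ind_bounds] by blast
qed

lemma determined_Int_stable: "Int_stable determined"
proof (rule Int_stableI)
  fix A B assume A: "A \<in> determined" and B: "B \<in> determined"
  obtain k where k: "\<And>x y. x \<in> good_base T \<Longrightarrow> y \<in> good_base T \<Longrightarrow>
     (\<And>j. j < k \<Longrightarrow> \<exists>i. (ret T ^^ j) x \<in> part T i \<and> (ret T ^^ j) y \<in> part T i) \<Longrightarrow> (x \<in> A \<longleftrightarrow> y \<in> A)"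
    using A unfolding determined_def by blast
  obtain k' where k': "\<And>x y. x \<in> good_base T \<Longrightarrow> y \<in> good_base T \<Longrightarrow>
     (\<And>j. j < k' \<Longrightarrow> \<exists>i. (ret T ^^ j) x \<in> part T i \<and> (ret T ^^ j) y \<in> part T i) \<Longrightarrow> (x \<in> B \<longleftrightarrow> y \<in> B)"
    using B unfolding determined_def by blast
  have "x \<in> A \<inter> B \<longleftrightarrow> y \<in> A \<inter> B" if "x \<in> good_base T" "y \<in> good_base T"
    "\<And>j. j < max k k' \<Longrightarrow> \<exists>i. (ret T ^^ j) x \<in> part T i \<and> (ret T ^^ j) y \<in> part T i" for x y
    using k[OF that(1,2)] k'[OF that(1,2)] that(3) by auto
  moreover have "A \<inter> B \<in> sets M" using A B by (auto simp: determined_def)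
  ultimately show "A \<inter> B \<in> determined" unfolding determined_def mem_Collect_eq by (intro conjI exI[of _ "max k k'"]) blast+
qed

lemma generator_determined: "(ret T ^^ n) -` part T i \<inter> space M \<in> determined"
proof -
  have "(ret T ^^ n) -` part T i \<inter> space M \<in> sets M" by (rule measurable_sets[OF funpow_ret_measurable part_sets])
  moreover have "x \<in> (ret T ^^ n) -` part T i \<inter> space M \<longleftrightarrow> y \<in> (ret T ^^ n) -` part T i \<inter> space M"
    if x: "x \<in> good_base T" and y: "y \<in> good_base T" and s: "\<forall>j<Suc n. \<exists>i. (ret T ^^ j) x \<in> part T i \<and> (ret T ^^ j) y \<in> part T i" for x y
  proof -
    obtain i' where i': "(ret T ^^ n) x \<in> part T i'" "(ret T ^^ n) y \<in> part T i'" using s by blast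
    have "(ret T ^^ n) x \<in> part T i \<longleftrightarrow> i = i'" using good_part[OF good_funpow_ret[OF x, of n]] i' by blast
    moreover have "(ret T ^^ n) y \<in> part T i \<longleftrightarrow> i = i'" using good_part[OF good_funpow_ret[OF y, of n]] i' by blast
    ultimately show ?thesis using x y good_base_subset by auto
  qed
  ultimately show ?thesis unfolding determined_def by blast
qed

lemma space_determined: "space M \<in> determined"
  unfolding determined_def using good_base_subset by auto

lemma decorrelating_const: "decorrelating (\<lambda>x. a)"
  unfolding decorrelating_def using corr_const by simp

lemma level_ind_Un: "A \<inter> B = {} \<Longrightarrow> level_ind (A \<union> B) l = (\<lambda>x. level_ind A l x + level_ind B l x)"
  by (rule ext) (auto simp: level_ind_def indicator_def)

text \<open>
  Dynkin's theorem.
\<close>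

lemma decorrelating_level_ind_sigma:
  assumes "A \<in> sigma_sets (space M) determined"
  shows "A \<in> sets M \<and> decorrelating (level_ind A l)"
proof -
  have sub: "determined \<subseteq> Pow (space M)" unfolding determined_def using sets.sets_into_space by blast
  show ?thesis using determined_Int_stable sub assms
  proof (induction rule: sigma_sets_induct_disjoint)
    case (basic A)
    then have "A \<in> sets M" by (simp add: determined_def)
    then show ?case using determined_decorrelating[OF basic] ..
  next
    case empty
    have "level_ind {} l = (\<lambda>x. 0)" by (auto simp: level_ind_def)
    then show ?case using decorrelating_const[of 0] by simp
  next
    case (compl A)
    have A: "A \<in> sets M" "decorrelating (level_ind A l)" using compl(2) by simp_all
    have B: "space M - A \<in> sets M" by (rule sets.compl_sets[OF A(1)])
    have "decorrelating (\<lambda>x. level_ind (space M) l x + (-1) * level_ind A l x)"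
      by (intro decorrelating_add decorrelating_cmult determined_decorrelating[OF space_determined] A)
    then have "decorrelating (level_ind (space M - A) l)"
    proof (rule decorrelating_cong_AE)
      show "AE x in \<nu>. level_ind (space M - A) l x = level_ind (space M) l x + (-1) * level_ind A l x"
      proof (rule AE_I2)
        fix x assume "x \<in> space \<nu>"
        then have "fst x \<in> space M" by (auto simp: space_\<nu> tower_space_def)
        then show "level_ind (space M - A) l x = level_ind (space M) l x + (-1) * level_ind A l x"
          by (simp add: level_ind_def indicator_def)
      qed
      show "level_ind (space M - A) l \<in> borel_measurable \<nu>" using level_ind_measurable[OF B] by (simp add: measurable_\<nu>)
    qed
    with B show ?case by simp
  next
    case (union A)
    have A: "A i \<in> sets M" "decorrelating (level_ind (A i) l)" for i using union(3)[of i] by simp_all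
    have fin: "decorrelating (level_ind (\<Union>i<n. A i) l)" for n
    proof (induction n)
      case 0
      have "level_ind {} l = (\<lambda>x. 0)" by (auto simp: level_ind_def)
      then show ?case using decorrelating_const[of 0] by simp
    next
      case (Suc n)
      have "A i \<inter> A n = {}" if "i < n" for i
        by (rule disjoint_family_onD[OF union(1)]) (use that in simp_all)
      then have d: "(\<Union>i<n. A i) \<inter> A n = {}" by blast
      have U: "(\<Union>i<Suc n. A i) = (\<Union>i<n. A i) \<union> A n" by (auto simp: less_Suc_eq)
      show ?case unfolding U level_ind_Un[OF d] by (rule decorrelating_add[OF Suc A(2)[of n]])
    qed
    have U: "(\<Union>i. A i) \<in> sets M" by (rule sets.countable_UN) (use A(1) in blast)
    have "decorrelating (level_ind (\<Union>i. A i) l)"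
    proof (rule decorrelating_dominated[OF fin, where w = "\<lambda>_. 1"])
      show "(\<lambda>n. level_ind (\<Union>i<n. A i) l x) \<longlonglongrightarrow> level_ind (\<Union>i. A i) l x" for x
        unfolding level_ind_def by (rule tendsto_mult[OF LIMSEQ_indicator_UN tendsto_const])
      show "level_ind (\<Union>i. A i) l \<in> borel_measurable \<nu>" using level_ind_measurable[OF U] by (simp add: measurable_\<nu>)
    qed (simp, rule level_ind_bounds)
    with U show ?case by simp
  qed
qed

text \<open>
  By the generating property every measurable set agrees, up to a null set, with a set covered by
  \<open>decorrelating_level_ind_sigma\<close>.
\<close>

lemma decorrelating_level_ind: assumes X: "X \<in> sets M" shows "decorrelating (level_ind X l)"
proof -
  obtain X' where X': "X' \<in> sigma_sets (space M) {(ret T ^^ n) -` part T i \<inter> space M | n i. True}"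
    "(X - X') \<union> (X' - X) \<in> null_sets M" using generates[OF X] by blast
  have "X' \<in> sigma_sets (space M) determined"
    using X'(1) sigma_sets_mono'[of "{(ret T ^^ n) -` part T i \<inter> space M | n i. True}" determined "space M"] generator_determined by blast
  then have n: "decorrelating (level_ind X' l)" using decorrelating_level_ind_sigma by blast
  show ?thesis
  proof (rule decorrelating_cong_AE[OF n])
    have "AE x in TM. fst x \<notin> (X - X') \<union> (X' - X)" by (rule AE_TM[OF AE_not_in[OF X'(2)]])
    then have "AE x in TM. level_ind X l x = level_ind X' l x"
      by eventually_elim (auto simp: level_ind_def indicator_def)
    then show "AE x in \<nu>. level_ind X l x = level_ind X' l x" by (rule AE_\<nu>)
    show "level_ind X l \<in> borel_measurable \<nu>" using level_ind_measurable[OF X] by (simp add: measurable_\<nu>)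
  qed
qed

lemma decorrelating_indicator: assumes A: "A \<in> sets TM" shows "decorrelating (indicator A)"
proof -
  define S where "S l = {z \<in> space M. (z, l) \<in> A}" for l
  have sub: "A \<subseteq> \<Omega>" using sets.sets_into_space[OF A] by (simp add: space_TM)
  have S: "S l \<in> sets M" for l
  proof -
    have "level_meas (ext (indicator A))" by (rule level_meas_ext[OF borel_measurable_indicator[OF A]])
    then have "(\<lambda>z. ext (indicator A) (z, l)) \<in> borel_measurable M" by (simp add: level_meas_def)
    then have "{z \<in> space M. ext (indicator A) (z, l) = (1 :: ennreal)} \<in> sets M" by measurable
    also have "{z \<in> space M. ext (indicator A) (z, l) = (1 :: ennreal)} = S l"
      using sub by (auto simp: S_def ext_def indicator_def)
    finally show ?thesis .
  qed
  have fin: "decorrelating (\<lambda>x. \<Sum>l<n. level_ind (S l) l x)" for n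
  proof (induction n)
    case 0
    show ?case using decorrelating_const[of 0] by simp
  next
    case (Suc n)
    show ?case using decorrelating_add[OF Suc decorrelating_level_ind[OF S[of n], of n]] by simp
  qed
  have val: "(\<Sum>l<n. level_ind (S l) l x) = (if snd x < n then indicator A x else 0)" if x: "x \<in> \<Omega>" for n x
  proof -
    have "level_ind (S l) l x = (if l = snd x then indicator A x else 0)" for l
      using x by (cases x) (auto simp: level_ind_def S_def indicator_def tower_space_def)
    then have "(\<Sum>l<n. level_ind (S l) l x) = (\<Sum>l<n. if l = snd x then indicator A x else 0)" by simp
    then show ?thesis by simp
  qed
  show ?thesis
  proof (rule decorrelating_dominated[OF fin, where w = "\<lambda>_. 1"])
    fix x assume x: "x \<in> \<Omega>"
    show "(\<lambda>n. \<Sum>l<n. level_ind (S l) l x) \<longlonglongrightarrow> indicator A x"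
      unfolding val[OF x]
    proof (rule tendsto_eventually)
      show "\<forall>\<^sub>F n in sequentially. (if snd x < n then indicator A x else 0) = (indicator A x :: real)"
        using eventually_gt_at_top[of "snd x"] by eventually_elim simp
    qed
    show "\<bar>\<Sum>l<n. level_ind (S l) l x\<bar> \<le> 1" for n unfolding val[OF x] by (simp add: indicator_def)
  qed (use A in \<open>auto simp: measurable_\<nu>\<close>)
qed

text \<open>
  Indicators, simple functions and dominated limits.
\<close>

theorem decorrelating_integrable: assumes "integrable \<nu> \<psi>" shows "decorrelating \<psi>"
  using assms
proof (induction rule: integrable_induct)
  case (base A c)
  then have "decorrelating (\<lambda>x. c * indicator A x)" by (intro decorrelating_cmult decorrelating_indicator) simp
  then show ?case by (simp add: mult.commute)
next
  case (add f g)
  then show ?case by (intro decorrelating_add)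
next
  case (lim f s)
  show ?case
  proof (rule decorrelating_dominated[where s = s and w = "\<lambda>x. 2 * \<bar>f x\<bar>"])
    show "integrable \<nu> (\<lambda>x. 2 * \<bar>f x\<bar>)" using lim by simp
    show "f \<in> borel_measurable \<nu>" using lim by auto
  qed (use lim in \<open>auto simp: space_\<nu>\<close>)
qed

lemma decorrelating_corr_tendsto: assumes \<psi>: "integrable \<nu> \<psi>" and \<phi>: "unit_obs \<phi>" shows "(\<lambda>n. corr \<phi> \<psi> n) \<longlonglongrightarrow> 0"
proof (rule LIMSEQ_I)
  fix e :: real assume "e > 0"
  then obtain n0 where "\<forall>n\<ge>n0. \<forall>\<phi>. unit_obs \<phi> \<longrightarrow> \<bar>corr \<phi> \<psi> n\<bar> \<le> e / 2" using niceD(2)[OF decorrelating_integrable[OF \<psi>], of "e / 2"] by auto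
  then show "\<exists>no. \<forall>n\<ge>no. norm (corr \<phi> \<psi> n - 0) < e" using \<phi> \<open>e > 0\<close> by (intro exI[of _ n0]) force
qed

lemma unit_obs_indicator: "A \<in> sets TM \<Longrightarrow> unit_obs (indicator A)"
  unfolding unit_obs_def by (auto simp: indicator_def)

theorem mixing_\<nu>: "mixing F \<nu>"
  unfolding mixing_def
proof (intro ballI)
  fix A B assume "A \<in> sets \<nu>" "B \<in> sets \<nu>"
  then have A: "A \<in> sets TM" and B: "B \<in> sets TM" by auto
  have sB: "B \<subseteq> \<Omega>" using sets.sets_into_space[OF B] by (simp add: space_TM)
  have sA: "A \<subseteq> \<Omega>" using sets.sets_into_space[OF A] by (simp add: space_TM)
  have iB: "integrable \<nu> (indicator B :: _ \<Rightarrow> real)" by (rule unit_obs_integrable[OF unit_obs_indicator[OF B]])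
  have "corr (indicator A) (indicator B) n = measure \<nu> ((F ^^ n) -` A \<inter> B) - measure \<nu> A * measure \<nu> B" for n
  proof -
    have "(\<lambda>x. indicator A ((F ^^ n) x) * indicator B x :: real) = indicator ((F ^^ n) -` A \<inter> B)"
      by (auto simp: indicator_def)
    moreover have "(F ^^ n) -` A \<inter> B \<inter> space \<nu> = (F ^^ n) -` A \<inter> B" "A \<inter> space \<nu> = A" "B \<inter> space \<nu> = B"
      using sA sB by (auto simp: space_\<nu>)
    ultimately show ?thesis unfolding correlation_def by simp
  qed
  with decorrelating_corr_tendsto[OF iB unit_obs_indicator[OF A]]
  have "(\<lambda>n. measure \<nu> ((F ^^ n) -` A \<inter> B) - measure \<nu> A * measure \<nu> B) \<longlonglongrightarrow> 0" by simp
  then show "(\<lambda>n. measure \<nu> ((F ^^ n) -` A \<inter> B)) \<longlonglongrightarrow> measure \<nu> A * measure \<nu> B" by (rule LIM_zero_cancel)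
qed

text \<open>
  The density of \<open>\<nu>\<close> is positive almost everywhere, because the uniform density is the first summand
  of \<open>\<rho>\<close>.
\<close>

lemma ac_\<nu>: assumes "absolutely_continuous TM \<nu>'" shows "absolutely_continuous \<nu> \<nu>'"
proof -
  have "AE x in TM. 0 < ennreal (1 / (c * suminf zb)) * \<rho> (fst x)"
    using AE_TM[OF AE_G]
  proof eventually_elim
    case (elim x)
    have "0 < 1 / (c * suminf zb)" using c_pos zb_sum_pos by simp
    then show ?case using \<rho>_pos[OF elim] by (simp add: ennreal_zero_less_mult_iff del: ennreal_1)
  qed
  have "null_sets \<nu> \<subseteq> null_sets TM"
  proof
    fix A assume A: "A \<in> null_sets \<nu>"
    then have "AE x in \<nu>. x \<notin> A" by (rule AE_not_in)
    then have "AE x in TM. 0 < ennreal (1 / (c * suminf zb)) * \<rho> (fst x) \<longrightarrow> x \<notin> A"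
      unfolding \<nu>_def by (subst (asm) AE_density) (auto intro: measurable_compose[OF fst_TM])
    then have "AE x in TM. x \<notin> A" using \<open>AE x in TM. 0 < _\<close> by eventually_elim simp
    moreover have "A \<in> sets TM" using A by auto
    ultimately show "A \<in> null_sets TM" using AE_iff_null_sets by blast
  qed
  with assms show ?thesis unfolding absolutely_continuous_def by blast
qed

text \<open>
  Let \<open>g\<close> be the density of \<open>\<nu>'\<close> with respect to \<open>\<nu>\<close>. By invariance of \<open>\<nu>'\<close> the correlation
  of the indicator of \<open>A\<close> with \<open>g\<close> is \<open>\<nu>' A - \<nu> A\<close> at all times; but correlations tend to zero.
\<close>

theorem acip_unique: assumes "acip T \<nu>'" shows "\<nu>' = \<nu>"
proof (rule measure_eqI)
  have s: "sets \<nu>' = sets TM" "prob_space \<nu>'" "invariant_measure F \<nu>'" "absolutely_continuous TM \<nu>'"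
    using assms by (auto simp: acip_def)
  interpret P: prob_space \<nu>' by fact
  show ss: "sets \<nu>' = sets \<nu>" using s(1) by simp
  obtain f where f: "f \<in> borel_measurable \<nu>" "density \<nu> f = \<nu>'"
    using nu.Radon_Nikodym[OF ac_\<nu>[OF s(4)] ss] by blast
  note [measurable] = f(1)
  have "emeasure (density \<nu> f) (space \<nu>) = (\<integral>\<^sup>+x. f x * indicator (space \<nu>) x \<partial>\<nu>)"
    by (rule emeasure_density[OF f(1) sets.top])
  also have "\<dots> = (\<integral>\<^sup>+x. f x \<partial>\<nu>)" by (rule nn_integral_cong) simp
  finally have "(\<integral>\<^sup>+x. f x \<partial>\<nu>) = emeasure \<nu>' (space \<nu>')"
    unfolding f(2) sets_eq_imp_space_eq[OF ss] by simp
  then have int1: "(\<integral>\<^sup>+x. f x \<partial>\<nu>) = 1" by (simp add: P.emeasure_space_1)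
  then have "AE x in \<nu>. f x \<noteq> \<infinity>" by (intro nn_integral_PInf_AE) auto
  then have fr: "AE x in \<nu>. f x = ennreal (enn2real (f x))" by eventually_elim (simp add: less_top)
  define g where "g x = enn2real (f x)" for x
  have gm[measurable]: "g \<in> borel_measurable \<nu>" unfolding g_def by measurable
  have inv_branch: "(\<integral>\<^sup>+x. ennreal (g x) \<partial>\<nu>) = 1"
    unfolding int1[symmetric] g_def by (rule nn_integral_cong_AE) (use fr in \<open>eventually_elim, simp\<close>)
  have g0: "0 \<le> g x" for x by (simp add: g_def)
  have ig: "integrable \<nu> g" by (rule integrableI_nonneg) (use inv_branch g0 in auto)
  have Ig: "(\<integral>x. g x \<partial>\<nu>) = 1"
    using nn_integral_eq_integral[OF ig] g0 inv_branch by simp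
  have dFn: "distr \<nu>' \<nu>' (F ^^ n) = \<nu>'" for n
  proof (induction n)
    case 0
    show ?case by (simp add: distr_id[unfolded id_def] id_def)
  next
    case (Suc n)
    have m: "F \<in> \<nu>' \<rightarrow>\<^sub>M \<nu>'" using s(3) by (simp add: invariant_measure_def)
    then have mn: "(F ^^ n) \<in> \<nu>' \<rightarrow>\<^sub>M \<nu>'" by (induction n) (auto simp: comp_def)
    have "distr \<nu>' \<nu>' (F ^^ Suc n) = distr (distr \<nu>' \<nu>' (F ^^ n)) \<nu>' F"
      using m mn by (subst distr_distr) (auto simp: comp_def)
    then show ?case using s(3) by (simp only: Suc invariant_measure_def)
  qed
  fix A assume "A \<in> sets \<nu>'"
  then have A[measurable]: "A \<in> sets TM" using s(1) by simp
  note r = unit_obs_indicator[OF A]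
  have "corr (indicator A) g n = measure \<nu>' A - measure \<nu> A" for n
  proof -
    have "ennreal (\<integral>x. indicator A ((F ^^ n) x) * g x \<partial>\<nu>) = (\<integral>\<^sup>+x. ennreal (indicator A ((F ^^ n) x) * g x) \<partial>\<nu>)"
      by (rule nn_integral_eq_integral[symmetric, OF unit_obs_integrable_mult[OF unit_obs_Fn[OF r] ig]]) (simp add: g0)
    also have "\<dots> = (\<integral>\<^sup>+x. f x * indicator A ((F ^^ n) x) \<partial>\<nu>)"
      by (rule nn_integral_cong_AE) (use fr in \<open>eventually_elim, auto simp: g_def indicator_def\<close>)
    also have "\<dots> = (\<integral>\<^sup>+x. indicator A ((F ^^ n) x) \<partial>density \<nu> f)"
      by (rule nn_integral_density[symmetric]) (auto intro!: measurable_compose[OF Fn_\<nu>])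
    also have "\<dots> = (\<integral>\<^sup>+x. indicator A x \<partial>distr \<nu>' \<nu>' (F ^^ n))"
      unfolding f(2) by (rule nn_integral_distr[symmetric]) (simp_all add: measurable_cong_sets[OF s(1) s(1)] s(1) borel_measurable_indicator)
    also have "\<dots> = emeasure \<nu>' A" unfolding dFn using A s(1) by simp
    finally have "ennreal (\<integral>x. indicator A ((F ^^ n) x) * g x \<partial>\<nu>) = ennreal (measure \<nu>' A)" by (simp add: P.emeasure_eq_measure)
    then have "(\<integral>x. indicator A ((F ^^ n) x) * g x \<partial>\<nu>) = measure \<nu>' A"
      by (subst (asm) ennreal_inj) (auto intro!: Bochner_Integration.integral_nonneg simp: g0)
    moreover have "A \<inter> space \<nu> = A" using sets.sets_into_space[OF A] by (auto simp: space_TM space_\<nu>)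
    ultimately show ?thesis unfolding correlation_def Ig by simp
  qed
  with decorrelating_corr_tendsto[OF ig r] have "(\<lambda>n::nat. measure \<nu>' A - measure \<nu> A) \<longlonglongrightarrow> 0" by simp
  then have "measure \<nu>' A - measure \<nu> A = 0" by (rule LIMSEQ_unique[OF tendsto_const])
  then show "emeasure \<nu>' A = emeasure \<nu> A" by (simp add: P.emeasure_eq_measure nu.emeasure_eq_measure)
qed

lemma Linf_norm_bound:
  assumes \<phi>: "\<phi> \<in> Linf TM" shows "0 \<le> Linf_norm TM \<phi>" "AE x in TM. \<bar>\<phi> x\<bar> \<le> Linf_norm TM \<phi>"
proof -
  define s where "s = esssup TM (\<lambda>x. ereal \<bar>\<phi> x\<bar>)"
  have s: "s < \<infinity>" using \<phi> by (simp add: Linf_def s_def)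
  have m[measurable]: "\<phi> \<in> borel_measurable TM" using \<phi> by (simp add: Linf_def)
  have ae: "AE x in TM. ereal \<bar>\<phi> x\<bar> \<le> s" unfolding s_def by (rule esssup_AE)
  have "0 \<le> s"
  proof (rule ccontr)
    assume "\<not> 0 \<le> s"
    have "\<not> ereal \<bar>\<phi> x\<bar> \<le> s" for x
    proof
      assume "ereal \<bar>\<phi> x\<bar> \<le> s"
      moreover have "0 \<le> ereal \<bar>\<phi> x\<bar>" by simp
      ultimately have "0 \<le> s" by (rule order_trans[rotated])
      with \<open>\<not> 0 \<le> s\<close> show False ..
    qed
    then have "AE x in TM. False" using ae by simp
    then have "AE x in \<nu>. False" by (rule AE_\<nu>)
    then show False by simp
  qed
  then obtain L where L: "s = ereal L" "0 \<le> L" using s by (cases s) auto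
  then have n: "Linf_norm TM \<phi> = L" by (simp add: Linf_norm_def s_def[symmetric])
  show "0 \<le> Linf_norm TM \<phi>" using L n by simp
  show "AE x in TM. \<bar>\<phi> x\<bar> \<le> Linf_norm TM \<phi>" using ae unfolding L n by simp
qed

text \<open>
  Truncate \<open>\<phi>\<close> at its essential supremum \<open>L\<close>, which changes it on a null set, and map \<open>[-L, L]\<close> to
  \<open>[0, 1]\<close>.
\<close>

theorem Linf_reduce:
  assumes \<phi>: "\<phi> \<in> Linf TM" and \<psi>: "integrable \<nu> \<psi>"
    and D: "\<And>\<phi>'. unit_obs \<phi>' \<Longrightarrow> \<bar>corr \<phi>' \<psi> n\<bar> \<le> D"
  shows "\<bar>corr \<phi> \<psi> n\<bar> \<le> Linf_norm TM \<phi> * (2 * D)"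
proof -
  define L where "L = Linf_norm TM \<phi>"
  have L: "0 \<le> L" "AE x in TM. \<bar>\<phi> x\<bar> \<le> L" using Linf_norm_bound[OF \<phi>] by (auto simp: L_def)
  have m[measurable]: "\<phi> \<in> borel_measurable TM" using \<phi> by (simp add: Linf_def)
  have \<psi>m[measurable]: "\<psi> \<in> borel_measurable TM" using borel_measurable_integrable[OF \<psi>] by (simp add: measurable_\<nu>)
  define \<phi>' where "\<phi>' x = (if L = 0 then 0 else (max (- L) (min L (\<phi> x)) + L) / (2 * L))" for x
  have r: "unit_obs \<phi>'"
    unfolding unit_obs_def
  proof (intro conjI allI)
    show "\<phi>' \<in> borel_measurable TM" unfolding \<phi>'_def by measurable
    show "0 \<le> \<phi>' x" for x using L(1) by (auto simp: \<phi>'_def)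
    show "\<phi>' x \<le> 1" for x using L(1) by (auto simp: \<phi>'_def field_simps)
  qed
  have eq: "AE x in \<nu>. \<phi> x = 2 * L * \<phi>' x - L"
    using AE_\<nu>[OF L(2)]
  proof eventually_elim
    case (elim x)
    then have "max (- L) (min L (\<phi> x)) = \<phi> x" by (auto simp: abs_le_iff)
    then show ?case using elim L(1) by (auto simp: \<phi>'_def)
  qed
  have F: "AE x in \<nu>. \<phi> ((F ^^ n) x) = 2 * L * \<phi>' ((F ^^ n) x) - L" by (rule AE_Fn[OF eq])
  note [measurable] = measurable_compose[OF tower_pow_measurable m] robsD(1)[OF r] measurable_compose[OF tower_pow_measurable robsD(1)[OF r]]
  have i1: "integrable \<nu> (\<lambda>x. \<phi>' ((F ^^ n) x) * \<psi> x)" by (rule unit_obs_integrable_mult[OF unit_obs_Fn[OF r] \<psi>])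
  have "(\<integral>x. \<phi> ((F ^^ n) x) * \<psi> x \<partial>\<nu>) = (\<integral>x. 2 * L * (\<phi>' ((F ^^ n) x) * \<psi> x) - L * \<psi> x \<partial>\<nu>)"
  proof (rule integral_cong_AE)
    show "AE x in \<nu>. \<phi> ((F ^^ n) x) * \<psi> x = 2 * L * (\<phi>' ((F ^^ n) x) * \<psi> x) - L * \<psi> x"
      using F by eventually_elim (simp only: left_diff_distrib mult.assoc)
  qed (simp_all add: measurable_\<nu>)
  also have "\<dots> = 2 * L * (\<integral>x. \<phi>' ((F ^^ n) x) * \<psi> x \<partial>\<nu>) - L * (\<integral>x. \<psi> x \<partial>\<nu>)"
    using i1 \<psi> by simp
  finally have 1: "(\<integral>x. \<phi> ((F ^^ n) x) * \<psi> x \<partial>\<nu>) = 2 * L * (\<integral>x. \<phi>' ((F ^^ n) x) * \<psi> x \<partial>\<nu>) - L * (\<integral>x. \<psi> x \<partial>\<nu>)" .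
  have "(\<integral>x. \<phi> x \<partial>\<nu>) = (\<integral>x. 2 * L * \<phi>' x - L \<partial>\<nu>)"
    by (rule integral_cong_AE) (use eq in \<open>auto simp: measurable_\<nu>\<close>)
  also have "\<dots> = 2 * L * (\<integral>x. \<phi>' x \<partial>\<nu>) - L"
    using unit_obs_integrable[OF r] by (simp add: nu.prob_space)
  finally have 2: "(\<integral>x. \<phi> x \<partial>\<nu>) = 2 * L * (\<integral>x. \<phi>' x \<partial>\<nu>) - L" .
  have "corr \<phi> \<psi> n = 2 * L * corr \<phi>' \<psi> n"
    unfolding correlation_def 1 2 by (simp add: algebra_simps)
  then have "\<bar>corr \<phi> \<psi> n\<bar> = 2 * L * \<bar>corr \<phi>' \<psi> n\<bar>" using L(1) by (simp add: abs_mult)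
  also have "\<dots> \<le> 2 * L * D" using L(1) D[OF r] by (intro mult_left_mono) auto
  finally show ?thesis by (simp add: L_def mult_ac)
qed

end

section \<open>How long the first returns take\<close>

lemma eventually_bound_all:
  fixes f g :: "nat \<Rightarrow> real"
  assumes "\<forall>\<^sub>F n in sequentially. \<bar>f n\<bar> \<le> C * g n" and g: "\<And>n. g n > 0"
  shows "\<exists>C'. \<forall>n. \<bar>f n\<bar> \<le> C' * g n"
proof -
  obtain n0 where n0: "\<And>n. n \<ge> n0 \<Longrightarrow> \<bar>f n\<bar> \<le> C * g n" using assms(1) unfolding eventually_sequentially by blast
  define S where "S = (\<Sum>i<n0. \<bar>f i\<bar> / g i)"
  have S0: "S \<ge> 0" unfolding S_def using g by (intro sum_nonneg) (simp add: less_imp_le)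
  have "\<bar>f n\<bar> \<le> (\<bar>C\<bar> + S) * g n" for n
  proof (cases "n \<ge> n0")
    case True
    have "\<bar>f n\<bar> \<le> C * g n" by (rule n0[OF True])
    also have "\<dots> \<le> (\<bar>C\<bar> + S) * g n" using S0 g[of n] by (intro mult_right_mono) auto
    finally show ?thesis .
  next
    case False
    then have "\<bar>f n\<bar> / g n \<le> S" unfolding S_def using g
      by (intro member_le_sum[of n _ "\<lambda>i. \<bar>f i\<bar> / g i"]) (auto simp: less_imp_le)
    then have "\<bar>f n\<bar> \<le> S * g n" using g[of n] by (simp add: pos_divide_le_eq)
    also have "\<dots> \<le> (\<bar>C\<bar> + S) * g n" using g[of n] by (intro mult_right_mono) auto
    finally show ?thesis .
  qed
  then show ?thesis by blast
qed

lemma exp_decay_bigo: assumes "f \<in> O(\<lambda>n. \<theta> ^ n)" "0 < \<theta>" "\<theta> < 1" shows "exp_decay f"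
proof -
  obtain C where "\<forall>\<^sub>F n in sequentially. norm (f n) \<le> C * norm (\<theta> ^ n)" using landau_o.bigE[OF assms(1)] by blast
  then have "\<forall>\<^sub>F n in sequentially. \<bar>f n\<bar> \<le> C * \<theta> ^ n" using assms(2) by simp
  then have "\<exists>C'. \<forall>n. \<bar>f n\<bar> \<le> C' * \<theta> ^ n" by (rule eventually_bound_all) (use assms in simp)
  then show ?thesis unfolding exp_decay_def using assms by blast
qed

lemma poly_decay_bigo: assumes "f \<in> O(\<lambda>n. real n powr (- \<alpha>))" "0 \<le> \<alpha>" shows "poly_decay \<alpha> f"
proof -
  obtain C where C: "C > 0" "\<forall>\<^sub>F n in sequentially. norm (f n) \<le> C * norm (real n powr (- \<alpha>))" using landau_o.bigE[OF assms(1)] by blast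
  have "\<forall>\<^sub>F n in sequentially. \<bar>f n\<bar> \<le> (C * 2 powr \<alpha>) * real (n + 1) powr (- \<alpha>)"
    using C(2) eventually_gt_at_top[of 0]
  proof eventually_elim
    case (elim n)
    have "real n powr (- \<alpha>) \<le> (1 / 2 * real (n + 1)) powr (- \<alpha>)" using elim assms(2) by (intro powr_mono2') auto
    also have "\<dots> = 2 powr \<alpha> * real (n + 1) powr (- \<alpha>)" by (simp only: powr_mult) (simp add: powr_minus powr_divide)
    finally have "C * real n powr (- \<alpha>) \<le> C * (2 powr \<alpha> * real (n + 1) powr (- \<alpha>))" using C(1) by (intro mult_left_mono) auto
    then show ?case using elim by simp
  qed
  then have "\<exists>C'. \<forall>n. \<bar>f n\<bar> \<le> C' * real (n + 1) powr (- \<alpha>)" by (rule eventually_bound_all) simp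
  then show ?thesis unfolding poly_decay_def .
qed

context distorted_tower
begin

definition rho_bound :: real where "rho_bound = exp K1 / c * mass \<rho>"
definition nu_scale :: real where "nu_scale = 1 / (c * suminf zb)"

lemma rho_bound_nonneg: "0 \<le> rho_bound" unfolding rho_bound_def using c_pos mass_nonneg by simp
lemma nu_scale_nonneg: "0 \<le> nu_scale" unfolding nu_scale_def using c_pos zb_sum_pos by simp

lemma \<rho>_le: "z \<in> G \<Longrightarrow> \<rho> z \<le> ennreal rho_bound" unfolding rho_bound_def by (rule reg_upper_mass[OF regular_\<rho>])

lemma emeasure_\<nu>: assumes "A \<in> sets TM" shows "emeasure \<nu> A = ennreal nu_scale * (\<Sum>l. \<integral>\<^sup>+z. indicator {z. l < rtime T z} z * indicator A (z, l) * \<rho> z \<partial>M)"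
proof -
  have "emeasure \<nu> A = (\<integral>\<^sup>+x. indicator A x \<partial>\<nu>)" using assms by simp
  also have "\<dots> = ennreal nu_scale * (\<Sum>l. H (indicator A) l \<rho>)"
    unfolding nu_scale_def by (rule nn_integral_\<nu>[OF borel_measurable_indicator[OF assms]])
  finally show ?thesis unfolding H_def .
qed

lemma sum_levels:
  assumes [measurable]: "u \<in> borel_measurable M"
  shows "(\<Sum>l. \<integral>\<^sup>+z. indicator {z. l < rtime T z} z * u z \<partial>M) = (\<integral>\<^sup>+z. of_nat (rtime T z) * u z \<partial>M)"
proof -
  have "(\<Sum>l. \<integral>\<^sup>+z. indicator {z. l < rtime T z} z * u z \<partial>M) = (\<integral>\<^sup>+z. (\<Sum>l. indicator {z. l < rtime T z} z * u z) \<partial>M)"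
    by (rule nn_integral_suminf[symmetric]) measurable
  then show ?thesis by (simp only: ennreal_suminf_multc suminf_indicator_less)
qed

text \<open>
  With unbounded weights a transfer operator still produces regular densities, provided that the
  total mass is finite.
\<close>

lemma regular_LopI: assumes f: "regular f" and fin: "(\<integral>\<^sup>+z. V (idx z) * f z \<partial>M) < \<infinity>"
  shows "regular (transfer_op V f)" "(\<integral>\<^sup>+y. transfer_op V f y \<partial>M) = (\<integral>\<^sup>+z. V (idx z) * f z \<partial>M)"
proof -
  have [measurable]: "f \<in> borel_measurable M" by (rule regular_measurable[OF f])
  show e: "(\<integral>\<^sup>+y. transfer_op V f y \<partial>M) = (\<integral>\<^sup>+z. V (idx z) * f z \<partial>M)" using nn_integral_transfer_op[of f one V] by simp
  have "reg K1 (transfer_op V f)" using f reg_mono[OF reg_transfer_op_K K_le_K1] by (simp add: regular_def)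
  then show "regular (transfer_op V f)" unfolding regular_def using e fin by simp
qed

lemma weighted_le:
  assumes f: "regular f" and [measurable]: "u \<in> borel_measurable M"
  shows "(\<integral>\<^sup>+z. u z * f z \<partial>M) \<le> ennreal (exp K1 / c * mass f) * (\<integral>\<^sup>+z. u z \<partial>M)"
proof -
  have "(\<integral>\<^sup>+z. u z * f z \<partial>M) \<le> (\<integral>\<^sup>+z. ennreal (exp K1 / c * mass f) * u z \<partial>M)"
  proof (rule nn_integral_mono_AE)
    show "AE z in M. u z * f z \<le> ennreal (exp K1 / c * mass f) * u z"
      using AE_G by eventually_elim (subst mult.commute, intro mult_right_mono reg_upper_mass[OF f], auto)
  qed
  also have "\<dots> = ennreal (exp K1 / c * mass f) * (\<integral>\<^sup>+z. u z \<partial>M)" by (rule nn_integral_cmult) measurable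
  finally show ?thesis .
qed

text \<open>
  The iterates of a regular density are bounded uniformly in time by a multiple of its mass.
\<close>

lemma iterate_le:
  assumes "regular f" "u \<in> borel_measurable M"
  shows "(\<integral>\<^sup>+z. f z * u ((ret T ^^ i) z) \<partial>M) \<le> ennreal (exp K1 / c * mass f) * (\<integral>\<^sup>+z. u z \<partial>M)"
  using assms
proof (induction i arbitrary: f)
  case 0
  then show ?case using weighted_le[of f u] by (simp add: mult.commute)
next
  case (Suc i)
  note [measurable] = regular_measurable[OF Suc.prems(1)] Suc.prems(2)
  have [measurable]: "(\<lambda>z. u ((ret T ^^ i) z)) \<in> borel_measurable M" by (rule measurable_compose[OF funpow_ret_measurable]) simp
  have fin: "(\<integral>\<^sup>+z. 1 * f z \<partial>M) < \<infinity>" using Suc.prems(1) by (simp add: regular_def)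
  let ?g = "transfer_op (\<lambda>_. 1) f"
  have g: "regular ?g" by (rule regular_LopI(1)[OF Suc.prems(1) fin])
  have mg: "mass ?g = mass f" using regular_LopI(2)[OF Suc.prems(1) fin] by (simp add: mass_def)
  have "(\<integral>\<^sup>+z. f z * u ((ret T ^^ Suc i) z) \<partial>M) = (\<integral>\<^sup>+z. 1 * f z * u ((ret T ^^ i) (ret T z)) \<partial>M)"
    by (simp add: funpow_swap1)
  also have "\<dots> = (\<integral>\<^sup>+y. ?g y * u ((ret T ^^ i) y) \<partial>M)" by (rule nn_integral_transfer_op[symmetric]) measurable
  also have "\<dots> \<le> ennreal (exp K1 / c * mass ?g) * (\<integral>\<^sup>+z. u z \<partial>M)" by (rule Suc.IH[OF g Suc.prems(2)])
  finally show ?case unfolding mg .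
qed

lemma return_sum_le: "(\<And>i. i < k \<Longrightarrow> rtime T ((ret T ^^ i) z) \<le> b) \<Longrightarrow> return_sum k z \<le> k * b"
proof (induction k arbitrary: z)
  case (Suc k)
  have "return_sum k (ret T z) \<le> k * b"
  proof (rule Suc.IH)
    fix i assume "i < k"
    then show "rtime T ((ret T ^^ i) (ret T z)) \<le> b" using Suc.prems[of "Suc i"] by (simp add: funpow_swap1)
  qed
  then show ?case using Suc.prems[of 0] by simp
qed simp

lemma R_integral_finite: "(\<integral>\<^sup>+z. of_nat (rtime T z) \<partial>M) < \<infinity>"
  using rtime_integrable by (simp add: integrable_iff_bounded ennreal_of_nat_eq_real_of_nat)

lemma of_nat_rtime_measurable[measurable]: "(\<lambda>z. of_nat (rtime T z) :: ennreal) \<in> borel_measurable M"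
  by (rule measurable_compose[OF rtime_measurable]) simp

lemma AE_branch_time: "AE z in M. branch_time (idx z) = rtime T z"
  using AE_good_base by eventually_elim (simp add: rtime_idx)

lemma nn_integral_branch_time: "(\<integral>\<^sup>+z. q (branch_time (idx z)) * f z \<partial>M) = (\<integral>\<^sup>+z. q (rtime T z) * f z \<partial>M)"
  by (rule nn_integral_cong_AE) (use AE_branch_time in \<open>eventually_elim, simp\<close>)

text \<open>
  If the return number \<open>k + 1\<close> is later than \<open>a + k * b\<close>, either the first return takes more than
  \<open>a\<close>, or one of the following \<open>k\<close> return times exceeds \<open>b\<close>. The first case is measured by the
  residual time in the column. In the second case integrating over the levels produces the weight
  \<open>R\<close>; as \<open>R\<close> is integrable, applying one transfer operator with this weight to \<open>\<rho>\<close> gives a regular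
  density of finite mass, whose iterates are bounded.
\<close>

lemma slow_union_bound:
  "\<exists>A\<ge>0. \<forall>k j a b. a + k * b \<le> j \<longrightarrow> slow k j \<le> A * ((\<Sum>l. tail T (l + a)) + real k * tail T b)"
proof -
  define fR where "fR = transfer_op (\<lambda>i. of_nat (branch_time i)) \<rho>"
  have finR: "(\<integral>\<^sup>+z. of_nat (branch_time (idx z)) * \<rho> z \<partial>M) < \<infinity>"
  proof -
    have "(\<integral>\<^sup>+z. of_nat (branch_time (idx z)) * \<rho> z \<partial>M) = (\<integral>\<^sup>+z. of_nat (rtime T z) * \<rho> z \<partial>M)" by (rule nn_integral_branch_time)
    also have "\<dots> \<le> ennreal (exp K1 / c * mass \<rho>) * (\<integral>\<^sup>+z. of_nat (rtime T z) \<partial>M)" by (rule weighted_le[OF regular_\<rho>]) measurable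
    also have "\<dots> < \<infinity>" using R_integral_finite by (simp add: ennreal_mult_less_top)
    finally show ?thesis .
  qed
  have fR: "regular fR" unfolding fR_def by (rule regular_LopI(1)[OF regular_\<rho> finR])
  define A where "A = nu_scale * (rho_bound + exp K1 / c * mass fR)"
  have D2: "0 \<le> exp K1 / c * mass fR" using c_pos mass_nonneg by simp
  have A: "0 \<le> A" unfolding A_def using nu_scale_nonneg rho_bound_nonneg D2 by simp
  have "slow k j \<le> A * ((\<Sum>l. tail T (l + a)) + real k * tail T b)" if j: "a + k * b \<le> j" for k j a b
  proof -
    let ?S = "{x \<in> \<Omega>. j + snd x < return_sum (Suc k) (fst x)}"
    define u where "u i z = (indicator {z. b < rtime T z} ((ret T ^^ i) (ret T z)) :: ennreal)" for i z
    have indm[measurable]: "(\<lambda>z. indicator {z. b < rtime T z} z :: ennreal) \<in> borel_measurable M" by measurable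
    have [measurable]: "u i \<in> borel_measurable M" for i
      unfolding u_def[abs_def]
      by (rule measurable_compose[OF measurable_compose[OF ret_measurable funpow_ret_measurable]]) measurable
    define X where "X = (\<Sum>l. tail T (l + a))"
    have sX: "summable (\<lambda>l. tail T (l + a))" by (rule summable_ignore_initial_segment[OF tail_summable])
    have X0: "0 \<le> X" unfolding X_def by (intro suminf_nonneg sX tail_nonneg)
    have pt: "indicator {z. l < rtime T z} z * indicator ?S (z, l) * \<rho> z \<le>
        indicator {z. a + l < rtime T z} z * \<rho> z + (\<Sum>i<k. indicator {z. l < rtime T z} z * (u i z * \<rho> z))" for z l
    proof (cases "l < rtime T z \<and> (z, l) \<in> ?S \<and> \<not> a + l < rtime T z")
      case True
      then have S: "j + l < rtime T z + return_sum k (ret T z)" by simp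
      have "\<exists>i<k. b < rtime T ((ret T ^^ i) (ret T z))"
      proof (rule ccontr)
        assume "\<not> ?thesis"
        then have "return_sum k (ret T z) \<le> k * b" by (intro return_sum_le) (metis not_less)
        with S j True show False by linarith
      qed
      then obtain i where i: "i < k" "u i z = 1" unfolding u_def by auto
      have "indicator {z. l < rtime T z} z * (u i z * \<rho> z) \<le> (\<Sum>i<k. indicator {z. l < rtime T z} z * (u i z * \<rho> z))"
        using i by (intro member_le_sum) auto
      then have "\<rho> z \<le> (\<Sum>i<k. indicator {z. l < rtime T z} z * (u i z * \<rho> z))" using True i by simp
      moreover have "indicator {z. l < rtime T z} z * indicator ?S (z, l) * \<rho> z \<le> \<rho> z" by (auto simp: indicator_def)
      ultimately show ?thesis by (meson add_increasing order_trans zero_le)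
    next
      case False
      then have "indicator {z. l < rtime T z} z * indicator ?S (z, l) * \<rho> z \<le> indicator {z. a + l < rtime T z} z * \<rho> z"
        by (auto simp: indicator_def simp del: return_sum.simps)
      then show ?thesis by (rule order_trans) simp
    qed
    have m1: "(\<integral>\<^sup>+z. indicator {z. a + l < rtime T z} z * \<rho> z \<partial>M) \<le> ennreal (rho_bound * tail T (l + a))" for l
    proof -
      have "(\<integral>\<^sup>+z. indicator {z. a + l < rtime T z} z * \<rho> z \<partial>M) \<le> ennreal rho_bound * (\<integral>\<^sup>+z. indicator {z. a + l < rtime T z} z \<partial>M)"
        unfolding rho_bound_def by (rule weighted_le[OF regular_\<rho>]) measurable
      also have "(\<integral>\<^sup>+z. indicator {z. a + l < rtime T z} z \<partial>M) = (\<integral>\<^sup>+z. indicator {x \<in> space M. a + l < rtime T x} z \<partial>M)"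
        by (rule nn_integral_cong) (simp add: indicator_def)
      also have "\<dots> = ennreal (tail T (l + a))" by (simp add: emeasure_tail add.commute)
      finally show ?thesis using rho_bound_nonneg by (simp add: ennreal_mult')
    qed
    have m2: "(\<Sum>l. \<integral>\<^sup>+z. indicator {z. l < rtime T z} z * (u i z * \<rho> z) \<partial>M) \<le> ennreal (exp K1 / c * mass fR * tail T b)" for i
    proof -
      have "(\<Sum>l. \<integral>\<^sup>+z. indicator {z. l < rtime T z} z * (u i z * \<rho> z) \<partial>M) = (\<integral>\<^sup>+z. of_nat (rtime T z) * (u i z * \<rho> z) \<partial>M)"
        by (rule sum_levels) measurable
      also have "\<dots> = (\<integral>\<^sup>+z. of_nat (branch_time (idx z)) * \<rho> z * indicator {z. b < rtime T z} ((ret T ^^ i) (ret T z)) \<partial>M)"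
        by (rule nn_integral_cong_AE) (use AE_branch_time in \<open>eventually_elim, simp add: u_def mult_ac\<close>)
      also have "\<dots> = (\<integral>\<^sup>+y. fR y * indicator {z. b < rtime T z} ((ret T ^^ i) y) \<partial>M)"
        unfolding fR_def
        by (rule nn_integral_transfer_op[OF \<rho>_measurable measurable_compose[OF funpow_ret_measurable indm], symmetric])
      also have "\<dots> \<le> ennreal (exp K1 / c * mass fR) * (\<integral>\<^sup>+z. indicator {z. b < rtime T z} z \<partial>M)"
        by (rule iterate_le[OF fR]) measurable
      also have "(\<integral>\<^sup>+z. indicator {z. b < rtime T z} z \<partial>M) = (\<integral>\<^sup>+z. indicator {x \<in> space M. b < rtime T x} z \<partial>M)"
        by (rule nn_integral_cong) (simp add: indicator_def)
      also have "\<dots> = ennreal (tail T b)" by (simp add: emeasure_tail)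
      finally show ?thesis by (simp only: ennreal_mult'[OF D2])
    qed
    have first: "(\<Sum>l. \<integral>\<^sup>+z. indicator {z. a + l < rtime T z} z * \<rho> z \<partial>M) \<le> ennreal (rho_bound * X)"
    proof -
      have "(\<Sum>l. \<integral>\<^sup>+z. indicator {z. a + l < rtime T z} z * \<rho> z \<partial>M) \<le> (\<Sum>l. ennreal (rho_bound * tail T (l + a)))"
        by (rule suminf_le[OF m1]) simp_all
      also have "\<dots> = ennreal (\<Sum>l. rho_bound * tail T (l + a))"
        by (rule suminf_ennreal2[OF mult_nonneg_nonneg[OF rho_bound_nonneg tail_nonneg] summable_mult[OF sX]])
      also have "(\<Sum>l. rho_bound * tail T (l + a)) = rho_bound * X" unfolding X_def by (rule suminf_mult[OF sX])
      finally show ?thesis .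
    qed
    have second: "(\<Sum>l. \<Sum>i<k. \<integral>\<^sup>+z. indicator {z. l < rtime T z} z * (u i z * \<rho> z) \<partial>M)
        \<le> ennreal (real k * (exp K1 / c * mass fR * tail T b))"
    proof -
      have "(\<Sum>l. \<Sum>i<k. \<integral>\<^sup>+z. indicator {z. l < rtime T z} z * (u i z * \<rho> z) \<partial>M)
        = (\<Sum>i<k. \<Sum>l. \<integral>\<^sup>+z. indicator {z. l < rtime T z} z * (u i z * \<rho> z) \<partial>M)"
        by (rule suminf_sum) simp
      also have "\<dots> \<le> (\<Sum>i<k. ennreal (exp K1 / c * mass fR * tail T b))" by (rule sum_mono[OF m2])
      also have "\<dots> = ennreal (\<Sum>i<k. exp K1 / c * mass fR * tail T b)"
        by (rule sum_ennreal) (rule mult_nonneg_nonneg[OF D2 tail_nonneg])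
      finally show ?thesis by simp
    qed
    have "(\<Sum>l. \<integral>\<^sup>+z. indicator {z. l < rtime T z} z * indicator ?S (z, l) * \<rho> z \<partial>M)
      \<le> (\<Sum>l. \<integral>\<^sup>+z. indicator {z. a + l < rtime T z} z * \<rho> z + (\<Sum>i<k. indicator {z. l < rtime T z} z * (u i z * \<rho> z)) \<partial>M)"
      by (rule suminf_le[OF nn_integral_mono[OF pt]]) simp_all
    also have "\<dots> = (\<Sum>l. (\<integral>\<^sup>+z. indicator {z. a + l < rtime T z} z * \<rho> z \<partial>M) + (\<Sum>i<k. \<integral>\<^sup>+z. indicator {z. l < rtime T z} z * (u i z * \<rho> z) \<partial>M))"
    proof (rule suminf_cong)
      fix l
      have [measurable]: "(\<lambda>z. indicator {z. l < rtime T z} z * (u i z * \<rho> z)) \<in> borel_measurable M" for i by measurable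
      have "(\<integral>\<^sup>+z. indicator {z. a + l < rtime T z} z * \<rho> z + (\<Sum>i<k. indicator {z. l < rtime T z} z * (u i z * \<rho> z)) \<partial>M)
        = (\<integral>\<^sup>+z. indicator {z. a + l < rtime T z} z * \<rho> z \<partial>M) + (\<integral>\<^sup>+z. (\<Sum>i<k. indicator {z. l < rtime T z} z * (u i z * \<rho> z)) \<partial>M)"
        by (rule nn_integral_add) measurable
      also have "(\<integral>\<^sup>+z. (\<Sum>i<k. indicator {z. l < rtime T z} z * (u i z * \<rho> z)) \<partial>M) = (\<Sum>i<k. \<integral>\<^sup>+z. indicator {z. l < rtime T z} z * (u i z * \<rho> z) \<partial>M)"
        by (rule nn_integral_sum) measurable
      finally show "(\<integral>\<^sup>+z. indicator {z. a + l < rtime T z} z * \<rho> z + (\<Sum>i<k. indicator {z. l < rtime T z} z * (u i z * \<rho> z)) \<partial>M)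
        = (\<integral>\<^sup>+z. indicator {z. a + l < rtime T z} z * \<rho> z \<partial>M) + (\<Sum>i<k. \<integral>\<^sup>+z. indicator {z. l < rtime T z} z * (u i z * \<rho> z) \<partial>M)" .
    qed
    also have "\<dots> = (\<Sum>l. \<integral>\<^sup>+z. indicator {z. a + l < rtime T z} z * \<rho> z \<partial>M) + (\<Sum>l. \<Sum>i<k. \<integral>\<^sup>+z. indicator {z. l < rtime T z} z * (u i z * \<rho> z) \<partial>M)"
      by (rule suminf_add[symmetric]) simp_all
    also have "\<dots> \<le> ennreal (rho_bound * X) + ennreal (real k * (exp K1 / c * mass fR * tail T b))"
      by (rule add_mono[OF first second])
    finally have "emeasure \<nu> ?S \<le> ennreal nu_scale * (ennreal (rho_bound * X) + ennreal (real k * (exp K1 / c * mass fR * tail T b)))"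
      unfolding emeasure_\<nu>[OF slow_set] by (rule mult_left_mono) simp
    also have "\<dots> = ennreal (nu_scale * (rho_bound * X + real k * (exp K1 / c * mass fR * tail T b)))"
      by (subst ennreal_plus[symmetric], rule mult_nonneg_nonneg[OF rho_bound_nonneg X0],
          rule mult_nonneg_nonneg[OF of_nat_0_le_iff mult_nonneg_nonneg[OF D2 tail_nonneg]],
          rule ennreal_mult'[OF nu_scale_nonneg, symmetric])
    finally have "ennreal (measure \<nu> ?S) \<le> ennreal (nu_scale * (rho_bound * X + real k * (exp K1 / c * mass fR * tail T b)))"
      unfolding nu.emeasure_eq_measure .
    then have "measure \<nu> ?S \<le> nu_scale * (rho_bound * X + real k * (exp K1 / c * mass fR * tail T b))"
      by (subst (asm) ennreal_le_iff)
         (intro mult_nonneg_nonneg add_nonneg_nonneg nu_scale_nonneg rho_bound_nonneg X0 D2 tail_nonneg of_nat_0_le_iff)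
    also have "\<dots> \<le> A * (X + real k * tail T b)"
    proof -
      have "rho_bound * X + real k * (exp K1 / c * mass fR * tail T b) \<le> (rho_bound + exp K1 / c * mass fR) * (X + real k * tail T b)"
      proof -
        have y: "0 \<le> real k * tail T b" by (rule mult_nonneg_nonneg[OF of_nat_0_le_iff tail_nonneg])
        have e1: "rho_bound * X \<le> rho_bound * (X + real k * tail T b)" using y by (intro mult_left_mono rho_bound_nonneg) simp
        have e2: "(exp K1 / c * mass fR) * (real k * tail T b) \<le> (exp K1 / c * mass fR) * (X + real k * tail T b)"
          using X0 by (intro mult_left_mono D2) simp
        have e3: "real k * (exp K1 / c * mass fR * tail T b) = (exp K1 / c * mass fR) * (real k * tail T b)"
          by (simp only: mult_ac)
        show ?thesis unfolding e3 distrib_right[of rho_bound] by (rule add_mono[OF e1 e2])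
      qed
      then show ?thesis unfolding A_def mult.assoc using nu_scale_nonneg by (intro mult_left_mono) auto
    qed
    finally show ?thesis unfolding slow_def X_def .
  qed
  with A show ?thesis by blast
qed

definition floor_powr :: "real \<Rightarrow> nat \<Rightarrow> nat" where "floor_powr \<sigma> n = nat \<lfloor>real n powr \<sigma>\<rfloor>"

text \<open>
  With \<open>a\<close> of order \<open>n\<close>, \<open>k\<close> of order \<open>n powr \<sigma>\<close> and \<open>b\<close> of order \<open>n powr (1 - \<sigma>)\<close> the union bound
  is of order \<open>n powr (1 - \<alpha>) + n powr (\<sigma> - \<alpha> * (1 - \<sigma>))\<close>. The two exponents agree for
  \<open>\<sigma> = 1 / (1 + \<alpha>)\<close>.
\<close>

lemma slow_poly:
  assumes \<alpha>: "\<alpha> > 1" and tl: "poly_decay \<alpha> (tail T)"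
  defines "\<sigma> \<equiv> 1 / (1 + \<alpha>)"
  shows "poly_decay (\<alpha> - 1) (\<lambda>n. slow (floor_powr \<sigma> n) (n div 2))"
proof -
  obtain A where A: "0 \<le> A" "\<And>k j a b. a + k * b \<le> j \<Longrightarrow> slow k j \<le> A * ((\<Sum>l. tail T (l + a)) + real k * tail T b)"
    using slow_union_bound by blast
  obtain C where C: "C > 0" "\<And>n. \<bar>tail T n\<bar> \<le> C * real (n + 1) powr (- \<alpha>)" using poly_decayE[OF tl] by blast
  obtain C' where C': "C' > 0" "\<And>n. \<bar>\<Sum>l. tail T (l + n)\<bar> \<le> C' * real (n + 1) powr (- (\<alpha> - 1))"
    using poly_decayE[OF poly_decay_tail_sum[OF \<alpha> tl tail_nonneg]] by blast
  have \<sigma>: "0 < \<sigma>" "\<sigma> < 1" using \<alpha> by (auto simp: \<sigma>_def)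
  define B where "B = A * (C' * 4 powr (\<alpha> - 1) + C * 8 powr \<alpha>)"
  have "slow (floor_powr \<sigma> n) (n div 2) \<le> B * real (n + 1) powr (- (\<alpha> - 1))" for n
  proof -
    define k where "k = floor_powr \<sigma> n"
    define a where "a = (n div 2) div 2"
    \<comment> \<open>dividing by \<open>k + 1\<close> avoids division by zero and still leaves \<open>k * b \<le> a\<close>\<close>
    define b where "b = a div (k + 1)"
    have "k * b \<le> a"
    proof -
      have "k * b \<le> (k + 1) * (a div (k + 1))" unfolding b_def by simp
      also have "\<dots> \<le> a" by (rule times_div_less_eq_dividend)
      finally show ?thesis .
    qed
    then have ab: "a + k * b \<le> n div 2" unfolding a_def by linarith
    let ?x = "real (n + 1)"
    have a1: "?x / 4 \<le> real (a + 1)"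
    proof -
      have "n + 1 \<le> 4 * (a + 1)" unfolding a_def by presburger
      then have "real (n + 1) \<le> real (4 * (a + 1))" by (simp only: of_nat_le_iff)
      then show ?thesis by simp
    qed
    have t1: "(\<Sum>l. tail T (l + a)) \<le> C' * 4 powr (\<alpha> - 1) * ?x powr (- (\<alpha> - 1))"
    proof -
      have "real (a + 1) powr (- (\<alpha> - 1)) \<le> (?x / 4) powr (- (\<alpha> - 1))" using a1 \<alpha> by (intro powr_mono2') auto
      also have "\<dots> = 4 powr (\<alpha> - 1) * ?x powr (- (\<alpha> - 1))" by (simp add: powr_divide powr_minus_divide powr_diff field_simps)
      finally have "C' * real (a + 1) powr (- (\<alpha> - 1)) \<le> C' * (4 powr (\<alpha> - 1) * ?x powr (- (\<alpha> - 1)))" using C' by (intro mult_left_mono) auto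
      then show ?thesis using C'(2)[of a] by (simp add: mult.assoc)
    qed
    have kx: "real k \<le> ?x powr \<sigma>"
    proof -
      have "real k \<le> real n powr \<sigma>" unfolding k_def floor_powr_def by simp
      also have "\<dots> \<le> ?x powr \<sigma>" using \<sigma> by (intro powr_mono2) auto
      finally show ?thesis .
    qed
    have x1: "1 \<le> ?x powr \<sigma>" using \<sigma> by (intro ge_one_powr_ge_zero) auto
    have b1: "?x / (8 * ?x powr \<sigma>) \<le> real (b + 1)"
    proof -
      have "a < (k + 1) * (b + 1)" unfolding b_def
        using dividend_less_times_div[of "k + 1" a] by simp
      then have "a + 1 \<le> (k + 1) * (b + 1)" by simp
      then have "real (a + 1) \<le> real ((k + 1) * (b + 1))" by (simp only: of_nat_le_iff)
      then have "real (a + 1) \<le> (real k + 1) * real (b + 1)" by (simp add: algebra_simps)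
      also have "\<dots> \<le> (2 * ?x powr \<sigma>) * real (b + 1)" using kx x1 by (intro mult_right_mono) auto
      finally have "?x / 4 \<le> (2 * ?x powr \<sigma>) * real (b + 1)" using a1 by simp
      then show ?thesis using x1 by (simp add: field_simps)
    qed
    have t2: "real k * tail T b \<le> C * 8 powr \<alpha> * ?x powr (- (\<alpha> - 1))"
    proof -
      have x0: "?x > 0" by simp
      have "real (b + 1) powr (- \<alpha>) \<le> (?x / (8 * ?x powr \<sigma>)) powr (- \<alpha>)" using b1 \<alpha> x1 by (intro powr_mono2') auto
      also have "\<dots> = (1/8 * ?x powr (1 - \<sigma>)) powr (- \<alpha>)" by (simp add: powr_diff)
      also have "\<dots> = (1/8) powr (- \<alpha>) * (?x powr (1 - \<sigma>)) powr (- \<alpha>)" by (rule powr_mult)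
      also have "(1/8 :: real) powr (- \<alpha>) = 8 powr \<alpha>" by (simp add: powr_minus powr_divide)
      also have "(?x powr (1 - \<sigma>)) powr (- \<alpha>) = ?x powr (- \<alpha> + \<sigma> * \<alpha>)" by (simp add: powr_powr algebra_simps)
      finally have "tail T b \<le> C * (8 powr \<alpha> * ?x powr (- \<alpha> + \<sigma> * \<alpha>))"
        using C(2)[of b] C(1) mult_left_mono[of "real (b + 1) powr (- \<alpha>)" "8 powr \<alpha> * ?x powr (- \<alpha> + \<sigma> * \<alpha>)" C] by linarith
      then have "real k * tail T b \<le> ?x powr \<sigma> * (C * (8 powr \<alpha> * ?x powr (- \<alpha> + \<sigma> * \<alpha>)))"
        using kx tail_nonneg[of b] by (intro mult_mono) auto
      also have "\<dots> = C * 8 powr \<alpha> * (?x powr \<sigma> * ?x powr (- \<alpha> + \<sigma> * \<alpha>))" by (simp add: mult_ac)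
      also have "?x powr \<sigma> * ?x powr (- \<alpha> + \<sigma> * \<alpha>) = ?x powr (\<sigma> + (- \<alpha> + \<sigma> * \<alpha>))" by (rule powr_add[symmetric])
      also have "\<sigma> + (- \<alpha> + \<sigma> * \<alpha>) = - (\<alpha> - 1)"
      proof -
        have "\<sigma> * (1 + \<alpha>) = 1" using \<alpha> by (simp add: \<sigma>_def)
        then show ?thesis by (simp add: algebra_simps)
      qed
      finally show ?thesis .
    qed
    have "slow k (n div 2) \<le> A * ((\<Sum>l. tail T (l + a)) + real k * tail T b)" by (rule A(2)[OF ab])
    also have "\<dots> \<le> A * (C' * 4 powr (\<alpha> - 1) * ?x powr (- (\<alpha> - 1)) + C * 8 powr \<alpha> * ?x powr (- (\<alpha> - 1)))"
      using A(1) t1 t2 by (intro mult_left_mono add_mono)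
    also have "\<dots> = B * ?x powr (- (\<alpha> - 1))" unfolding B_def by (simp only: distrib_left distrib_right mult.assoc)
    finally show ?thesis unfolding k_def .
  qed
  then have "\<bar>slow (floor_powr \<sigma> n) (n div 2)\<bar> \<le> B * real (n + 1) powr (- (\<alpha> - 1))" for n
    by (simp only: abs_of_nonneg slow_def measure_nonneg)
  then show ?thesis unfolding poly_decay_def by blast
qed

lemma cylinder_err_poly:
  assumes \<alpha>: "\<alpha> > 1" and tl: "poly_decay \<alpha> (tail T)"
  shows "poly_decay (\<alpha> - 1) (\<lambda>n. cylinder_err (floor_powr (1 / (1 + \<alpha>)) n) n)"
  unfolding cylinder_err_def by (intro poly_decay_add poly_decay_half regular_err_poly slow_poly assms) (use \<alpha> in simp)

text \<open>
  Write \<open>y ^ r = 1 + (\<Sum>n<r. (y - 1) * y ^ n)\<close> and integrate, so that the tail of \<open>R\<close> appears.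
\<close>

lemma exp_moment:
  assumes tl: "\<And>n. \<bar>tail T n\<bar> \<le> C * \<theta> ^ n" and th: "0 < \<theta>" and y: "1 < y" "y * \<theta> < 1"
  shows "(\<integral>\<^sup>+z. ennreal (y ^ rtime T z) \<partial>M) < \<infinity>"
proof -
  have gs: "y ^ r = 1 + (\<Sum>n<r. (y - 1) * y ^ n)" for r :: nat
    by (induction r) (auto simp: algebra_simps)
  have "ennreal (y ^ rtime T z) = 1 + (\<Sum>n. ennreal ((y - 1) * y ^ n) * indicator {z. n < rtime T z} z)" for z
  proof -
    have "(\<Sum>n. ennreal ((y - 1) * y ^ n) * indicator {z. n < rtime T z} z) = (\<Sum>n<rtime T z. ennreal ((y - 1) * y ^ n) * indicator {z. n < rtime T z} z)"
      by (rule suminf_finite) auto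
    also have "\<dots> = (\<Sum>n<rtime T z. ennreal ((y - 1) * y ^ n))" by (intro sum.cong) auto
    also have "\<dots> = ennreal (\<Sum>n<rtime T z. (y - 1) * y ^ n)" using y by (intro sum_ennreal) auto
    finally have eq: "(\<Sum>n. ennreal ((y - 1) * y ^ n) * indicator {z. n < rtime T z} z) = ennreal (\<Sum>n<rtime T z. (y - 1) * y ^ n)" .
    have "0 \<le> (\<Sum>n<rtime T z. (y - 1) * y ^ n)" using y by (intro sum_nonneg) auto
    then have "ennreal (1 + (\<Sum>n<rtime T z. (y - 1) * y ^ n)) = ennreal 1 + ennreal (\<Sum>n<rtime T z. (y - 1) * y ^ n)"
      by (intro ennreal_plus) auto
    then show ?thesis unfolding gs[of "rtime T z", symmetric] eq by simp
  qed
  then have "(\<integral>\<^sup>+z. ennreal (y ^ rtime T z) \<partial>M) = (\<integral>\<^sup>+z. 1 + (\<Sum>n. ennreal ((y - 1) * y ^ n) * indicator {z. n < rtime T z} z) \<partial>M)" by simp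
  also have "\<dots> = ennreal c + (\<Sum>n. \<integral>\<^sup>+z. ennreal ((y - 1) * y ^ n) * indicator {z. n < rtime T z} z \<partial>M)"
    by (subst nn_integral_add, measurable, subst nn_integral_suminf, measurable) (simp add: c_eq)
  also have "(\<Sum>n. \<integral>\<^sup>+z. ennreal ((y - 1) * y ^ n) * indicator {z. n < rtime T z} z \<partial>M) = (\<Sum>n. ennreal ((y - 1) * y ^ n * tail T n))"
  proof (rule suminf_cong)
    fix n
    have "(\<integral>\<^sup>+z. ennreal ((y - 1) * y ^ n) * indicator {z. n < rtime T z} z \<partial>M) = (\<integral>\<^sup>+z. ennreal ((y - 1) * y ^ n) * indicator {x \<in> space M. n < rtime T x} z \<partial>M)"
      by (rule nn_integral_cong) (simp add: indicator_def)
    also have "\<dots> = ennreal ((y - 1) * y ^ n) * emeasure M {x \<in> space M. n < rtime T x}" by (rule nn_integral_cmult_indicator) measurable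
    finally show "(\<integral>\<^sup>+z. ennreal ((y - 1) * y ^ n) * indicator {z. n < rtime T z} z \<partial>M) = ennreal ((y - 1) * y ^ n * tail T n)"
      unfolding emeasure_tail using y by (simp add: ennreal_mult')
  qed
  also have "\<dots> < \<infinity>"
  proof -
    have "summable (\<lambda>n. (y - 1) * y ^ n * tail T n)"
    proof (rule summable_comparison_test'[where N = 0])
      show "summable (\<lambda>n. ((y - 1) * C) * (y * \<theta>) ^ n)" using y th by (intro summable_mult summable_geometric) auto
      show "norm ((y - 1) * y ^ n * tail T n) \<le> ((y - 1) * C) * (y * \<theta>) ^ n" for n
      proof -
        have "((y - 1) * y ^ n) * \<bar>tail T n\<bar> \<le> ((y - 1) * y ^ n) * (C * \<theta> ^ n)" using y by (intro mult_left_mono tl) auto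
        then show ?thesis using y by (simp add: abs_mult power_mult_distrib mult_ac)
      qed
    qed
    then show ?thesis using y tail_nonneg ennreal_suminf_neq_top by (simp add: less_top[symmetric])
  qed
  finally show ?thesis by simp
qed

text \<open>
  Each return multiplies the mass of the weighted density by at most a constant, since a regular
  density is comparable with the uniform one. Independence is replaced by this comparison.
\<close>

lemma chernoff:
  assumes f: "regular f" and x: "1 \<le> x" and X: "(\<integral>\<^sup>+z. ennreal (x ^ rtime T z) \<partial>M) = ennreal X" "0 \<le> X"
  shows "(\<integral>\<^sup>+z. f z * ennreal (x ^ return_sum k z) \<partial>M) \<le> ennreal ((exp K1 / c * X) ^ k * mass f)"
  using f
proof (induction k arbitrary: f)
  case 0
  then show ?case using ennreal_mass[OF 0] by simp
next
  case (Suc k)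
  note [measurable] = regular_measurable[OF Suc.prems]
  let ?V = "\<lambda>i. ennreal (x ^ branch_time i)"
  let ?q = "exp K1 / c"
  have q: "0 \<le> ?q" using c_pos by simp
  have le: "(\<integral>\<^sup>+z. ?V (idx z) * f z \<partial>M) \<le> ennreal (?q * X * mass f)"
  proof -
    have "(\<integral>\<^sup>+z. ?V (idx z) * f z \<partial>M) = (\<integral>\<^sup>+z. ennreal (x ^ rtime T z) * f z \<partial>M)" by (rule nn_integral_branch_time)
    also have "\<dots> \<le> ennreal (?q * mass f) * ennreal X" unfolding X(1)[symmetric] by (rule weighted_le[OF Suc.prems]) measurable
    also have "\<dots> = ennreal (?q * X * mass f)" using q X(2) mass_nonneg by (simp add: ennreal_mult'[symmetric] mult_ac)
    finally show ?thesis .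
  qed
  then have fin: "(\<integral>\<^sup>+z. ?V (idx z) * f z \<partial>M) < \<infinity>" by (rule le_less_trans) simp
  let ?g = "transfer_op ?V f"
  have g: "regular ?g" by (rule regular_LopI(1)[OF Suc.prems fin])
  have "ennreal (mass ?g) \<le> ennreal (?q * X * mass f)" using le regular_LopI(2)[OF Suc.prems fin] ennreal_mass[OF g] by simp
  then have mg: "mass ?g \<le> ?q * X * mass f" using c_pos X(2) mass_nonneg[of f] by (subst (asm) ennreal_le_iff) auto
  have "(\<integral>\<^sup>+z. f z * ennreal (x ^ return_sum (Suc k) z) \<partial>M) = (\<integral>\<^sup>+z. ?V (idx z) * f z * ennreal (x ^ return_sum k (ret T z)) \<partial>M)"
  proof (rule nn_integral_cong_AE)
    show "AE z in M. f z * ennreal (x ^ return_sum (Suc k) z) = ?V (idx z) * f z * ennreal (x ^ return_sum k (ret T z))"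
      using AE_branch_time by eventually_elim (use x in \<open>simp add: power_add ennreal_mult' mult_ac\<close>)
  qed
  also have "\<dots> = (\<integral>\<^sup>+y. ?g y * ennreal (x ^ return_sum k y) \<partial>M)" by (rule nn_integral_transfer_op[symmetric]) measurable
  also have "\<dots> \<le> ennreal ((?q * X) ^ k * mass ?g)" by (rule Suc.IH[OF g])
  also have "\<dots> \<le> ennreal ((?q * X) ^ k * (?q * X * mass f))"
    using mg q X(2) by (intro ennreal_leI mult_left_mono zero_le_power mult_nonneg_nonneg)
  finally show ?case by (simp add: mult_ac)
qed

text \<open>
  Markov's inequality for \<open>x\<close> to the power of the time of the return number \<open>k + 1\<close>. Integrating
  over the levels adds a factor \<open>R\<close> to the weight of the first return, which is absorbed by taking
  \<open>x = sqrt y\<close>, where \<open>y\<close> has a finite exponential moment.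
\<close>

lemma slow_chernoff:
  assumes tl: "exp_decay (tail T)"
  shows "\<exists>A \<Theta> x. 1 < x \<and> 0 \<le> A \<and> 0 \<le> \<Theta> \<and> (\<forall>k j. slow k j \<le> A * \<Theta> ^ k * (1 / x) ^ j)"
proof -
  obtain C \<theta> where C: "C > 0" "0 < \<theta>" "\<theta> < 1" "\<And>n. \<bar>tail T n\<bar> \<le> C * \<theta> ^ n" using exp_decayE[OF tl] by blast
  define y where "y = (1 + 1 / \<theta>) / 2"
  have y: "1 < y" "y * \<theta> < 1" using C by (auto simp: y_def field_simps)
  define x where "x = sqrt y"
  have x: "1 < x" "x\<^sup>2 = y" "x \<le> y" using y by (auto simp: x_def real_le_lsqrt power2_eq_square)
  have Y: "(\<integral>\<^sup>+z. ennreal (y ^ rtime T z) \<partial>M) < \<infinity>" by (rule exp_moment[OF C(4,2) y])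
  have "x * \<theta> \<le> y * \<theta>" using x(3) C by (intro mult_right_mono) auto
  then have X': "(\<integral>\<^sup>+z. ennreal (x ^ rtime T z) \<partial>M) < \<infinity>" using y x by (intro exp_moment[OF C(4,2)]) auto
  define X where "X = enn2real (\<integral>\<^sup>+z. ennreal (x ^ rtime T z) \<partial>M)"
  have X: "(\<integral>\<^sup>+z. ennreal (x ^ rtime T z) \<partial>M) = ennreal X" "0 \<le> X" using X' by (auto simp: X_def)
  let ?V = "\<lambda>i. of_nat (branch_time i) * ennreal (x ^ branch_time i)"
  have Rx: "of_nat r * ennreal (x ^ r) \<le> ennreal (1 / (x - 1)) * ennreal (y ^ r)" for r :: nat
  proof -
    have "1 + real r * (x - 1) \<le> (1 + (x - 1)) ^ r" using x by (intro Bernoulli_inequality) auto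
    then have "real r \<le> 1 / (x - 1) * x ^ r" using x by (simp add: field_simps)
    then have "real r * x ^ r \<le> 1 / (x - 1) * x ^ r * x ^ r" using x by (intro mult_right_mono) auto
    also have "\<dots> = 1 / (x - 1) * y ^ r" unfolding x(2)[symmetric] by (simp add: power2_eq_square power_mult_distrib)
    finally show ?thesis using x y by (simp add: ennreal_of_nat_eq_real_of_nat ennreal_mult'[symmetric] ennreal_leI)
  qed
  have finV: "(\<integral>\<^sup>+z. ?V (idx z) * \<rho> z \<partial>M) < \<infinity>"
  proof -
    have "(\<integral>\<^sup>+z. ?V (idx z) * \<rho> z \<partial>M) = (\<integral>\<^sup>+z. of_nat (rtime T z) * ennreal (x ^ rtime T z) * \<rho> z \<partial>M)" by (rule nn_integral_branch_time)
    also have "\<dots> \<le> (\<integral>\<^sup>+z. ennreal (1 / (x - 1)) * ennreal (y ^ rtime T z) * \<rho> z \<partial>M)" by (intro nn_integral_mono mult_right_mono Rx) auto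
    also have "\<dots> \<le> ennreal (exp K1 / c * mass \<rho>) * (\<integral>\<^sup>+z. ennreal (1 / (x - 1)) * ennreal (y ^ rtime T z) \<partial>M)"
      by (rule weighted_le[OF regular_\<rho>]) measurable
    also have "\<dots> < \<infinity>" using Y by (subst nn_integral_cmult) (auto simp: ennreal_mult_less_top)
    finally show ?thesis .
  qed
  define f2 where "f2 = transfer_op ?V \<rho>"
  have f2: "regular f2" unfolding f2_def by (rule regular_LopI(1)[OF regular_\<rho> finV])
  define \<Theta> where "\<Theta> = exp K1 / c * X"
  have \<Theta>: "0 \<le> \<Theta>" unfolding \<Theta>_def using c_pos X by simp
  define A where "A = nu_scale * mass f2"
  have A: "0 \<le> A" unfolding A_def using nu_scale_nonneg mass_nonneg by simp
  have "slow k j \<le> A * \<Theta> ^ k * (1 / x) ^ j" for k j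
  proof -
    let ?S = "{x \<in> \<Omega>. j + snd x < return_sum (Suc k) (fst x)}"
    let ?p = "ennreal ((1 / x) ^ j)"
    define u where "u z = ?p * (ennreal (x ^ rtime T z) * ennreal (x ^ return_sum k (ret T z)) * \<rho> z)" for z
    have um[measurable]: "u \<in> borel_measurable M"
    proof -
      have [measurable]: "(\<lambda>z. ennreal (x ^ return_sum k (ret T z))) \<in> borel_measurable M"
        by (rule measurable_compose[OF measurable_compose[OF ret_measurable return_sum_measurable]]) simp
      show ?thesis unfolding u_def[abs_def] by measurable
    qed
    have pt: "indicator {z. l < rtime T z} z * indicator ?S (z, l) * \<rho> z \<le> indicator {z. l < rtime T z} z * u z" for l z
    proof (cases "(z, l) \<in> ?S")
      case True
      then have "j \<le> return_sum (Suc k) z" by (simp del: return_sum.simps)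
      then have "x ^ j \<le> x ^ return_sum (Suc k) z" using x by (intro power_increasing) auto
      then have "1 \<le> (1 / x) ^ j * (x ^ rtime T z * x ^ return_sum k (ret T z))" using x by (simp add: power_one_over field_simps power_add)
      then have "ennreal 1 \<le> ennreal ((1 / x) ^ j * (x ^ rtime T z * x ^ return_sum k (ret T z)))" by (rule ennreal_leI)
      then have "1 * \<rho> z \<le> ennreal ((1 / x) ^ j * (x ^ rtime T z * x ^ return_sum k (ret T z))) * \<rho> z" by (intro mult_right_mono) auto
      also have "\<dots> = u z" unfolding u_def using x by (simp add: ennreal_mult' mult_ac)
      finally show ?thesis using True by (simp add: mult_left_mono del: return_sum.simps)
    qed (simp del: return_sum.simps)
    have "(\<Sum>l. \<integral>\<^sup>+z. indicator {z. l < rtime T z} z * indicator ?S (z, l) * \<rho> z \<partial>M) \<le> (\<Sum>l. \<integral>\<^sup>+z. indicator {z. l < rtime T z} z * u z \<partial>M)"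
      by (rule suminf_le[OF nn_integral_mono[OF pt]]) simp_all
    also have "(\<Sum>l. \<integral>\<^sup>+z. indicator {z. l < rtime T z} z * u z \<partial>M) = (\<integral>\<^sup>+z. of_nat (rtime T z) * u z \<partial>M)"
      by (rule sum_levels[OF um])
    also have "\<dots> = (\<integral>\<^sup>+z. ?p * (?V (idx z) * \<rho> z * ennreal (x ^ return_sum k (ret T z))) \<partial>M)"
      by (rule nn_integral_cong_AE) (use AE_branch_time in \<open>eventually_elim, simp add: u_def mult_ac\<close>)
    also have "\<dots> = ?p * (\<integral>\<^sup>+z. ?V (idx z) * \<rho> z * ennreal (x ^ return_sum k (ret T z)) \<partial>M)"
    proof (rule nn_integral_cmult)
      have [measurable]: "(\<lambda>z. ennreal (x ^ return_sum k (ret T z))) \<in> borel_measurable M"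
        by (rule measurable_compose[OF measurable_compose[OF ret_measurable return_sum_measurable]]) simp
      have [measurable]: "(\<lambda>z. ?V (idx z)) \<in> borel_measurable M" by (rule measurable_compose[OF idx_measurable]) simp
      show "(\<lambda>z. ?V (idx z) * \<rho> z * ennreal (x ^ return_sum k (ret T z))) \<in> borel_measurable M" by measurable
    qed
    also have "(\<integral>\<^sup>+z. ?V (idx z) * \<rho> z * ennreal (x ^ return_sum k (ret T z)) \<partial>M) = (\<integral>\<^sup>+y. f2 y * ennreal (x ^ return_sum k y) \<partial>M)"
      unfolding f2_def by (rule nn_integral_transfer_op[symmetric]) measurable
    also have "?p * \<dots> \<le> ?p * ennreal (\<Theta> ^ k * mass f2)"
      unfolding \<Theta>_def by (intro mult_left_mono chernoff[OF f2 _ X]) (use x in simp_all)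
    finally have "emeasure \<nu> ?S \<le> ennreal nu_scale * (?p * ennreal (\<Theta> ^ k * mass f2))"
      unfolding emeasure_\<nu>[OF slow_set] by (rule mult_left_mono) simp
    also have "\<dots> = ennreal (A * \<Theta> ^ k * (1 / x) ^ j)"
      unfolding A_def using nu_scale_nonneg x \<Theta> mass_nonneg by (simp add: ennreal_mult'[symmetric] mult_ac)
    finally have "ennreal (measure \<nu> ?S) \<le> ennreal (A * \<Theta> ^ k * (1 / x) ^ j)" unfolding nu.emeasure_eq_measure .
    then show ?thesis unfolding slow_def using A \<Theta> x by (subst (asm) ennreal_le_iff) auto
  qed
  then show ?thesis using x(1) A \<Theta> by blast
qed

text \<open>
  Choose \<open>m\<close> so large that the factor \<open>\<Theta> ^ (n / m)\<close> of \<open>slow_chernoff\<close> costs at most a small power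
  of \<open>x\<close>.
\<close>

lemma cylinder_err_exp:
  assumes tl: "exp_decay (tail T)"
  shows "\<exists>m>0. exp_decay (\<lambda>n. cylinder_err (n div m) n)"
proof -
  obtain A \<Theta> x where x: "1 < x" "0 \<le> A" "0 \<le> \<Theta>" "\<And>k j. slow k j \<le> A * \<Theta> ^ k * (1 / x) ^ j"
    using slow_chernoff[OF tl] by blast
  obtain p where p: "\<Theta> < x ^ p" using real_arch_pow[OF x(1)] by blast
  \<comment> \<open>then \<open>\<Theta> ^ (n div m) \<le> x ^ (n div 8)\<close>, which the factor \<open>(1 / x) ^ (n div 2)\<close> compensates with room to spare\<close>
  define m where "m = 8 * (p + 1)"
  have "slow (n div m) (n div 2) \<le> A * (1 / x) ^ ((n div 2) div 2)" for n
  proof -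
    let ?k = "n div m"
    have pk: "p * ?k \<le> n div 8"
    proof -
      have "p * ?k \<le> (p + 1) * ((n div 8) div (p + 1))" unfolding m_def div_mult2_eq by simp
      also have "\<dots> \<le> n div 8" by (rule times_div_less_eq_dividend)
      finally show ?thesis .
    qed
    have "\<Theta> ^ ?k \<le> (x ^ p) ^ ?k" using p x by (intro power_mono) auto
    also have "\<dots> = x ^ (p * ?k)" by (simp add: power_mult)
    also have "\<dots> \<le> x ^ (n div 8)" using pk x by (intro power_increasing) auto
    finally have T: "\<Theta> ^ ?k \<le> x ^ (n div 8)" .
    have "slow ?k (n div 2) \<le> A * \<Theta> ^ ?k * (1 / x) ^ (n div 2)" by (rule x(4))
    also have "\<dots> \<le> A * x ^ (n div 8) * (1 / x) ^ (n div 2)"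
      using T x by (intro mult_right_mono mult_left_mono) auto
    also have "\<dots> \<le> A * x ^ (n div 8) * (1 / x) ^ (n div 8 + (n div 2) div 2)"
      using x by (intro mult_left_mono power_decreasing) auto
    also have "\<dots> = A * (1 / x) ^ ((n div 2) div 2)" using x by (simp add: power_add power_one_over)
    finally show ?thesis .
  qed
  then have "\<bar>slow (n div m) (n div 2)\<bar> \<le> A * (1 / x) ^ ((n div 2) div 2)" for n
    by (simp only: abs_of_nonneg slow_def measure_nonneg)
  moreover have "exp_decay (\<lambda>n. A * (1 / x) ^ n)"
    unfolding exp_decay_def by (intro exI[of _ A] exI[of _ "1 / x"]) (use x in auto)
  then have "exp_decay (\<lambda>n. A * (1 / x) ^ ((n div 2) div 2))" by (intro exp_decay_half[of "\<lambda>n. A * (1 / x) ^ (n div 2)"] exp_decay_half[of "\<lambda>n. A * (1 / x) ^ n"])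
  ultimately have "exp_decay (\<lambda>n. slow (n div m) (n div 2))"
    by (elim exp_decay_mono) (meson abs_ge_self order_trans)
  then have "exp_decay (\<lambda>n. cylinder_err (n div m) n)"
    unfolding cylinder_err_def by (intro exp_decay_add exp_decay_half[OF regular_err_exp[OF tl]])
  moreover have "m > 0" by (simp add: m_def)
  ultimately show ?thesis by blast
qed

end

section \<open>Rates in Landau notation\<close>

lemma powr_bigo_mono:
  assumes "a \<le> (b::real)" shows "(\<lambda>n::nat. real n powr a) \<in> O(\<lambda>n. real n powr b)"
proof (rule bigoI[of _ 1])
  show "\<forall>\<^sub>F n in sequentially. norm (real n powr a) \<le> 1 * norm (real n powr b)"
    using eventually_ge_at_top[of 1] by eventually_elim (use assms in \<open>simp add: powr_mono\<close>)
qed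

lemma exp_decay_D: assumes "exp_decay f" shows "\<exists>\<theta>. 0 < \<theta> \<and> \<theta> < 1 \<and> f \<in> O(\<lambda>n. \<theta> ^ n)"
proof -
  obtain C \<theta> where C: "C > 0" "0 < \<theta>" "\<theta> < 1" "\<And>n. \<bar>f n\<bar> \<le> C * \<theta> ^ n" using exp_decayE[OF assms] by blast
  have "f \<in> O(\<lambda>n. \<theta> ^ n)" by (rule bigoI[of _ C]) (use C in simp)
  with C show ?thesis by blast
qed

lemma poly_decay_D: assumes "poly_decay \<alpha> f" "0 \<le> \<alpha>" shows "f \<in> O(\<lambda>n. real n powr (- \<alpha>))"
proof -
  obtain C where C: "C > 0" "\<And>n. \<bar>f n\<bar> \<le> C * real (n + 1) powr (- \<alpha>)" using poly_decayE[OF assms(1)] by blast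
  show ?thesis
  proof (rule bigoI[of _ C])
    show "\<forall>\<^sub>F n in sequentially. norm (f n) \<le> C * norm (real n powr (- \<alpha>))"
      using eventually_ge_at_top[of 1]
    proof eventually_elim
      case (elim n)
      have "real (n + 1) powr (- \<alpha>) \<le> real n powr (- \<alpha>)" using elim assms(2) by (intro powr_mono2') auto
      then have "C * real (n + 1) powr (- \<alpha>) \<le> C * real n powr (- \<alpha>)" using C(1) by (intro mult_left_mono) auto
      then show ?case using C(2)[of n] by simp
    qed
  qed
qed

lemma exp_decay_powr: assumes "exp_decay f" shows "f \<in> O(\<lambda>n. real n powr a)"
proof -
  obtain \<theta> where t: "0 < \<theta>" "\<theta> < 1" "f \<in> O(\<lambda>n. \<theta> ^ n)" using exp_decay_D[OF assms] by blast
  have "(\<lambda>n. \<theta> ^ n) \<in> O(\<lambda>n. real n powr a)" using t by real_asymp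
  with t(3) show ?thesis by (rule landau_o.big_trans)
qed

lemma exp_decay_stretched:
  assumes f: "exp_decay f" and g: "\<gamma> < 1"
  shows "f \<in> O(\<lambda>n. exp (- (real n powr \<gamma>)))"
proof -
  obtain \<theta> where t: "0 < \<theta>" "\<theta> < 1" "f \<in> O(\<lambda>n. \<theta> ^ n)" using exp_decay_D[OF f] by blast
  define s where "s = - ln \<theta>"
  have s: "s > 0" using t by (simp add: s_def)
  have "(\<lambda>n. real n powr (\<gamma> - 1)) \<longlonglongrightarrow> 0" using g by real_asymp
  then have ev: "\<forall>\<^sub>F n in sequentially. real n powr (\<gamma> - 1) < s" using s by (rule order_tendstoD(2))
  have "(\<lambda>n. \<theta> ^ n) \<in> O(\<lambda>n. exp (- (real n powr \<gamma>)))"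
  proof (rule bigoI[of _ 1])
    show "\<forall>\<^sub>F n in sequentially. norm (\<theta> ^ n) \<le> 1 * norm (exp (- (real n powr \<gamma>)))"
      using ev eventually_ge_at_top[of 1]
    proof eventually_elim
      case (elim n)
      have "real n powr \<gamma> = real n powr (\<gamma> - 1) * real n" using elim by (simp add: powr_diff)
      also have "\<dots> \<le> s * real n" using elim by (intro mult_right_mono) auto
      finally have "- (s * real n) \<le> - (real n powr \<gamma>)" by simp
      moreover have "\<theta> ^ n = exp (- (s * real n))"
        using t exp_of_nat_mult[of n "ln \<theta>"] by (simp add: s_def mult.commute)
      ultimately show ?case using t by simp
    qed
  qed
  with t(3) show ?thesis by (rule landau_o.big_trans)
qed

lemma exp_decay_log_stretched:
  assumes f: "exp_decay f" shows "f \<in> O(\<lambda>n. exp (- (ln (real n) powr \<gamma>)))"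
proof -
  obtain \<theta> where t: "0 < \<theta>" "\<theta> < 1" "f \<in> O(\<lambda>n. \<theta> ^ n)" using exp_decay_D[OF f] by blast
  define s where "s = - ln \<theta>"
  have s: "s > 0" using t by (simp add: s_def)
  have "(\<lambda>n. ln (real n) powr \<gamma> / real n) \<longlonglongrightarrow> 0" by real_asymp
  then have ev: "\<forall>\<^sub>F n in sequentially. ln (real n) powr \<gamma> / real n < s" using s by (rule order_tendstoD(2))
  have "(\<lambda>n. \<theta> ^ n) \<in> O(\<lambda>n. exp (- (ln (real n) powr \<gamma>)))"
  proof (rule bigoI[of _ 1])
    show "\<forall>\<^sub>F n in sequentially. norm (\<theta> ^ n) \<le> 1 * norm (exp (- (ln (real n) powr \<gamma>)))"
      using ev eventually_ge_at_top[of 1]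
    proof eventually_elim
      case (elim n)
      have "ln (real n) powr \<gamma> \<le> s * real n" using elim by (simp add: field_simps)
      then have "- (s * real n) \<le> - (ln (real n) powr \<gamma>)" by simp
      moreover have "\<theta> ^ n = exp (- (s * real n))"
        using t exp_of_nat_mult[of n "ln \<theta>"] by (simp add: s_def mult.commute)
      ultimately show ?case using t by simp
    qed
  qed
  with t(3) show ?thesis by (rule landau_o.big_trans)
qed

lemma filterlim_Suc_div: "m > 0 \<Longrightarrow> filterlim (\<lambda>n. Suc (n div m)) sequentially sequentially"
  unfolding filterlim_at_top
proof
  fix k assume m: "m > (0::nat)"
  show "\<forall>\<^sub>F n in sequentially. k \<le> Suc (n div m)"
    using eventually_ge_at_top[of "k * m"]
  proof eventually_elim
    case (elim n)
    then have "k \<le> n div m" using m by (simp add: less_eq_div_iff_mult_less_eq)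
    then show ?case by simp
  qed
qed

lemma Suc_div_ge: "m > 0 \<Longrightarrow> real n / real m \<le> real (Suc (n div m))"
proof -
  assume m: "m > 0"
  then have "n \<le> m * Suc (n div m)" using dividend_less_times_div[of m n] by simp
  then have "real n \<le> real (m * Suc (n div m))" by (simp only: of_nat_le_iff)
  then show ?thesis using m by (simp add: field_simps)
qed

lemma exp_decay_Suc_div: assumes "exp_decay f" "m > 0" shows "exp_decay (\<lambda>n. f (Suc (n div m)))"
proof -
  obtain C \<theta> where C: "C > 0" "0 < \<theta>" "\<theta> < 1" "\<And>n. \<bar>f n\<bar> \<le> C * \<theta> ^ n" using exp_decayE[OF assms(1)] by blast
  define s where "s = root m \<theta>"
  have s: "0 < s" "s < 1" "s ^ m = \<theta>" using C assms(2) by (auto simp: s_def)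
  have "\<bar>f (Suc (n div m))\<bar> \<le> C * s ^ n" for n
  proof -
    have "n \<le> m * Suc (n div m)" using dividend_less_times_div[OF assms(2), of n] by simp
    then have "s ^ (m * Suc (n div m)) \<le> s ^ n" using s by (intro power_decreasing) auto
    then have "\<theta> ^ Suc (n div m) \<le> s ^ n" by (simp only: power_mult s(3))
    then show ?thesis using C(1) by (intro order_trans[OF C(4)] mult_left_mono) auto
  qed
  then show ?thesis unfolding exp_decay_def using s by blast
qed

lemma stretched_Suc_div:
  assumes f: "f \<in> O(\<lambda>n. exp (- (real n powr \<gamma>)))" and g: "0 < \<gamma>" "\<gamma>' < \<gamma>" and m: "m > 0"
  shows "(\<lambda>n. f (Suc (n div m))) \<in> O(\<lambda>n. exp (- (real n powr \<gamma>')))"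
proof -
  have "(\<lambda>n. f (Suc (n div m))) \<in> O(\<lambda>n. exp (- (real (Suc (n div m)) powr \<gamma>)))"
    by (rule landau_o.big.compose[OF f filterlim_Suc_div[OF m]])
  moreover have "(\<lambda>n. exp (- (real (Suc (n div m)) powr \<gamma>))) \<in> O(\<lambda>n. exp (- (real n powr \<gamma>')))"
  proof (rule bigoI[of _ 1])
    have "filterlim (\<lambda>n. real n powr (\<gamma> - \<gamma>')) at_top sequentially" using g by real_asymp
    then have ev: "\<forall>\<^sub>F n in sequentially. real m powr \<gamma> \<le> real n powr (\<gamma> - \<gamma>')" unfolding filterlim_at_top by blast
    show "\<forall>\<^sub>F n in sequentially. norm (exp (- (real (Suc (n div m)) powr \<gamma>))) \<le> 1 * norm (exp (- (real n powr \<gamma>')))"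
      using ev eventually_ge_at_top[of 1]
    proof eventually_elim
      case (elim n)
      have "real n powr \<gamma>' * real m powr \<gamma> \<le> real n powr \<gamma>' * real n powr (\<gamma> - \<gamma>')" using elim by (intro mult_left_mono) auto
      also have "\<dots> = real n powr \<gamma>" by (simp flip: powr_add)
      finally have "real n powr \<gamma>' \<le> real n powr \<gamma> / real m powr \<gamma>" using m by (simp add: field_simps)
      also have "\<dots> = (real n / real m) powr \<gamma>" using m by (simp add: powr_divide)
      also have "\<dots> \<le> real (Suc (n div m)) powr \<gamma>" using g Suc_div_ge[OF m, of n] by (intro powr_mono2) auto
      finally show ?case by simp
    qed
  qed
  ultimately show ?thesis by (rule landau_o.big_trans)
qed

lemma log_stretched_Suc_div:
  assumes f: "f \<in> O(\<lambda>n. exp (- (ln (real n) powr \<gamma>)))" and g: "0 < \<gamma>" "\<gamma>' < \<gamma>" and m: "m > 0"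
  shows "(\<lambda>n. f (Suc (n div m))) \<in> O(\<lambda>n. exp (- (ln (real n) powr \<gamma>')))"
proof -
  have "(\<lambda>n. f (Suc (n div m))) \<in> O(\<lambda>n. exp (- (ln (real (Suc (n div m))) powr \<gamma>)))"
    by (rule landau_o.big.compose[OF f filterlim_Suc_div[OF m]])
  moreover have "(\<lambda>n. exp (- (ln (real (Suc (n div m))) powr \<gamma>))) \<in> O(\<lambda>n. exp (- (ln (real n) powr \<gamma>')))"
  proof (rule bigoI[of _ 1])
    have "filterlim (\<lambda>n. ln (real n) powr (\<gamma> - \<gamma>')) at_top sequentially" using g by real_asymp
    then have ev: "\<forall>\<^sub>F n in sequentially. 2 powr \<gamma> \<le> ln (real n) powr (\<gamma> - \<gamma>')" unfolding filterlim_at_top by blast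
    have "filterlim (\<lambda>n. ln (real n)) at_top sequentially" by real_asymp
    then have ev2: "\<forall>\<^sub>F n in sequentially. 2 * ln (real m) + 1 \<le> ln (real n)" unfolding filterlim_at_top by blast
    show "\<forall>\<^sub>F n in sequentially. norm (exp (- (ln (real (Suc (n div m))) powr \<gamma>))) \<le> 1 * norm (exp (- (ln (real n) powr \<gamma>')))"
      using ev ev2 eventually_ge_at_top[of 1]
    proof eventually_elim
      case (elim n)
      have lm: "0 \<le> ln (real m)" using m by simp
      have ln1: "1 \<le> ln (real n)" using elim(2) lm by linarith
      have "ln (real n) powr \<gamma>' * 2 powr \<gamma> \<le> ln (real n) powr \<gamma>' * ln (real n) powr (\<gamma> - \<gamma>')" using elim by (intro mult_left_mono) auto
      also have "\<dots> = ln (real n) powr \<gamma>" by (simp flip: powr_add)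
      finally have "ln (real n) powr \<gamma>' \<le> ln (real n) powr \<gamma> / 2 powr \<gamma>" by (simp add: field_simps)
      also have "\<dots> = (ln (real n) / 2) powr \<gamma>" using ln1 by (simp add: powr_divide)
      also have "\<dots> \<le> ln (real (Suc (n div m))) powr \<gamma>"
      proof (intro powr_mono2)
        have "ln (real n) / 2 \<le> ln (real n) - ln (real m)" using elim(2) by linarith
        also have "\<dots> = ln (real n / real m)" using elim m by (simp add: ln_div)
        also have "\<dots> \<le> ln (real (Suc (n div m)))" using Suc_div_ge[OF m, of n] elim m by (subst ln_le_cancel_iff) auto
        finally show "ln (real n) / 2 \<le> ln (real (Suc (n div m)))" .
      qed (use g ln1 in auto)
      finally show ?case by simp
    qed
  qed
  ultimately show ?thesis by (rule landau_o.big_trans)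
qed

lemma powr_Suc_div:
  assumes f: "f \<in> O(\<lambda>n. real n powr (- \<gamma>))" and g: "0 < \<gamma>" and m: "m > 0"
  shows "(\<lambda>n. f (Suc (n div m))) \<in> O(\<lambda>n. real n powr (- \<gamma>))"
proof -
  have "(\<lambda>n. f (Suc (n div m))) \<in> O(\<lambda>n. real (Suc (n div m)) powr (- \<gamma>))"
    by (rule landau_o.big.compose[OF f filterlim_Suc_div[OF m]])
  moreover have "(\<lambda>n. real (Suc (n div m)) powr (- \<gamma>)) \<in> O(\<lambda>n. real n powr (- \<gamma>))"
  proof (rule bigoI[of _ "(1 / real m) powr (- \<gamma>)"])
    show "\<forall>\<^sub>F n in sequentially. norm (real (Suc (n div m)) powr (- \<gamma>)) \<le> (1 / real m) powr (- \<gamma>) * norm (real n powr (- \<gamma>))"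
      using eventually_ge_at_top[of 1]
    proof eventually_elim
      case (elim n)
      have "real (Suc (n div m)) powr (- \<gamma>) \<le> (1 / real m * real n) powr (- \<gamma>)"
        using Suc_div_ge[OF m, of n] elim m g by (intro powr_mono2') auto
      also have "\<dots> = (1 / real m) powr (- \<gamma>) * real n powr (- \<gamma>)" by (rule powr_mult)
      finally show ?case by simp
    qed
  qed
  ultimately show ?thesis by (rule landau_o.big_trans)
qed

section \<open>The rate of decay of correlations\<close>

context distorted_tower
begin

text \<open>
  The best bound that \<open>corr_variation\<close> gives for the correlations with an observable of variations
  \<open>v\<close>. Bounds in particular cases come from special choices of \<open>k\<close>.
\<close>

definition rate :: "(nat \<Rightarrow> real) \<Rightarrow> nat \<Rightarrow> real" where
  "rate v n = (INF k. \<bar>v (Suc k)\<bar> + cylinder_err k n)"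

lemma rate_bdd: "bdd_below (range (\<lambda>k. \<bar>v (Suc k)\<bar> + cylinder_err k n))"
  by (rule bdd_belowI2[of _ 0]) (simp add: cylinder_err_nonneg)

lemma rate_le: "rate v n \<le> \<bar>v (Suc k)\<bar> + cylinder_err k n"
  unfolding rate_def by (rule cINF_lower[OF rate_bdd]) simp

lemma rate_nonneg: "0 \<le> rate v n"
  unfolding rate_def by (rule cINF_greatest) (simp_all add: cylinder_err_nonneg)

text \<open>
  First choose \<open>k\<close>, then \<open>n\<close>.
\<close>

lemma rate_tendsto: assumes v: "v \<longlonglongrightarrow> 0" shows "rate v \<longlonglongrightarrow> 0"
proof (rule LIMSEQ_I)
  fix e :: real assume e: "e > 0"
  have "(\<lambda>k. \<bar>v (Suc k)\<bar>) \<longlonglongrightarrow> 0" using LIMSEQ_Suc[OF tendsto_rabs_zero[OF v]] .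
  then have "\<forall>\<^sub>F k in sequentially. \<bar>v (Suc k)\<bar> < e / 2" using e by (intro order_tendstoD(2)) auto
  then obtain k where k: "\<bar>v (Suc k)\<bar> < e / 2" using eventually_happens'[OF sequentially_bot] by blast
  have "\<forall>\<^sub>F n in sequentially. cylinder_err k n < e / 2" using e by (intro order_tendstoD(2)[OF cylinder_err_tendsto]) auto
  then obtain n0 where n0: "\<And>n. n \<ge> n0 \<Longrightarrow> cylinder_err k n < e / 2" unfolding eventually_sequentially by blast
  have "norm (rate v n - 0) < e" if "n \<ge> n0" for n
    using rate_le[of v n k] rate_nonneg[of v n] k n0[OF that] by simp
  then show "\<exists>no. \<forall>n\<ge>no. norm (rate v n - 0) < e" by blast
qed

lemma rate_bigo:
  assumes "(\<lambda>n. v (Suc (kk n))) \<in> O(g)" "(\<lambda>n. cylinder_err (kk n) n) \<in> O(g)"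
  shows "rate v \<in> O(g)"
proof -
  have 1: "(\<lambda>n. \<bar>v (Suc (kk n))\<bar> + cylinder_err (kk n) n) \<in> O(g)"
    by (rule sum_in_bigo) (use assms in simp_all)
  have 2: "rate v \<in> O(\<lambda>n. \<bar>v (Suc (kk n))\<bar> + cylinder_err (kk n) n)"
    by (rule bigoI[of _ 1], rule always_eventually, rule allI)
       (use rate_le rate_nonneg cylinder_err_nonneg in simp)
  show ?thesis by (rule landau_o.big_trans[OF 2 1])
qed

theorem corr_rate:
  assumes \<phi>: "unit_obs \<phi>" and \<psi>: "\<psi> \<in> borel_measurable TM" "\<psi> \<in> bounded_obs T"
  shows "\<bar>corr \<phi> \<psi> n\<bar> \<le> (2 + \<bar>variation T \<psi> 0\<bar>) * rate (variation T \<psi>) n"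
proof -
  let ?B = "2 + \<bar>variation T \<psi> 0\<bar>"
  have "\<bar>corr \<phi> \<psi> n\<bar> / ?B \<le> rate (variation T \<psi>) n"
    unfolding rate_def
  proof (rule cINF_greatest)
    fix k
    have "\<bar>corr \<phi> \<psi> n\<bar> \<le> variation T \<psi> 0 * cylinder_err k n + 2 * variation T \<psi> (Suc k)" by (rule corr_variation[OF \<phi> \<psi>])
    also have "\<dots> \<le> ?B * cylinder_err k n + ?B * \<bar>variation T \<psi> (Suc k)\<bar>"
    proof (rule add_mono)
      show "variation T \<psi> 0 * cylinder_err k n \<le> ?B * cylinder_err k n" by (rule mult_right_mono[OF _ cylinder_err_nonneg]) simp
      have "2 * variation T \<psi> (Suc k) \<le> 2 * \<bar>variation T \<psi> (Suc k)\<bar>" by simp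
      also have "\<dots> \<le> ?B * \<bar>variation T \<psi> (Suc k)\<bar>" by (rule mult_right_mono) simp_all
      finally show "2 * variation T \<psi> (Suc k) \<le> ?B * \<bar>variation T \<psi> (Suc k)\<bar>" .
    qed
    finally have "\<bar>corr \<phi> \<psi> n\<bar> \<le> (\<bar>variation T \<psi> (Suc k)\<bar> + cylinder_err k n) * ?B" by (simp add: algebra_simps)
    then show "\<bar>corr \<phi> \<psi> n\<bar> / ?B \<le> \<bar>variation T \<psi> (Suc k)\<bar> + cylinder_err k n" by (subst pos_divide_le_eq) simp_all
  qed simp
  then show ?thesis by (subst (asm) pos_divide_le_eq) (simp_all add: mult.commute)
qed

lemma Linf_integrable: assumes "\<psi> \<in> Linf TM" shows "\<psi> \<in> borel_measurable TM" "integrable \<nu> \<psi>"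
proof -
  show m: "\<psi> \<in> borel_measurable TM" using assms by (simp add: Linf_def)
  show "integrable \<nu> \<psi>" by (rule bounded_integrable[OF m AE_\<nu>[OF Linf_norm_bound(2)[OF assms]]])
qed

text \<open>
  If the variations of \<open>\<psi>\<close> do not tend to zero, the supremum of the correlations over all
  observables serves as the rate; it tends to zero because \<open>\<psi>\<close> is integrable.
\<close>

lemma decay_bound:
  assumes \<psi>: "\<psi> \<in> Linf TM"
  shows "\<exists>C>0. \<exists>u. u \<longlonglongrightarrow> 0 \<and>
        (\<psi> \<in> bounded_obs T \<and> variation T \<psi> \<longlonglongrightarrow> 0 \<longrightarrow> u = rate (variation T \<psi>)) \<and>
        (\<forall>\<phi> \<in> Linf TM. \<forall>n. \<bar>correlation F \<nu> \<phi> \<psi> n\<bar> \<le> Linf_norm TM \<phi> * C * u n)"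
proof (cases "\<psi> \<in> bounded_obs T \<and> variation T \<psi> \<longlonglongrightarrow> 0")
  case True
  let ?C = "2 * (2 + \<bar>variation T \<psi> 0\<bar>)"
  have "\<bar>correlation F \<nu> \<phi> \<psi> n\<bar> \<le> Linf_norm TM \<phi> * ?C * rate (variation T \<psi>) n" if "\<phi> \<in> Linf TM" for \<phi> n
  proof -
    have "\<bar>correlation F \<nu> \<phi> \<psi> n\<bar> \<le> Linf_norm TM \<phi> * (2 * ((2 + \<bar>variation T \<psi> 0\<bar>) * rate (variation T \<psi>) n))"
      by (rule Linf_reduce[OF that Linf_integrable(2)[OF \<psi>]], rule corr_rate[OF _ Linf_integrable(1)[OF \<psi>]]) (use True in auto)
    then show ?thesis by (simp only: mult.assoc)
  qed
  moreover have "rate (variation T \<psi>) \<longlonglongrightarrow> 0" using True rate_tendsto by blast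
  moreover have "0 < ?C" by simp
  ultimately show ?thesis by blast
next
  case False
  \<comment> \<open>the best possible rate for this \<open>\<psi>\<close>\<close>
  define u where "u n = (SUP \<phi>\<in>{\<phi>. unit_obs \<phi>}. \<bar>corr \<phi> \<psi> n\<bar>)" for n
  note i = Linf_integrable(2)[OF \<psi>]
  have bdd: "bdd_above ((\<lambda>\<phi>. \<bar>corr \<phi> \<psi> n\<bar>) ` {\<phi>. unit_obs \<phi>})" for n
    by (rule bdd_aboveI2[of _ _ "2 * (\<integral>x. \<bar>\<psi> x\<bar> \<partial>\<nu>)"]) (use corr_bound[OF _ i] in simp)
  have up: "\<bar>corr \<phi> \<psi> n\<bar> \<le> u n" if "unit_obs \<phi>" for \<phi> n
    unfolding u_def by (rule cSUP_upper[OF _ bdd]) (use that in simp)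
  have r0: "unit_obs (\<lambda>x. 0)" by (simp add: unit_obs_def)
  have "u \<longlonglongrightarrow> 0"
  proof (rule LIMSEQ_I)
    fix e :: real assume e: "e > 0"
    obtain n0 where n0: "\<And>n \<phi>. n \<ge> n0 \<Longrightarrow> unit_obs \<phi> \<Longrightarrow> \<bar>corr \<phi> \<psi> n\<bar> \<le> e / 2"
      using niceD(2)[OF decorrelating_integrable[OF i], of "e / 2"] e by auto
    have "norm (u n - 0) < e" if "n \<ge> n0" for n
    proof -
      have "u n \<le> e / 2" unfolding u_def by (rule cSUP_least) (use r0 n0[OF that] in auto)
      moreover have "0 \<le> u n" using up[OF r0, of n] by linarith
      ultimately show ?thesis using e by simp
    qed
    then show "\<exists>no. \<forall>n\<ge>no. norm (u n - 0) < e" by blast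
  qed
  moreover have "\<bar>correlation F \<nu> \<phi> \<psi> n\<bar> \<le> Linf_norm TM \<phi> * 2 * u n" if "\<phi> \<in> Linf TM" for \<phi> n
    using Linf_reduce[OF that i up, of n] by (simp add: mult.assoc)
  ultimately show ?thesis using False by (intro exI[of _ 2] conjI exI[of _ u]) auto
qed

text \<open>
  All four cases use \<open>k\<close> proportional to \<open>n\<close>, so the rate is essentially that of the variations.
\<close>

lemma case_exponential:
  assumes tl: "\<exists>\<theta>\<^sub>0. 0 < \<theta>\<^sub>0 \<and> \<theta>\<^sub>0 < 1 \<and> tail T \<in> O(\<lambda>n. \<theta>\<^sub>0 ^ n)"
  shows "\<psi> \<in> V1 T \<gamma> \<Longrightarrow> \<exists>\<theta>. 0 < \<theta> \<and> \<theta> < 1 \<and> rate (variation T \<psi>) \<in> O(\<lambda>n. \<theta> ^ n)"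
    and "\<psi> \<in> V2 T \<gamma> \<Longrightarrow> \<gamma>' < \<gamma> \<Longrightarrow> rate (variation T \<psi>) \<in> O(\<lambda>n. exp (- (real n powr \<gamma>')))"
    and "\<psi> \<in> V3 T \<gamma> \<Longrightarrow> \<gamma>' < \<gamma> \<Longrightarrow> rate (variation T \<psi>) \<in> O(\<lambda>n. exp (- (ln (real n) powr \<gamma>')))"
    and "\<psi> \<in> V4 T \<gamma> \<Longrightarrow> rate (variation T \<psi>) \<in> O(\<lambda>n. real n powr (1 - 1 / 2 * \<gamma>))"
proof -
  obtain \<theta>\<^sub>0 where t0: "0 < \<theta>\<^sub>0" "\<theta>\<^sub>0 < 1" "tail T \<in> O(\<lambda>n. \<theta>\<^sub>0 ^ n)" using tl by blast
  have te: "exp_decay (tail T)" by (rule exp_decay_bigo[OF t0(3,1,2)])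
  obtain m where m: "m > 0" "exp_decay (\<lambda>n. cylinder_err (n div m) n)" using cylinder_err_exp[OF te] by blast
  show "\<exists>\<theta>. 0 < \<theta> \<and> \<theta> < 1 \<and> rate (variation T \<psi>) \<in> O(\<lambda>n. \<theta> ^ n)" if \<psi>: "\<psi> \<in> V1 T \<gamma>"
  proof -
    have g: "0 < \<gamma>" "\<gamma> < 1" "variation T \<psi> \<in> O(\<lambda>n. \<gamma> ^ n)" using \<psi> unfolding V1_def by blast+
    have "exp_decay (\<lambda>n. variation T \<psi> (Suc (n div m)))"
      by (rule exp_decay_Suc_div[OF exp_decay_bigo[OF g(3,1,2)] m(1)])
    then have "exp_decay (\<lambda>n. \<bar>variation T \<psi> (Suc (n div m))\<bar>)" by (rule exp_decay_mono) simp
    then have sm: "exp_decay (\<lambda>n. \<bar>variation T \<psi> (Suc (n div m))\<bar> + cylinder_err (n div m) n)" by (rule exp_decay_add[OF _ m(2)])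
    have "exp_decay (rate (variation T \<psi>))"
    proof (rule exp_decay_mono[OF sm])
      fix n
      show "\<bar>rate (variation T \<psi>) n\<bar> \<le> \<bar>\<bar>variation T \<psi> (Suc (n div m))\<bar> + cylinder_err (n div m) n\<bar>"
        using rate_le[of "variation T \<psi>" n "n div m"] rate_nonneg[of "variation T \<psi>" n] by linarith
    qed
    then show ?thesis by (rule exp_decay_D)
  qed
  show "rate (variation T \<psi>) \<in> O(\<lambda>n. exp (- (real n powr \<gamma>')))" if \<psi>: "\<psi> \<in> V2 T \<gamma>" and l: "\<gamma>' < \<gamma>"
  proof -
    have g: "0 < \<gamma>" "\<gamma> < 1" "variation T \<psi> \<in> O(\<lambda>n. exp (- (real n powr \<gamma>)))" using \<psi> unfolding V2_def by blast+
    have "\<gamma>' < 1" using g(2) l by simp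
    then show ?thesis
      by (intro rate_bigo[of _ "\<lambda>n. n div m", OF stretched_Suc_div[OF g(3,1) l m(1)] exp_decay_stretched[OF m(2)]])
  qed
  show "rate (variation T \<psi>) \<in> O(\<lambda>n. exp (- (ln (real n) powr \<gamma>')))" if \<psi>: "\<psi> \<in> V3 T \<gamma>" and l: "\<gamma>' < \<gamma>"
  proof -
    have g: "1 < \<gamma>" "variation T \<psi> \<in> O(\<lambda>n. exp (- (ln (real n) powr \<gamma>)))" using \<psi> unfolding V3_def by blast+
    have g0: "0 < \<gamma>" using g(1) by simp
    show ?thesis
      by (rule rate_bigo[of _ "\<lambda>n. n div m", OF log_stretched_Suc_div[OF g(2) g0 l m(1)] exp_decay_log_stretched[OF m(2)]])
  qed
  show "rate (variation T \<psi>) \<in> O(\<lambda>n. real n powr (1 - 1 / 2 * \<gamma>))" if \<psi>: "\<psi> \<in> V4 T \<gamma>"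
  proof (rule rate_bigo[of _ "\<lambda>n. n div m"])
    have g: "1 < \<gamma>" "variation T \<psi> \<in> O(\<lambda>n. real n powr (- \<gamma>))" using \<psi> unfolding V4_def by blast+
    have g0: "0 < \<gamma>" "- \<gamma> \<le> 1 - 1 / 2 * \<gamma>" using g(1) by simp_all
    show "(\<lambda>n. variation T \<psi> (Suc (n div m))) \<in> O(\<lambda>n. real n powr (1 - 1 / 2 * \<gamma>))"
      by (rule landau_o.big_trans[OF powr_Suc_div[OF g(2) g0(1) m(1)] powr_bigo_mono[OF g0(2)]])
    show "(\<lambda>n. cylinder_err (n div m) n) \<in> O(\<lambda>n. real n powr (1 - 1 / 2 * \<gamma>))" by (rule exp_decay_powr[OF m(2)])
  qed
qed

text \<open>
  Here \<open>k\<close> is about \<open>n powr \<zeta>\<close>, and the variation of order \<open>k\<close> becomes \<open>n powr (- \<zeta> * \<gamma>)\<close>.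
\<close>

lemma case_polynomial:
  assumes \<alpha>: "\<alpha> > 1" and tl: "tail T \<in> O(\<lambda>n. real n powr (- \<alpha>))" and \<psi>: "\<psi> \<in> V4 T \<gamma>"
  defines "\<zeta> \<equiv> 1 / (1 + \<alpha>)"
  shows "rate (variation T \<psi>) \<in> O(\<lambda>n. max (real n powr (1 - \<alpha>)) (real n powr (- (\<zeta> * \<gamma>))))"
proof (rule rate_bigo[of _ "floor_powr \<zeta>"])
  have tp: "poly_decay \<alpha> (tail T)" using poly_decay_bigo[OF tl] \<alpha> by simp
  have \<gamma>: "\<gamma> > 1" and v: "variation T \<psi> \<in> O(\<lambda>n. real n powr (- \<gamma>))" using \<psi> unfolding V4_def by blast+
  obtain C where C: "C > 0" "\<And>n. \<bar>variation T \<psi> n\<bar> \<le> C * real (n + 1) powr (- \<gamma>)"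
    using poly_decayE[OF poly_decay_bigo[OF v order_less_imp_le[OF order_less_trans[OF zero_less_one \<gamma>]]]] by blast
  show "(\<lambda>n. variation T \<psi> (Suc (floor_powr \<zeta> n))) \<in> O(\<lambda>n. max (real n powr (1 - \<alpha>)) (real n powr (- (\<zeta> * \<gamma>))))"
  proof (rule bigoI[of _ C])
    show "\<forall>\<^sub>F n in sequentially. norm (variation T \<psi> (Suc (floor_powr \<zeta> n))) \<le> C * norm (max (real n powr (1 - \<alpha>)) (real n powr (- (\<zeta> * \<gamma>))))"
      using eventually_ge_at_top[of 1]
    proof eventually_elim
      case (elim n)
      have "real n powr \<zeta> \<le> real (Suc (floor_powr \<zeta> n) + 1)" unfolding floor_powr_def by linarith
      then have "real (Suc (floor_powr \<zeta> n) + 1) powr (- \<gamma>) \<le> (real n powr \<zeta>) powr (- \<gamma>)"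
        using elim \<gamma> by (intro powr_mono2') auto
      also have "\<dots> = real n powr (- (\<zeta> * \<gamma>))" by (simp add: powr_powr)
      also have "\<dots> \<le> max (real n powr (1 - \<alpha>)) (real n powr (- (\<zeta> * \<gamma>)))" by simp
      finally have "C * real (Suc (floor_powr \<zeta> n) + 1) powr (- \<gamma>) \<le> C * max (real n powr (1 - \<alpha>)) (real n powr (- (\<zeta> * \<gamma>)))"
        using C(1) by (intro mult_left_mono) auto
      then show ?case using C(2)[of "Suc (floor_powr \<zeta> n)"] by (simp add: max_def split: if_splits)
    qed
  qed
  have "(\<lambda>n. cylinder_err (floor_powr \<zeta> n) n) \<in> O(\<lambda>n. real n powr (- (\<alpha> - 1)))"
    unfolding \<zeta>_def by (rule poly_decay_D[OF cylinder_err_poly[OF \<alpha> tp]]) (use \<alpha> in simp)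
  moreover have "(\<lambda>n. real n powr (- (\<alpha> - 1))) \<in> O(\<lambda>n. max (real n powr (1 - \<alpha>)) (real n powr (- (\<zeta> * \<gamma>))))"
    by (rule bigoI[of _ 1], rule always_eventually) (auto simp: max_def)
  ultimately show "(\<lambda>n. cylinder_err (floor_powr \<zeta> n) n) \<in> O(\<lambda>n. max (real n powr (1 - \<alpha>)) (real n powr (- (\<zeta> * \<gamma>))))"
    by (rule landau_o.big_trans)
qed

end

text \<open>
  In the exponential case \<open>\<zeta> = 1 / 2\<close> is one possible choice, for which \<open>case_exponential\<close> gives the
  exponent \<open>1 - \<gamma> / 2\<close>. In the polynomial case \<open>\<zeta> = 1 / (1 + \<alpha>)\<close> is the exponent of \<open>slow_poly\<close>.
\<close>

theorem theorem6:
  fixes T :: "'a tower_data"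
  assumes "tower T"
  shows "\<exists>\<nu>. acip T \<nu> \<and> (\<forall>\<nu>'. acip T \<nu>' \<longrightarrow> \<nu>' = \<nu>) \<and> mixing (tower_map T) \<nu> \<and>
    (\<exists>rate :: (nat \<Rightarrow> real) \<Rightarrow> nat \<Rightarrow> real.
      (\<forall>\<psi> \<in> Linf (tower_measure T). \<exists>C>0. \<exists>u. u \<longlonglongrightarrow> 0 \<and>
        (\<psi> \<in> bounded_obs T \<and> variation T \<psi> \<longlonglongrightarrow> 0 \<longrightarrow> u = rate (variation T \<psi>)) \<and>
        (\<forall>\<phi> \<in> Linf (tower_measure T). \<forall>n.
          \<bar>correlation (tower_map T) \<nu> \<phi> \<psi> n\<bar> \<le> Linf_norm (tower_measure T) \<phi> * C * u n)) \<and>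
      ((\<exists>\<theta>\<^sub>0. 0 < \<theta>\<^sub>0 \<and> \<theta>\<^sub>0 < 1 \<and> tail T \<in> O(\<lambda>n. \<theta>\<^sub>0 ^ n)) \<longrightarrow>
        (\<forall>\<gamma>. \<forall>\<psi> \<in> Linf (tower_measure T) \<inter> V1 T \<gamma>.
          \<exists>\<theta>. 0 < \<theta> \<and> \<theta> < 1 \<and> rate (variation T \<psi>) \<in> O(\<lambda>n. \<theta> ^ n)) \<and>
        (\<forall>\<gamma>. \<forall>\<psi> \<in> Linf (tower_measure T) \<inter> V2 T \<gamma>. \<forall>\<gamma>'<\<gamma>.
          rate (variation T \<psi>) \<in> O(\<lambda>n. exp (- (real n powr \<gamma>')))) \<and>
        (\<forall>\<gamma>. \<forall>\<psi> \<in> Linf (tower_measure T) \<inter> V3 T \<gamma>. \<forall>\<gamma>'<\<gamma>.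
          rate (variation T \<psi>) \<in> O(\<lambda>n. exp (- (ln (real n) powr \<gamma>')))) \<and>
        (\<forall>K>0. \<exists>\<zeta>. 0 < \<zeta> \<and> \<zeta> < 1 \<and>
          (\<forall>\<gamma>>1 / \<zeta>. \<forall>\<psi> \<in> Linf (tower_measure T) \<inter> V4 T \<gamma>. variation T \<psi> 0 < K \<longrightarrow>
            rate (variation T \<psi>) \<in> O(\<lambda>n. real n powr (1 - \<zeta> * \<gamma>))))) \<and>
      (\<forall>\<alpha>>1. tail T \<in> O(\<lambda>n. real n powr (- \<alpha>)) \<longrightarrow>
        (\<forall>K>0. \<exists>\<zeta>. 0 < \<zeta> \<and> \<zeta> < 1 \<and>
          (\<forall>\<gamma>>2 / \<zeta>. \<forall>\<psi> \<in> Linf (tower_measure T) \<inter> V4 T \<gamma>. variation T \<psi> 0 < K \<longrightarrow>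
            (\<gamma> = (\<alpha> + 1) / \<zeta> \<longrightarrow>
              rate (variation T \<psi>) \<in> O(\<lambda>n. real n powr (1 - \<alpha>) * ln (real n))) \<and>
            (\<gamma> \<noteq> (\<alpha> + 1) / \<zeta> \<longrightarrow>
              rate (variation T \<psi>) \<in> O(\<lambda>n. max (real n powr (1 - \<alpha>)) (real n powr (2 - \<zeta> * \<gamma>))))))))"
proof -
  interpret tower T by fact
  obtain C\<^sub>0 \<beta> where CB: "C\<^sub>0 > 0" "0 < \<beta>" "\<beta> < 1"
    "\<forall>i. \<forall>x \<in> part T i \<inter> good_base T. \<forall>y \<in> part T i \<inter> good_base T.
        \<bar>jac T x / jac T y - 1\<bar> \<le> C\<^sub>0 * power_enat \<beta> (sep_base T (ret T x) (ret T y))"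
    using bounded_distortion by blast
  interpret distorted_tower T C\<^sub>0 \<beta> by unfold_locales (use CB in blast)+
  have z: "(0::real) < 1 / 2" "(1/2 :: real) < 1" by auto
  have exponential: "(\<forall>\<gamma>. \<forall>\<psi> \<in> Linf (tower_measure T) \<inter> V1 T \<gamma>.
          \<exists>\<theta>. 0 < \<theta> \<and> \<theta> < 1 \<and> rate (variation T \<psi>) \<in> O(\<lambda>n. \<theta> ^ n)) \<and>
        (\<forall>\<gamma>. \<forall>\<psi> \<in> Linf (tower_measure T) \<inter> V2 T \<gamma>. \<forall>\<gamma>'<\<gamma>.
          rate (variation T \<psi>) \<in> O(\<lambda>n. exp (- (real n powr \<gamma>')))) \<and>
        (\<forall>\<gamma>. \<forall>\<psi> \<in> Linf (tower_measure T) \<inter> V3 T \<gamma>. \<forall>\<gamma>'<\<gamma>.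
          rate (variation T \<psi>) \<in> O(\<lambda>n. exp (- (ln (real n) powr \<gamma>')))) \<and>
        (\<forall>K>0. \<exists>\<zeta>. 0 < \<zeta> \<and> \<zeta> < 1 \<and>
          (\<forall>\<gamma>>1 / \<zeta>. \<forall>\<psi> \<in> Linf (tower_measure T) \<inter> V4 T \<gamma>. variation T \<psi> 0 < K \<longrightarrow>
            rate (variation T \<psi>) \<in> O(\<lambda>n. real n powr (1 - \<zeta> * \<gamma>))))"
    if t: "\<exists>\<theta>\<^sub>0. 0 < \<theta>\<^sub>0 \<and> \<theta>\<^sub>0 < 1 \<and> tail T \<in> O(\<lambda>n. \<theta>\<^sub>0 ^ n)"
  proof -
    note c = case_exponential[OF t]
    show ?thesis
      by (intro conjI allI impI ballI, rule c(1), erule IntD2, rule c(2), erule IntD2, assumption,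
          rule c(3), erule IntD2, assumption, rule exI[of _ "1 / 2"], intro conjI allI impI ballI,
          rule z(1), rule z(2), rule c(4), erule IntD2)
  qed
  have polynomial: "\<exists>\<zeta>. 0 < \<zeta> \<and> \<zeta> < 1 \<and>
          (\<forall>\<gamma>>2 / \<zeta>. \<forall>\<psi> \<in> Linf (tower_measure T) \<inter> V4 T \<gamma>. variation T \<psi> 0 < K \<longrightarrow>
            (\<gamma> = (\<alpha> + 1) / \<zeta> \<longrightarrow>
              rate (variation T \<psi>) \<in> O(\<lambda>n. real n powr (1 - \<alpha>) * ln (real n))) \<and>
            (\<gamma> \<noteq> (\<alpha> + 1) / \<zeta> \<longrightarrow>
              rate (variation T \<psi>) \<in> O(\<lambda>n. max (real n powr (1 - \<alpha>)) (real n powr (2 - \<zeta> * \<gamma>)))))"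
    if \<alpha>: "\<alpha> > 1" and tl: "tail T \<in> O(\<lambda>n. real n powr (- \<alpha>))" for \<alpha> K
  proof -
    define \<zeta> where "\<zeta> = 1 / (1 + \<alpha>)"
    have \<zeta>: "0 < \<zeta>" "\<zeta> < 1" using \<alpha> by (auto simp: \<zeta>_def)
    have log: "rate (variation T \<psi>) \<in> O(\<lambda>n. real n powr (1 - \<alpha>) * ln (real n))"
      if "\<psi> \<in> V4 T \<gamma>" "\<gamma> = (\<alpha> + 1) / \<zeta>" for \<psi> \<gamma>
    proof -
      have "\<zeta> * \<gamma> = \<alpha> + 1" using that(2) \<zeta> by simp
      then have "rate (variation T \<psi>) \<in> O(\<lambda>n. max (real n powr (1 - \<alpha>)) (real n powr (- (\<alpha> + 1))))"
        using case_polynomial[OF \<alpha> tl that(1)] by (simp only: \<zeta>_def)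
      moreover have "(\<lambda>n. max (real n powr (1 - \<alpha>)) (real n powr (- (\<alpha> + 1)))) \<in> O(\<lambda>n. real n powr (1 - \<alpha>) * ln (real n))"
      proof (rule bigoI[of _ 1])
        have "filterlim (\<lambda>n. ln (real n)) at_top sequentially" by real_asymp
        then have "\<forall>\<^sub>F n in sequentially. 1 \<le> ln (real n)" unfolding filterlim_at_top by blast
        then show "\<forall>\<^sub>F n in sequentially. norm (max (real n powr (1 - \<alpha>)) (real n powr (- (\<alpha> + 1)))) \<le> 1 * norm (real n powr (1 - \<alpha>) * ln (real n))"
          using eventually_ge_at_top[of 1]
        proof eventually_elim
          case (elim n)
          have "real n powr (- (\<alpha> + 1)) \<le> real n powr (1 - \<alpha>)" using elim by (intro powr_mono) auto
          moreover have "real n powr (1 - \<alpha>) * 1 \<le> real n powr (1 - \<alpha>) * ln (real n)" using elim by (intro mult_left_mono) auto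
          ultimately show ?case using elim by (simp add: max_def abs_mult)
        qed
      qed
      ultimately show ?thesis by (rule landau_o.big_trans)
    qed
    have other: "rate (variation T \<psi>) \<in> O(\<lambda>n. max (real n powr (1 - \<alpha>)) (real n powr (2 - \<zeta> * \<gamma>)))"
      if "\<psi> \<in> V4 T \<gamma>" for \<psi> \<gamma>
    proof -
      have "(\<lambda>n::nat. max (real n powr (1 - \<alpha>)) (real n powr (- (\<zeta> * \<gamma>)))) \<in> O(\<lambda>n. max (real n powr (1 - \<alpha>)) (real n powr (2 - \<zeta> * \<gamma>)))"
      proof (rule bigoI[of _ 1])
        show "\<forall>\<^sub>F n in sequentially. norm (max (real n powr (1 - \<alpha>)) (real n powr (- (\<zeta> * \<gamma>)))) \<le> 1 * norm (max (real n powr (1 - \<alpha>)) (real n powr (2 - \<zeta> * \<gamma>)))"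
          using eventually_ge_at_top[of 1]
        proof eventually_elim
          case (elim n)
          have "real n powr (- (\<zeta> * \<gamma>)) \<le> real n powr (2 - \<zeta> * \<gamma>)" using elim by (intro powr_mono) auto
          then have "max (real n powr (1 - \<alpha>)) (real n powr (- (\<zeta> * \<gamma>))) \<le> max (real n powr (1 - \<alpha>)) (real n powr (2 - \<zeta> * \<gamma>))" by (intro max.mono) auto
          moreover have "0 \<le> max (real n powr (1 - \<alpha>)) (real n powr (- (\<zeta> * \<gamma>)))" by (simp add: max_def)
          ultimately show ?case by simp
        qed
      qed
      with case_polynomial[OF \<alpha> tl that] show ?thesis unfolding \<zeta>_def by (rule landau_o.big_trans)
    qed
    show ?thesis
      by (intro exI[of _ \<zeta>] conjI allI impI ballI, rule \<zeta>(1), rule \<zeta>(2),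
          rule log, erule IntD2, assumption, rule other, erule IntD2)
  qed
  show ?thesis
  proof (intro exI[of _ \<nu>] conjI)
    show "acip T \<nu>" by (rule acip_\<nu>)
    show "\<forall>\<nu>'. acip T \<nu>' \<longrightarrow> \<nu>' = \<nu>" using acip_unique by blast
    show "mixing (tower_map T) \<nu>" by (rule mixing_\<nu>)
  qed (rule exI[of _ rate], intro conjI ballI, erule decay_bound, intro impI, erule exponential,
      intro allI impI, erule (1) polynomial)
qed

end
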